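(* Let $I$ be a compact $d$-dimensional $C^\infty$ manifold (possibly with boundary) embedded in $\mathbb{R}^N$, $N\ge d$, and let $X:I\to\mathbb{R}$ be a Gaussian process with paths of class $C^2$ such that for $s\ne t$ the triplet $(X(s),X(t),X'(t))$ in $\mathbb{R}\times\mathbb{R}\times\mathbb{R}^d$ has a nondegenerate distribution. Suppose in addition that $\mathrm{E}(X(t))=0$ and $\mathrm{Var}(X(t))=1$ for every $t\in I$. Let $F_I(u)=\mathrm{P}\{\sup_{t\in I}X(t)\le u\}$, and let $F_I'$ be its (continuous) derivative. Then, as $u\to+\infty$, $F_I'(u)$ is equivalent to $$\frac{u^d}{(2\pi)^{(d+1)/2}}\,e^{-u^2/2}\int_I\big(\det(\Lambda(t))\big)^{1/2}\,\sigma(dt),$$ where $\Lambda(t)$ is the variance–covariance matrix of $X'(t)$.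
   Context: $\sigma$ is the geometric (Riemannian volume) measure on $I$ induced by the embedding. $X'(t)$ is the derivative of $X$ at $t$ on the manifold $I$, read in an orthonormal basis of the tangent space. Under the stated hypotheses $F_I$ has a continuous derivative. "Equivalent" means that the ratio of the two quantities tends to $1$. *)

theory Defs
  imports "HOL-Probability.Probability" "HOL-Library.Extended_Nat"
begin

section \<open>Differentiability classes\<close>

primrec higher_differentiable_on ::
    "'a::real_normed_vector set \<Rightarrow> ('a \<Rightarrow> 'b::real_normed_vector) \<Rightarrow> nat \<Rightarrow> bool" where
  "higher_differentiable_on U f 0 \<longleftrightarrow> continuous_on U f"
| "higher_differentiable_on U f (Suc n) \<longleftrightarrow>
     (\<forall>x\<in>U. f differentiable (at x)) \<and>
     (\<forall>v. higher_differentiable_on U (\<lambda>x. frechet_derivative f (at x) v) n)"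

text \<open>
  Maps of class \<open>C\<^sup>k\<close> (\<open>k\<close> possibly infinite) on an arbitrary subset of a Euclidean space:
  locally the restriction of a \<open>C\<^sup>k\<close> map defined on an open set. It is applied to relatively open
  subsets of half-spaces (chart domains) and to embedded manifolds with boundary.
\<close>

definition Ck_on :: "enat \<Rightarrow> 'a::euclidean_space set \<Rightarrow> ('a \<Rightarrow> 'b::real_normed_vector) \<Rightarrow> bool" where
  "Ck_on k S f \<longleftrightarrow>
     (\<forall>p\<in>S. \<exists>U g. open U \<and> p \<in> U \<and>
        (\<forall>n. enat n \<le> k \<longrightarrow> higher_differentiable_on U g n) \<and> (\<forall>x\<in>S \<inter> U. g x = f x))"


section \<open>Embedded manifolds with boundary\<close>

text \<open>
  The dimension \<open>d\<close> is the cardinality of the index type \<open>'d\<close>. The domain \<open>W\<close> of a coordinate patch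
  is relatively open in the whole space or in a coordinate half-space. Derivatives are taken within
  \<open>W\<close>, where they are uniquely determined also at the boundary points of the half-space.
\<close>

definition smooth_patch ::
    "(real ^ 'd \<Rightarrow> real ^ 'n) \<Rightarrow> (real ^ 'd) set \<Rightarrow> (real ^ 'n) set \<Rightarrow> bool" where
  "smooth_patch \<alpha> W I \<longleftrightarrow>
     (open W \<or> (\<exists>k. openin (top_of_set {x. 0 \<le> x $ k}) W)) \<and>
     openin (top_of_set I) (\<alpha> ` W) \<and>
     (\<exists>\<beta>. homeomorphism W (\<alpha> ` W) \<alpha> \<beta>) \<and>
     Ck_on \<infinity> W \<alpha> \<and>
     (\<forall>x\<in>W. inj (frechet_derivative \<alpha> (at x within W)))"

definition embedded_manifold :: "'d::finite itself \<Rightarrow> (real ^ 'n) set \<Rightarrow> bool" where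
  "embedded_manifold d I \<longleftrightarrow>
     (\<forall>p\<in>I. \<exists>(\<alpha> :: real ^ 'd \<Rightarrow> real ^ 'n) W. smooth_patch \<alpha> W I \<and> p \<in> \<alpha> ` W)"

definition tangent_space :: "'d::finite itself \<Rightarrow> (real ^ 'n) set \<Rightarrow> real ^ 'n \<Rightarrow> (real ^ 'n) set" where
  "tangent_space d I p =
     {v. \<exists>(\<alpha> :: real ^ 'd \<Rightarrow> real ^ 'n) W x.
           smooth_patch \<alpha> W I \<and> x \<in> W \<and> \<alpha> x = p \<and> v \<in> range (frechet_derivative \<alpha> (at x within W))}"

definition orthonormal_tangent_basis ::
    "(real ^ 'n) set \<Rightarrow> real ^ 'n \<Rightarrow> ('d::finite \<Rightarrow> real ^ 'n) \<Rightarrow> bool" where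
  "orthonormal_tangent_basis I p e \<longleftrightarrow>
     (\<forall>i j. e i \<bullet> e j = (if i = j then 1 else 0)) \<and>
     span (range e) = tangent_space TYPE('d) I p"

text \<open>
  The derivative on \<open>I\<close> at \<open>p\<close>, in the basis \<open>e\<close> of the tangent space. A Frechet derivative of \<open>f\<close>
  within \<open>I\<close> at \<open>p\<close> is not unique as a linear map on the ambient space when \<open>d < N\<close>, but its
  restriction to the tangent space is the differential of \<open>f\<close> at \<open>p\<close>: if \<open>\<alpha>\<close> is a patch with
  \<open>\<alpha> x = p\<close>, the chain rule makes it map \<open>D \<alpha>(x) h\<close> to \<open>D (f \<circ> \<alpha>)(x) h\<close>.
\<close>

definition manifold_deriv ::
    "(real ^ 'n) set \<Rightarrow> ('d::finite \<Rightarrow> real ^ 'n) \<Rightarrow> (real ^ 'n \<Rightarrow> real) \<Rightarrow> real ^ 'n \<Rightarrow> real ^ 'd" where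
  "manifold_deriv I e f p = (\<chi> i. frechet_derivative f (at p within I) (e i))"

definition patch_jacobian :: "(real ^ 'd \<Rightarrow> real ^ 'n) \<Rightarrow> (real ^ 'd) set \<Rightarrow> real ^ 'd \<Rightarrow> real" where
  "patch_jacobian \<alpha> W x =
     (let D = frechet_derivative \<alpha> (at x within W)
      in sqrt (det (\<chi> i j. D (axis i 1) \<bullet> D (axis j 1) :: real ^ 'd ^ 'd)))"

text \<open>
  The Riemannian volume measure of \<open>I\<close>, for the metric induced by the embedding: the Borel measure
  on \<open>I\<close> which in every patch has density \<open>sqrt (det (D \<alpha>\<^sup>T D \<alpha>))\<close> with respect to Lebesgue measure.
  As countably many patches cover a manifold, this determines the measure uniquely.
\<close>

definition riemannian_volume :: "'d::finite itself \<Rightarrow> (real ^ 'n) set \<Rightarrow> (real ^ 'n) measure \<Rightarrow> bool" where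
  "riemannian_volume d I \<sigma> \<longleftrightarrow>
     space \<sigma> = I \<and> sets \<sigma> = sets (restrict_space borel I) \<and>
     (\<forall>(\<alpha> :: real ^ 'd \<Rightarrow> real ^ 'n) W B. smooth_patch \<alpha> W I \<longrightarrow> B \<in> sets borel \<longrightarrow> B \<subseteq> W \<longrightarrow>
        emeasure \<sigma> (\<alpha> ` B) = (\<integral>\<^sup>+x\<in>B. ennreal (patch_jacobian \<alpha> W x) \<partial>lborel))"


section \<open>Gaussian processes\<close>

text \<open>Point masses count as (degenerate) Gaussian distributions.\<close>

definition gaussian_rv :: "'w measure \<Rightarrow> ('w \<Rightarrow> real) \<Rightarrow> bool" where
  "gaussian_rv M Y \<longleftrightarrow> Y \<in> borel_measurable M \<and>
     (\<exists>\<mu>. distr M borel Y = return borel \<mu> \<or>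
       (\<exists>s>0. distr M borel Y = density lborel (normal_density \<mu> s)))"

definition gaussian_process :: "'w measure \<Rightarrow> 't set \<Rightarrow> ('t \<Rightarrow> 'w \<Rightarrow> real) \<Rightarrow> bool" where
  "gaussian_process M I X \<longleftrightarrow>
     (\<forall>J c. finite J \<longrightarrow> J \<subseteq> I \<longrightarrow> gaussian_rv M (\<lambda>\<omega>. \<Sum>t\<in>J. c t * X t \<omega>))"

text \<open>The distribution of the random vector is not carried by an affine hyperplane.\<close>

definition nondegenerate :: "'w measure \<Rightarrow> ('w \<Rightarrow> 'a::euclidean_space) \<Rightarrow> bool" where
  "nondegenerate M Y \<longleftrightarrow> (\<forall>a c. a \<noteq> 0 \<longrightarrow> \<not> (AE \<omega> in M. a \<bullet> Y \<omega> = c))"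

definition covariance_matrix :: "'w measure \<Rightarrow> ('w \<Rightarrow> real ^ 'd) \<Rightarrow> real ^ 'd ^ 'd" where
  "covariance_matrix M Y =
     (\<chi> i j. \<integral>\<omega>. (Y \<omega> $ i - (\<integral>\<eta>. Y \<eta> $ i \<partial>M)) * (Y \<omega> $ j - (\<integral>\<eta>. Y \<eta> $ j \<partial>M)) \<partial>M)"

definition sup_cdf :: "'w measure \<Rightarrow> 't set \<Rightarrow> ('t \<Rightarrow> 'w \<Rightarrow> real) \<Rightarrow> real \<Rightarrow> real" where
  "sup_cdf M I X u = measure M {\<omega> \<in> space M. (SUP t\<in>I. X t \<omega>) \<le> u}"

end

theory Submission
 imports Defs "HOL-Real_Asymp.Real_Asymp"
begin

text \<open>Let \<open>F\<close> be the distribution function of the supremum over a subset of \<open>I\<close>. For a finite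
 subset, conditioning on the point where the maximum is attained gives \<open>F' = g \<phi>\<close>, where \<open>\<phi>\<close> is the
 normal density and \<open>g u\<close>, the sum over the points \<open>t\<close> of the probabilities that \<open>t\<close> is the
 maximizer given \<open>X t = u\<close>, increases with \<open>u\<close>. In the limit \<open>F\<close> is convex as a function of the normal
 distribution function, and it is log-concave, hence differentiable; the density \<open>k = F' / \<phi>\<close> is
 squeezed between difference quotients of \<open>F\<close> from \<open>u\<close> to \<open>u + 1/u\<close> and from \<open>u - 1/u\<close> to \<open>u\<close>.
 There \<open>F\<close> may be replaced by its version for a net of mesh about \<open>\<delta>/u\<close>, with an error controlled by
 chaining. At a point of the net the maximizer probability converges to the probability that the
 gradient lies in \<open>\<delta>\<close> times the Voronoi cell of the lattice in the metric given by \<open>\<Lambda>\<close>, a cell of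
 volume \<open>\<delta>\<^sup>d sqrt (det \<Lambda>)\<close>; summing over the net yields the integral.\<close>

section \<open>Centred Gaussian variables\<close>

text \<open>The derivative is wanted, not only the tail \<open>1 - F u\<close>. Convexity relative
  to \<open>Phi\<close> still allows kinks; log-concavity supplies an exponential majorant touching
  \<open>F\<close> at the same point and excludes them. Convexity then turns bounds on increments
  into bounds on the density. The interval from \<open>u\<close> to \<open>u + 1/u\<close> has
  normal mass of order \<open>phi u / u\<close>, the same order as \<open>1 - Phi u\<close>, and a
  cube contains about \<open>u ^ d\<close> cells of side \<open>1/u\<close>. Hence the net may
  change \<open>F\<close> by a small multiple of \<open>u ^ d * phi u / u\<close>. Chaining provides
  this cell by cell, with a factor that vanishes together with \<open>\<delta> = 1 / 2 ^ p\<close>.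
  Charts overlap, so they are cut into disjoint parts. Net points are kept only in subcubes of side
  \<open>1/N\<close> inside a part; there different charts are at positive distance and do not
  interact in the limit. Subcubes straddling a seam are estimated crudely, and their share vanishes
  for large \<open>N\<close>. The limits are taken in the order \<open>u\<close>, \<open>p\<close>,
  \<open>N\<close>. Path regularity enters as strict differentiability, which controls increments
  between two points that both move with \<open>u\<close>.\<close>

definition Phi :: "real \<Rightarrow> real" where
 "Phi x = measure std_normal_distribution {..x}"

abbreviation phi :: "real \<Rightarrow> real" where "phi \<equiv> std_normal_density"

lemma prob_space_std_normal: "prob_space std_normal_distribution"
 by (rule prob_space_normal_density) simp

lemma phi_antimono: "0 \<le> x \<Longrightarrow> x \<le> y \<Longrightarrow> phi y \<le> phi x"
 by (auto simp: std_normal_density_def power2_eq_square intro!: divide_right_mono mult_mono)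

lemma Phi_diff:
 assumes "u \<le> v" shows "Phi v - Phi u = (\<integral>x. phi x * indicator {u<..v} x \<partial>lborel)"
proof -
 interpret N: prob_space std_normal_distribution by (rule prob_space_std_normal)
 have "measure std_normal_distribution ({..v} - {..u}) = Phi v - Phi u" unfolding Phi_def using assms by (intro N.finite_measure_Diff) auto
 moreover have "{..v} - {..u} = {u<..v}" by auto
 moreover have "measure std_normal_distribution {u<..v} = (\<integral>x. indicator {u<..v} x \<partial>std_normal_distribution)" by simp
 moreover have "\<dots> = (\<integral>x. phi x * indicator {u<..v} x \<partial>lborel)" by (subst integral_density) auto
 ultimately show ?thesis by metis
qed

lemma integrable_phi_indicator: "A \<in> sets borel \<Longrightarrow> integrable lborel (\<lambda>x. phi x * indicator A x)"
 using integrable_mult_indicator[of A lborel phi] by (simp add: mult.commute)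

lemma Phi_mono: "u \<le> v \<Longrightarrow> Phi u \<le> Phi v"
 using Phi_diff[of u v] by (smt (verit) Bochner_Integration.integral_nonneg indicator_pos_le mult_nonneg_nonneg normal_density_nonneg)

lemma Phi_diff_bounds:
 assumes "u \<le> v" and b: "\<And>x. u < x \<Longrightarrow> x \<le> v \<Longrightarrow> m \<le> phi x \<and> phi x \<le> M"
 shows "m * (v - u) \<le> Phi v - Phi u" "Phi v - Phi u \<le> M * (v - u)"
proof -
 have i: "integrable lborel (\<lambda>x. c * indicator {u<..v} x :: real)" for c by (intro integrable_mult_right) (simp add: assms)
 have e: "(\<integral>x. c * indicator {u<..v} x \<partial>lborel) = c * (v - u)" for c using assms by simp
 show "m * (v - u) \<le> Phi v - Phi u" unfolding Phi_diff[OF assms(1)] e[symmetric]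
  by (intro integral_mono i integrable_phi_indicator) (auto simp: b split: split_indicator)
 show "Phi v - Phi u \<le> M * (v - u)" unfolding Phi_diff[OF assms(1)] e[symmetric]
  by (intro integral_mono i integrable_phi_indicator) (auto simp: b split: split_indicator)
qed

lemma Phi_step:
 assumes "0 \<le> u" "u \<le> v"
 shows "phi v * (v - u) \<le> Phi v - Phi u" "Phi v - Phi u \<le> phi u * (v - u)"
 by (rule Phi_diff_bounds[OF assms(2)], use assms in \<open>auto intro!: phi_antimono\<close>)+

lemma isCont_phi: "isCont phi x"
 unfolding std_normal_density_def by (intro continuous_intros) auto

lemma Phi_strict_mono: assumes "u < v" shows "Phi u < Phi v"
proof -
 have "compact {u..v}" "continuous_on {u..v} phi" by (auto intro!: continuous_at_imp_continuous_on isCont_phi)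
 then obtain x where "x \<in> {u..v}" "\<forall>y\<in>{u..v}. phi x \<le> phi y" using continuous_attains_inf[of "{u..v}" phi] assms by auto
 moreover from this obtain y where "y \<in> {u..v}" "\<forall>x\<in>{u..v}. phi x \<le> phi y"
  using continuous_attains_sup[of "{u..v}" phi] \<open>continuous_on {u..v} phi\<close> assms by auto
 ultimately have "phi x * (v - u) \<le> Phi v - Phi u" using assms by (intro Phi_diff_bounds(1)[where M="phi y"]) auto
 moreover have "phi x * (v - u) > 0" using assms normal_density_pos[of 1 0 x] by simp
 ultimately show ?thesis by simp
qed

lemma Phi_deriv: "(Phi has_real_derivative phi u) (at u)"
proof -
 have "((\<lambda>x. integral {u-1..x} phi) has_real_derivative phi u) (at u within {u-1..u+1})"
  by (intro integral_has_real_derivative) (auto intro!: continuous_at_imp_continuous_on isCont_phi)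
 moreover have "at u within {u-1..u+1} = at u" by (rule at_within_interior) (simp add: interior_atLeastAtMost_real)
 ultimately have d: "((\<lambda>x. integral {u-1..x} phi + Phi (u-1)) has_real_derivative phi u) (at u)" by (auto intro!: derivative_eq_intros)
 have e: "integral {u-1..x} phi + Phi (u-1) = Phi x" if "u - 1 < x" for x
 proof -
  have "Phi x - Phi (u-1) = (\<integral>y. phi y * indicator {u-1<..x} y \<partial>lborel)" using that by (intro Phi_diff) simp
  also have "\<dots> = (\<integral>y. indicator {u-1..x} y *\<^sub>R phi y \<partial>lborel)"
  proof (rule integral_cong_AE)
   have "AE y in lborel. y \<noteq> u - 1" by (rule AE_lborel_singleton)
   thus "AE y in lborel. phi y * indicator {u-1<..x} y = indicator {u-1..x} y *\<^sub>R phi y" by eventually_elim (auto split: split_indicator)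
  qed auto
  also have "\<dots> = integral {u-1..x} phi" using set_borel_integral_eq_integral(2)[of "{u-1..x}" phi] integrable_mult_indicator[of "{u-1..x}" lborel phi]
   unfolding set_lebesgue_integral_def set_integrable_def by simp
  finally show ?thesis by simp
 qed
 show ?thesis by (rule DERIV_cong_ev[OF refl _ refl, THEN iffD1, OF _ d])
    (use eventually_gt_at_top in \<open>auto intro!: eventually_mono[OF eventually_nhds_in_open[of "{u-1<..}" u]] e\<close>)
qed

lemma Phi_le_1: "Phi x \<le> 1"
 using prob_space.prob_le_1[OF prob_space_std_normal] by (auto simp: Phi_def)

lemma one_minus_Phi: "1 - Phi x = measure std_normal_distribution {x<..}"
proof -
 interpret N: prob_space std_normal_distribution by (rule prob_space_std_normal)
 have "{x<..} = space std_normal_distribution - {..x}" by auto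
 thus ?thesis unfolding Phi_def using N.prob_compl[of "{..x}"] by simp
qed

text \<open>Mills' bound: beyond \<open>u\<close> the factor \<open>x / u\<close> is at least one,
  and \<open>x * phi x\<close> has the primitive \<open>- phi x\<close>.\<close>

lemma std_normal_tail:
 assumes u: "u > 0"
 shows "measure std_normal_distribution {u<..} \<le> phi u / u"
proof -
 let ?F = "\<lambda>x. - phi x / u"
 have F: "(?F has_real_derivative x * phi x / u) (at x)" for x
  unfolding std_normal_density_def using u by (auto intro!: derivative_eq_intros simp: field_simps power2_eq_square)
 have lim: "(?F \<longlongrightarrow> 0) at_top"
 proof -
  have "(phi \<longlongrightarrow> 0) at_top" unfolding std_normal_density_def by real_asymp
  from tendsto_divide[OF tendsto_minus[OF this] tendsto_const[of u]] u show ?thesis by simp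
 qed
 have "emeasure std_normal_distribution {u<..} = (\<integral>\<^sup>+x. ennreal (phi x) * indicator {u<..} x \<partial>lborel)"
  by (subst emeasure_density) auto
 also have "\<dots> \<le> (\<integral>\<^sup>+x. ennreal (x * phi x / u) * indicator {u..} x \<partial>lborel)"
 proof (rule nn_integral_mono)
  fix x show "ennreal (phi x) * indicator {u<..} x \<le> ennreal (x * phi x / u) * indicator {u..} x"
   using u by (auto split: split_indicator intro!: ennreal_leI simp: field_simps mult_right_mono)
 qed
 also have "\<dots> = ennreal (0 - ?F u)" using u by (intro nn_integral_FTC_atLeast F lim) (auto intro!: divide_nonneg_pos mult_nonneg_nonneg)
 finally have "emeasure std_normal_distribution {u<..} \<le> ennreal (phi u / u)" by simp
 thus ?thesis using u by (simp add: measure_def enn2real_leI divide_nonneg_pos)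
qed

lemma Psi_upper: "u > 0 \<Longrightarrow> 1 - Phi u \<le> phi u / u"
 using std_normal_tail by (simp add: one_minus_Phi)

lemma Phi_lt_1: "Phi x < 1"
 using Phi_strict_mono[of x "x+1"] Phi_le_1[of "x+1"] by simp

lemma phi_shift: "phi (u + h) = phi u * exp (- u * h - h\<^sup>2 / 2)"
 by (simp add: std_normal_density_def power2_eq_square field_simps flip: exp_add)

text \<open>Matches the order of \<open>Psi_upper\<close>. Over an interval of length
  \<open>1/u\<close> the density loses at most the factor
  \<open>exp (- 1 - 1 / (2 * u\<^sup>2))\<close>, which is at least \<open>exp (-2)\<close> for
  \<open>u \<ge> 1\<close>.\<close>

lemma Psi_lower: assumes "u \<ge> 1" shows "phi u * exp (-2) / u \<le> 1 - Phi u"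
proof -
 have "phi u * exp (-2) \<le> phi (u + 1/u)" using assms by (subst phi_shift) (auto intro!: mult_left_mono simp: power2_eq_square divide_simps mult_ge1_I)
 hence "phi u * exp (-2) / u \<le> phi (u + 1/u) * (u + 1/u - u)" using assms by (auto simp: field_simps)
 also have "\<dots> \<le> Phi (u + 1/u) - Phi u" using assms by (intro Phi_step) auto
 finally show ?thesis using Phi_le_1[of "u+1/u"] by simp
qed

text \<open>For \<open>x \<ge> u \<ge> 0\<close> the density is at most
  \<open>exp (-u\<^sup>2/2)\<close> times the normal density centred at \<open>u\<close>. Unlike the
  bound by \<open>phi u / u\<close>, this one is usable down to \<open>u = 0\<close>, as
  \<open>cgauss_tail\<close> requires.\<close>

lemma std_normal_tail_exp:
 assumes "u \<ge> 0" shows "measure std_normal_distribution {u..} \<le> exp (-u\<^sup>2/2)"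
proof -
 have e: "(\<integral>\<^sup>+x. ennreal (phi (x - u)) \<partial>lborel) = 1"
 proof -
  have "(\<integral>\<^sup>+x. ennreal (phi (x - u)) \<partial>lborel) = (\<integral>\<^sup>+x. ennreal (normal_density u 1 x) \<partial>lborel)"
   by (simp add: normal_density_def)
  also have "\<dots> = 1" using prob_space.emeasure_space_1[OF prob_space_normal_density[of 1 u]] by (simp add: emeasure_density)
  finally show ?thesis .
 qed
 have "emeasure std_normal_distribution {u..} = (\<integral>\<^sup>+x. ennreal (phi x) * indicator {u..} x \<partial>lborel)" by (subst emeasure_density) auto
 also have "\<dots> \<le> (\<integral>\<^sup>+x. ennreal (exp (-u\<^sup>2/2)) * ennreal (phi (x - u)) \<partial>lborel)"
 proof (rule nn_integral_mono)
  fix x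
  have "phi x \<le> exp (-u\<^sup>2/2) * phi (x - u)" if "u \<le> x"
  proof -
   have "phi x = phi ((x - u) + u)" by simp
   also have "\<dots> = phi (x-u) * exp (- (x-u) * u - u\<^sup>2/2)" by (rule phi_shift)
   also have "\<dots> \<le> phi (x-u) * exp (- u\<^sup>2/2)" using assms that by (intro mult_left_mono) (auto intro!: mult_nonpos_nonneg)
   finally show ?thesis by (simp add: mult.commute)
  qed
  thus "ennreal (phi x) * indicator {u..} x \<le> ennreal (exp (-u\<^sup>2/2)) * ennreal (phi (x - u))"
   by (auto split: split_indicator simp flip: ennreal_mult' intro!: ennreal_leI)
 qed
 also have "\<dots> = ennreal (exp (-u\<^sup>2/2))" by (subst nn_integral_cmult) (auto simp: e)
 finally show ?thesis by (simp add: measure_def enn2real_leI)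
qed

text \<open>The law of \<open>sqrt v\<close> times a standard normal variable; \<open>v = 0\<close>
  gives the point mass at 0, so degenerate variables are included.\<close>

definition cgauss :: "'w measure \<Rightarrow> ('w \<Rightarrow> real) \<Rightarrow> real \<Rightarrow> bool" where
 "cgauss M Y v \<longleftrightarrow> Y \<in> borel_measurable M \<and> 0 \<le> v \<and>
   distr M borel Y = distr std_normal_distribution borel (\<lambda>x. sqrt v * x)"

lemma cgauss_measurable: "cgauss M Y v \<Longrightarrow> Y \<in> borel_measurable M"
 and cgauss_nonneg: "cgauss M Y v \<Longrightarrow> 0 \<le> v"
 by (auto simp: cgauss_def)

lemma cgauss_integral:
 fixes g :: "real \<Rightarrow> 'b::{banach, second_countable_topology}"
 assumes "cgauss M Y v" "g \<in> borel_measurable borel"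
 shows "(\<integral>w. g (Y w) \<partial>M) = (\<integral>x. g (sqrt v * x) \<partial>std_normal_distribution)"
proof -
 have "(\<integral>w. g (Y w) \<partial>M) = (\<integral>y. g y \<partial>distr M borel Y)" using assms by (subst integral_distr) (auto simp: cgauss_def)
 also have "\<dots> = (\<integral>x. g (sqrt v * x) \<partial>std_normal_distribution)" using assms by (subst (asm) cgauss_def) (simp add: integral_distr)
 finally show ?thesis .
qed

lemma cgauss_integrable:
 fixes g :: "real \<Rightarrow> 'b::{banach, second_countable_topology}"
 assumes "cgauss M Y v" "g \<in> borel_measurable borel"
 shows "integrable M (\<lambda>w. g (Y w)) \<longleftrightarrow> integrable std_normal_distribution (\<lambda>x. g (sqrt v * x))"
proof -
 have "integrable M (\<lambda>w. g (Y w)) \<longleftrightarrow> integrable (distr M borel Y) g"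
  using assms by (subst integrable_distr_eq) (auto simp: cgauss_def)
 also have "\<dots> \<longleftrightarrow> integrable std_normal_distribution (\<lambda>x. g (sqrt v * x))"
  using assms by (subst (asm) cgauss_def) (simp add: integrable_distr_eq)
 finally show ?thesis .
qed

lemma cgauss_prob:
 assumes "cgauss M Y v" "A \<in> sets borel"
 shows "measure M {w\<in>space M. Y w \<in> A} = measure std_normal_distribution {x. sqrt v * x \<in> A}"
proof -
 have "measure M {w\<in>space M. Y w \<in> A} = measure (distr M borel Y) A"
  using assms by (subst measure_distr) (auto simp: cgauss_def vimage_def Int_def conj_commute)
 also have "\<dots> = measure std_normal_distribution {x. sqrt v * x \<in> A}" using assms by (subst (asm) cgauss_def) (simp add: measure_distr vimage_def)
 finally show ?thesis .
qed

lemma cgauss_square: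
 assumes "cgauss M Y v"
 shows "integrable M (\<lambda>w. (Y w)\<^sup>2)" "(\<integral>w. (Y w)\<^sup>2 \<partial>M) = v"
  "integrable M Y" "(\<integral>w. Y w \<partial>M) = 0"
proof -
 have v: "v \<ge> 0" using assms by (simp add: cgauss_def)
 note i = integrable_std_normal_distribution_moment
 show "integrable M (\<lambda>w. (Y w)\<^sup>2)" using cgauss_integrable[OF assms, of "\<lambda>x. x\<^sup>2"] i[of 2] by (simp add: power_mult_distrib)
 show "(\<integral>w. (Y w)\<^sup>2 \<partial>M) = v"
  using cgauss_integral[OF assms, of "\<lambda>x. x\<^sup>2"] std_normal_distribution_even_moments(1)[of 1] v by (simp add: power_mult_distrib)
 show "integrable M Y" using cgauss_integrable[OF assms, of "\<lambda>x. x"] i[of 1] by simp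
 show "(\<integral>w. Y w \<partial>M) = 0" using cgauss_integral[OF assms, of "\<lambda>x. x"] integral_std_normal_distribution_moment_odd[of 1] by simp
qed

lemma cgauss_iexp:
 assumes "cgauss M Y v"
 shows "(CLINT w|M. iexp (a * Y w)) = complex_of_real (exp (- (a\<^sup>2 * v) / 2))"
proof -
 have v: "v \<ge> 0" using assms by (simp add: cgauss_def)
 have "(CLINT w|M. iexp (a * Y w)) = (CLINT x|std_normal_distribution. iexp (a * (sqrt v * x)))"
  using cgauss_integral[OF assms, of "\<lambda>y. iexp (a * y)"] by simp
 also have "\<dots> = char std_normal_distribution (a * sqrt v)" by (simp add: char_def mult.assoc)
 also have "\<dots> = complex_of_real (exp (- (a\<^sup>2 * v) / 2))" using v by (simp add: char_std_normal_distribution power_mult_distrib)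
 finally show ?thesis .
qed

lemma cgaussI:
 assumes "prob_space M" and Y: "Y \<in> borel_measurable M" and v: "0 \<le> v"
  and c: "\<And>a. (CLINT w|M. iexp (a * Y w)) = complex_of_real (exp (- (a\<^sup>2 * v) / 2))"
 shows "cgauss M Y v"
proof -
 let ?D = "distr std_normal_distribution borel (\<lambda>x. sqrt v * x)"
 interpret prob_space M by fact
 interpret N: prob_space std_normal_distribution by (rule prob_space_std_normal)
 have "distr M borel Y = ?D"
 proof (rule Levy_uniqueness)
  show "real_distribution (distr M borel Y)" using Y by (rule real_distribution_distr)
  show "real_distribution ?D" by (rule N.real_distribution_distr) simp
  show "char (distr M borel Y) = char ?D"
  proof
   fix a
   have "char (distr M borel Y) a = (CLINT w|M. iexp (a * Y w))" unfolding char_def using Y by (subst integral_distr) auto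
   also have "\<dots> = complex_of_real (exp (- (a\<^sup>2 * v) / 2))" by (rule c)
   also have "\<dots> = char std_normal_distribution (a * sqrt v)" using v by (simp add: char_std_normal_distribution power_mult_distrib)
   also have "\<dots> = char ?D a" unfolding char_def by (subst integral_distr) (auto simp: mult.assoc)
   finally show "char (distr M borel Y) a = char ?D a" .
  qed
 qed
 thus ?thesis using Y v by (simp add: cgauss_def)
qed

lemma cgauss_tail:
 assumes "cgauss M Y v" "v \<le> V" "V > 0" "l \<ge> 0"
 shows "measure M {w\<in>space M. l < Y w} \<le> exp (- l\<^sup>2 / (2 * V))"
proof -
 interpret N: prob_space std_normal_distribution by (rule prob_space_std_normal)
 have v: "v \<ge> 0" using assms by (simp add: cgauss_def)
 have "measure M {w\<in>space M. Y w \<in> {l<..}} = measure std_normal_distribution {x. sqrt v * x \<in> {l<..}}" by (rule cgauss_prob[OF assms(1)]) simp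
 also have "\<dots> \<le> measure std_normal_distribution {l / sqrt V..}"
 proof (rule N.finite_measure_mono)
  show "{x. sqrt v * x \<in> {l<..}} \<subseteq> {l / sqrt V..}"
  proof (rule subsetI)
   fix x assume "x \<in> {x. sqrt v * x \<in> {l<..}}"
   hence h: "l < sqrt v * x" by simp
   have x0: "x \<ge> 0"
   proof (rule ccontr)
    assume "\<not> x \<ge> 0"
    hence "sqrt v * x \<le> 0" using v by (intro mult_nonneg_nonpos) auto
    with h assms show False by simp
   qed
   have "sqrt v * x \<le> sqrt V * x" using assms x0 by (intro mult_right_mono) auto
   with h show "x \<in> {l / sqrt V..}" using assms by (simp add: field_simps)
  qed
 qed simp
 also have "\<dots> \<le> exp (- (l / sqrt V)\<^sup>2 / 2)" using assms by (intro std_normal_tail_exp) auto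
 also have "\<dots> = exp (- l\<^sup>2 / (2 * V))" using assms by (simp add: power_divide)
 finally show ?thesis by simp
qed

lemma std_normal_singleton: "measure std_normal_distribution {c} = 0"
proof -
 have "emeasure std_normal_distribution {c} = (\<integral>\<^sup>+x. ennreal (phi x) * indicator {c} x \<partial>lborel)" by (subst emeasure_density) auto
 also have "\<dots> = (\<integral>\<^sup>+x. 0 \<partial>(lborel :: real measure))"
  by (intro nn_integral_cong_AE, use AE_lborel_singleton[of c] in eventually_elim) auto
 finally show ?thesis by (simp add: measure_def)
qed

lemma cgauss_eq_prob:
 assumes "cgauss M Y v" "v > 0"
 shows "measure M {w\<in>space M. Y w = c} = 0"
proof -
 have "measure M {w\<in>space M. Y w \<in> {c}} = measure std_normal_distribution {x. sqrt v * x \<in> {c}}" by (rule cgauss_prob[OF assms(1)]) simp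
 also have "{x. sqrt v * x \<in> {c}} = {c / sqrt v}" using assms by (auto simp: field_simps)
 finally show ?thesis by (simp add: std_normal_singleton)
qed

lemma cgauss_zero_AE:
 assumes "cgauss M Y 0"
 shows "AE w in M. Y w = 0"
proof -
 have "integrable M (\<lambda>w. (Y w)\<^sup>2)" "(\<integral>w. (Y w)\<^sup>2 \<partial>M) = 0" using cgauss_square[OF assms] by auto
 hence "AE w in M. (Y w)\<^sup>2 = 0" by (subst (asm) integral_nonneg_eq_0_iff_AE) auto
 thus ?thesis by simp
qed

lemma cgauss_var_unique: "cgauss M Y v \<Longrightarrow> cgauss M Y w \<Longrightarrow> v = w"
 using cgauss_square(2) by metis

lemma cgauss_std:
 assumes "cgauss M Y 1" shows "distr M borel Y = std_normal_distribution"
proof -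
 have "distr std_normal_distribution borel (\<lambda>x. sqrt 1 * x) = distr std_normal_distribution borel (\<lambda>x. x)" by (rule distr_cong) auto
 also have "\<dots> = std_normal_distribution" by (simp add: distr_id2)
 finally show ?thesis using assms unfolding cgauss_def by metis
qed

lemma cgauss_scale:
 assumes "prob_space M" "cgauss M Y v"
 shows "cgauss M (\<lambda>w. c * Y w) (c\<^sup>2 * v)"
proof (rule cgaussI[OF assms(1)])
 show "(\<lambda>w. c * Y w) \<in> borel_measurable M" "0 \<le> c\<^sup>2 * v" using cgauss_measurable[OF assms(2)] cgauss_nonneg[OF assms(2)] by auto
 fix a show "(CLINT w|M. iexp (a * (c * Y w))) = complex_of_real (exp (- (a\<^sup>2 * (c\<^sup>2 * v)) / 2))"
  using cgauss_iexp[OF assms(2), of "a * c"] by (simp add: mult.assoc power_mult_distrib)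
qed

text \<open>The characteristic functions \<open>exp (- a\<^sup>2 * v n / 2)\<close> converge. Their
  limit is the characteristic function of \<open>Z\<close>, continuous at 0 with value 1, hence
  positive at some \<open>a > 0\<close>. Taking logarithms there yields convergence of the variances
  without any bound on them beforehand.\<close>

lemma cgauss_limit:
 assumes M: "prob_space M" and Y: "\<And>n::nat. cgauss M (Y n) (v n)"
  and lim: "\<And>\<omega>. \<omega> \<in> space M \<Longrightarrow> (\<lambda>n. Y n \<omega>) \<longlonglongrightarrow> Z \<omega>"
 shows "\<exists>w. v \<longlonglongrightarrow> w \<and> cgauss M Z w"
proof -
 interpret prob_space M by fact
 have Ym[measurable]: "Y n \<in> borel_measurable M" for n using Y by (rule cgauss_measurable)
 have Zm[measurable]: "Z \<in> borel_measurable M" by (rule borel_measurable_LIMSEQ_real[OF lim Ym])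
 define \<phi> where "\<phi> a = (CLINT \<omega>|M. iexp (a * Z \<omega>))" for a
 have conv: "(\<lambda>n. complex_of_real (exp (- (a\<^sup>2 * v n) / 2))) \<longlonglongrightarrow> \<phi> a" for a
 proof -
  have "(\<lambda>n. CLINT \<omega>|M. iexp (a * Y n \<omega>)) \<longlonglongrightarrow> \<phi> a" unfolding \<phi>_def
  proof (rule integral_dominated_convergence[where w="\<lambda>_. 1"])
   show "AE \<omega> in M. (\<lambda>n. iexp (a * Y n \<omega>)) \<longlonglongrightarrow> iexp (a * Z \<omega>)" by (intro AE_I2 tendsto_intros lim)
  qed auto
  thus ?thesis by (subst (asm) cgauss_iexp[OF Y])
 qed
 have conv': "(\<lambda>n. exp (- (a\<^sup>2 * v n) / 2)) \<longlonglongrightarrow> Re (\<phi> a)" for a using tendsto_Re[OF conv[of a]] by simp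
 interpret Z: real_distribution "distr M borel Z" by (rule real_distribution_distr) simp
 have \<phi>char: "\<phi> = char (distr M borel Z)" by (rule ext) (simp add: \<phi>_def char_def integral_distr)
 have "isCont \<phi> 0" unfolding \<phi>char by (rule Z.isCont_char)
 moreover have "\<phi> 0 = 1" unfolding \<phi>char by (rule Z.char_zero)
 ultimately have "((\<lambda>a. Re (\<phi> a)) \<longlongrightarrow> 1) (at 0)" by (auto simp: isCont_def dest: tendsto_Re)
 hence "eventually (\<lambda>a. 0 < Re (\<phi> a)) (at 0)" by (rule order_tendstoD) simp
 then obtain d where "d > 0" and d: "\<And>a. a \<noteq> 0 \<Longrightarrow> dist a 0 < d \<Longrightarrow> 0 < Re (\<phi> a)" unfolding eventually_at by auto
 define a where "a = d / 2"
 have a: "a > 0" "0 < Re (\<phi> a)" using \<open>d > 0\<close> d[of a] by (auto simp: a_def dist_real_def)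
 have "(\<lambda>n. - 2 * ln (exp (- (a\<^sup>2 * v n) / 2)) / a\<^sup>2) \<longlonglongrightarrow> - 2 * ln (Re (\<phi> a)) / a\<^sup>2"
  using a by (intro tendsto_intros conv') auto
 then obtain w where vlim: "v \<longlonglongrightarrow> w" using a by auto
 have "0 \<le> w" by (rule LIMSEQ_le_const[OF vlim]) (use cgauss_nonneg[OF Y] in auto)
 moreover have "\<phi> b = complex_of_real (exp (- (b\<^sup>2 * w) / 2))" for b
  by (rule LIMSEQ_unique[OF conv]) (intro tendsto_of_real tendsto_exp tendsto_divide tendsto_minus tendsto_mult tendsto_const vlim, simp)
 ultimately have "cgauss M Z w" by (intro cgaussI M) (auto simp: \<phi>_def)
 with vlim show ?thesis by blast
qed

lemma gaussian_rv_cgauss: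
 assumes "prob_space M" "gaussian_rv M Y" "(\<integral>w. Y w \<partial>M) = 0"
 shows "\<exists>v. cgauss M Y v"
proof -
 interpret prob_space M by fact
 interpret N: prob_space std_normal_distribution by (rule prob_space_std_normal)
 have [measurable]: "Y \<in> borel_measurable M" using assms(2) by (simp add: gaussian_rv_def)
 have mean: "(\<integral>x. x \<partial>distr M borel Y) = 0" using assms(3) by (simp add: integral_distr)
 from assms(2) obtain \<mu> where "distr M borel Y = return borel \<mu> \<or>
    (\<exists>s>0. distr M borel Y = density lborel (normal_density \<mu> s))"
  unfolding gaussian_rv_def by auto
 thus ?thesis
 proof (elim disjE exE conjE)
  assume d: "distr M borel Y = return borel \<mu>"
  with mean have "\<mu> = 0" by (simp add: integral_return)
  moreover have "distr std_normal_distribution borel (\<lambda>x. sqrt 0 * x) = return borel (0::real)"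
   using N.emeasure_space_1 by (intro measure_eqI) (auto simp: emeasure_distr split: split_indicator)
  ultimately have "cgauss M Y 0" using d by (simp add: cgauss_def)
  thus ?thesis by blast
 next
  fix s :: real assume s: "s > 0" and d: "distr M borel Y = density lborel (normal_density \<mu> s)"
  have "(\<integral>x. x \<partial>density lborel (normal_density \<mu> s)) = \<mu>"
   using has_bochner_integral_integral_eq[OF normal_moment_nz_1[OF s, of \<mu>]] by (subst integral_density) auto
  with mean d have mu: "\<mu> = 0" by simp
  have "distributed std_normal_distribution lborel (\<lambda>x. x) (normal_density 0 1)" unfolding distributed_def by (simp add: distr_id2)
  from N.normal_density_affine[OF this, of s 0] s
  have "distributed std_normal_distribution lborel (\<lambda>x. s * x) (normal_density 0 s)" by simp
  hence "distr std_normal_distribution lborel (\<lambda>x. s * x) = density lborel (normal_density 0 s)" by (simp add: distributed_def)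
  hence "distr std_normal_distribution borel (\<lambda>x. s * x) = density lborel (normal_density 0 s)"
   by (subst distr_cong[OF refl sets_lborel[symmetric] refl])
  hence "cgauss M Y (s\<^sup>2)" using d s mu by (simp add: cgauss_def)
  thus ?thesis by blast
 qed
qed

section \<open>Independence of uncorrelated Gaussian variables\<close>

lemma prob_space_weighted:
 assumes "prob_space P" and w[measurable]: "w \<in> borel_measurable P"
  and wb: "\<And>x. x \<in> space P \<Longrightarrow> 0 \<le> w x \<and> w x \<le> B"
  and c: "c = (\<integral>x. w x \<partial>P)" "c > 0"
 shows "prob_space (density P (\<lambda>x. ennreal (w x / c)))"
proof -
 interpret prob_space P by fact
 have i: "integrable P w" by (rule integrable_const_bound[where B=B]) (use wb in auto)
 have "(\<integral>\<^sup>+x. ennreal (w x / c) \<partial>P) = ennreal (\<integral>x. w x / c \<partial>P)"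
  using i wb c by (intro nn_integral_eq_integral) auto
 also have "(\<integral>x. w x / c \<partial>P) = 1" using c by simp
 finally have 1: "(\<integral>\<^sup>+x. ennreal (w x / c) \<partial>P) = 1" by simp
 have "emeasure (density P (\<lambda>x. ennreal (w x / c))) (space P) = (\<integral>\<^sup>+x. ennreal (w x / c) * indicator (space P) x \<partial>P)"
  by (rule emeasure_density) auto
 also have "\<dots> = (\<integral>\<^sup>+x. ennreal (w x / c) \<partial>P)" by (rule nn_integral_cong) simp
 finally show ?thesis using 1 by (intro prob_spaceI) simp
qed

text \<open>Divided by its total mass, a nonnegative weight becomes a density, and the hypothesis is
  equality of two characteristic functions under the new measures. If the total mass is 0, both
  weights vanish almost everywhere.\<close>

lemma weighted_Levy:
 assumes P: "prob_space P" and Q: "prob_space Q"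
  and X[measurable]: "X \<in> borel_measurable P" and Y[measurable]: "Y \<in> borel_measurable Q"
  and w[measurable]: "w \<in> borel_measurable P" and w'[measurable]: "w' \<in> borel_measurable Q"
  and wb: "\<And>x. x \<in> space P \<Longrightarrow> 0 \<le> w x \<and> w x \<le> B"
  and wb': "\<And>x. x \<in> space Q \<Longrightarrow> 0 \<le> w' x \<and> w' x \<le> B"
  and eq: "\<And>a. (CLINT x|P. complex_of_real (w x) * iexp (a * X x)) = (CLINT y|Q. complex_of_real (w' y) * iexp (a * Y y))"
  and E[measurable]: "E \<in> sets borel"
 shows "(\<integral>x. w x * indicator E (X x) \<partial>P) = (\<integral>y. w' y * indicator E (Y y) \<partial>Q)"
proof -
 interpret P: prob_space P by fact
 interpret Q: prob_space Q by fact
 have i: "integrable P w" by (rule P.integrable_const_bound[where B=B]) (use wb in auto)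
 have i': "integrable Q w'" by (rule Q.integrable_const_bound[where B=B]) (use wb' in auto)
 define c where "c = (\<integral>x. w x \<partial>P)"
 have "complex_of_real (\<integral>x. w x \<partial>P) = complex_of_real (\<integral>x. w' x \<partial>Q)" using eq[of 0] by simp
 hence c': "c = (\<integral>x. w' x \<partial>Q)" by (simp add: c_def)
 have "c \<ge> 0" unfolding c_def using wb by (intro integral_nonneg_AE) auto
 show ?thesis
 proof (cases "c = 0")
  case True
  have "AE x in P. w x = 0" using True wb i by (subst (asm) c_def, subst (asm) integral_nonneg_eq_0_iff_AE) auto
  hence 1: "(\<integral>x. w x * indicator E (X x) \<partial>P) = 0" by (subst integral_eq_zero_AE) auto
  have "AE x in Q. w' x = 0" using True wb' i' by (subst (asm) c', subst (asm) integral_nonneg_eq_0_iff_AE) auto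
  hence 2: "(\<integral>x. w' x * indicator E (Y x) \<partial>Q) = 0" by (subst integral_eq_zero_AE) auto
  from 1 2 show ?thesis by simp
 next
  case False
  with \<open>c \<ge> 0\<close> have c: "c > 0" by simp
  define P1 where "P1 = density P (\<lambda>x. ennreal (w x / c))"
  define Q1 where "Q1 = density Q (\<lambda>x. ennreal (w' x / c))"
  interpret P1: prob_space P1 unfolding P1_def by (rule prob_space_weighted[OF P w wb c_def c])
  interpret Q1: prob_space Q1 unfolding Q1_def by (rule prob_space_weighted[OF Q w' wb' c' c])
  have [measurable]: "X \<in> borel_measurable P1" "Y \<in> borel_measurable Q1" by (auto simp: P1_def Q1_def)
  have "distr P1 borel X = distr Q1 borel Y"
  proof (rule Levy_uniqueness)
   show "real_distribution (distr P1 borel X)" by (rule P1.real_distribution_distr) simp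
   show "real_distribution (distr Q1 borel Y)" by (rule Q1.real_distribution_distr) simp
   show "char (distr P1 borel X) = char (distr Q1 borel Y)"
   proof
    fix a
    have "char (distr P1 borel X) a = (CLINT x|P1. iexp (a * X x))" unfolding char_def by (subst integral_distr) auto
    also have "\<dots> = (CLINT x|P. complex_of_real (w x) * iexp (a * X x) / complex_of_real c)"
     unfolding P1_def using wb c by (subst integral_density) (auto simp: scaleR_conv_of_real)
    also have "\<dots> = (CLINT x|P. complex_of_real (w x) * iexp (a * X x)) / complex_of_real c" by simp
    also have "\<dots> = (CLINT x|Q. complex_of_real (w' x) * iexp (a * Y x)) / complex_of_real c" by (simp only: eq)
    also have "\<dots> = (CLINT x|Q. complex_of_real (w' x) * iexp (a * Y x) / complex_of_real c)" by simp
    also have "\<dots> = (CLINT x|Q1. iexp (a * Y x))" unfolding Q1_def using wb' c by (subst integral_density) (auto simp: scaleR_conv_of_real)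
    also have "\<dots> = char (distr Q1 borel Y) a" unfolding char_def by (subst integral_distr) auto
    finally show "char (distr P1 borel X) a = char (distr Q1 borel Y) a" .
   qed
  qed
  hence "(\<integral>x. indicator E x \<partial>distr P1 borel X) = (\<integral>x. indicator E x \<partial>distr Q1 borel Y :: real)" by simp
  hence "(\<integral>x. indicator E (X x) \<partial>P1) = (\<integral>x. indicator E (Y x) \<partial>Q1 :: real)" by (subst (asm) (1 2) integral_distr) auto
  hence "(\<integral>x. w x * indicator E (X x) / c \<partial>P) = (\<integral>y. w' y * indicator E (Y y) / c \<partial>Q)"
   unfolding P1_def Q1_def using wb wb' c by (simp add: integral_density)
  thus ?thesis using c by simp
 qed
qed

text \<open>The weight \<open>1 + Re v\<close> is nonnegative, so the previous lemma applies to it;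
  its transform at \<open>a\<close> is assembled from the transforms of \<open>v\<close> at
  \<open>a\<close> and, by conjugation, at \<open>- a\<close>. Subtracting the case of weight 1
  leaves \<open>Re v\<close>.\<close>

lemma weighted_Levy_Re:
 assumes P: "prob_space P" and Q: "prob_space Q"
  and X[measurable]: "X \<in> borel_measurable P" and Y[measurable]: "Y \<in> borel_measurable Q"
  and v[measurable]: "v \<in> borel_measurable P" and v'[measurable]: "v' \<in> borel_measurable Q"
  and b: "\<And>x. x \<in> space P \<Longrightarrow> cmod (v x) \<le> 1" "\<And>x. x \<in> space Q \<Longrightarrow> cmod (v' x) \<le> 1"
  and eq: "\<And>a. (CLINT x|P. v x * iexp (a * X x)) = (CLINT y|Q. v' y * iexp (a * Y y))"
  and eq1: "\<And>a. (CLINT x|P. iexp (a * X x)) = (CLINT y|Q. iexp (a * Y y))"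
  and E: "E \<in> sets borel"
 shows "(\<integral>x. Re (v x) * indicator E (X x) \<partial>P) = (\<integral>y. Re (v' y) * indicator E (Y y) \<partial>Q)"
proof -
 have split: "(CLINT x|R. complex_of_real (1 + Re (u x)) * iexp (a * Z x))
   = (CLINT x|R. iexp (a * Z x)) + ((CLINT x|R. u x * iexp (a * Z x)) + cnj (CLINT x|R. u x * iexp (- a * Z x))) / 2"
  and ind: "(\<integral>x. Re (u x) * indicator E (Z x) \<partial>R) = (\<integral>x. (1 + Re (u x)) * indicator E (Z x) \<partial>R) - (\<integral>x. 1 * indicator E (Z x) \<partial>R)"
  if R: "prob_space R" and [measurable]: "Z \<in> borel_measurable R" "u \<in> borel_measurable R" and u: "\<And>x. x \<in> space R \<Longrightarrow> cmod (u x) \<le> 1"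
  for R :: "'z measure" and Z u a
 proof -
  interpret R: prob_space R by fact
  have i: "integrable R (\<lambda>x. iexp (c * Z x))" "integrable R (\<lambda>x. u x * iexp (c * Z x))" for c
   using u by (intro R.integrable_const_bound[where B=1]; auto simp: norm_mult)+
  have "complex_of_real (1 + Re (u x)) * iexp (a * Z x) = iexp (a * Z x) + (u x * iexp (a * Z x) + cnj (u x * iexp (- a * Z x))) / 2" for x
   by (simp add: complex_eq_iff Re_exp Im_exp field_simps)
  thus "(CLINT x|R. complex_of_real (1 + Re (u x)) * iexp (a * Z x))
   = (CLINT x|R. iexp (a * Z x)) + ((CLINT x|R. u x * iexp (a * Z x)) + cnj (CLINT x|R. u x * iexp (- a * Z x))) / 2"
   using i by (simp only: integrable_cnj integrable_divide Bochner_Integration.integral_add Bochner_Integration.integrable_add integral_divide_zero)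
    (simp del: complex_cnj_mult)
  have [measurable]: "E \<in> sets borel" by (rule E)
  have "\<bar>Re (u x)\<bar> \<le> 1" if "x \<in> space R" for x using abs_Re_le_cmod[of "u x"] u[OF that] by linarith
  hence "integrable R (\<lambda>x. Re (u x) * indicator E (Z x))" "integrable R (\<lambda>x. indicator E (Z x) :: real)"
   by (intro R.integrable_const_bound[where B=1]; auto simp: indicator_def)+
  thus "(\<integral>x. Re (u x) * indicator E (Z x) \<partial>R) = (\<integral>x. (1 + Re (u x)) * indicator E (Z x) \<partial>R) - (\<integral>x. 1 * indicator E (Z x) \<partial>R)"
   by (simp add: distrib_right)
 qed
 have R01: "0 \<le> 1 + Re z \<and> 1 + Re z \<le> 2" if "cmod z \<le> 1" for z using abs_Re_le_cmod[of z] that by linarith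
 have "(\<integral>x. (1 + Re (v x)) * indicator E (X x) \<partial>P) = (\<integral>y. (1 + Re (v' y)) * indicator E (Y y) \<partial>Q)"
 proof (rule weighted_Levy[OF P Q X Y _ _ _ _ _ E, where B=2])
  show "(\<lambda>x. 1 + Re (v x)) \<in> borel_measurable P" "(\<lambda>x. 1 + Re (v' x)) \<in> borel_measurable Q" by measurable
 qed (use b R01 in \<open>simp_all only: split[OF P X v b(1)] split[OF Q Y v' b(2)] eq eq1\<close>)
 moreover have "(\<integral>x. 1 * indicator E (X x) \<partial>P) = (\<integral>y. 1 * indicator E (Y y) \<partial>Q :: real)"
  by (rule weighted_Levy[OF P Q X Y, where B=1]) (use eq1 E in auto)
 ultimately show ?thesis by (simp only: ind[OF P X v b(1)] ind[OF Q Y v' b(2)])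
qed

text \<open>The imaginary part of \<open>v\<close> is the real part of \<open>- \<i> * v\<close>, so
  the version for real parts applies twice.\<close>

lemma complex_weighted_Levy:
 assumes P: "prob_space P" and Q: "prob_space Q"
  and X[measurable]: "X \<in> borel_measurable P" and Y[measurable]: "Y \<in> borel_measurable Q"
  and v[measurable]: "v \<in> borel_measurable P" and v'[measurable]: "v' \<in> borel_measurable Q"
  and b: "\<And>x. x \<in> space P \<Longrightarrow> cmod (v x) \<le> 1" "\<And>x. x \<in> space Q \<Longrightarrow> cmod (v' x) \<le> 1"
  and eq: "\<And>a. (CLINT x|P. v x * iexp (a * X x)) = (CLINT y|Q. v' y * iexp (a * Y y))"
  and eq1: "\<And>a. (CLINT x|P. iexp (a * X x)) = (CLINT y|Q. iexp (a * Y y))"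
  and E[measurable]: "E \<in> sets borel"
 shows "(CLINT x|P. v x * complex_of_real (indicator E (X x))) = (CLINT y|Q. v' y * complex_of_real (indicator E (Y y)))"
proof -
 interpret P: prob_space P by fact
 interpret Q: prob_space Q by fact
 have i: "integrable P (\<lambda>x. v x * complex_of_real (indicator E (X x)))" "integrable Q (\<lambda>x. v' x * complex_of_real (indicator E (Y x)))"
  using b by (intro P.integrable_const_bound[where B=1] Q.integrable_const_bound[where B=1]; auto simp: norm_mult indicator_def)+
 have "(\<integral>x. Re (- \<i> * v x) * indicator E (X x) \<partial>P) = (\<integral>y. Re (- \<i> * v' y) * indicator E (Y y) \<partial>Q)"
  by (rule weighted_Levy_Re[OF P Q X Y]) (use b eq eq1 E in \<open>auto simp: norm_mult mult.assoc\<close>)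
 with weighted_Levy_Re[OF P Q X Y v v' b eq eq1 E] show ?thesis using i by (simp add: complex_eq_iff integral_Re[symmetric] integral_Im[symmetric])
qed

text \<open>Levy's uniqueness theorem in finitely many variables: the exponentials are replaced by
 indicators one coordinate at a time, the remaining ones serving as weights.\<close>

lemma PiM_char_eq_indicator:
 fixes J :: "'i set"
 assumes J: "finite J" and P: "prob_space P" and Q: "prob_space Q"
  and sP: "sets P = sets (\<Pi>\<^sub>M j\<in>J. borel)" and sQ: "sets Q = sets (\<Pi>\<^sub>M j\<in>J. (borel :: real measure))"
  and eq: "\<And>c. (CLINT x|P. iexp (\<Sum>j\<in>J. c j * x j)) = (CLINT x|Q. iexp (\<Sum>j\<in>J. c j * x j))"
  and A: "A \<subseteq> J" and E: "\<And>j. E j \<in> sets borel"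
 shows "(CLINT x|P. complex_of_real (\<Prod>j\<in>A. indicator (E j) (x j)) * iexp (\<Sum>j\<in>J-A. c j * x j))
    = (CLINT x|Q. complex_of_real (\<Prod>j\<in>A. indicator (E j) (x j)) * iexp (\<Sum>j\<in>J-A. c j * x j))"
 using finite_subset[OF A J] A
proof (induction A arbitrary: c rule: finite_induct)
 case empty
 show ?case using eq[of c] by simp
next
 case (insert k A)
 have k: "k \<in> J" "k \<notin> A" "A \<subseteq> J" using insert by auto
 define v where "v x = complex_of_real (\<Prod>j\<in>A. indicator (E j) (x j)) * iexp (\<Sum>j\<in>J - insert k A. c j * x j)" for x :: "'i \<Rightarrow> real"
 have v1: "cmod (v x) \<le> 1" for x unfolding v_def norm_mult norm_exp_i_times norm_of_real by (auto simp: abs_prod intro!: prod_le_1)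
 have meas: "(\<lambda>x. x k) \<in> borel_measurable R" "v \<in> borel_measurable R" if R: "sets R = sets (\<Pi>\<^sub>M j\<in>J. borel)" for R
 proof -
  note [measurable_cong] = R
  have [measurable]: "(\<lambda>x. x j) \<in> borel_measurable R" if "j \<in> J" for j using that by measurable
  show "(\<lambda>x. x k) \<in> borel_measurable R" using k by simp
  note E[measurable]
  have "(\<lambda>x. \<Prod>j\<in>A. indicator (E j) (x j) :: real) \<in> borel_measurable R"
   by (intro borel_measurable_prod borel_measurable_indicator') (use k E in auto)
  moreover have "(\<lambda>x. \<Sum>j\<in>J - insert k A. c j * x j) \<in> borel_measurable R" by (intro borel_measurable_sum borel_measurable_times) auto
  ultimately show "v \<in> borel_measurable R" unfolding v_def by measurable
 qed
 have sum_k: "(\<Sum>j\<in>J - B. (c(k := a)) j * x j) = a * x k + (\<Sum>j\<in>J - insert k B. c j * x j)" if "k \<notin> B" for B c a and x :: "'i \<Rightarrow> real"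
  using J k that by (subst sum.remove[of _ k]) (auto simp flip: Diff_insert intro!: sum.cong)
 have prod: "complex_of_real (\<Prod>j\<in>insert k A. indicator (E j) (x j)) * iexp (\<Sum>j\<in>J - insert k A. c j * x j)
   = v x * complex_of_real (indicator (E k) (x k))" for x
  using insert.hyps by (simp add: v_def mult_ac)
 have vk: "v x * iexp (a * x k) = complex_of_real (\<Prod>j\<in>A. indicator (E j) (x j)) * iexp (\<Sum>j\<in>J - A. (c(k := a)) j * x j)" for x a
  unfolding sum_k[OF k(2)] v_def by (simp add: distrib_left exp_add mult_ac)
 have ek: "iexp (a * x k) = iexp (\<Sum>j\<in>J. ((\<lambda>_. 0)(k := a)) j * x j)" for x a using sum_k[of "{}" "\<lambda>_. 0" a x] by simp
 have "(CLINT x|P. v x * iexp (a * x k)) = (CLINT x|Q. v x * iexp (a * x k))" for a unfolding vk by (rule insert.IH[OF k(3), of "c(k := a)"])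
 moreover have "(CLINT x|P. iexp (a * x k)) = (CLINT x|Q. iexp (a * x k))" for a unfolding ek by (rule eq)
 ultimately show ?case unfolding prod by (rule complex_weighted_Levy[OF P Q meas(1)[OF sP] meas(1)[OF sQ] meas(2)[OF sP] meas(2)[OF sQ] v1 v1 _ _ E])
qed

lemma PiM_char_unique:
 fixes J :: "'i set"
 assumes J: "finite J" and P: "prob_space P" and Q: "prob_space Q"
  and sP: "sets P = sets (\<Pi>\<^sub>M j\<in>J. borel)" and sQ: "sets Q = sets (\<Pi>\<^sub>M j\<in>J. (borel :: real measure))"
  and eq: "\<And>c. (CLINT x|P. iexp (\<Sum>j\<in>J. c j * x j)) = (CLINT x|Q. iexp (\<Sum>j\<in>J. c j * x j))"
 shows "P = Q"
proof (rule measure_eqI_PiM_finite[OF J sP sQ])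
 interpret P: prob_space P by fact
 interpret Q: prob_space Q by fact
 fix A :: "'i \<Rightarrow> real set" assume A: "\<And>i. i \<in> J \<Longrightarrow> A i \<in> sets borel"
 define E where "E j = (if j \<in> J then A j else {})" for j
 have E: "E j \<in> sets borel" for j using A by (auto simp: E_def)
 have Pi: "Pi\<^sub>E J A \<in> sets (\<Pi>\<^sub>M j\<in>J. (borel :: real measure))" using A J by (intro sets_PiM_I_finite) auto
 have ind: "(\<Prod>j\<in>J. indicator (E j) (x j)) = (indicator (Pi\<^sub>E J A) x :: real)"
  if "x \<in> extensional J" for x :: "'i \<Rightarrow> real"
  using that J by (auto simp: E_def indicator_def PiE_def Pi_def prod_eq_1_iff prod_zero_iff intro!: prod.neutral)
 have sp: "space P = extensional J" "space Q = extensional J" using sets_eq_imp_space_eq[OF sP] sets_eq_imp_space_eq[OF sQ] by (auto simp: space_PiM PiE_def)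
 have "(CLINT x|P. complex_of_real (\<Prod>j\<in>J. indicator (E j) (x j))) = (CLINT x|Q. complex_of_real (\<Prod>j\<in>J. indicator (E j) (x j)))"
  using PiM_char_eq_indicator[OF assms, of J E] E by simp
 hence "(\<integral>x. (\<Prod>j\<in>J. indicator (E j) (x j)) \<partial>P) = (\<integral>x. (\<Prod>j\<in>J. indicator (E j) (x j)) \<partial>Q :: real)"
  by (simp only: integral_complex_of_real of_real_eq_iff)
 moreover have "(\<integral>x. (\<Prod>j\<in>J. indicator (E j) (x j)) \<partial>P) = (\<integral>x. indicator (Pi\<^sub>E J A) x \<partial>P :: real)"
  by (rule Bochner_Integration.integral_cong) (auto simp: ind sp)
 moreover have "(\<integral>x. (\<Prod>j\<in>J. indicator (E j) (x j)) \<partial>Q) = (\<integral>x. indicator (Pi\<^sub>E J A) x \<partial>Q :: real)"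
  by (rule Bochner_Integration.integral_cong) (auto simp: ind sp)
 ultimately have "measure P (Pi\<^sub>E J A \<inter> space P) = measure Q (Pi\<^sub>E J A \<inter> space Q)" by simp
 moreover have "Pi\<^sub>E J A \<inter> space P = Pi\<^sub>E J A" "Pi\<^sub>E J A \<inter> space Q = Pi\<^sub>E J A" by (auto simp: sp PiE_def)
 ultimately show "emeasure P (Pi\<^sub>E J A) = emeasure Q (Pi\<^sub>E J A)" by (simp add: P.emeasure_eq_measure Q.emeasure_eq_measure)
next
 fix i
 show "range (\<lambda>n::nat. Pi\<^sub>E J (\<lambda>_. UNIV :: real set)) \<subseteq> prod_algebra J (\<lambda>_. borel)"
  using J by (auto intro!: prod_algebraI_finite)
 show "(\<Union>n::nat. Pi\<^sub>E J (\<lambda>_. UNIV :: real set)) = space (\<Pi>\<^sub>M j\<in>J. (borel :: real measure))" by (auto simp: space_PiM)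
 show "emeasure P (Pi\<^sub>E J (\<lambda>_. UNIV :: real set)) \<noteq> \<infinity>"
  using prob_space.emeasure_le_1[OF P] by (metis infinity_ennreal_def ennreal_one_neq_top top.extremum_unique)
qed

section \<open>Linear spaces of centred Gaussian variables\<close>

locale gaussian_space = prob_space M for M :: "'w measure" +
 fixes H :: "('w \<Rightarrow> real) set"
 assumes H_cgauss_ex: "Y \<in> H \<Longrightarrow> \<exists>v. cgauss M Y v"
  and H_zero: "(\<lambda>_. 0) \<in> H"
  and H_add: "Y \<in> H \<Longrightarrow> Z \<in> H \<Longrightarrow> (\<lambda>w. Y w + Z w) \<in> H"
  and H_scale: "Y \<in> H \<Longrightarrow> (\<lambda>w. c * Y w) \<in> H"
begin

definition cov :: "('w \<Rightarrow> real) \<Rightarrow> ('w \<Rightarrow> real) \<Rightarrow> real" where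
 "cov Y Z = expectation (\<lambda>w. Y w * Z w)"

lemma H_cgauss: "Y \<in> H \<Longrightarrow> cgauss M Y (cov Y Y)"
 using H_cgauss_ex[of Y] cgauss_square(2)[of M Y] by (auto simp: cov_def power2_eq_square)

lemma H_measurable: "Y \<in> H \<Longrightarrow> Y \<in> borel_measurable M"
 using H_cgauss cgauss_measurable by blast

lemma H_diff: "Y \<in> H \<Longrightarrow> Z \<in> H \<Longrightarrow> (\<lambda>w. Y w - Z w) \<in> H"
 using H_add[of Y "\<lambda>w. -1 * Z w"] H_scale[of Z "-1"] by simp

lemma H_sum: "finite J \<Longrightarrow> (\<And>j. j \<in> J \<Longrightarrow> Y j \<in> H) \<Longrightarrow> (\<lambda>w. \<Sum>j\<in>J. Y j w) \<in> H"
 by (induction J rule: finite_induct) (auto intro: H_zero H_add)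

lemma H_integrable: "Y \<in> H \<Longrightarrow> integrable M Y" "Y \<in> H \<Longrightarrow> expectation Y = 0"
 using cgauss_square[OF H_cgauss] by auto

lemma H_integrable_mult:
 assumes "Y \<in> H" "Z \<in> H" shows "integrable M (\<lambda>w. Y w * Z w)"
proof -
 have "integrable M (\<lambda>w. ((Y w + Z w)\<^sup>2 - (Y w)\<^sup>2 - (Z w)\<^sup>2) / 2)"
  using cgauss_square(1)[OF H_cgauss] assms H_add by (intro integrable_divide Bochner_Integration.integrable_diff) auto
 moreover have "((Y w + Z w)\<^sup>2 - (Y w)\<^sup>2 - (Z w)\<^sup>2) / 2 = Y w * Z w" for w by (simp add: power2_eq_square algebra_simps)
 ultimately show ?thesis by simp
qed

lemma cov_commute: "cov Y Z = cov Z Y"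
 by (simp add: cov_def mult.commute)

lemma cov_nonneg: "0 \<le> cov Y Y"
 by (simp add: cov_def)

lemma cov_add: "Y \<in> H \<Longrightarrow> Z \<in> H \<Longrightarrow> W \<in> H \<Longrightarrow> cov (\<lambda>w. Y w + Z w) W = cov Y W + cov Z W"
 by (simp add: cov_def distrib_right H_integrable_mult)

lemma cov_diff: "Y \<in> H \<Longrightarrow> Z \<in> H \<Longrightarrow> W \<in> H \<Longrightarrow> cov (\<lambda>w. Y w - Z w) W = cov Y W - cov Z W"
 by (simp add: cov_def left_diff_distrib H_integrable_mult)

lemma cov_scale: "cov (\<lambda>w. c * Y w) W = c * cov Y W"
 by (simp add: cov_def mult.assoc)

lemma cov_sum: "finite J \<Longrightarrow> (\<And>j. j \<in> J \<Longrightarrow> Y j \<in> H) \<Longrightarrow> W \<in> H \<Longrightarrow>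
  cov (\<lambda>w. \<Sum>j\<in>J. Y j w) W = (\<Sum>j\<in>J. cov (Y j) W)"
 by (simp add: cov_def sum_distrib_right H_integrable_mult)

lemma cov_diff_self:
 assumes "Y \<in> H" "Z \<in> H"
 shows "cov (\<lambda>w. Y w - Z w) (\<lambda>w. Y w - Z w) = cov Y Y - 2 * cov Y Z + cov Z Z"
 using assms H_diff[OF assms] by (simp add: cov_diff cov_commute[of Y "\<lambda>w. Y w - Z w"] cov_commute[of Z "\<lambda>w. Y w - Z w"] cov_commute[of Z Y])

lemma cov_add_self:
 assumes "Y \<in> H" "Z \<in> H"
 shows "cov (\<lambda>w. Y w + Z w) (\<lambda>w. Y w + Z w) = cov Y Y + 2 * cov Y Z + cov Z Z"
 using assms H_add[OF assms] by (simp add: cov_add cov_commute[of Y "\<lambda>w. Y w + Z w"] cov_commute[of Z "\<lambda>w. Y w + Z w"] cov_commute[of Z Y])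

lemma H_iexp: "Y \<in> H \<Longrightarrow> (CLINT w|M. iexp (Y w)) = complex_of_real (exp (- cov Y Y / 2))"
 using cgauss_iexp[OF H_cgauss, of Y 1] by simp

text \<open>Linearity of \<open>H\<close> makes the sum Gaussian, so its transform depends on its
  variance alone, and a vanishing covariance splits that variance. All independence statements come
  from here.\<close>

lemma H_uncorrelated_iexp:
 assumes "Y \<in> H" "Z \<in> H" "cov Y Z = 0"
 shows "(CLINT w|M. iexp (Y w + Z w)) = (CLINT w|M. iexp (Y w)) * (CLINT w|M. iexp (Z w))"
 using assms H_iexp[OF H_add[OF assms(1,2)]] by (simp add: H_iexp cov_add_self add_divide_distrib flip: of_real_mult exp_add)

abbreviation vec_rv :: "'i set \<Rightarrow> ('i \<Rightarrow> 'w \<Rightarrow> real) \<Rightarrow> 'w \<Rightarrow> 'i \<Rightarrow> real" where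
 "vec_rv J Y w \<equiv> (\<lambda>j\<in>J. Y j w)"

lemma vec_rv_measurable: "(\<And>j. j \<in> J \<Longrightarrow> Y j \<in> H) \<Longrightarrow> vec_rv J Y \<in> measurable M (\<Pi>\<^sub>M j\<in>J. borel)"
 by (intro measurable_restrict) (auto intro: H_measurable)

lemma uncorrelated_pair:
 fixes J :: "'i set"
 assumes J: "finite J" and X: "X \<in> H" and Y: "\<And>j. j \<in> J \<Longrightarrow> Y j \<in> H" and c: "\<And>j. j \<in> J \<Longrightarrow> cov X (Y j) = 0"
 shows "distr M borel X \<Otimes>\<^sub>M distr M (\<Pi>\<^sub>M j\<in>J. borel) (vec_rv J Y)
  = distr M (borel \<Otimes>\<^sub>M (\<Pi>\<^sub>M j\<in>J. borel)) (\<lambda>w. (X w, vec_rv J Y w))"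
proof -
 let ?P = "\<Pi>\<^sub>M j\<in>J. (borel :: real measure)" and ?J = "insert None (Some ` J)"
 let ?B = "borel \<Otimes>\<^sub>M ?P" and ?PJ = "\<Pi>\<^sub>M i\<in>?J. (borel :: real measure)"
 define T where "T p = (\<lambda>i\<in>?J. case i of None \<Rightarrow> fst p | Some j \<Rightarrow> snd p j)" for p :: "real \<times> ('i \<Rightarrow> real)"
 define S where "S z = (z None, \<lambda>j\<in>J. z (Some j))" for z :: "'i option \<Rightarrow> real"
 define V where "V w = (X w, vec_rv J Y w)" for w
 note [measurable] = H_measurable[OF X] vec_rv_measurable[of J Y, OF Y]
 have V[measurable]: "V \<in> measurable M ?B" unfolding V_def by measurable
 have T[measurable]: "T \<in> measurable ?B ?PJ" unfolding T_def by (intro measurable_restrict) (auto split: option.split)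
 have S[measurable]: "S \<in> measurable ?PJ ?B" unfolding S_def by (intro measurable_Pair measurable_restrict measurable_component_singleton) auto
 have ST: "S (T p) = p" if "p \<in> space ?B" for p
  using that by (cases p) (auto simp: S_def T_def space_pair_measure space_PiM PiE_def extensional_def restrict_def)
 define D where "D = distr M borel X \<Otimes>\<^sub>M distr M ?P (vec_rv J Y)"
 have sD[measurable_cong]: "sets D = sets ?B" unfolding D_def by (intro sets_pair_measure_cong) simp_all
 interpret D1: prob_space "distr M borel X" by (rule prob_space_distr) simp
 interpret D2: prob_space "distr M ?P (vec_rv J Y)" by (rule prob_space_distr) simp
 interpret D: pair_prob_space "distr M borel X" "distr M ?P (vec_rv J Y)" ..
 have "distr D ?PJ T = distr (distr M ?B V) ?PJ T"
 proof (rule PiM_char_unique)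
  show "prob_space (distr D ?PJ T)" "prob_space (distr (distr M ?B V) ?PJ T)"
   using D.prob_space_axioms by (auto simp: D_def[symmetric] intro!: prob_space.prob_space_distr prob_space_distr)
  fix c
  define Z where "Z w = (\<Sum>j\<in>J. c (Some j) * Y j w)" for w
  have Z: "Z \<in> H" unfolding Z_def[abs_def] using J Y by (intro H_sum H_scale) auto
  have cZ: "cov (\<lambda>w. c None * X w) Z = 0" unfolding cov_scale cov_commute[of X Z] unfolding Z_def[abs_def]
   using J Y X assms(4) by (subst cov_sum) (auto simp: cov_scale cov_commute[of _ X] intro!: H_scale sum.neutral)
  have sumT: "(\<Sum>i\<in>?J. c i * T p i) = c None * fst p + (\<Sum>j\<in>J. c (Some j) * snd p j)" for p using J by (simp add: T_def sum.reindex)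
  have [measurable]: "(\<lambda>z. iexp (\<Sum>i\<in>?J. c i * z i)) \<in> borel_measurable ?PJ" by measurable
  have "(CLINT z|distr D ?PJ T. iexp (\<Sum>i\<in>?J. c i * z i)) = (CLINT p|D. iexp (c None * fst p) * iexp (\<Sum>j\<in>J. c (Some j) * snd p j))"
   by (subst integral_distr) (auto simp: sumT distrib_left exp_add)
  also have "\<dots> = (CLINT x|distr M borel X. CLINT y|distr M ?P (vec_rv J Y). iexp (c None * x) * iexp (\<Sum>j\<in>J. c (Some j) * y j))"
  proof -
   have "integrable D (\<lambda>p. iexp (c None * fst p) * iexp (\<Sum>j\<in>J. c (Some j) * snd p j))"
    by (intro D.integrable_const_bound[where B=1, folded D_def]) (auto simp: norm_mult)
   thus ?thesis unfolding D_def by (subst D.integral_fst'[symmetric]) auto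
  qed
  also have "\<dots> = (CLINT w|M. iexp (c None * X w)) * (CLINT w|M. iexp (Z w))" by (simp add: integral_distr Z_def cong: sum.cong)
  also have "\<dots> = (CLINT w|M. iexp (c None * X w + Z w))" by (rule H_uncorrelated_iexp[OF H_scale[OF X] Z cZ, symmetric])
  also have "\<dots> = (CLINT z|distr (distr M ?B V) ?PJ T. iexp (\<Sum>i\<in>?J. c i * z i))"
   by (simp add: integral_distr sumT V_def Z_def del: of_real_sum of_real_add of_real_mult cong: sum.cong)
  finally show "(CLINT z|distr D ?PJ T. iexp (\<Sum>i\<in>?J. c i * z i)) = (CLINT z|distr (distr M ?B V) ?PJ T. iexp (\<Sum>i\<in>?J. c i * z i))" .
 qed (use J in auto)
 hence "distr (distr D ?PJ T) ?B S = distr (distr (distr M ?B V) ?PJ T) ?B S" by simp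
 hence "distr D ?B (\<lambda>p. S (T p)) = distr M ?B (\<lambda>w. S (T (V w)))" by (simp add: distr_distr comp_def)
 moreover have "distr D ?B (\<lambda>p. S (T p)) = distr D ?B (\<lambda>p. p)" using sets_eq_imp_space_eq[OF sD] by (intro distr_cong) (simp_all add: ST)
 moreover have "distr M ?B (\<lambda>w. S (T (V w))) = distr M ?B V" using measurable_space[OF V] by (intro distr_cong) (simp_all add: ST)
 ultimately show ?thesis using sD by (simp add: D_def V_def[abs_def] distr_id2)
qed

text \<open>Conditioning on \<open>X\<close>: by independence \<open>X\<close> may be frozen at
  \<open>x\<close> in the constraints on \<open>Y\<close>. Bounds affine in \<open>X\<close> are
  what remains of constant bounds once the projection onto \<open>X\<close> has been subtracted from
  a Gaussian vector.\<close>

lemma uncorrelated_fubini: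
 fixes J :: "'i set"
 assumes J: "finite J" and X: "X \<in> H" and Y: "\<And>j. j \<in> J \<Longrightarrow> Y j \<in> H" and c: "\<And>j. j \<in> J \<Longrightarrow> cov X (Y j) = 0"
  and A[measurable]: "A \<in> sets borel"
 shows "prob {w\<in>space M. X w \<in> A \<and> (\<forall>j\<in>J. Y j w \<le> p j + q j * X w)}
    = (\<integral>x. indicator A x * prob {w\<in>space M. \<forall>j\<in>J. Y j w \<le> p j + q j * x} \<partial>distr M borel X)" (is ?A)
  and "(\<lambda>x. prob {w\<in>space M. \<forall>j\<in>J. Y j w \<le> p j + q j * x}) \<in> borel_measurable borel" (is ?B)
proof -
 let ?P = "\<Pi>\<^sub>M j\<in>J. (borel :: real measure)"
 note [measurable] = H_measurable[OF X] vec_rv_measurable[of J Y, OF Y]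
 define D1 where "D1 = distr M borel X"
 define D2 where "D2 = distr M ?P (vec_rv J Y)"
 interpret D1: prob_space D1 unfolding D1_def by (rule prob_space_distr) simp
 interpret D2: prob_space D2 unfolding D2_def by (rule prob_space_distr) simp
 have [measurable_cong]: "sets D1 = sets borel" "sets D2 = sets ?P" by (auto simp: D1_def D2_def)
 have pair: "D1 \<Otimes>\<^sub>M D2 = distr M (borel \<Otimes>\<^sub>M ?P) (\<lambda>w. (X w, vec_rv J Y w))"
  unfolding D1_def D2_def using J X Y c by (rule uncorrelated_pair)
 interpret D: pair_prob_space D1 D2 ..
 define f where "f A z = (indicator {z \<in> space (borel \<Otimes>\<^sub>M ?P). fst z \<in> A \<and> (\<forall>j\<in>J. snd z j \<le> p j + q j * fst z)} z :: real)" for A z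
 have f[measurable]: "f A \<in> borel_measurable (D1 \<Otimes>\<^sub>M D2)" if [measurable]: "A \<in> sets borel" for A
  unfolding f_def[abs_def] using J by measurable
 have slice: "(\<integral>z. f A (x, z) \<partial>D2) = indicator A x * prob {w\<in>space M. \<forall>j\<in>J. Y j w \<le> p j + q j * x}"
  if [measurable]: "A \<in> sets borel" for x A
 proof -
  have "(\<integral>z. f A (x, z) \<partial>D2) = (\<integral>w. f A (x, vec_rv J Y w) \<partial>M)"
   unfolding D2_def f_def using J by (subst integral_distr) auto
  also have "\<dots> = (\<integral>w. indicator A x * indicator {w\<in>space M. \<forall>j\<in>J. Y j w \<le> p j + q j * x} w \<partial>M)"
   by (intro Bochner_Integration.integral_cong) (auto simp: f_def space_pair_measure space_PiM indicator_def)
  finally show ?thesis by (simp add: Int_absorb2 subset_eq)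
 qed
 have meas: "(\<lambda>x. \<integral>z. f A (x, z) \<partial>D2) \<in> borel_measurable D1" if "A \<in> sets borel" for A
  using f[OF that] by (intro D2.borel_measurable_lebesgue_integral) simp
 show ?B using meas[of UNIV] by (simp add: slice D1_def)
 have "integrable (D1 \<Otimes>\<^sub>M D2) (f A)" by (intro D.integrable_const_bound[where B=1]) (auto simp: f_def indicator_def)
 hence "(\<integral>x. \<integral>z. f A (x, z) \<partial>D2 \<partial>D1) = (\<integral>z. f A z \<partial>(D1 \<Otimes>\<^sub>M D2))" by (rule D.integral_fst')
 also have "\<dots> = (\<integral>w. f A (X w, vec_rv J Y w) \<partial>M)" unfolding pair using f[OF A] unfolding pair by (subst integral_distr) auto
 also have "\<dots> = (\<integral>w. indicator {w\<in>space M. X w \<in> A \<and> (\<forall>j\<in>J. Y j w \<le> p j + q j * X w)} w \<partial>M)"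
  by (intro Bochner_Integration.integral_cong) (auto simp: f_def space_pair_measure space_PiM indicator_def)
 finally show ?A by (simp add: slice[OF A] D1_def Int_absorb2 subset_eq)
qed

end

section \<open>Log-concavity of Gaussian orthant probabilities\<close>

text \<open>On the line only endpoints matter. \<open>A\<close> and \<open>B\<close> lie between
  their infimum and supremum, the inclusion forces the endpoints of \<open>C\<close> to be at least
  the weighted length apart, and a convex \<open>C\<close> contains everything strictly between its
  endpoints.\<close>

lemma brunn_minkowski_real:
 fixes A B C :: "real set"
 assumes A: "A \<noteq> {}" "bounded A" and B: "B \<noteq> {}" "bounded B"
  and C: "C \<in> sets borel" "convex C" "bounded C" and l: "0 < l" "l < 1"
  and sub: "\<And>x y. x \<in> A \<Longrightarrow> y \<in> B \<Longrightarrow> l * x + (1 - l) * y \<in> C"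
 shows "ennreal l * emeasure lborel A + ennreal (1 - l) * emeasure lborel B \<le> emeasure lborel C"
proof -
 have bdd: "bdd_above S" "bdd_below S" if "bounded S" for S :: "real set" using that bounded_imp_bdd_above bounded_imp_bdd_below by auto
 have len: "emeasure lborel S \<le> ennreal (Sup S - Inf S)" "Inf S \<le> Sup S" if S: "S \<noteq> {}" "bounded S" for S :: "real set"
 proof -
  show le: "Inf S \<le> Sup S" using S bdd by (intro cInf_le_cSup) auto
  have "emeasure lborel S \<le> emeasure lborel {Inf S..Sup S}" using S bdd[OF S(2)] by (intro emeasure_mono) (auto intro: cInf_lower cSup_upper)
  thus "emeasure lborel S \<le> ennreal (Sup S - Inf S)" using le by simp
 qed
 have *: "Sup B \<le> (Sup C - l * x) / (1 - l)" "(Inf C - l * x) / (1 - l) \<le> Inf B" if x: "x \<in> A" for x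
 proof -
  have *: "l * x + (1 - l) * y \<le> Sup C" "Inf C \<le> l * x + (1 - l) * y" if "y \<in> B" for y
   using sub[OF x that] bdd[OF C(3)] by (auto intro: cSup_upper cInf_lower)
  have "y \<le> (Sup C - l * x) / (1 - l)" "(Inf C - l * x) / (1 - l) \<le> y" if "y \<in> B" for y
   using *[OF that] l by (simp_all add: pos_le_divide_eq pos_divide_le_eq mult.commute)
  thus "Sup B \<le> (Sup C - l * x) / (1 - l)" "(Inf C - l * x) / (1 - l) \<le> Inf B" using B(1) by (blast intro: cSup_least cInf_greatest)+
 qed
 have "x \<le> (Sup C - (1 - l) * Sup B) / l" "(Inf C - (1 - l) * Inf B) / l \<le> x" if "x \<in> A" for x
  using *[OF that] l by (simp_all add: pos_le_divide_eq pos_divide_le_eq mult.commute)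
 hence "Sup A \<le> (Sup C - (1 - l) * Sup B) / l" "(Inf C - (1 - l) * Inf B) / l \<le> Inf A" using A(1) by (blast intro: cSup_least cInf_greatest)+
 hence ends: "l * (Sup A - Inf A) + (1 - l) * (Sup B - Inf B) \<le> Sup C - Inf C" using l by (simp add: field_simps)
 have Cne: "C \<noteq> {}" using A B sub by blast
 have "{Inf C<..<Sup C} \<subseteq> C"
 proof
  fix x assume x: "x \<in> {Inf C<..<Sup C}"
  obtain p q where pq: "p \<in> C" "p < x" "q \<in> C" "x < q"
   using x cInf_less_iff[OF Cne, of x] less_cSup_iff[OF Cne, of x] bdd[OF C(3)] by auto
  hence "{p..q} \<subseteq> C" using C(2) closed_segment_eq_real_ivl[of p q] by (metis convex_contains_segment less_imp_le order_trans)
  thus "x \<in> C" using pq by auto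
 qed
 hence "emeasure lborel {Inf C<..<Sup C} \<le> emeasure lborel C" using C by (intro emeasure_mono) auto
 hence "ennreal (Sup C - Inf C) \<le> emeasure lborel C" using len(2)[OF Cne C(3)] by simp
 moreover have "ennreal l * emeasure lborel A + ennreal (1 - l) * emeasure lborel B
   \<le> ennreal l * ennreal (Sup A - Inf A) + ennreal (1 - l) * ennreal (Sup B - Inf B)"
  using A B by (intro add_mono mult_left_mono len) auto
 moreover have "\<dots> = ennreal (l * (Sup A - Inf A) + (1 - l) * (Sup B - Inf B))" using l len(2)[OF A] len(2)[OF B] by (simp add: ennreal_mult)
 moreover have "\<dots> \<le> ennreal (Sup C - Inf C)" using ends by (rule ennreal_leI)
 ultimately show ?thesis by simp
qed

lemma layer_cake:
 fixes f :: "real \<Rightarrow> real"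
 assumes [measurable]: "f \<in> borel_measurable borel" and "\<And>x. 0 \<le> f x"
 shows "(\<integral>\<^sup>+x. ennreal (f x) \<partial>lborel) = (\<integral>\<^sup>+t. indicator {0<..} t * emeasure lborel {x. t < f x} \<partial>lborel)"
proof -
 have "(\<integral>\<^sup>+x. ennreal (f x) \<partial>lborel) = (\<integral>\<^sup>+x. (\<integral>\<^sup>+t. indicator {0<..<f x} t \<partial>lborel) \<partial>lborel)"
  using assms by (intro nn_integral_cong) simp
 also have "\<dots> = (\<integral>\<^sup>+x. (\<integral>\<^sup>+t. indicator {(x, t). 0 < t \<and> t < f x} (x, t) \<partial>lborel) \<partial>lborel)"
  by (intro nn_integral_cong) (auto split: split_indicator)
 also have "\<dots> = (\<integral>\<^sup>+t. (\<integral>\<^sup>+x. indicator {(x, t). 0 < t \<and> t < f x} (x, t) \<partial>lborel) \<partial>lborel)"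
  by (rule lborel_pair.Fubini'[symmetric]) measurable
 also have "\<dots> = (\<integral>\<^sup>+t. (\<integral>\<^sup>+x. indicator {0<..} t * indicator {x. t < f x} x \<partial>lborel) \<partial>lborel)"
  by (intro nn_integral_cong) (auto split: split_indicator)
 also have "\<dots> = (\<integral>\<^sup>+t. indicator {0<..} t * emeasure lborel {x. t < f x} \<partial>lborel)"
  by (intro nn_integral_cong) (simp add: nn_integral_cmult)
 finally show ?thesis .
qed

text \<open>With both suprema equal to 1 the level sets of \<open>f\<close> and \<open>g\<close> are
  nonempty for exactly the same levels \<open>t < 1\<close>, so the one-dimensional Brunn-Minkowski
  inequality can be used at each level and integrated over \<open>t\<close>.\<close>

lemma prekopa_normalized:
 fixes f g h :: "real \<Rightarrow> real"
 assumes [measurable]: "f \<in> borel_measurable borel" "g \<in> borel_measurable borel" "h \<in> borel_measurable borel"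
  and nn: "\<And>x. 0 \<le> f x" "\<And>x. 0 \<le> g x" "\<And>x. 0 \<le> h x"
  and l: "0 < l" "l < 1"
  and sup: "\<And>x. f x \<le> 1" "\<And>x. g x \<le> 1" "\<And>t. t < 1 \<Longrightarrow> \<exists>x. t < f x" "\<And>t. t < 1 \<Longrightarrow> \<exists>x. t < g x"
  and bdd: "\<And>t. 0 < t \<Longrightarrow> bounded {x. t < f x}" "\<And>t. 0 < t \<Longrightarrow> bounded {x. t < g x}" "\<And>t. 0 < t \<Longrightarrow> bounded {x. t < h x}"
  and conv: "\<And>t. 0 < t \<Longrightarrow> convex {x. t < h x}"
  and ineq: "\<And>x y. f x powr l * g y powr (1 - l) \<le> h (l * x + (1 - l) * y)"
 shows "ennreal l * (\<integral>\<^sup>+x. ennreal (f x) \<partial>lborel) + ennreal (1 - l) * (\<integral>\<^sup>+x. ennreal (g x) \<partial>lborel) \<le> (\<integral>\<^sup>+x. ennreal (h x) \<partial>lborel)"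
proof -
 have lev: "ennreal l * emeasure lborel {x. t < f x} + ennreal (1 - l) * emeasure lborel {x. t < g x} \<le> emeasure lborel {x. t < h x}"
  if t: "0 < t" for t
 proof (cases "t < 1")
  case True
  show ?thesis
  proof (rule brunn_minkowski_real)
   show "{x. t < f x} \<noteq> {}" "{x. t < g x} \<noteq> {}" using sup True by auto
   show "bounded {x. t < f x}" "bounded {x. t < g x}" "bounded {x. t < h x}" "convex {x. t < h x}" using bdd conv t by auto
   show "0 < l" "l < 1" by fact+
   fix x y assume "x \<in> {x. t < f x}" "y \<in> {x. t < g x}"
   hence "t powr l * t powr (1 - l) < f x powr l * g y powr (1 - l)" using t l by (intro mult_strict_mono) (auto intro: powr_less_mono2)
   moreover have "t powr l * t powr (1 - l) = t" using t by (simp flip: powr_add)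
   ultimately show "l * x + (1 - l) * y \<in> {x. t < h x}" using ineq[of x y] by simp
  qed measurable
 next
  case False
  hence "{x. t < f x} = {}" "{x. t < g x} = {}" using sup(1,2) by (auto simp: not_less intro: order_trans)
  thus ?thesis by simp
 qed
 have mf: "(\<lambda>t. emeasure lborel {x. t < k x}) \<in> borel_measurable borel" if [measurable]: "k \<in> borel_measurable borel" for k :: "real \<Rightarrow> real"
 proof -
  have "{p \<in> space (borel \<Otimes>\<^sub>M lborel). fst p < k (snd p)} \<in> sets (borel \<Otimes>\<^sub>M lborel)" by measurable
  from lborel.measurable_emeasure_Pair[OF this] show ?thesis by (simp add: vimage_def space_pair_measure)
 qed
 note [measurable] = mf[of f] mf[of g] mf[of h]
 have "ennreal l * (\<integral>\<^sup>+x. ennreal (f x) \<partial>lborel) + ennreal (1 - l) * (\<integral>\<^sup>+x. ennreal (g x) \<partial>lborel)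
  = (\<integral>\<^sup>+t. ennreal l * (indicator {0<..} t * emeasure lborel {x. t < f x}) + ennreal (1 - l) * (indicator {0<..} t * emeasure lborel {x. t < g x}) \<partial>lborel)"
  unfolding layer_cake[OF assms(1) nn(1)] layer_cake[OF assms(2) nn(2)] by (subst nn_integral_add) (auto simp: nn_integral_cmult)
 also have "\<dots> \<le> (\<integral>\<^sup>+t. indicator {0<..} t * emeasure lborel {x. t < h x} \<partial>lborel)"
  by (intro nn_integral_mono) (auto split: split_indicator simp: lev)
 also have "\<dots> = (\<integral>\<^sup>+x. ennreal (h x) \<partial>lborel)" unfolding layer_cake[OF assms(3) nn(3)] ..
 finally show ?thesis .
qed

text \<open>Dividing \<open>f\<close> and \<open>g\<close> by their suprema \<open>F\<close> and
  \<open>G\<close>, and \<open>h\<close> by \<open>F powr l * G powr (1 - l)\<close>, reduces to the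
  normalized case. That case bounds an arithmetic mean, which dominates the geometric mean by
  Young's inequality.\<close>

lemma prekopa_leindler:
 fixes f g h :: "real \<Rightarrow> real"
 assumes fm[measurable]: "f \<in> borel_measurable borel" "g \<in> borel_measurable borel" "h \<in> borel_measurable borel"
  and nn: "\<And>x. 0 \<le> f x" "\<And>x. 0 \<le> g x" "\<And>x. 0 \<le> h x"
  and int: "integrable lborel f" "integrable lborel g" "integrable lborel h"
  and l: "0 < l" "l < 1"
  and ub: "\<And>x. f x \<le> B" "\<And>x. g x \<le> B"
  and bdd: "\<And>t. 0 < t \<Longrightarrow> bounded {x. t < f x}" "\<And>t. 0 < t \<Longrightarrow> bounded {x. t < g x}" "\<And>t. 0 < t \<Longrightarrow> bounded {x. t < h x}"
  and conv: "\<And>t. 0 < t \<Longrightarrow> convex {x. t < h x}"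
  and ineq: "\<And>x y. f x powr l * g y powr (1 - l) \<le> h (l * x + (1 - l) * y)"
 shows "(\<integral>x. f x \<partial>lborel) powr l * (\<integral>x. g x \<partial>lborel) powr (1 - l) \<le> (\<integral>x. h x \<partial>lborel)"
proof -
 define F where "F = (SUP x. f x)"
 define G where "G = (SUP x. g x)"
 have bdF: "bdd_above (range f)" "bdd_above (range g)" using ub by (auto intro!: bdd_aboveI)
 have F: "f x \<le> F" "g x \<le> G" for x unfolding F_def G_def using bdF by (auto intro: cSUP_upper)
 have FG: "F \<ge> 0" "G \<ge> 0" using F[of 0] nn(1,2)[of 0] by auto
 have hn: "0 \<le> (\<integral>x. h x \<partial>lborel)" using nn by (intro Bochner_Integration.integral_nonneg) auto
 show ?thesis
 proof (cases "F = 0 \<or> G = 0")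
  case True
  hence "(\<forall>x. f x = 0) \<or> (\<forall>x. g x = 0)" using F nn by (metis order_antisym)
  hence "(\<integral>x. f x \<partial>lborel) = 0 \<or> (\<integral>x. g x \<partial>lborel) = 0" by auto
  thus ?thesis using hn l by auto
 next
  case False
  with FG have F0: "F > 0" "G > 0" by auto
  define K where "K = F powr l * G powr (1 - l)"
  have K: "K > 0" using F0 by (simp add: K_def)
  have lt: "\<exists>x. t < f x" if "t < F" for t using that less_cSUP_iff[of UNIV f t] bdF by (auto simp: F_def)
  have lt': "\<exists>x. t < g x" if "t < G" for t using that less_cSUP_iff[of UNIV g t] bdF by (auto simp: G_def)
  have sf: "{x. t < f x / F} = {x. t * F < f x}" "{x. t < g x / G} = {x. t * G < g x}" "{x. t < h x / K} = {x. t * K < h x}" for t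
   using F0 K by (auto simp: field_simps)
  have "ennreal l * (\<integral>\<^sup>+x. ennreal (f x / F) \<partial>lborel) + ennreal (1 - l) * (\<integral>\<^sup>+x. ennreal (g x / G) \<partial>lborel) \<le> (\<integral>\<^sup>+x. ennreal (h x / K) \<partial>lborel)"
  proof (rule prekopa_normalized)
   fix t :: real
   { assume "t < 1"
    hence "t * F < F" "t * G < G" using F0 by auto
    from lt[OF this(1)] lt'[OF this(2)] show "\<exists>x. t < f x / F" "\<exists>x. t < g x / G" using F0 by (auto simp: field_simps) }
   assume "0 < t"
   thus "bounded {x. t < f x / F}" "bounded {x. t < g x / G}" "bounded {x. t < h x / K}" "convex {x. t < h x / K}"
    unfolding sf using F0 K by (auto intro!: bdd conv)
  next
   fix x y
   have "(f x / F) powr l * (g y / G) powr (1 - l) = (f x powr l * g y powr (1 - l)) / K" using nn F0 by (simp add: powr_divide K_def)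
   also have "\<dots> \<le> h (l * x + (1 - l) * y) / K" using K ineq by (intro divide_right_mono) auto
   finally show "(f x / F) powr l * (g y / G) powr (1 - l) \<le> h (l * x + (1 - l) * y) / K" .
  qed (use nn F F0 K l in \<open>auto simp: field_simps\<close>)
  also have "(\<integral>\<^sup>+x. ennreal (f x / F) \<partial>lborel) = ennreal ((\<integral>x. f x \<partial>lborel) / F)"
   using int nn F0 by (subst nn_integral_eq_integral) auto
  also have "(\<integral>\<^sup>+x. ennreal (g x / G) \<partial>lborel) = ennreal ((\<integral>x. g x \<partial>lborel) / G)"
   using int nn F0 by (subst nn_integral_eq_integral) auto
  also have "(\<integral>\<^sup>+x. ennreal (h x / K) \<partial>lborel) = ennreal ((\<integral>x. h x \<partial>lborel) / K)"
   using int nn K by (subst nn_integral_eq_integral) auto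
  finally have *: "l * ((\<integral>x. f x \<partial>lborel) / F) + (1 - l) * ((\<integral>x. g x \<partial>lborel) / G) \<le> (\<integral>x. h x \<partial>lborel) / K"
   using l F0 K nn hn by (simp add: ennreal_mult[symmetric] ennreal_plus[symmetric] Bochner_Integration.integral_nonneg del: ennreal_plus)
  define a where "a = (\<integral>x. f x \<partial>lborel)"
  define b where "b = (\<integral>x. g x \<partial>lborel)"
  have ab: "a \<ge> 0" "b \<ge> 0" unfolding a_def b_def using nn by (auto intro!: Bochner_Integration.integral_nonneg)
  have "(a / F) powr l * (b / G) powr (1 - l) \<le> l * (a / F) + (1 - l) * (b / G)"
  proof (cases "a = 0 \<or> b = 0")
   case False
   thus ?thesis using ab F0 l by (intro Youngs_inequality_0) auto
  qed (use l ab F0 in auto)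
  with * have "(a / F) powr l * (b / G) powr (1 - l) \<le> (\<integral>x. h x \<partial>lborel) / K" by (simp add: a_def b_def)
  moreover have "(a / F) powr l * (b / G) powr (1 - l) = a powr l * b powr (1 - l) / K" using ab F0 by (simp add: powr_divide K_def)
  ultimately show ?thesis using K by (simp add: a_def b_def divide_le_cancel)
 qed
qed

lemma phi_log_concave:
 assumes l: "0 < l" "l < 1"
 shows "phi x powr l * phi y powr (1 - l) \<le> phi (l * x + (1 - l) * y)"
proof -
 have p: "phi x powr l = (1 / sqrt (2 * pi)) powr l * exp (- x\<^sup>2 / 2 * l)" for x l
  unfolding std_normal_density_def by (subst powr_mult) (auto simp: powr_def)
 have "(l * x + (1 - l) * y)\<^sup>2 \<le> l * x\<^sup>2 + (1 - l) * y\<^sup>2"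
 proof -
  have "l * x\<^sup>2 + (1 - l) * y\<^sup>2 - (l * x + (1 - l) * y)\<^sup>2 = l * (1 - l) * (x - y)\<^sup>2" by (simp add: power2_eq_square algebra_simps)
  also have "\<dots> \<ge> 0" using l by simp
  finally show ?thesis by simp
 qed
 hence e: "exp (- x\<^sup>2 / 2 * l) * exp (- y\<^sup>2 / 2 * (1 - l)) \<le> exp (- (l * x + (1 - l) * y)\<^sup>2 / 2)"
  by (simp flip: exp_add) (simp add: algebra_simps)
 have "phi x powr l * phi y powr (1 - l) = (1 / sqrt (2 * pi)) powr l * (1 / sqrt (2 * pi)) powr (1 - l) * (exp (- x\<^sup>2 / 2 * l) * exp (- y\<^sup>2 / 2 * (1 - l)))"
  by (simp add: p)
 also have "(1 / sqrt (2 * pi)) powr l * (1 / sqrt (2 * pi)) powr (1 - l) = 1 / sqrt (2 * pi)" by (simp flip: powr_add)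
 also have "\<dots> * (exp (- x\<^sup>2 / 2 * l) * exp (- y\<^sup>2 / 2 * (1 - l))) \<le> phi (l * x + (1 - l) * y)"
  unfolding std_normal_density_def by (intro mult_left_mono e) simp
 finally show ?thesis .
qed

lemma phi_level_bounded:
 assumes "0 < t" shows "bounded {x. t < phi x}"
proof -
 have "(phi \<longlongrightarrow> 0) at_top" unfolding std_normal_density_def by real_asymp
 hence "eventually (\<lambda>x. phi x < t) at_top" using assms by (rule order_tendstoD)
 then obtain b where b: "\<And>x. x \<ge> b \<Longrightarrow> phi x < t" by (auto simp: eventually_at_top_linorder)
 have "\<bar>x\<bar> \<le> \<bar>b\<bar>" if "t < phi x" for x
 proof (rule ccontr)
  assume "\<not> \<bar>x\<bar> \<le> \<bar>b\<bar>"
  hence "\<bar>x\<bar> \<ge> b" by linarith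
  hence "phi \<bar>x\<bar> < t" by (rule b)
  moreover have "phi \<bar>x\<bar> = phi x" by (simp add: std_normal_density_def)
  ultimately show False using that by simp
 qed
 thus ?thesis by (intro boundedI[where B="\<bar>b\<bar>"]) auto
qed

context gaussian_space
begin

definition orth :: "'i set \<Rightarrow> ('i \<Rightarrow> 'w \<Rightarrow> real) \<Rightarrow> ('i \<Rightarrow> real) \<Rightarrow> real" where
 "orth J Y b = prob {w\<in>space M. \<forall>j\<in>J. Y j w \<le> b j}"

text \<open>Induction on the number of coordinates with nonzero variance. One of them is normalized
  to \<open>U\<close>, and its projection is subtracted from all coordinates. Then
  \<open>orth J Y b\<close> is the integral over \<open>x\<close> of \<open>phi x\<close> times an
  orthant probability of the residuals with bounds \<open>b j - c j * x\<close>. By induction this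
  integrand is log-concave jointly in \<open>b\<close> and \<open>x\<close>, and the
  Prekopa-Leindler inequality integrates \<open>x\<close> out. Without variance left the probability
  is 0 or 1.\<close>

lemma orth_log_concave:
 fixes J :: "'i set"
 assumes J: "finite J"
 shows "(\<And>j. j \<in> J \<Longrightarrow> Y j \<in> H) \<Longrightarrow> 0 < l \<Longrightarrow> l < 1 \<Longrightarrow> orth J Y b powr l * orth J Y b' powr (1 - l) \<le> orth J Y (\<lambda>j. l * b j + (1 - l) * b' j)"
proof (induction "card {j\<in>J. cov (Y j) (Y j) \<noteq> 0}" arbitrary: Y b b' l rule: less_induct)
 case less
 note Y = less.prems(1) and l = less.prems(2,3)
 have 01: "0 \<le> orth J Y b" "orth J Y b \<le> 1" for Y b by (auto simp: orth_def)
 show ?case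
 proof (cases "{j\<in>J. cov (Y j) (Y j) \<noteq> 0} = {}")
  case True
  have "AE w in M. \<forall>j\<in>J. Y j w = 0" using J True H_cgauss[OF Y] by (intro AE_finite_allI) (auto intro!: cgauss_zero_AE simp: Y)
  have val: "orth J Y b = (if \<forall>j\<in>J. 0 \<le> b j then 1 else 0)" for b
  proof -
   have "orth J Y b = prob {w\<in>space M. \<forall>j\<in>J. 0 \<le> b j}" unfolding orth_def
   proof (rule measure_eq_AE)
    show "AE x in M. (x \<in> {w \<in> space M. \<forall>j\<in>J. Y j w \<le> b j}) = (x \<in> {w \<in> space M. \<forall>j\<in>J. 0 \<le> b j})"
     using \<open>AE w in M. \<forall>j\<in>J. Y j w = 0\<close> by eventually_elim auto
    show "{w \<in> space M. \<forall>j\<in>J. Y j w \<le> b j} \<in> sets M" using J H_measurable[OF Y] by measurable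
   qed measurable
   moreover have "{w\<in>space M. \<forall>j\<in>J. 0 \<le> b j} = (if \<forall>j\<in>J. 0 \<le> b j then space M else {})" by auto
   ultimately show ?thesis by (simp add: prob_space)
  qed
  show ?thesis unfolding val using l by (auto intro!: add_nonneg_nonneg mult_nonneg_nonneg)
 next
  case False
  then obtain t where t: "t \<in> J" "cov (Y t) (Y t) \<noteq> 0" by auto
  define v where "v = cov (Y t) (Y t)"
  have v: "v > 0" using t cov_nonneg[of "Y t"] by (simp add: v_def)
  define U where "U = (\<lambda>w. (1 / sqrt v) * Y t w)"
  have U: "U \<in> H" unfolding U_def using Y t by (intro H_scale) auto
  have UU: "cov U U = 1" using v unfolding U_def cov_scale cov_commute[of _ "\<lambda>w. 1 / sqrt v * Y t w"] by (simp add: v_def[symmetric])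
  define c where "c j = cov (Y j) U" for j
  define Z where "Z j = (\<lambda>w. Y j w - c j * U w)" for j
  have Z: "Z j \<in> H" if "j \<in> J" for j unfolding Z_def using that Y U by (intro H_diff H_scale)
  have UZ: "cov U (Z j) = 0" if "j \<in> J" for j
   unfolding cov_commute[of U] unfolding Z_def using that Y U UU by (simp add: cov_diff H_scale cov_scale c_def)
  have Zt: "Z t = (\<lambda>_. 0)"
  proof -
   have "c t = sqrt v" unfolding c_def cov_commute[of "Y t"] unfolding U_def cov_scale using v by (simp add: v_def[symmetric] real_div_sqrt)
   thus ?thesis using v by (auto simp: Z_def U_def)
  qed
  \<comment> \<open>Coordinates of variance zero must stay so under the projection; otherwise the
    count would not decrease.\<close>
  have Z0: "cov (Z j) (Z j) = 0" if j: "j \<in> J" "cov (Y j) (Y j) = 0" for j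
  proof -
   have ae: "AE w in M. Y j w = 0" using H_cgauss[OF Y[OF j(1)]] j by (intro cgauss_zero_AE) simp
   have "c j = (\<integral>w. 0 \<partial>M)" unfolding c_def cov_def
    using ae H_measurable[OF Y[OF j(1)]] H_measurable[OF U] by (intro integral_cong_AE) auto
   hence "Z j = Y j" by (simp add: Z_def)
   thus ?thesis using j by simp
  qed
  have "card {j\<in>J. cov (Z j) (Z j) \<noteq> 0} < card {j\<in>J. cov (Y j) (Y j) \<noteq> 0}"
  proof (rule psubset_card_mono)
   have "t \<notin> {j\<in>J. cov (Z j) (Z j) \<noteq> 0}" by (simp add: Zt cov_def)
   thus "{j\<in>J. cov (Z j) (Z j) \<noteq> 0} \<subset> {j\<in>J. cov (Y j) (Y j) \<noteq> 0}" using t Z0 by auto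
  qed (use J in auto)
  from less.hyps[OF this Z]
  have IH: "orth J Z a powr l * orth J Z a' powr (1 - l) \<le> orth J Z (\<lambda>j. l * a j + (1 - l) * a' j)"
   if "0 < l" "l < 1" for a a' l using that by blast
  define k where "k b x = phi x * orth J Z (\<lambda>j. b j - c j * x)" for b x
  have Ud: "distr M borel U = std_normal_distribution" using H_cgauss[OF U] UU by (intro cgauss_std) simp
  have om: "(\<lambda>x. orth J Z (\<lambda>j. b j - c j * x)) \<in> borel_measurable borel" for b
   using uncorrelated_fubini(2)[OF J U Z UZ, where A=UNIV and p=b and q="\<lambda>j. - c j"] by (simp add: orth_def)
  have km[measurable]: "k b \<in> borel_measurable borel" for b unfolding k_def[abs_def] using om by measurable
  have kle: "0 \<le> k b x" "k b x \<le> phi x" for b x unfolding k_def using 01[of Z] by (auto intro: mult_left_le)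
  have ki: "integrable lborel (k b)" for b by (rule Bochner_Integration.integrable_bound[where f=phi]) (use kle in auto)
  have orthk: "orth J Y b = (\<integral>x. k b x \<partial>lborel)" for b
  proof -
   have "orth J Y b = prob {w\<in>space M. U w \<in> UNIV \<and> (\<forall>j\<in>J. Z j w \<le> b j + - c j * U w)}"
    unfolding orth_def by (rule arg_cong[where f=prob]) (auto simp: Z_def)
   also have "\<dots> = (\<integral>x. orth J Z (\<lambda>j. b j - c j * x) \<partial>std_normal_distribution)"
    using uncorrelated_fubini(1)[OF J U Z UZ, where A=UNIV and p=b and q="\<lambda>j. - c j"] by (simp add: orth_def Ud)
   also have "\<dots> = (\<integral>x. k b x \<partial>lborel)" unfolding k_def using om by (subst integral_density) auto
   finally show ?thesis .
  qed
  have kpl: "k b x powr l * k b' y powr (1 - l) \<le> k (\<lambda>j. l * b j + (1 - l) * b' j) (l * x + (1 - l) * y)"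
   if l: "0 < l" "l < 1" for b b' x y l
  proof -
   have "k b x powr l * k b' y powr (1 - l)
    = (phi x powr l * phi y powr (1 - l)) * (orth J Z (\<lambda>j. b j - c j * x) powr l * orth J Z (\<lambda>j. b' j - c j * y) powr (1 - l))"
    unfolding k_def using 01[of Z] by (simp add: powr_mult)
   also have "\<dots> \<le> phi (l * x + (1 - l) * y) * orth J Z (\<lambda>j. l * (b j - c j * x) + (1 - l) * (b' j - c j * y))"
    by (intro mult_mono phi_log_concave l IH) auto
   also have "(\<lambda>j. l * (b j - c j * x) + (1 - l) * (b' j - c j * y)) = (\<lambda>j. l * b j + (1 - l) * b' j - c j * (l * x + (1 - l) * y))"
    by (auto simp: algebra_simps)
   finally show ?thesis by (simp add: k_def)
  qed
  show ?thesis unfolding orthk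
  proof (rule prekopa_leindler[where B="phi 0"])
   show "k b x \<le> phi 0" for b x using kle(2)[of b x] by (rule order_trans) (simp add: std_normal_density_def divide_right_mono)
   then show "k b' x \<le> phi 0" for x .
   fix t :: real assume t: "0 < t"
   show "bounded {x. t < k b x}" "bounded {x. t < k b' x}" "bounded {x. t < k (\<lambda>j. l * b j + (1 - l) * b' j) x}"
    using kle(2) by (auto intro!: bounded_subset[OF phi_level_bounded[OF t]] intro: less_le_trans)
   \<comment> \<open>The joint inequality \<open>kpl\<close>, with the interpolated bound in both
     places, makes the level sets convex.\<close>
   show "convex {x. t < k (\<lambda>j. l * b j + (1 - l) * b' j) x}" (is "convex {x. t < ?k x}")
   proof (rule convexI)
    fix x y and p q :: real assume xy: "x \<in> {x. t < ?k x}" "y \<in> {x. t < ?k x}" and pq: "0 \<le> p" "0 \<le> q" "p + q = 1"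
    show "p *\<^sub>R x + q *\<^sub>R y \<in> {x. t < ?k x}"
    proof (cases "p = 0 \<or> q = 0")
     case False
     hence p: "0 < p" "p < 1" and q: "q = 1 - p" using pq by auto
     let ?d = "\<lambda>j. l * b j + (1 - l) * b' j"
     have "t = t powr p * t powr (1 - p)" using t by (simp flip: powr_add)
     also have "\<dots> < ?k x powr p * ?k y powr (1 - p)" using xy t p by (intro mult_strict_mono) (auto intro: powr_less_mono2)
     also have "\<dots> \<le> k (\<lambda>j. p * ?d j + (1 - p) * ?d j) (p * x + (1 - p) * y)" by (rule kpl[OF p])
     also have "(\<lambda>j. p * ?d j + (1 - p) * ?d j) = ?d" by (auto simp: algebra_simps)
     finally show ?thesis by (simp add: q)
    qed (use xy pq in auto)
   qed
  qed (use kle(1) ki l kpl[OF l] in auto)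
 qed
qed

end

section \<open>The distribution function of the supremum\<close>

lemma deriv_squeeze:
 fixes F l m :: "real \<Rightarrow> real"
 assumes l: "(l has_real_derivative D) (at u)" and m: "(m has_real_derivative D) (at u)"
  and eq: "l u = F u" "m u = F u" and b: "eventually (\<lambda>y. l y \<le> F y \<and> F y \<le> m y) (at u)"
 shows "(F has_real_derivative D) (at u)"
proof -
 have lq: "((\<lambda>y. (l y - F u) / (y - u)) \<longlongrightarrow> D) (at u)" and mq: "((\<lambda>y. (m y - F u) / (y - u)) \<longlongrightarrow> D) (at u)"
  using l m eq by (simp_all add: has_field_derivative_iff)
 have "((\<lambda>y. (F y - F u) / (y - u) - D) \<longlongrightarrow> 0) (at u)"
 proof (rule Lim_null_comparison)
  show "eventually (\<lambda>y. norm ((F y - F u) / (y - u) - D) \<le> \<bar>(l y - F u) / (y - u) - D\<bar> + \<bar>(m y - F u) / (y - u) - D\<bar>) (at u)"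
   using b
  proof eventually_elim
   case (elim y)
   have "(l y - F u) / (y - u) \<le> (F y - F u) / (y - u) \<and> (F y - F u) / (y - u) \<le> (m y - F u) / (y - u) \<or>
      (m y - F u) / (y - u) \<le> (F y - F u) / (y - u) \<and> (F y - F u) / (y - u) \<le> (l y - F u) / (y - u)"
   proof (cases "y \<ge> u")
    case True thus ?thesis using elim by (intro disjI1 conjI divide_right_mono) auto
   next
    case False thus ?thesis using elim by (intro disjI2 conjI divide_right_mono_neg) auto
   qed
   thus ?case by auto
  qed
  have "((\<lambda>y. \<bar>(l y - F u) / (y - u) - D\<bar> + \<bar>(m y - F u) / (y - u) - D\<bar>) \<longlongrightarrow> \<bar>D - D\<bar> + \<bar>D - D\<bar>) (at u)"
   by (intro tendsto_intros lq mq)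
  thus "((\<lambda>y. \<bar>(l y - F u) / (y - u) - D\<bar> + \<bar>(m y - F u) / (y - u) - D\<bar>) \<longlongrightarrow> 0) (at u)" by simp
 qed
 thus ?thesis unfolding has_field_derivative_iff by (simp add: LIM_zero_iff)
qed

text \<open>A function that is convex relative to \<open>Phi\<close> and log-concave is squeezed at each point
 between two differentiable functions touching it there.\<close>

lemma Phi_convex_log_concave_deriv:
 fixes F :: "real \<Rightarrow> real"
 assumes conv: "\<And>u v w. u < v \<Longrightarrow> v < w \<Longrightarrow> (F v - F u) * (Phi w - Phi v) \<le> (F w - F v) * (Phi v - Phi u)"
  and conc: "\<And>x y l. 0 < l \<Longrightarrow> l < 1 \<Longrightarrow> F x powr l * F y powr (1 - l) \<le> F (l * x + (1 - l) * y)"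
  and pos: "\<And>x. u0 < x \<Longrightarrow> 0 < F x" and u: "u0 < u"
 shows "\<exists>k. (F has_real_derivative k * phi u) (at u) \<and> (\<forall>y. F u + k * (Phi y - Phi u) \<le> F y)"
proof -
 define S where "S x = (F u - F x) / (Phi u - Phi x)" for x
 have bd: "S x \<le> S y" if "x < u" "u < y" for x y
 proof -
  have P: "0 < Phi u - Phi x" "0 < Phi y - Phi u" using that Phi_strict_mono by auto
  have "S y = (F y - F u) / (Phi y - Phi u)" unfolding S_def by (metis minus_diff_eq minus_divide_divide)
  moreover have "(F u - F x) / (Phi u - Phi x) \<le> (F y - F u) / (Phi y - Phi u)" using conv[OF that] P by (simp add: divide_simps mult.commute)
  ultimately show ?thesis by (simp add: S_def)
 qed
 \<comment> \<open>The supremum of the left slopes of \<open>F\<close> as a function of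
   \<open>Phi\<close>; convexity puts it below all right slopes, so it is the slope of a supporting
   line.\<close>
 define k where "k = Sup (S ` {..<u})"
 have k1: "S x \<le> k" if "x < u" for x unfolding k_def using that bd[of _ "u + 1"] by (intro cSup_upper bdd_aboveI[where M="S (u + 1)"]) auto
 have k2: "k \<le> S y" if "u < y" for y unfolding k_def using that bd by (intro cSup_least) (auto intro: exI[of _ "u - 1"])
 have lower: "F u + k * (Phi y - Phi u) \<le> F y" for y
 proof (rule linorder_cases[of y u])
  assume "y < u"
  hence "Phi y < Phi u" by (rule Phi_strict_mono)
  with k1[OF \<open>y < u\<close>] have "F u - F y \<le> k * (Phi u - Phi y)" by (simp add: S_def field_simps)
  thus ?thesis by (simp add: algebra_simps)
 next
  assume "u < y"
  hence P: "Phi u < Phi y" by (rule Phi_strict_mono)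
  have "S y = (F y - F u) / (Phi y - Phi u)" unfolding S_def by (metis minus_diff_eq minus_divide_divide)
  with k2[OF \<open>u < y\<close>] P have "k * (Phi y - Phi u) \<le> F y - F u" by (simp add: field_simps)
  thus ?thesis by simp
 qed auto
 have "convex_on {u0<..} (\<lambda>x. - ln (F x))"
 proof (rule convex_onI)
  fix t x y :: real assume t: "0 < t" "t < 1" and xy: "x \<in> {u0<..}" "y \<in> {u0<..}"
  have px: "F x > 0" "F y > 0" using pos xy by auto
  have "(1 - t) * ln (F x) + t * ln (F y) = ln (F x powr (1 - t) * F y powr (1 - (1 - t)))" using px t by (simp add: ln_mult ln_powr)
  also have "\<dots> \<le> ln (F ((1 - t) * x + (1 - (1 - t)) * y))" using px t conc[of "1 - t" x y] by (intro ln_mono) (auto intro!: mult_pos_pos)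
  finally show "- ln (F ((1 - t) *\<^sub>R x + t *\<^sub>R y)) \<le> (1 - t) * - ln (F x) + t * - ln (F y)" by simp
 qed auto
 from convex_le_Inf_differential[OF this, of u] u
 obtain c where c: "\<And>y. u0 < y \<Longrightarrow> - ln (F u) + c * (y - u) \<le> - ln (F y)" by (auto simp: interior_open)
 \<comment> \<open>A supporting line of the convex function \<open>- ln F\<close> at
   \<open>u\<close> becomes an exponential majorant of \<open>F\<close>.\<close>
 define m where "m y = F u * exp (- c * (y - u))" for y
 have upper: "F y \<le> m y" if "u0 < y" for y
 proof -
  have "F y = exp (ln (F y))" using pos that by simp
  also have "\<dots> \<le> exp (ln (F u) - c * (y - u))" using c[OF that] by simp
  also have "\<dots> = m y" using pos[OF u] by (simp add: m_def exp_add[symmetric] exp_diff ring_distribs)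
  finally show ?thesis .
 qed
 have dm: "(m has_real_derivative - c * F u) (at u)" unfolding m_def by (auto intro!: derivative_eq_intros)
 have dl: "((\<lambda>y. F u + k * (Phi y - Phi u)) has_real_derivative k * phi u) (at u)" by (auto intro!: derivative_eq_intros Phi_deriv)
 \<comment> \<open>The gap between majorant and minorant is nonnegative near \<open>u\<close> and
   zero at \<open>u\<close>, so its derivative vanishes there: both have the same slope.\<close>
 have "((\<lambda>y. m y - (F u + k * (Phi y - Phi u))) has_real_derivative (- c * F u) - k * phi u) (at u)" by (intro derivative_intros dm dl)
 hence "(- c * F u) - k * phi u = 0"
 proof (rule DERIV_local_min[where d="u - u0"])
  show "\<forall>y. \<bar>u - y\<bar> < u - u0 \<longrightarrow> m u - (F u + k * (Phi u - Phi u)) \<le> m y - (F u + k * (Phi y - Phi u))"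
  proof (intro allI impI)
   fix y assume "\<bar>u - y\<bar> < u - u0"
   hence "u0 < y" by linarith
   from upper[OF this] lower[of y] show "m u - (F u + k * (Phi u - Phi u)) \<le> m y - (F u + k * (Phi y - Phi u))" by (simp add: m_def)
  qed
 qed (use u in auto)
 hence dm': "(m has_real_derivative k * phi u) (at u)" using dm by simp
 have "(F has_real_derivative k * phi u) (at u)"
 proof (rule deriv_squeeze[OF dl dm'])
  have "eventually (\<lambda>y. u0 < y) (at u)" using u by (metis eventually_at_topological greaterThan_iff open_greaterThan)
  thus "eventually (\<lambda>y. F u + k * (Phi y - Phi u) \<le> F y \<and> F y \<le> m y) (at u)" by eventually_elim (use lower upper in auto)
 qed (auto simp: m_def)
 with lower show ?thesis by blast
qed

lemma (in prob_space) prob_union_bound: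
 assumes "finite K" "\<And>k. k \<in> K \<Longrightarrow> C k \<in> sets M" "B \<in> sets M" "A \<subseteq> B \<union> (\<Union>k\<in>K. C k)"
  and "\<And>k. k \<in> K \<Longrightarrow> prob (C k) \<le> w k"
 shows "prob A \<le> prob B + sum w K"
proof -
 have "prob A \<le> prob (B \<union> (\<Union>k\<in>K. C k))" using assms by (intro finite_measure_mono) auto
 also have "\<dots> \<le> prob B + prob (\<Union>k\<in>K. C k)" using assms by (intro measure_Un_le) auto
 also have "prob (\<Union>k\<in>K. C k) \<le> (\<Sum>k\<in>K. prob (C k))" using assms by (intro finite_measure_subadditive_finite) auto
 also have "\<dots> \<le> sum w K" using assms by (intro sum_mono)
 finally show ?thesis by simp
qed

section \<open>Maximizer probabilities and distribution functions over subsets\<close>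

locale gaussian_field = gaussian_space M H for M :: "'w measure" and H +
 fixes X :: "'t::{metric_space, second_countable_topology} \<Rightarrow> 'w \<Rightarrow> real" and I :: "'t set"
 assumes compact_I: "compact I"
  and X_H: "t \<in> I \<Longrightarrow> X t \<in> H"
  and X_var: "t \<in> I \<Longrightarrow> cov (X t) (X t) = 1"
  and X_cov: "s \<in> I \<Longrightarrow> t \<in> I \<Longrightarrow> s \<noteq> t \<Longrightarrow> cov (X s) (X t) < 1"
  and X_cont: "w \<in> space M \<Longrightarrow> continuous_on I (\<lambda>t. X t w)"
begin

definition FK :: "'t set \<Rightarrow> real \<Rightarrow> real" where
 "FK K u = prob {w\<in>space M. \<forall>t\<in>K. X t w \<le> u}"

abbreviation r :: "'t \<Rightarrow> 't \<Rightarrow> real" where "r s t \<equiv> cov (X s) (X t)"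

text \<open>The residual \<open>X j - r j i * X i\<close> is independent of \<open>X i\<close>; so
  this is the conditional probability, given \<open>X i = x\<close>, that no point of
  \<open>T\<close> exceeds \<open>i\<close>.\<close>

definition argmax_prob :: "'t set \<Rightarrow> 't \<Rightarrow> real \<Rightarrow> real" where
 "argmax_prob T i x = prob {w\<in>space M. \<forall>j\<in>T. X j w - r j i * X i w \<le> x * (1 - r j i)}"

definition gT :: "'t set \<Rightarrow> real \<Rightarrow> real" where
 "gT T x = (\<Sum>i\<in>T. argmax_prob T i x)"

lemma r_le_1: "s \<in> I \<Longrightarrow> t \<in> I \<Longrightarrow> r s t \<le> 1"
 using X_cov[of s t] X_var[of s] by (cases "s = t") auto

lemma X_measurable: "t \<in> I \<Longrightarrow> X t \<in> borel_measurable M"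
 using X_H H_measurable by blast

lemma Z_H: "i \<in> I \<Longrightarrow> j \<in> I \<Longrightarrow> (\<lambda>w. X j w - r j i * X i w) \<in> H"
 by (intro H_diff H_scale X_H)

lemma cov_X_Z: "i \<in> I \<Longrightarrow> j \<in> I \<Longrightarrow> cov (X i) (\<lambda>w. X j w - r j i * X i w) = 0"
 unfolding cov_commute[of "X i"] by (simp add: cov_diff X_H H_scale cov_scale X_var)

lemma X_std: "i \<in> I \<Longrightarrow> distr M borel (X i) = std_normal_distribution"
 using H_cgauss[OF X_H] X_var by (intro cgauss_std) simp

lemma X_distinct_AE:
 assumes "finite T" "T \<subseteq> I"
 shows "AE w in M. \<forall>i\<in>T. \<forall>j\<in>T. i \<noteq> j \<longrightarrow> X i w \<noteq> X j w"
proof -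
 have "AE w in M. X i w \<noteq> X j w" if "i \<in> I" "j \<in> I" "i \<noteq> j" for i j
 proof -
  have "(\<lambda>w. X i w - X j w) \<in> H" using that by (intro H_diff X_H)
  moreover have "cov (\<lambda>w. X i w - X j w) (\<lambda>w. X i w - X j w) > 0" using that X_cov[of i j] by (simp add: cov_diff_self X_H X_var)
  ultimately have 0: "prob {w\<in>space M. X i w - X j w = 0} = 0" using cgauss_eq_prob[OF H_cgauss] by blast
  have [measurable]: "X i \<in> borel_measurable M" "X j \<in> borel_measurable M" using that X_measurable by auto
  have "{w\<in>space M. X i w - X j w = 0} \<in> sets M" by measurable
  from prob_eq_0[OF this] 0 show ?thesis by auto
 qed
 thus ?thesis using assms by (intro AE_finite_allI AE_impI) auto
qed

lemma argmax_event_measurable: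
 assumes "finite T" "T \<subseteq> I" "i \<in> I"
 shows "{w\<in>space M. \<forall>j\<in>T. X j w - r j i * X i w \<le> x * (1 - r j i)} \<in> sets M"
proof -
 have [measurable]: "j \<in> T \<Longrightarrow> X j \<in> borel_measurable M" "X i \<in> borel_measurable M" for j using assms X_measurable by auto
 show ?thesis using assms(1) by measurable
qed

text \<open>Unit variances force \<open>r j i \<le> 1\<close>, so the thresholds
  \<open>x * (1 - r j i)\<close> increase with \<open>x\<close>. The convexity of \<open>FK\<close>
  relative to \<open>Phi\<close> has its origin here.\<close>

lemma argmax_prob_mono:
 assumes "finite T" "T \<subseteq> I" "i \<in> I" "x \<le> y"
 shows "argmax_prob T i x \<le> argmax_prob T i y"
 unfolding argmax_prob_def
proof (intro finite_measure_mono argmax_event_measurable assms Collect_mono impI, safe)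
 fix w j assume h: "\<forall>j\<in>T. X j w - r j i * X i w \<le> x * (1 - r j i)" "j \<in> T"
 have "x * (1 - r j i) \<le> y * (1 - r j i)" using assms h r_le_1[of j i] by (intro mult_right_mono) auto
 with h show "X j w - r j i * X i w \<le> y * (1 - r j i)" by force
qed

lemma gT_mono: "finite T \<Longrightarrow> T \<subseteq> I \<Longrightarrow> x \<le> y \<Longrightarrow> gT T x \<le> gT T y"
 unfolding gT_def by (intro sum_mono argmax_prob_mono) auto

lemma argmax_prob_measurable:
 assumes "finite T" "T \<subseteq> I" "i \<in> I"
 shows "argmax_prob T i \<in> borel_measurable borel"
proof -
 have T: "\<And>j. j \<in> T \<Longrightarrow> j \<in> I" using assms by auto
 have "(\<lambda>x. prob {w\<in>space M. \<forall>j\<in>T. X j w - r j i * X i w \<le> 0 + (1 - r j i) * x}) \<in> borel_measurable borel"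
  by (rule uncorrelated_fubini(2)[OF assms(1) X_H[OF assms(3)] Z_H[OF assms(3) T] cov_X_Z[OF assms(3) T], where A=UNIV]) auto
 thus ?thesis by (simp add: argmax_prob_def[abs_def] mult.commute)
qed

lemma argmax_prob_range: "0 \<le> argmax_prob T i x" "argmax_prob T i x \<le> 1"
 by (auto simp: argmax_prob_def)

text \<open>The increment is the probability that the maximum lies in \<open>{u<..v}\<close>. Almost
  surely there are no ties, so this event is the disjoint union over \<open>i\<close> of the events
  that the maximum is attained at \<open>i\<close>; each is computed by conditioning on
  \<open>X i\<close>.\<close>

lemma FK_finite_diff:
 assumes T: "finite T" "T \<subseteq> I" and uv: "u \<le> v"
 shows "FK T v - FK T u = (\<integral>x. indicator {u<..v} x * gT T x \<partial>std_normal_distribution)"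
proof (cases "T = {}")
 case True thus ?thesis by (simp add: FK_def gT_def)
next
 case False
 interpret N: prob_space std_normal_distribution by (rule prob_space_std_normal)
 have m[measurable]: "j \<in> T \<Longrightarrow> X j \<in> borel_measurable M" for j using T X_measurable by auto
 note fT[measurable] = T(1)
 define A where "A i = {w\<in>space M. X i w \<in> {u<..v} \<and> (\<forall>j\<in>T. X j w - r j i * X i w \<le> 0 + (1 - r j i) * X i w)}" for i
 have Am: "A i \<in> sets M" if "i \<in> T" for i unfolding A_def using that by measurable
 have A_eq: "A i = {w\<in>space M. u < X i w \<and> X i w \<le> v \<and> (\<forall>j\<in>T. X j w \<le> X i w)}" for i by (auto simp: A_def algebra_simps)
 have pA: "prob (A i) = (\<integral>x. indicator {u<..v} x * argmax_prob T i x \<partial>std_normal_distribution)" if i: "i \<in> T" for i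
 proof -
  have "prob (A i) = (\<integral>x. indicator {u<..v} x * prob {w\<in>space M. \<forall>j\<in>T. X j w - r j i * X i w \<le> 0 + (1 - r j i) * x} \<partial>distr M borel (X i))"
   unfolding A_def using T i by (intro uncorrelated_fubini(1)) (auto intro: X_H Z_H cov_X_Z)
  thus ?thesis using T i by (subst (asm) X_std) (auto simp: argmax_prob_def mult.commute)
 qed
 define D where "D = {w\<in>space M. \<forall>t\<in>T. X t w \<le> v} - {w\<in>space M. \<forall>t\<in>T. X t w \<le> u}"
 have Em: "{w\<in>space M. \<forall>t\<in>T. X t w \<le> v} \<in> sets M" for v by measurable
 have Dm: "D \<in> sets M" unfolding D_def using Em by auto
 have "AE w in M. (\<Sum>i\<in>T. indicator (A i) w) = (indicator D w :: real)" using X_distinct_AE[OF T] AE_space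
 proof eventually_elim
  case (elim w)
  obtain i where i: "i \<in> T" "\<And>j. j \<in> T \<Longrightarrow> X j w \<le> X i w"
   using obtains_MAX[OF T(1) False, of "\<lambda>j. X j w"] T(1) by (metis Max_ge finite_imageI imageI)
  have other: "w \<notin> A j" if "j \<in> T" "j \<noteq> i" for j
  proof
   assume "w \<in> A j"
   hence "X i w \<le> X j w" using i by (auto simp: A_eq)
   with i(2)[OF that(1)] elim i(1) that show False by force
  qed
  have "w \<in> A i \<longleftrightarrow> w \<in> D" using i elim by (force simp: A_eq D_def not_le)
  hence "(\<Sum>j\<in>T. indicator (A j) w) = (\<Sum>j\<in>T. if j = i then indicator D w else 0 :: real)"
   using other by (intro sum.cong) (auto simp: indicator_def)
  also have "\<dots> = indicator D w" using i T by simp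
  finally show ?case .
 qed
 hence "(\<integral>w. (\<Sum>i\<in>T. indicator (A i) w) \<partial>M) = (\<integral>w. indicator D w \<partial>M :: real)"
  using Am Dm by (intro integral_cong_AE) auto
 hence "(\<Sum>i\<in>T. prob (A i)) = prob D" using Am Dm by (subst (asm) Bochner_Integration.integral_sum) (auto simp: sets.Int_space_eq2 emeasure_eq_measure)
 also have "prob D = FK T v - FK T u" unfolding D_def FK_def using uv Em by (intro finite_measure_Diff) (auto intro: order_trans)
 finally have "FK T v - FK T u = (\<Sum>i\<in>T. prob (A i))" by simp
 also have "\<dots> = (\<Sum>i\<in>T. \<integral>x. indicator {u<..v} x * argmax_prob T i x \<partial>std_normal_distribution)" by (intro sum.cong pA) auto
 also have "\<dots> = (\<integral>x. (\<Sum>i\<in>T. indicator {u<..v} x * argmax_prob T i x) \<partial>std_normal_distribution)"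
 proof (rule Bochner_Integration.integral_sum[symmetric])
  fix i assume "i \<in> T"
  hence "argmax_prob T i \<in> borel_measurable borel" using T by (intro argmax_prob_measurable) auto
  thus "integrable std_normal_distribution (\<lambda>x. indicator {u<..v} x * argmax_prob T i x)"
   by (intro N.integrable_const_bound[where B=1]) (auto simp: argmax_prob_range split: split_indicator intro!: borel_measurable_times)
 qed
 finally show ?thesis by (simp add: gT_def sum_distrib_left)
qed

lemma FK_finite_bounds:
 assumes T: "finite T" "T \<subseteq> I" and uv: "u \<le> v"
 shows "gT T u * (Phi v - Phi u) \<le> FK T v - FK T u" "FK T v - FK T u \<le> gT T v * (Phi v - Phi u)"
proof -
 interpret N: prob_space std_normal_distribution by (rule prob_space_std_normal)
 have gm: "gT T \<in> borel_measurable borel" unfolding gT_def[abs_def] using T by (intro borel_measurable_sum argmax_prob_measurable) auto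
 have g0: "0 \<le> gT T x" for x by (auto simp: gT_def argmax_prob_def intro!: sum_nonneg)
 have gc: "gT T x \<le> card T" for x
 proof -
  have "gT T x \<le> (\<Sum>i\<in>T. 1)" unfolding gT_def by (intro sum_mono) (auto simp: argmax_prob_def)
  thus ?thesis by simp
 qed
 have i: "integrable std_normal_distribution (\<lambda>x. indicator {u<..v} x * gT T x)"
  using gm g0 gc by (intro N.integrable_const_bound[where B="card T"]) (auto split: split_indicator)
 have ci: "integrable std_normal_distribution (\<lambda>x. indicator {u<..v} x * c)" for c :: real
  by (intro N.integrable_const_bound[where B="\<bar>c\<bar>"]) (auto split: split_indicator)
 have c: "(\<integral>x. indicator {u<..v} x * c \<partial>std_normal_distribution) = c * (Phi v - Phi u)" for c
 proof -
  have "(\<integral>x. indicator {u<..v} x \<partial>std_normal_distribution) = Phi v - Phi u" unfolding Phi_diff[OF uv] by (subst integral_density) auto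
  thus ?thesis using integral_mult_left_zero[of std_normal_distribution "indicator {u<..v}" c] by (simp add: mult.commute)
 qed
 show "gT T u * (Phi v - Phi u) \<le> FK T v - FK T u" unfolding FK_finite_diff[OF assms] c[symmetric]
  by (intro integral_mono i ci) (auto split: split_indicator intro!: gT_mono T)
 show "FK T v - FK T u \<le> gT T v * (Phi v - Phi u)" unfolding FK_finite_diff[OF assms] c[symmetric]
  by (intro integral_mono i ci) (auto split: split_indicator intro!: gT_mono T)
qed

lemma sup_event_countable:
 assumes K: "K \<subseteq> I"
 obtains D where "countable D" "D \<subseteq> K"
  "\<And>w u. w \<in> space M \<Longrightarrow> (\<forall>t\<in>K. X t w \<le> u) \<longleftrightarrow> (\<forall>t\<in>D. X t w \<le> u)"
proof -
 obtain D where D: "countable D" "D \<subseteq> K" "K \<subseteq> closure D" using separable[of K] by blast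
 have "X t w \<le> u" if w: "w \<in> space M" and d: "\<forall>t\<in>D. X t w \<le> u" and t: "t \<in> K" for w u t
 proof -
  obtain s where s: "\<And>n. s n \<in> D" "s \<longlonglongrightarrow> t" using D(3) t closure_sequential[of t D] by blast
  have "(\<lambda>n. X (s n) w) \<longlonglongrightarrow> X t w"
   using X_cont[OF w, unfolded continuous_on_sequentially comp_def, rule_format, of t s] s t D K by blast
  thus ?thesis by (rule LIMSEQ_le_const2) (use d s in auto)
 qed
 hence "(\<forall>t\<in>K. X t w \<le> u) \<longleftrightarrow> (\<forall>t\<in>D. X t w \<le> u)" if "w \<in> space M" for w u
  using that subsetD[OF D(2)] by blast
 thus ?thesis by (rule that[OF D(1,2)])
qed

lemma sup_event_measurable: "K \<subseteq> I \<Longrightarrow> {w\<in>space M. \<forall>t\<in>K. X t w \<le> u} \<in> sets M"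
proof -
 assume K: "K \<subseteq> I"
 obtain D where D: "countable D" "D \<subseteq> K"
  "\<And>w u. w \<in> space M \<Longrightarrow> (\<forall>t\<in>K. X t w \<le> u) \<longleftrightarrow> (\<forall>t\<in>D. X t w \<le> u)"
  by (rule sup_event_countable[OF K]) blast
 have [measurable]: "t \<in> D \<Longrightarrow> X t \<in> borel_measurable M" for t using subsetD[OF K] subsetD[OF D(2)] X_measurable by blast
 have "{w\<in>space M. \<forall>t\<in>K. X t w \<le> u} = {w\<in>space M. \<forall>t\<in>D. X t w \<le> u}" using D by auto
 also have "\<dots> \<in> sets M" using D(1) by measurable
 finally show ?thesis .
qed

definition exceed :: "'t set \<Rightarrow> real \<Rightarrow> 'w set" where
 "exceed K u = {w\<in>space M. \<exists>t\<in>K. u < X t w}"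

lemma exceed_compl: "exceed K u = space M - {w\<in>space M. \<forall>t\<in>K. X t w \<le> u}"
 by (auto simp: exceed_def not_le)

lemma exceed_measurable: "K \<subseteq> I \<Longrightarrow> exceed K u \<in> sets M"
 unfolding exceed_compl by (intro sets.compl_sets sup_event_measurable)

lemma prob_exceed: "K \<subseteq> I \<Longrightarrow> prob (exceed K u) = 1 - FK K u"
 unfolding exceed_compl FK_def by (intro prob_compl sup_event_measurable)

lemma exceed_antimono: "u \<le> v \<Longrightarrow> exceed K v \<subseteq> exceed K u"
 by (force simp: exceed_def)

lemma prob_X_gt:
 assumes "t \<in> I" shows "prob {w\<in>space M. u < X t w} = 1 - Phi u"
proof -
 have "prob {w\<in>space M. u < X t w} = measure (distr M borel (X t)) {u<..}"
  using X_measurable[OF assms] by (subst measure_distr) (auto simp: vimage_def Int_def conj_commute)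
 thus ?thesis by (simp add: X_std[OF assms] one_minus_Phi)
qed

lemma prob_exceed_finite:
 assumes "finite T" "T \<subseteq> I" shows "prob (exceed T u) \<le> real (card T) * (1 - Phi u)"
proof -
 have "{w\<in>space M. u < X t w} \<in> sets M" if "t \<in> T" for t using X_measurable[OF subsetD[OF assms(2) that]] by measurable
 hence "prob (exceed T u) \<le> prob {} + (\<Sum>t\<in>T. 1 - Phi u)"
  using assms by (intro prob_union_bound[where C="\<lambda>t. {w\<in>space M. u < X t w}"]) (auto simp: exceed_def prob_X_gt)
 thus ?thesis by simp
qed

text \<open>Path continuity reduces \<open>K\<close> to a countable dense subset. The initial
  segments of an enumeration give decreasing events, and continuity from above applies.\<close>

lemma FK_finite_approx:
 assumes K: "K \<subseteq> I"
 obtains T where "\<And>n. finite (T n)" "\<And>n. T n \<subseteq> K" "\<And>u. (\<lambda>n. FK (T n) u) \<longlonglongrightarrow> FK K u"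
proof (cases "K = {}")
 case True thus ?thesis using that[of "\<lambda>_. {}"] by auto
next
 case False
 obtain D where D: "countable D" "D \<subseteq> K"
  "\<And>w u. w \<in> space M \<Longrightarrow> (\<forall>t\<in>K. X t w \<le> u) \<longleftrightarrow> (\<forall>t\<in>D. X t w \<le> u)"
  by (rule sup_event_countable[OF K]) blast
 define D' where "D' = insert (SOME t. t \<in> K) D"
 have someK: "(SOME t. t \<in> K) \<in> K" using False by (auto intro: someI)
 have D': "countable D'" "D' \<subseteq> K" "D' \<noteq> {}" using D someK by (auto simp: D'_def)
 define T where "T n = from_nat_into D' ` {..n}" for n :: nat
 have TD: "T n \<subseteq> D'" for n using from_nat_into[OF D'(3)] by (auto simp: T_def)
 have UT: "(\<Union>n. T n) = D'" using range_from_nat_into[OF D'(3,1)] by (fastforce simp: T_def)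
 let ?E = "\<lambda>u n. {w\<in>space M. \<forall>t\<in>T n. X t w \<le> u}"
 show ?thesis
 proof (rule that[of T])
  show "finite (T n)" "T n \<subseteq> K" for n using TD D' by (auto simp: T_def)
  fix u
  have "(\<lambda>n. prob (?E u n)) \<longlonglongrightarrow> prob (\<Inter>n. ?E u n)"
  proof (rule finite_Lim_measure_decseq)
   show "range (\<lambda>n. ?E u n) \<subseteq> sets M" using TD D' K by (auto intro!: sup_event_measurable)
   show "decseq (\<lambda>n. ?E u n)" by (auto simp: decseq_def T_def)
  qed
  also have "(\<Inter>n. ?E u n) = {w\<in>space M. \<forall>t\<in>D'. X t w \<le> u}" using UT by auto
  also have "\<dots> = {w\<in>space M. \<forall>t\<in>K. X t w \<le> u}" using D D' someK by (auto simp: D'_def)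
  finally show "(\<lambda>n. FK (T n) u) \<longlonglongrightarrow> FK K u" by (simp add: FK_def)
 qed
qed

text \<open>For finite sets the slopes before and after \<open>v\<close> are both compared with the
  same number, \<open>gT\<close> at \<open>v\<close>. The inequality is written without division and
  so passes to the limit.\<close>

lemma FK_Phi_convex:
 assumes K: "K \<subseteq> I" and uv: "u < v" "v < w"
 shows "(FK K v - FK K u) * (Phi w - Phi v) \<le> (FK K w - FK K v) * (Phi v - Phi u)"
proof -
 obtain T where T: "\<And>n::nat. finite (T n)" "\<And>n. T n \<subseteq> K" "\<And>u. (\<lambda>n. FK (T n) u) \<longlonglongrightarrow> FK K u"
  by (rule FK_finite_approx[OF K]) blast
 have "(FK (T n) v - FK (T n) u) * (Phi w - Phi v) \<le> (FK (T n) w - FK (T n) v) * (Phi v - Phi u)" for n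
 proof -
  have TI: "T n \<subseteq> I" using T(2)[of n] K by blast
  have P: "0 \<le> Phi w - Phi v" "0 \<le> Phi v - Phi u" using uv Phi_mono[of u v] Phi_mono[of v w] by auto
  have "(FK (T n) v - FK (T n) u) * (Phi w - Phi v) \<le> gT (T n) v * (Phi v - Phi u) * (Phi w - Phi v)"
   using T(1) TI uv P by (intro mult_right_mono FK_finite_bounds(2)) (auto simp: subset_iff)
  also have "\<dots> = gT (T n) v * (Phi w - Phi v) * (Phi v - Phi u)" by simp
  also have "\<dots> \<le> (FK (T n) w - FK (T n) v) * (Phi v - Phi u)"
   using T(1) TI uv P by (intro mult_right_mono FK_finite_bounds(1)) (auto simp: subset_iff)
  finally show ?thesis .
 qed
 thus ?thesis by (intro LIMSEQ_le[OF tendsto_mult_right[OF tendsto_diff[OF T(3) T(3)]] tendsto_mult_right[OF tendsto_diff[OF T(3) T(3)]]]) auto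
qed

lemma FK_log_concave:
 assumes K: "K \<subseteq> I" and l: "0 < l" "l < 1"
 shows "FK K x powr l * FK K y powr (1 - l) \<le> FK K (l * x + (1 - l) * y)"
proof -
 obtain T where T: "\<And>n::nat. finite (T n)" "\<And>n. T n \<subseteq> K" "\<And>u. (\<lambda>n. FK (T n) u) \<longlonglongrightarrow> FK K u"
  by (rule FK_finite_approx[OF K]) blast
 have "(\<lambda>n. FK (T n) x powr l * FK (T n) y powr (1 - l)) \<longlonglongrightarrow> FK K x powr l * FK K y powr (1 - l)"
  using l by (intro tendsto_mult tendsto_powr' T tendsto_const) (auto simp: FK_def)
 thus ?thesis
 proof (rule LIMSEQ_le[OF _ T(3)])
  show "\<exists>N. \<forall>n\<ge>N. FK (T n) x powr l * FK (T n) y powr (1 - l) \<le> FK (T n) (l * x + (1 - l) * y)"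
  proof (intro exI allI impI)
   fix n
   show "FK (T n) x powr l * FK (T n) y powr (1 - l) \<le> FK (T n) (l * x + (1 - l) * y)"
    using orth_log_concave[OF T(1)[of n], of X l "\<lambda>_. x" "\<lambda>_. y"] T(2)[of n] K l X_H by (auto simp: orth_def FK_def subset_iff)
  qed
 qed
qed

lemma FK_mono: "K \<subseteq> I \<Longrightarrow> u \<le> v \<Longrightarrow> FK K u \<le> FK K v"
 unfolding FK_def by (intro finite_measure_mono sup_event_measurable) auto

lemma FK_antimono: "K \<subseteq> K' \<Longrightarrow> K' \<subseteq> I \<Longrightarrow> FK K' u \<le> FK K u"
 unfolding FK_def by (intro finite_measure_mono sup_event_measurable) auto

lemma FK_pos: "\<exists>u0. 0 < FK I u0"
proof -
 let ?E = "\<lambda>n::nat. {w\<in>space M. \<forall>t\<in>I. X t w \<le> real n}"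
 have "(\<lambda>n. prob (?E n)) \<longlonglongrightarrow> prob (\<Union>n. ?E n)"
 proof (rule finite_Lim_measure_incseq)
  show "range (\<lambda>n. ?E n) \<subseteq> sets M" by (auto intro!: sup_event_measurable)
  show "incseq (\<lambda>n. ?E n)" by (force simp: incseq_def)
 qed
 also have "(\<Union>n. ?E n) = space M"
 proof safe
  fix w assume w: "w \<in> space M"
  have "bounded ((\<lambda>t. X t w) ` I)" using compact_continuous_image[OF X_cont[OF w] compact_I] by (rule compact_imp_bounded)
  then obtain B where B: "\<And>t. t \<in> I \<Longrightarrow> \<bar>X t w\<bar> \<le> B" by (auto simp: bounded_iff)
  obtain n where "B \<le> real n" using real_arch_simple by blast
  hence "\<forall>t\<in>I. X t w \<le> real n" using B by (smt (verit))
  thus "w \<in> (\<Union>n. ?E n)" using w by auto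
 qed
 finally have "(\<lambda>n. FK I (real n)) \<longlonglongrightarrow> 1" by (simp add: FK_def prob_space)
 hence "eventually (\<lambda>n. 0 < FK I (real n)) sequentially" by (rule order_tendstoD) simp
 thus ?thesis by (meson eventually_happens trivial_limit_sequentially)
qed

lemma FK_deriv:
 assumes K: "K \<subseteq> I" and u: "0 < FK K u0" "u0 < u"
 shows "\<exists>k. (FK K has_real_derivative k * phi u) (at u) \<and> (\<forall>y. FK K u + k * (Phi y - Phi u) \<le> FK K y)"
proof (rule Phi_convex_log_concave_deriv[OF FK_Phi_convex[OF K] FK_log_concave[OF K] _ u(2)])
 fix x assume "u0 < x" thus "0 < FK K x" using FK_mono[OF K, of u0 x] u by simp
qed auto

end

section \<open>Chaining\<close>

text \<open>Expresses a far tail as a small multiple of the tail at \<open>u\<close>. The constant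
  absorbs \<open>exp (1/2)\<close> from the exponent and \<open>exp 2\<close> from
  \<open>Psi_lower\<close>.\<close>

lemma Psi_scale:
 assumes "u \<ge> 1" "y \<ge> 1"
 shows "1 - Phi (y * u) \<le> exp 3 * exp (- y\<^sup>2 / 2) * (1 - Phi u)"
proof -
 have "1 - Phi (y * u) \<le> phi (y * u) / (y * u)" using assms by (intro Psi_upper) auto
 also have "\<dots> \<le> phi (y * u) / u" using assms by (intro divide_left_mono) (auto simp: mult_le_cancel_right1)
 also have "phi (y * u) = phi u * exp (- ((y\<^sup>2 - 1) * u\<^sup>2) / 2)"
  by (simp add: std_normal_density_def power_mult_distrib flip: exp_add) (simp add: field_simps)
 also have "phi u * exp (- ((y\<^sup>2 - 1) * u\<^sup>2) / 2) / u \<le> phi u * exp (1 / 2 - y\<^sup>2 / 2) / u"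
 proof -
  have "(y\<^sup>2 - 1) * 1 \<le> (y\<^sup>2 - 1) * u\<^sup>2" using assms by (intro mult_left_mono) (auto simp: one_le_power)
  thus ?thesis using assms by (intro divide_right_mono mult_left_mono) auto
 qed
 also have "\<dots> = exp (5/2) * exp (- y\<^sup>2 / 2) * (phi u * exp (-2) / u)"
 proof -
  have "exp (1 / 2 - y\<^sup>2 / 2) = exp (5/2) * exp (- y\<^sup>2 / 2) * exp (-2)" by (simp flip: exp_add)
  thus ?thesis by simp
 qed
 also have "\<dots> \<le> exp (5/2) * exp (- y\<^sup>2 / 2) * (1 - Phi u)" using assms by (intro mult_left_mono Psi_lower) auto
 also have "\<dots> \<le> exp 3 * exp (- y\<^sup>2 / 2) * (1 - Phi u)" using Phi_le_1[of u] by (intro mult_right_mono) auto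
 finally show ?thesis .
qed

text \<open>Lowering the level by \<open>1/u\<close> multiplies the density by at most
  \<open>exp 1\<close> and at worst halves the denominator, which gives the factor 2. The rest of
  \<open>exp 3\<close> is the loss \<open>exp 2\<close> of \<open>Psi_lower\<close>.\<close>

lemma Psi_shift:
 assumes "u \<ge> 2"
 shows "1 - Phi (u - 1/u) \<le> 2 * exp 3 * (1 - Phi u)"
proof -
 have "1/u \<le> 1/2" using assms by (intro divide_left_mono) auto
 hence u': "u - 1/u \<ge> u / 2" using assms by linarith
 have "1 - Phi (u - 1/u) \<le> phi (u - 1/u) / (u - 1/u)" using assms u' by (intro Psi_upper) auto
 also have "\<dots> \<le> phi (u - 1/u) / (u/2)" using assms u' by (intro divide_left_mono) auto
 also have "phi (u - 1/u) = phi (u + (- (1/u)))" by simp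
 also have "\<dots> = phi u * exp (1 - (1/u)\<^sup>2 / 2)" using assms by (subst phi_shift) simp
 also have "phi u * exp (1 - (1/u)\<^sup>2 / 2) / (u/2) \<le> phi u * exp 1 / (u/2)" using assms by (intro divide_right_mono mult_left_mono) auto
 also have "\<dots> = 2 * exp 3 * (phi u * exp (-2) / u)"
 proof -
  have "exp 1 = exp 3 * exp (-2 :: real)" by (simp flip: exp_add)
  thus ?thesis by simp
 qed
 also have "\<dots> \<le> 2 * exp 3 * (1 - Phi u)" using assms by (intro mult_left_mono Psi_lower) auto
 finally show ?thesis .
qed

text \<open>The number of grid points grows exponentially in \<open>n\<close>, while both
  exponentials decay doubly exponentially. For terms \<open>B ^ n * exp (- c * b ^ n)\<close> the
  ratio of neighbours is \<open>B * exp (- k * b ^ n)\<close> with \<open>k = c * (b - 1)\<close>,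
  eventually below 1/2.\<close>

lemma summable_chain_weights:
 assumes "0 < \<kappa>"
 shows "summable (\<lambda>n. 2 ^ ((n + 2) * d) * (exp (- \<kappa> * (9/4) ^ n) + exp 3 * exp (- (\<kappa> * 3 ^ n)\<^sup>2 / 2)) :: real)"
proof -
 have "2 ^ ((n + 2) * d) = (4 :: real) ^ d * (2 ^ d) ^ n" "(\<kappa> * 3 ^ n)\<^sup>2 = \<kappa>\<^sup>2 * 9 ^ n" for n :: nat
 proof -
  have "2 ^ ((n + 2) * d) = (2 :: real) ^ (d * n) * 2 ^ (2 * d)" unfolding power_add[symmetric] by (simp add: algebra_simps)
  also have "\<dots> = (2 ^ d) ^ n * (2 ^ 2) ^ d" unfolding power_mult ..
  finally show "2 ^ ((n + 2) * d) = (4 :: real) ^ d * (2 ^ d) ^ n" by simp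
  have "(3 ^ n)\<^sup>2 = (9 ^ n :: real)" by (simp add: power2_eq_square flip: power_mult_distrib)
  thus "(\<kappa> * 3 ^ n)\<^sup>2 = \<kappa>\<^sup>2 * 9 ^ n" by (simp add: power_mult_distrib)
 qed
 hence eq: "(\<lambda>n. 2 ^ ((n + 2) * d) * (exp (- \<kappa> * (9/4) ^ n) + exp 3 * exp (- (\<kappa> * 3 ^ n)\<^sup>2 / 2)) :: real) =
   (\<lambda>n. (4 ^ d) * ((2 ^ d) ^ n * exp (- \<kappa> * (9/4) ^ n) + exp 3 * ((2 ^ d) ^ n * exp (- (\<kappa>\<^sup>2 / 2) * 9 ^ n))))"
  by (auto simp: algebra_simps)
 have s: "summable (\<lambda>n. B ^ n * exp (- c * b ^ n) :: real)" if "B > 0" "c > 0" "b > 1" for B c b :: real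
 proof -
  define k where "k = c * (b - 1)"
  have "k > 0" using that by (simp add: k_def)
  hence "eventually (\<lambda>x. B * exp (- k * x) \<le> 1/2) at_top" using that by real_asymp
  moreover have "filterlim (\<lambda>n. b ^ n) at_top sequentially" using that by real_asymp
  ultimately have "eventually (\<lambda>n. B * exp (- k * b ^ n) \<le> 1/2) sequentially" by (rule eventually_compose_filterlim)
  then obtain N where N: "\<And>n. n \<ge> N \<Longrightarrow> B * exp (- k * b ^ n) \<le> 1/2" by (auto simp: eventually_sequentially)
  show ?thesis
  proof (rule summable_ratio_test[of "1/2" N])
   fix n assume n: "N \<le> n"
   have "- c * b ^ Suc n = - c * b ^ n + - k * b ^ n" by (simp add: k_def algebra_simps)
   hence "B ^ Suc n * exp (- c * b ^ Suc n) = (B * exp (- k * b ^ n)) * (B ^ n * exp (- c * b ^ n))"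
   proof -
    have "exp (- c * b ^ Suc n) = exp (- c * b ^ n) * exp (- k * b ^ n)"
     unfolding \<open>- c * b ^ Suc n = - c * b ^ n + - k * b ^ n\<close> by (rule exp_add)
    thus ?thesis by simp
   qed
   also have "\<dots> \<le> 1/2 * (B ^ n * exp (- c * b ^ n))" using that by (intro mult_right_mono N n) auto
   finally show "norm (B ^ Suc n * exp (- c * b ^ Suc n)) \<le> 1/2 * norm (B ^ n * exp (- c * b ^ n))" using that by simp
  qed simp
 qed
 have "summable (\<lambda>n. (2 ^ d) ^ n * exp (- \<kappa> * (9/4) ^ n))" "summable (\<lambda>n. (2 ^ d) ^ n * exp (- (\<kappa>\<^sup>2 / 2) * 9 ^ n))"
  using assms by (intro s; simp)+
 thus ?thesis unfolding eq by (intro summable_mult summable_add)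
qed

definition gridpt :: "real ^ 'd \<Rightarrow> real \<Rightarrow> ('d \<Rightarrow> nat) \<Rightarrow> real ^ 'd" where
 "gridpt x0 h k = (\<chi> i. x0 $ i + h * real (k i))"

definition grid :: "real ^ 'd \<Rightarrow> real \<Rightarrow> nat \<Rightarrow> (real ^ 'd) set" where
 "grid x0 h n = gridpt x0 h ` (UNIV \<rightarrow>\<^sub>E {..n})"

lemma finite_grid: "finite (grid x0 h n :: (real ^ 'd::finite) set)"
 and card_grid: "card (grid x0 h n :: (real ^ 'd::finite) set) \<le> (n + 1) ^ CARD('d)"
proof -
 have f: "finite (UNIV \<rightarrow>\<^sub>E {..n} :: ('d \<Rightarrow> nat) set)" by (intro finite_PiE) auto
 thus "finite (grid x0 h n)" by (simp add: grid_def)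
 show "card (grid x0 h n) \<le> (n + 1) ^ CARD('d)" unfolding grid_def using card_image_le[OF f, of "gridpt x0 h"] by (simp add: card_PiE)
qed

lemma grid_subset_box:
 assumes "0 \<le> h"
 shows "grid x0 h n \<subseteq> cbox x0 (x0 + (h * real n) *\<^sub>R 1)"
 using assms by (auto simp: grid_def gridpt_def mem_box_cart PiE_def Pi_def intro!: mult_left_mono)

context gaussian_field
begin

lemma cov_Z_Z_le:
 assumes st: "s \<in> I" "t \<in> I"
 shows "cov (\<lambda>w. X t w - r t s * X s w) (\<lambda>w. X t w - r t s * X s w) \<le> 2 * (1 - r t s)"
proof -
 define Z where "Z = (\<lambda>w. X t w - r t s * X s w)"
 have Z: "Z \<in> H" unfolding Z_def using st by (intro Z_H)
 have cXZ: "cov (X s) Z = 0" unfolding Z_def using st by (rule cov_X_Z)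
 have "cov Z Z = cov (X t) Z - r t s * cov (X s) Z" by (subst (1) Z_def) (use st Z in \<open>simp add: cov_diff cov_scale X_H H_scale\<close>)
 also have "\<dots> = cov Z (X t)" using cXZ by (simp add: cov_commute)
 also have "\<dots> = 1 - (r t s)\<^sup>2"
  unfolding Z_def using st by (simp add: cov_diff cov_scale X_H H_scale X_var power2_eq_square cov_commute[of "X s" "X t"])
 also have "\<dots> = (1 - r t s) * (1 + r t s)" by (simp add: power2_eq_square algebra_simps)
 also have "\<dots> \<le> (1 - r t s) * 2" using r_le_1[OF st(2,1)] by (intro mult_left_mono) auto
 finally show ?thesis by (simp add: Z_def mult.commute)
qed

text \<open>With \<open>Z\<close> the residual of \<open>X t\<close> given \<open>X s\<close>, the
  drop \<open>X s - X t\<close> equals \<open>(1 - r t s) * X s - Z\<close>. If it exceeds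
  \<open>\<eta>\<close>, then either \<open>Z\<close> is at most \<open>- \<eta> / 2\<close>,
  independently of \<open>X s > v\<close>, or the first term exceeds \<open>\<eta> / 2\<close>,
  which needs an extremely large value of \<open>X s\<close>.\<close>

lemma increment_bound:
 assumes st: "s \<in> I" "t \<in> I" and \<rho>: "1 - r t s \<le> \<rho>" "0 < \<rho>" and \<eta>: "0 < \<eta>"
 shows "prob {w\<in>space M. v < X s w \<and> \<eta> < X s w - X t w}
   \<le> (1 - Phi v) * exp (- \<eta>\<^sup>2 / (64 * \<rho>)) + (1 - Phi (\<eta> / (2 * \<rho>)))"
proof -
 note [measurable] = X_measurable[OF st(1)] X_measurable[OF st(2)]
 define Z where "Z w = X t w - r t s * X s w" for w
 have Z: "Z \<in> H" unfolding Z_def[abs_def] using st by (intro Z_H)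
 have cXZ: "cov (X s) Z = 0" unfolding Z_def[abs_def] using st by (rule cov_X_Z)
 note [measurable] = H_measurable[OF Z]
 have r1: "r t s \<le> 1" using st r_le_1 by auto
 have ZZ: "cov Z Z \<le> 2 * \<rho>" using cov_Z_Z_le[OF st] \<rho> by (simp add: Z_def[abs_def])
 define A where "A = {w\<in>space M. X s w \<in> {v<..} \<and> (\<forall>j\<in>{()}. Z w \<le> - \<eta> / 2 + 0 * X s w)}"
 define B where "B = {w\<in>space M. \<eta> / (2 * \<rho>) < X s w}"
 have "prob {w\<in>space M. v < X s w \<and> \<eta> < X s w - X t w} \<le> prob (A \<union> B)"
 proof (intro finite_measure_mono subsetI)
  fix w assume w: "w \<in> {w\<in>space M. v < X s w \<and> \<eta> < X s w - X t w}"
  have e: "X s w - X t w = (1 - r t s) * X s w - Z w" by (simp add: Z_def algebra_simps)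
  show "w \<in> A \<union> B"
  proof (cases "Z w \<le> - \<eta> / 2")
   case True thus ?thesis using w by (auto simp: A_def)
  next
   case False
   hence h: "\<eta> / 2 < (1 - r t s) * X s w" using w e by auto
   have "0 < X s w"
   proof (rule ccontr)
    assume "\<not> 0 < X s w"
    hence "(1 - r t s) * X s w \<le> 0" using r1 by (intro mult_nonneg_nonpos) auto
    with h \<eta> show False by simp
   qed
   hence "(1 - r t s) * X s w \<le> \<rho> * X s w" using \<rho> by (intro mult_right_mono) auto
   with h \<rho> have "\<eta> / (2 * \<rho>) < X s w" by (simp add: field_simps)
   thus ?thesis using w by (auto simp: B_def)
  qed
 qed (auto simp: A_def B_def)
 also have "\<dots> \<le> prob A + prob B" by (rule measure_Un_le) (auto simp: A_def B_def)
 also have "prob B = 1 - Phi (\<eta> / (2 * \<rho>))" unfolding B_def by (rule prob_X_gt[OF st(1)])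
 also have "prob A \<le> (1 - Phi v) * exp (- \<eta>\<^sup>2 / (64 * \<rho>))"
 proof -
  have "prob A = (\<integral>x. indicator {v<..} x * prob {w\<in>space M. \<forall>j\<in>{()}. Z w \<le> - \<eta> / 2 + 0 * x} \<partial>distr M borel (X s))"
   unfolding A_def by (rule uncorrelated_fubini(1)) (use X_H st Z cXZ in auto)
  also have "\<dots> = measure (distr M borel (X s)) {v<..} * prob {w\<in>space M. Z w \<le> - \<eta> / 2}" by simp
  also have "measure (distr M borel (X s)) {v<..} = 1 - Phi v" by (simp add: X_std[OF st(1)] one_minus_Phi)
  \<comment> \<open>\<open>cgauss_tail\<close> treats strict inequalities, so the level is lowered
    from \<open>\<eta> / 2\<close> to \<open>\<eta> / 4\<close>; with variance at most
    \<open>2 * \<rho>\<close> this gives the constant 64.\<close>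
  also have "prob {w\<in>space M. Z w \<le> - \<eta> / 2} \<le> exp (- \<eta>\<^sup>2 / (64 * \<rho>))"
  proof -
   have "prob {w\<in>space M. Z w \<le> - \<eta> / 2} \<le> prob {w\<in>space M. \<eta> / 4 < - 1 * Z w}" using \<eta> by (intro finite_measure_mono) auto
   also have "\<dots> \<le> exp (- (\<eta> / 4)\<^sup>2 / (2 * (2 * \<rho>)))"
    using cgauss_scale[OF prob_space_axioms H_cgauss[OF Z], of "-1"] ZZ \<rho> \<eta> by (intro cgauss_tail[where v="cov Z Z"]) auto
   finally show ?thesis by (simp add: power2_eq_square)
  qed
  finally show ?thesis using Phi_le_1[of v] by (simp add: mult_left_mono)
 qed
 finally show ?thesis by simp
qed

section \<open>Chaining inside one cube\<close>

context
 fixes \<psi> :: "real ^ 'd::finite \<Rightarrow> 't" and C :: real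
 assumes \<psi>_cont: "continuous_on (cbox 0 1) \<psi>" and \<psi>_I: "\<psi> ` cbox 0 1 \<subseteq> I"
  and C_pos: "0 < C" and lip: "\<And>x y. x \<in> cbox 0 1 \<Longrightarrow> y \<in> cbox 0 1 \<Longrightarrow> 1 - r (\<psi> x) (\<psi> y) \<le> C * (norm (x - y))\<^sup>2"
begin

lemma chart_path_cont: "w \<in> space M \<Longrightarrow> continuous_on (cbox 0 1) (\<lambda>x. X (\<psi> x) w)"
 using continuous_on_compose2[OF X_cont \<psi>_cont \<psi>_I] by simp

text \<open>The index \<open>k i div 2\<close> leads to the parent on the grid twice as coarse. The
  allowances \<open>(3/4) ^ m / u\<close> are summable, with total \<open>4 * (3/4) ^ p / u\<close>
  from level \<open>p\<close> on, yet they shrink more slowly than the standard deviations of the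
  increments, which are at most of order \<open>2 ^ - m / u\<close>. The requirement that the finer
  point exceed \<open>u\<close> later yields the factor \<open>1 - Phi u\<close>.\<close>

definition chain_jump :: "real ^ 'd \<Rightarrow> real \<Rightarrow> real \<Rightarrow> nat \<Rightarrow> ('d \<Rightarrow> nat) \<Rightarrow> 'w set" where
 "chain_jump x0 h u m k = {w\<in>space M. u < X (\<psi> (gridpt x0 (h / 2 ^ Suc m) k)) w \<and>
   (3/4) ^ m / u < X (\<psi> (gridpt x0 (h / 2 ^ Suc m) k)) w - X (\<psi> (gridpt x0 (h / 2 ^ m) (\<lambda>i. k i div 2))) w}"

definition chain_step :: "real ^ 'd \<Rightarrow> real \<Rightarrow> real \<Rightarrow> nat \<Rightarrow> 'w set" where
 "chain_step x0 h u m = (\<Union>k\<in>UNIV \<rightarrow>\<^sub>E {..2 ^ Suc m}. chain_jump x0 h u m k)"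

text \<open>Passing from a point to its parent loses at most \<open>(3/4) ^ m / u\<close> unless a
  jump occurs. The threshold decreases by exactly this geometric sum, so without a jump a point of
  level \<open>p\<close> would exceed \<open>u\<close>, against \<open>small\<close>.\<close>

lemma chain_descent:
 assumes w: "w \<in> space M" and u: "u > 0"
  and small: "\<And>y. y \<in> grid x0 (h / 2 ^ p) (2 ^ p) \<Longrightarrow> X (\<psi> y) w \<le> u"
  and Np: "N \<ge> p" and k: "k \<in> UNIV \<rightarrow>\<^sub>E {..2 ^ N}"
  and big: "u + (4 * (3/4) ^ p - 4 * (3/4) ^ N) / u < X (\<psi> (gridpt x0 (h / 2 ^ N) k)) w"
 shows "\<exists>m\<ge>p. w \<in> chain_step x0 h u m"
 using Np k big
proof (induction N arbitrary: k rule: dec_induct)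
 case base
 thus ?case using small[of "gridpt x0 (h / 2 ^ p) k"] by (auto simp: grid_def)
next
 case (step m)
 let ?y = "gridpt x0 (h / 2 ^ Suc m) k" and ?k' = "\<lambda>i. k i div 2"
 show ?case
 proof (cases "(3/4) ^ m / u < X (\<psi> ?y) w - X (\<psi> (gridpt x0 (h / 2 ^ m) ?k')) w")
  case True
  have "(3/4) ^ Suc m \<le> ((3/4) ^ p :: real)" using step by (intro power_decreasing) auto
  hence "u \<le> u + (4 * (3/4) ^ p - 4 * (3/4) ^ Suc m) / u" using u by simp
  with step.prems(2) have "u < X (\<psi> ?y) w" by linarith
  with True step w show ?thesis by (auto simp: chain_step_def chain_jump_def intro!: exI[of _ m])
 next
  case False
  have "u + (4 * (3/4) ^ p - 4 * (3/4) ^ m) / u = u + (4 * (3/4) ^ p - 4 * (3/4) ^ Suc m) / u - (3/4) ^ m / u"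
   by (simp add: diff_divide_distrib add_divide_distrib)
  also have "\<dots> < X (\<psi> (gridpt x0 (h / 2 ^ m) ?k')) w" using False step.prems(2) by linarith
  finally have "u + (4 * (3/4) ^ p - 4 * (3/4) ^ m) / u < X (\<psi> (gridpt x0 (h / 2 ^ m) ?k')) w" .
  moreover have "k i div 2 \<le> 2 ^ m" for i using div_le_mono[of "k i" "2 ^ Suc m" 2] step.prems(1) by auto
  hence "?k' \<in> UNIV \<rightarrow>\<^sub>E {..2 ^ m}" by auto
  ultimately show ?thesis using step.IH by blast
 qed
qed

text \<open>Rounding coordinates down to dyadic levels approximates \<open>x\<close> by grid points,
  and continuity of the path preserves the strict inequality. The level can be taken beyond any
  \<open>p\<close>.\<close>

lemma dyadic_approx:
 assumes w: "w \<in> space M" and h: "h > 0" and sub: "cbox x0 (x0 + h *\<^sub>R 1) \<subseteq> cbox 0 1"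
  and x: "x \<in> cbox x0 (x0 + h *\<^sub>R 1)" and big: "b < X (\<psi> x) w"
 shows "\<exists>N\<ge>p. \<exists>k\<in>UNIV \<rightarrow>\<^sub>E {..2 ^ N}. b < X (\<psi> (gridpt x0 (h / 2 ^ N) k)) w"
proof -
 define k where "k N i = nat \<lfloor>(x $ i - x0 $ i) / (h / 2 ^ N)\<rfloor>" for N i
 define y where "y N = gridpt x0 (h / 2 ^ N) (k N)" for N
 have xi: "0 \<le> x $ i - x0 $ i" "x $ i - x0 $ i \<le> h" for i using x by (auto simp: mem_box_cart algebra_simps)
 have kle: "k N \<in> UNIV \<rightarrow>\<^sub>E {..2 ^ N}" for N
 proof -
  have "k N i \<le> 2 ^ N" for i
  proof -
   have "(x $ i - x0 $ i) / (h / 2 ^ N) \<le> h / (h / 2 ^ N)" using xi[of i] h by (intro divide_right_mono) auto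
   hence "(x $ i - x0 $ i) / (h / 2 ^ N) \<le> 2 ^ N" using h by simp
   thus ?thesis by (simp add: k_def nat_le_iff floor_le_iff)
  qed
  thus ?thesis by auto
 qed
 have close: "y N $ i \<le> x $ i \<and> x $ i \<le> y N $ i + h / 2 ^ N" for N i
 proof -
  let ?q = "(x $ i - x0 $ i) / (h / 2 ^ N)"
  have q0: "0 \<le> ?q" using xi[of i] h by simp
  hence "real (k N i) = of_int \<lfloor>?q\<rfloor>" by (simp add: k_def)
  hence "real (k N i) \<le> ?q" "?q \<le> real (k N i) + 1" by linarith+
  thus ?thesis using h by (simp add: y_def gridpt_def field_simps)
 qed
 have "(\<lambda>N. y N $ i) \<longlonglongrightarrow> x $ i" for i
 proof (rule tendsto_sandwich[where f="\<lambda>N. x $ i - h / 2 ^ N" and h="\<lambda>_. x $ i"])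
  have "(\<lambda>N. x $ i - h / 2 ^ N) \<longlonglongrightarrow> x $ i - 0" by (intro tendsto_intros) real_asymp
  thus "(\<lambda>N. x $ i - h / 2 ^ N) \<longlonglongrightarrow> x $ i" by simp
 qed (use close in \<open>auto simp: algebra_simps\<close>)
 hence ylim: "y \<longlonglongrightarrow> x" by (rule vec_tendstoI)
 have yQ: "y N \<in> cbox 0 1" for N
 proof -
  have "y N \<in> grid x0 (h / 2 ^ N) (2 ^ N)" using kle by (auto simp: grid_def y_def)
  thus ?thesis using grid_subset_box[of "h / 2 ^ N" x0 "2 ^ N"] sub h by auto
 qed
 have "(\<lambda>N. X (\<psi> (y N)) w) \<longlonglongrightarrow> X (\<psi> x) w"
  using chart_path_cont[OF w, unfolded continuous_on_sequentially comp_def, rule_format, of x y] yQ ylim x sub by auto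
 hence "eventually (\<lambda>N. b < X (\<psi> (y N)) w) sequentially" using big by (rule order_tendstoD)
 then obtain N0 where "\<And>N. N \<ge> N0 \<Longrightarrow> b < X (\<psi> (y N)) w" by (auto simp: eventually_sequentially)
 hence "max N0 p \<ge> p" "b < X (\<psi> (y (max N0 p))) w" by auto
 thus ?thesis using kle unfolding y_def by blast
qed

text \<open>Chosen to bring the exponents of \<open>increment_bound\<close> into the form
  \<open>chain_rate * (9/4) ^ m\<close>: 256 is the 64 found there times the bound 4 for
  \<open>(u * h)\<^sup>2\<close>. The squared dimension comes from bounding the distance to the
  parent by the sum of the coordinate distances.\<close>

definition chain_rate :: real where
 "chain_rate = 1 / (256 * C * (real CARD('d))\<^sup>2)"

definition chain_weight :: "nat \<Rightarrow> real" where
 "chain_weight n = 2 ^ ((n + 2) * CARD('d)) * (exp (- chain_rate * (9/4) ^ n) + exp 3 * exp (- (chain_rate * 3 ^ n)\<^sup>2 / 2))"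

lemma chain_rate_pos: "0 < chain_rate"
 using C_pos by (simp add: chain_rate_def)

lemma summable_chain_weight: "summable chain_weight"
 unfolding chain_weight_def[abs_def] using chain_rate_pos by (rule summable_chain_weights)

text \<open>A union bound over the grid of level \<open>Suc m\<close>. A jump either beats a
  residual of variance of order \<open>4 ^ - m / u\<^sup>2\<close>, independently of the exceedance
  of \<open>u\<close>, or requires a value of size \<open>chain_rate * 3 ^ m * u\<close>; the last
  hypothesis makes \<open>Psi_scale\<close> applicable to the second case.\<close>

lemma chain_level_bound:
 assumes u: "u \<ge> 1" and h: "0 < h" "u * h \<le> 2" and sub: "cbox x0 (x0 + h *\<^sub>R 1) \<subseteq> cbox 0 1"
  and m: "chain_rate * 3 ^ m \<ge> 1"
 shows "chain_step x0 h u m \<in> sets M" "prob (chain_step x0 h u m) \<le> chain_weight m * (1 - Phi u)"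
proof -
 define D where "D = real CARD('d)"
 have D: "D > 0" by (simp add: D_def)
 define \<rho> where "\<rho> = C * (D * (h / 2 ^ m))\<^sup>2"
 have \<rho>: "\<rho> > 0" using C_pos D h by (simp add: \<rho>_def)
 let ?K = "UNIV \<rightarrow>\<^sub>E {..2 ^ Suc m} :: ('d \<Rightarrow> nat) set"
 let ?w = "exp (- chain_rate * (9/4) ^ m) + exp 3 * exp (- (chain_rate * 3 ^ m)\<^sup>2 / 2)"
 have fK: "finite ?K" by (intro finite_PiE) auto
 have inQ: "gridpt x0 (h / 2 ^ j) k \<in> cbox 0 1" if "k \<in> UNIV \<rightarrow>\<^sub>E {..2 ^ j}" for j k
  using grid_subset_box[of "h / 2 ^ j" x0 "2 ^ j"] that sub h unfolding grid_def by auto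
 have half: "(\<lambda>i. k i div 2) \<in> UNIV \<rightarrow>\<^sub>E {..2 ^ m}" if "k \<in> ?K" for k :: "'d \<Rightarrow> nat"
 proof -
  have "k i div 2 \<le> 2 ^ m" for i using div_le_mono[of "k i" "2 ^ Suc m" 2] that by auto
  thus ?thesis by auto
 qed
 have each: "prob (chain_jump x0 h u m k) \<le> ?w * (1 - Phi u)" and meas: "chain_jump x0 h u m k \<in> sets M" if k: "k \<in> ?K" for k
 proof -
  let ?y = "gridpt x0 (h / 2 ^ Suc m) k" and ?z = "gridpt x0 (h / 2 ^ m) (\<lambda>i. k i div 2)"
  have yI: "\<psi> ?y \<in> I" "\<psi> ?z \<in> I" using inQ[OF k] inQ[OF half[OF k]] \<psi>_I by auto
  note [measurable] = X_measurable[OF yI(1)] X_measurable[OF yI(2)]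
  show "chain_jump x0 h u m k \<in> sets M" unfolding chain_jump_def by measurable
  have "norm (?z - ?y) \<le> (\<Sum>i\<in>UNIV. \<bar>(?z - ?y) $ i\<bar>)" by (rule norm_le_l1_cart)
  also have "\<dots> \<le> (\<Sum>i\<in>(UNIV :: 'd set). h / 2 ^ m)"
  proof (rule sum_mono)
   fix i
   have "real (k i) = 2 * real (k i div 2) + real (k i mod 2)" by (metis div_mult_mod_eq mult.commute of_nat_add of_nat_mult of_nat_numeral)
   hence "(?z - ?y) $ i = - (h / 2 ^ Suc m) * real (k i mod 2)" by (simp add: gridpt_def field_simps)
   also have "\<bar>\<dots>\<bar> \<le> h / 2 ^ m"
   proof -
    have "real (k i mod 2) \<le> 2" by linarith
    hence "(h / 2 ^ Suc m) * real (k i mod 2) \<le> (h / 2 ^ Suc m) * 2" using h by (intro mult_left_mono) auto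
    thus ?thesis using h by (simp add: abs_mult)
   qed
   finally show "\<bar>(?z - ?y) $ i\<bar> \<le> h / 2 ^ m" .
  qed
  also have "\<dots> = D * (h / 2 ^ m)" by (simp add: D_def)
  finally have nb: "norm (?z - ?y) \<le> D * (h / 2 ^ m)" .
  have "1 - r (\<psi> ?z) (\<psi> ?y) \<le> C * (norm (?z - ?y))\<^sup>2" using inQ[OF k] inQ[OF half[OF k]] by (intro lip) auto
  also have "\<dots> \<le> \<rho>" unfolding \<rho>_def using C_pos nb by (intro mult_left_mono power_mono) auto
  finally have r\<rho>: "1 - r (\<psi> ?z) (\<psi> ?y) \<le> \<rho>" .
  have uh: "u\<^sup>2 * h\<^sup>2 \<le> 4" using power_mono[OF h(2), of 2] u h by (simp add: power_mult_distrib)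
  have p43: "(3/4) ^ m * 4 ^ m = (3 ^ m :: real)" "((3/4) ^ m)\<^sup>2 * 4 ^ m = ((9/4) ^ m :: real)"
   by (simp_all flip: power_mult_distrib add: power2_eq_square)
  have four: "(2 ^ m)\<^sup>2 = (4 ^ m :: real)" by (simp add: power2_eq_square flip: power_mult_distrib)
  have e1: "- ((3/4) ^ m / u)\<^sup>2 / (64 * \<rho>) \<le> - chain_rate * (9/4) ^ m"
  proof -
   have "chain_rate * (9/4) ^ m * (64 * \<rho>) * u\<^sup>2 = (9/4) ^ m / 4 ^ m * (u\<^sup>2 * h\<^sup>2) / 4"
    using C_pos D by (simp add: chain_rate_def \<rho>_def D_def[symmetric] power_mult_distrib power_divide four field_simps)
   also have "\<dots> \<le> (9/4) ^ m / 4 ^ m * 4 / 4" using uh by (intro divide_right_mono mult_left_mono) auto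
   also have "\<dots> = ((3/4) ^ m)\<^sup>2" by (simp flip: p43(2))
   finally have "chain_rate * (9/4) ^ m * (64 * \<rho>) * u\<^sup>2 \<le> ((3/4) ^ m)\<^sup>2" .
   hence "chain_rate * (9/4) ^ m \<le> ((3/4) ^ m / u)\<^sup>2 / (64 * \<rho>)" using u \<rho> by (simp add: field_simps power_divide)
   thus ?thesis by simp
  qed
  have e2: "chain_rate * 3 ^ m * u \<le> (3/4) ^ m / u / (2 * \<rho>)"
  proof -
   have "chain_rate * 3 ^ m * u * (2 * \<rho>) * u = 3 ^ m / 4 ^ m * (u\<^sup>2 * h\<^sup>2) / 128"
    using C_pos D by (simp add: chain_rate_def \<rho>_def D_def[symmetric] power_mult_distrib power_divide four four[unfolded power2_eq_square] field_simps power2_eq_square)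
   also have "\<dots> \<le> 3 ^ m / 4 ^ m * 4 / 128" using uh by (intro divide_right_mono mult_left_mono) auto
   also have "\<dots> \<le> (3/4) ^ m" by (simp add: power_divide field_simps)
   finally show ?thesis using u \<rho> by (simp add: field_simps)
  qed
  have "prob (chain_jump x0 h u m k) \<le> (1 - Phi u) * exp (- ((3/4) ^ m / u)\<^sup>2 / (64 * \<rho>)) + (1 - Phi ((3/4) ^ m / u / (2 * \<rho>)))"
   unfolding chain_jump_def using u \<rho> by (intro increment_bound yI r\<rho>) auto
  also have "\<dots> \<le> (1 - Phi u) * exp (- chain_rate * (9/4) ^ m) + (1 - Phi (chain_rate * 3 ^ m * u))"
   using e1 e2 Phi_le_1[of u] by (intro add_mono mult_left_mono diff_left_mono Phi_mono) auto
  also have "\<dots> \<le> (1 - Phi u) * exp (- chain_rate * (9/4) ^ m) + exp 3 * exp (- (chain_rate * 3 ^ m)\<^sup>2 / 2) * (1 - Phi u)"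
   using u m by (intro add_left_mono Psi_scale)
  finally show "prob (chain_jump x0 h u m k) \<le> ?w * (1 - Phi u)" by (simp add: algebra_simps)
 qed
 show "chain_step x0 h u m \<in> sets M" unfolding chain_step_def using fK meas by (intro sets.finite_UN)
 have "prob (chain_step x0 h u m) \<le> prob {} + (\<Sum>k\<in>?K. ?w * (1 - Phi u))"
  using fK meas each by (intro prob_union_bound[where C="chain_jump x0 h u m"]) (auto simp: chain_step_def)
 also have "\<dots> = real (card ?K) * (?w * (1 - Phi u))" by simp
 also have "\<dots> \<le> 2 ^ ((m + 2) * CARD('d)) * (?w * (1 - Phi u))"
 proof (rule mult_right_mono)
  have "card ?K = (2 ^ Suc m + 1) ^ CARD('d)" by (simp add: card_PiE)
  also have "\<dots> \<le> (2 ^ (m + 2)) ^ CARD('d)" by (intro power_mono) auto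
  finally have "card ?K \<le> 2 ^ ((m + 2) * CARD('d))" by (simp only: power_mult)
  hence "real (card ?K) \<le> real (2 ^ ((m + 2) * CARD('d)))" by (rule of_nat_mono)
  thus "real (card ?K) \<le> 2 ^ ((m + 2) * CARD('d))" by (simp only: of_nat_power of_nat_numeral)
 qed (use Phi_le_1[of u] in auto)
 finally show "prob (chain_step x0 h u m) \<le> chain_weight m * (1 - Phi u)" by (simp add: chain_weight_def mult.assoc)
qed

text \<open>If the supremum passes \<open>u\<close> by the whole allowance while no point of the
  coarse grid exceeds \<open>u\<close>, some jump occurs at a level from \<open>p\<close> on.
  Summing over levels leaves the tail of a convergent series, which is the error factor in
  \<open>chaining\<close>.\<close>

lemma chain_event_bound:
 assumes u: "u \<ge> 1" and h: "0 < h" "u * h \<le> 2" and sub: "cbox x0 (x0 + h *\<^sub>R 1) \<subseteq> cbox 0 1"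
  and p: "chain_rate * 3 ^ p \<ge> 1"
 shows "prob (exceed (\<psi> ` cbox x0 (x0 + h *\<^sub>R 1)) (u + 4 * (3/4) ^ p / u) - exceed (\<psi> ` grid x0 (h / 2 ^ p) (2 ^ p)) u)
  \<le> (\<Sum>n. chain_weight (n + p)) * (1 - Phi u)" (is "prob ?E \<le> _")
proof -
 let ?B = "chain_step x0 h u"
 have rate: "1 \<le> chain_rate * 3 ^ (n + p)" for n
 proof -
  have "chain_rate * 3 ^ p \<le> chain_rate * 3 ^ (n + p)" using chain_rate_pos by (intro mult_left_mono power_increasing) auto
  thus ?thesis using p by simp
 qed
 note bnd = chain_level_bound[OF u h sub rate]
 have sw: "summable (\<lambda>n. chain_weight (n + p) * (1 - Phi u))" using summable_chain_weight by (intro summable_mult2) (subst summable_iff_shift)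
 have sB: "summable (\<lambda>n. prob (?B (n + p)))" by (rule summable_comparison_test'[OF sw, where N=0]) (use bnd in auto)
 have "?E \<subseteq> (\<Union>n. ?B (n + p))"
 proof
  fix w assume "w \<in> ?E"
  then obtain x where w: "w \<in> space M" and x: "x \<in> cbox x0 (x0 + h *\<^sub>R 1)" "u + 4 * (3/4) ^ p / u < X (\<psi> x) w"
   and small: "\<And>y. y \<in> grid x0 (h / 2 ^ p) (2 ^ p) \<Longrightarrow> X (\<psi> y) w \<le> u"
   by (auto simp: exceed_def not_less)
  obtain N k where N: "N \<ge> p" and k: "k \<in> UNIV \<rightarrow>\<^sub>E {..2 ^ N}" and big: "u + 4 * (3/4) ^ p / u < X (\<psi> (gridpt x0 (h / 2 ^ N) k)) w"
   using dyadic_approx[OF w h(1) sub x] by blast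
  have "u + (4 * (3/4) ^ p - 4 * (3/4) ^ N) / u \<le> u + 4 * (3/4) ^ p / u" using u by (intro add_left_mono divide_right_mono) auto
  with big have "u + (4 * (3/4) ^ p - 4 * (3/4) ^ N) / u < X (\<psi> (gridpt x0 (h / 2 ^ N) k)) w" by linarith
  from chain_descent[OF w _ small N k this] u
  obtain m where m: "m \<ge> p" "w \<in> ?B m" by auto
  hence "w \<in> ?B ((m - p) + p)" by simp
  thus "w \<in> (\<Union>n. ?B (n + p))" by blast
 qed
 hence "prob ?E \<le> prob (\<Union>n. ?B (n + p))" using bnd(1) by (intro finite_measure_mono) auto
 also have "\<dots> \<le> (\<Sum>n. prob (?B (n + p)))" using bnd(1) sB by (intro finite_measure_subadditive_countably) auto
 also have "\<dots> \<le> (\<Sum>n. chain_weight (n + p) * (1 - Phi u))" by (intro suminf_le bnd sB sw)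
 also have "\<dots> = (\<Sum>n. chain_weight (n + p)) * (1 - Phi u)" using summable_chain_weight by (intro suminf_mult2[symmetric]) (subst summable_iff_shift)
 finally show ?thesis .
qed

lemma chaining:
 obtains e :: "nat \<Rightarrow> real" where "e \<longlonglongrightarrow> 0"
  "\<And>p u h x0. u \<ge> 1 \<Longrightarrow> 0 < h \<Longrightarrow> u * h \<le> 2 \<Longrightarrow> cbox x0 (x0 + h *\<^sub>R 1) \<subseteq> cbox 0 1 \<Longrightarrow> chain_rate * 3 ^ p \<ge> 1 \<Longrightarrow>
   prob (exceed (\<psi> ` cbox x0 (x0 + h *\<^sub>R 1)) (u + 4 * (3/4) ^ p / u) - exceed (\<psi> ` grid x0 (h / 2 ^ p) (2 ^ p)) u) \<le> e p * (1 - Phi u)"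
  "eventually (\<lambda>p. chain_rate * 3 ^ p \<ge> 1) sequentially"
proof
 show "(\<lambda>p. \<Sum>n. chain_weight (n + p)) \<longlonglongrightarrow> 0" using suminf_exist_split2[OF summable_chain_weight] by simp
 show "eventually (\<lambda>p. chain_rate * 3 ^ p \<ge> 1) sequentially" using chain_rate_pos by real_asymp
qed (rule chain_event_bound)

text \<open>Chaining is started at \<open>u' = u - 1/u\<close>. A fixed \<open>p\<close> with
  \<open>4 * (3/4) ^ p \<le> 1/2\<close> keeps the overshoot below \<open>1/u\<close> because
  \<open>u' \<ge> u / 2\<close>. The grid of level \<open>p\<close> has boundedly many points, and
  returning from \<open>u'\<close> to \<open>u\<close> costs the constant of
  \<open>Psi_shift\<close>.\<close>

lemma crude_cell_bound:
 obtains B :: real where "0 < B"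
  "\<And>u h x0. u \<ge> 2 \<Longrightarrow> 0 < h \<Longrightarrow> u * h \<le> 2 \<Longrightarrow> cbox x0 (x0 + h *\<^sub>R 1) \<subseteq> cbox 0 1 \<Longrightarrow>
    prob (exceed (\<psi> ` cbox x0 (x0 + h *\<^sub>R 1)) u) \<le> B * (1 - Phi u)"
proof -
 have "eventually (\<lambda>p. chain_rate * 3 ^ p \<ge> 1) sequentially" using chain_rate_pos by real_asymp
 moreover have "eventually (\<lambda>p. 4 * (3/4) ^ p \<le> (1/2 :: real)) sequentially" by real_asymp
 ultimately have "eventually (\<lambda>p. chain_rate * 3 ^ p \<ge> 1 \<and> 4 * (3/4) ^ p \<le> (1/2 :: real)) sequentially" by (rule eventually_conj)
 then obtain p where p: "chain_rate * 3 ^ p \<ge> 1" "4 * (3/4) ^ p \<le> (1/2 :: real)" by (auto simp: eventually_sequentially)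
 define e where "e = (\<Sum>n. chain_weight (n + p))"
 have "summable (\<lambda>n. chain_weight (n + p))" using summable_chain_weight by (subst summable_iff_shift)
 hence e0: "e \<ge> 0" unfolding e_def by (intro suminf_nonneg) (auto simp: chain_weight_def)
 define Kc where "Kc = (real (2 ^ p + 1)) ^ CARD('d)"
 have Kc: "Kc \<ge> 0" by (simp add: Kc_def)
 show ?thesis
 proof (rule that[of "(e + Kc + 1) * (2 * exp 3)"])
  show "0 < (e + Kc + 1) * (2 * exp 3)" using e0 Kc by simp
  fix u h :: real and x0 :: "real ^ 'd"
  assume u: "u \<ge> 2" and h: "0 < h" "u * h \<le> 2" and sub: "cbox x0 (x0 + h *\<^sub>R 1) \<subseteq> cbox 0 1"
  define u' where "u' = u - 1/u"
  have "1/u \<le> 1/2" using u by (intro divide_left_mono) auto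
  hence u': "u' \<ge> u / 2" "u' \<le> u" using u unfolding u'_def by (linarith, simp)
  have u1: "u' \<ge> 1" "u' * h \<le> 2"
  proof -
   have "u' * h \<le> u * h" using u' h by (intro mult_right_mono) auto
   thus "u' * h \<le> 2" using h(2) by linarith
   show "u' \<ge> 1" using u u' by linarith
  qed
  have "4 * (3/4) ^ p / u' \<le> (1/2) / u'" using p u1 by (intro divide_right_mono) auto
  also have "\<dots> \<le> (1/2) / (u/2)" using u u' by (intro divide_left_mono) auto
  finally have th: "u' + 4 * (3/4) ^ p / u' \<le> u" by (simp add: u'_def)
  let ?G = "grid x0 (h / 2 ^ p) (2 ^ p)" and ?Q = "cbox x0 (x0 + h *\<^sub>R 1)"
  have GQ: "?G \<subseteq> ?Q" using grid_subset_box[of "h / 2 ^ p" x0 "2 ^ p"] h by simp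
  have QI: "\<psi> ` ?Q \<subseteq> I" using sub \<psi>_I by auto
  have GI: "\<psi> ` ?G \<subseteq> I" using GQ QI by auto
  let ?D = "exceed (\<psi> ` ?Q) (u' + 4 * (3/4) ^ p / u') - exceed (\<psi> ` ?G) u'"
  have m: "?D \<in> sets M" "exceed (\<psi> ` ?G) u' \<in> sets M" using QI GI by (auto intro!: exceed_measurable)
  have "prob (exceed (\<psi> ` ?Q) u) \<le> prob (?D \<union> exceed (\<psi> ` ?G) u')"
   using m exceed_antimono[OF th, of "\<psi> ` ?Q"] by (intro finite_measure_mono sets.Un) blast+
  also have "\<dots> \<le> prob ?D + prob (exceed (\<psi> ` ?G) u')" using m by (rule measure_Un_le)
  also have "prob ?D \<le> e * (1 - Phi u')" unfolding e_def by (rule chain_event_bound[OF u1(1) h(1) u1(2) sub p(1)])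
  also have "prob (exceed (\<psi> ` ?G) u') \<le> real (card (\<psi> ` ?G)) * (1 - Phi u')" using GI by (intro prob_exceed_finite finite_imageI finite_grid)
  also have "\<dots> \<le> Kc * (1 - Phi u')"
  proof (rule mult_right_mono)
   have "card (\<psi> ` ?G) \<le> (2 ^ p + 1) ^ CARD('d)" by (rule order_trans[OF card_image_le[OF finite_grid] card_grid])
   hence "real (card (\<psi> ` ?G)) \<le> real ((2 ^ p + 1) ^ CARD('d))" by (rule of_nat_mono)
   thus "real (card (\<psi> ` ?G)) \<le> Kc" by (simp add: Kc_def)
  qed (use Phi_le_1 in auto)
  finally have "prob (exceed (\<psi> ` ?Q) u) \<le> (e + Kc) * (1 - Phi u')" by (simp add: algebra_simps)
  also have "\<dots> \<le> (e + Kc + 1) * (1 - Phi u')" using Phi_le_1[of u'] by (intro mult_right_mono) auto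
  also have "\<dots> \<le> (e + Kc + 1) * (2 * exp 3 * (1 - Phi u))" unfolding u'_def using u e0 Kc by (intro mult_left_mono Psi_shift) auto
  finally show "prob (exceed (\<psi> ` ?Q) u) \<le> (e + Kc + 1) * (2 * exp 3) * (1 - Phi u)" by simp
 qed
qed

end

end

section \<open>Gaussian fields in charts\<close>

lemma (in gaussian_space) cov_limit:
 assumes "\<And>n::nat. Y n \<in> H" "Z \<in> H" "\<And>\<omega>. \<omega> \<in> space M \<Longrightarrow> (\<lambda>n. Y n \<omega>) \<longlonglongrightarrow> Z \<omega>"
 shows "(\<lambda>n. cov (Y n) (Y n)) \<longlonglongrightarrow> cov Z Z"
proof -
 obtain w where "(\<lambda>n. cov (Y n) (Y n)) \<longlonglongrightarrow> w" "cgauss M Z w"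
  using cgauss_limit[OF prob_space_axioms H_cgauss[OF assms(1)] assms(3)] by blast
 thus ?thesis using cgauss_var_unique[OF H_cgauss[OF assms(2)]] by metis
qed

text \<open>Off the null event that some limit sits on its threshold, each of the finitely many
  comparisons is eventually constant; dominated convergence of the indicators finishes.\<close>

lemma (in prob_space) prob_limit:
 assumes F: "finite F"
  and V: "\<And>k n. k \<in> F \<Longrightarrow> V k n \<in> borel_measurable M" "\<And>k. k \<in> F \<Longrightarrow> W k \<in> borel_measurable M"
  and lim: "\<And>k w. k \<in> F \<Longrightarrow> w \<in> space M \<Longrightarrow> (\<lambda>n::nat. V k n w) \<longlonglongrightarrow> W k w"
  and b: "\<And>k. k \<in> F \<Longrightarrow> b k \<longlonglongrightarrow> (c k :: real)"
  and null: "\<And>k. k \<in> F \<Longrightarrow> prob {w\<in>space M. W k w = c k} = 0"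
 shows "(\<lambda>n. prob {w\<in>space M. \<forall>k\<in>F. V k n w \<le> b k n}) \<longlonglongrightarrow> prob {w\<in>space M. \<forall>k\<in>F. W k w \<le> c k}"
proof -
 note [measurable] = V
 let ?A = "\<lambda>n. {w\<in>space M. \<forall>k\<in>F. V k n w \<le> b k n}" and ?B = "{w\<in>space M. \<forall>k\<in>F. W k w \<le> c k}"
 have A: "?A n \<in> sets M" for n using F by measurable
 have B: "?B \<in> sets M" using F by measurable
 have ae: "AE w in M. \<forall>k\<in>F. W k w \<noteq> c k"
 proof (intro AE_finite_allI F)
  fix k assume k: "k \<in> F"
  have "{w\<in>space M. W k w = c k} \<in> sets M" using V(2)[OF k] by measurable
  from prob_eq_0[OF this] null[OF k] show "AE w in M. W k w \<noteq> c k" by auto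
 qed
 have "(\<lambda>n. expectation (indicator (?A n))) \<longlonglongrightarrow> (expectation (indicator ?B) :: real)"
 proof (rule integral_dominated_convergence[where w="\<lambda>_. 1"])
  show "AE w in M. (\<lambda>n. indicator (?A n) w :: real) \<longlonglongrightarrow> indicator ?B w" using ae AE_space
  proof eventually_elim
   case (elim w)
   have "eventually (\<lambda>n. \<forall>k\<in>F. (V k n w \<le> b k n) = (W k w \<le> c k)) sequentially"
   proof (intro eventually_ball_finite F ballI)
    fix k assume k: "k \<in> F"
    have d: "(\<lambda>n. V k n w - b k n) \<longlonglongrightarrow> W k w - c k" using lim[OF k elim(2)] b[OF k] by (rule tendsto_diff)
    show "eventually (\<lambda>n. (V k n w \<le> b k n) = (W k w \<le> c k)) sequentially"
    proof (cases "W k w < c k")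
     case True
     hence "eventually (\<lambda>n. V k n w - b k n < 0) sequentially" by (intro order_tendstoD(2)[OF d]) auto
     thus ?thesis by eventually_elim (use True in auto)
    next
     case False
     hence "W k w > c k" using elim k by force
     hence "eventually (\<lambda>n. V k n w - b k n > 0) sequentially" by (intro order_tendstoD(1)[OF d]) auto
     thus ?thesis by eventually_elim (use \<open>W k w > c k\<close> in auto)
    qed
   qed
   hence "eventually (\<lambda>n. indicator (?A n) w = (indicator ?B w :: real)) sequentially" by eventually_elim (auto simp: indicator_def)
   thus ?case by (rule tendsto_eventually)
  qed
 qed (use A B in \<open>auto\<close>)
 thus ?thesis using A B by (simp add: sets.Int_space_eq2)
qed

abbreviation ivec :: "int ^ 'd \<Rightarrow> real ^ 'd" where "ivec k \<equiv> (\<chi> i. of_int (k $ i))"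

lemma ivec_eq_0: "ivec k = 0 \<longleftrightarrow> k = 0"
 by (auto simp: vec_eq_iff)

text \<open>The exponential of the squared norm factorizes over coordinates, so any finite sum is at
  most a power of the one-dimensional theta sum \<open>S\<close>.\<close>

lemma gaussian_lattice_summable:
 assumes a: "a > 0"
 shows "(\<lambda>k. exp (- a * (norm (ivec k :: real ^ 'd::finite))\<^sup>2)) summable_on UNIV"
proof -
 define f where "f j = exp (- a * (of_int j)\<^sup>2)" for j :: int
 have fn: "f j \<ge> 0" for j by (simp add: f_def)
 have "f summable_on UNIV"
 proof -
  have nat: "summable (\<lambda>n::nat. exp (- a * (real n)\<^sup>2))"
  proof (rule summable_comparison_test'[where N=0])
   show "summable (\<lambda>n. (exp (- a)) ^ n)" using a by (intro summable_geometric) auto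
   fix n :: nat
   have "real n \<le> (real n)\<^sup>2" by (cases n) (auto simp: power2_eq_square)
   hence "exp (- a * (real n)\<^sup>2) \<le> exp (real n * (- a))" using a by (simp add: mult.commute)
   also have "\<dots> = exp (- a) ^ n" by (rule exp_of_nat_mult)
   finally show "norm (exp (- a * (real n)\<^sup>2)) \<le> (exp (- a)) ^ n" by simp
  qed
  hence nat': "(\<lambda>n::nat. exp (- a * (real n)\<^sup>2)) summable_on UNIV" by (intro norm_summable_imp_summable_on) auto
  have "f summable_on (int ` UNIV)" by (subst summable_on_reindex) (auto simp: f_def comp_def nat'[simplified])
  moreover have "f summable_on ((\<lambda>n. - int n) ` UNIV)" by (subst summable_on_reindex) (auto simp: f_def comp_def inj_on_def nat'[simplified])
  ultimately have "f summable_on (int ` UNIV \<union> (\<lambda>n. - int n) ` UNIV)" by (intro summable_on_union)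
  also have "int ` UNIV \<union> (\<lambda>n. - int n) ` UNIV = UNIV" by (auto intro: int_cases2 simp: image_iff)
  finally show ?thesis .
 qed
 then obtain S where S: "\<And>A. finite A \<Longrightarrow> sum f A \<le> S" using finite_sum_le_infsum[of f UNIV] fn by (metis subset_UNIV)
 show ?thesis
 proof (rule nonneg_bdd_above_summable_on)
  show "bdd_above (sum (\<lambda>k. exp (- a * (norm (ivec k :: real ^ 'd))\<^sup>2)) ` {F. F \<subseteq> UNIV \<and> finite F})"
  proof (intro bdd_aboveI2[where M="S ^ CARD('d)"])
   fix F :: "(int ^ 'd) set" assume "F \<in> {F. F \<subseteq> UNIV \<and> finite F}"
   hence F: "finite F" by simp
   define R where "R = (\<Union>k\<in>F. range (\<lambda>i. k $ i))"
   have R: "finite R" using F by (simp add: R_def)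
   have "(\<Sum>k\<in>F. exp (- a * (norm (ivec k :: real ^ 'd))\<^sup>2)) = (\<Sum>k\<in>F. \<Prod>i\<in>UNIV. f (k $ i))"
    by (intro sum.cong) (auto simp: f_def norm_vec_def L2_set_def sum_nonneg sum_distrib_left exp_sum)
   also have "\<dots> = (\<Sum>g\<in>(\<lambda>k. ($) k) ` F. \<Prod>i\<in>UNIV. f (g i))" by (subst sum.reindex) (auto simp: inj_on_def vec_eq_iff)
   also have "\<dots> \<le> (\<Sum>g\<in>(UNIV :: 'd set) \<rightarrow>\<^sub>E R. \<Prod>i\<in>UNIV. f (g i))"
   proof (rule sum_mono2)
    show "finite ((UNIV :: 'd set) \<rightarrow>\<^sub>E R)" using R by (intro finite_PiE) auto
    show "(\<lambda>k. ($) k) ` F \<subseteq> (UNIV :: 'd set) \<rightarrow>\<^sub>E R" by (auto simp: R_def)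
   qed (auto intro!: prod_nonneg fn)
   also have "\<dots> = (\<Prod>i\<in>(UNIV::'d set). sum f R)" using R by (subst prod_sum_PiE) auto
   also have "\<dots> = sum f R ^ CARD('d)" by simp
   also have "\<dots> \<le> S ^ CARD('d)" by (intro power_mono S R sum_nonneg fn)
   finally show "(\<Sum>k\<in>F. exp (- a * (norm (ivec k :: real ^ 'd))\<^sup>2)) \<le> S ^ CARD('d)" .
  qed
 qed auto
qed

lemma summable_on_small_tail:
 fixes w :: "'a \<Rightarrow> real"
 assumes "w summable_on UNIV" "\<And>x. w x \<ge> 0" "e > 0"
 obtains F where "finite F" "\<And>A. finite A \<Longrightarrow> A \<inter> F = {} \<Longrightarrow> sum w A \<le> e"
proof -
 have "(sum w \<longlongrightarrow> infsum w UNIV) (finite_subsets_at_top UNIV)" using has_sum_infsum[OF assms(1)] by (simp add: has_sum_def)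
 from order_tendstoD(1)[OF this, of "infsum w UNIV - e"] assms(3)
 have "eventually (\<lambda>F. infsum w UNIV - e < sum w F) (finite_subsets_at_top UNIV)" by simp
 then obtain F where F: "finite F" "infsum w UNIV - e < sum w F" unfolding eventually_finite_subsets_at_top by auto
 show ?thesis
 proof (rule that[OF F(1)])
  fix A :: "'a set" assume A: "finite A" "A \<inter> F = {}"
  have "sum w A + sum w F = sum w (A \<union> F)" using A F by (subst sum.union_disjoint) auto
  also have "\<dots> \<le> infsum w UNIV" using A F assms by (intro finite_sum_le_infsum) auto
  finally show "sum w A \<le> e" using F by simp
 qed
qed

text \<open>Both points may move, which ordinary differentiability at \<open>x\<close> does not
  allow. Net points \<open>x n\<close> and their lattice neighbours both tend to \<open>x\<close>,
  and their rescaled increments have to converge to the gradient at \<open>x\<close>.\<close>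

definition strict_diff :: "'a::real_normed_vector set \<Rightarrow> ('a \<Rightarrow> 'b::real_normed_vector) \<Rightarrow> ('a \<Rightarrow> 'b) \<Rightarrow> 'a \<Rightarrow> bool" where
 "strict_diff S f D x \<longleftrightarrow> bounded_linear D \<and>
   (\<forall>e>0. \<exists>d>0. \<forall>y\<in>S \<inter> ball x d. \<forall>z\<in>S \<inter> ball x d. norm (f y - f z - D (y - z)) \<le> e * norm (y - z))"

lemma strict_diffD:
 assumes "strict_diff S f D x" "0 < e"
 obtains d where "0 < d" "\<And>y z. y \<in> S \<inter> ball x d \<Longrightarrow> z \<in> S \<inter> ball x d \<Longrightarrow> norm (f y - f z - D (y - z)) \<le> e * norm (y - z)"
 using assms unfolding strict_diff_def by metis

lemma strict_diff_bounded_linear: "strict_diff S f D x \<Longrightarrow> bounded_linear D"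
 by (simp add: strict_diff_def)

lemma strict_diff_increment:
 fixes f :: "'a::real_normed_vector \<Rightarrow> real"
 assumes s: "strict_diff S f D x" and y: "\<And>n. y n \<in> S" "y \<longlonglongrightarrow> x" and z: "\<And>n. z n \<in> S" "z \<longlonglongrightarrow> x"
  and a: "(\<lambda>n. a n *\<^sub>R (y n - z n)) \<longlonglongrightarrow> v"
 shows "(\<lambda>n. a n * (f (y n) - f (z n))) \<longlonglongrightarrow> D v"
proof -
 note D = strict_diff_bounded_linear[OF s]
 have "(\<lambda>n. a n * (f (y n) - f (z n)) - D (a n *\<^sub>R (y n - z n))) \<longlonglongrightarrow> 0"
 proof (rule tendstoI)
  fix \<epsilon> :: real assume \<epsilon>: "0 < \<epsilon>"
  define e where "e = \<epsilon> / (norm v + 1)"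
  have e: "0 < e" "e * (norm v + 1) = \<epsilon>" using \<epsilon> norm_ge_zero[of v] by (simp_all add: e_def add_nonneg_eq_0_iff add_nonneg_pos)
  obtain d where d: "0 < d" "\<And>y z. y \<in> S \<inter> ball x d \<Longrightarrow> z \<in> S \<inter> ball x d \<Longrightarrow> norm (f y - f z - D (y - z)) \<le> e * norm (y - z)"
   by (rule strict_diffD[OF s e(1)]) blast
  have "eventually (\<lambda>n. norm (a n *\<^sub>R (y n - z n)) < norm v + 1) sequentially" by (rule order_tendstoD(2)[OF tendsto_norm[OF a]]) simp
  thus "eventually (\<lambda>n. dist (a n * (f (y n) - f (z n)) - D (a n *\<^sub>R (y n - z n))) 0 < \<epsilon>) sequentially"
   using tendstoD[OF y(2) d(1)] tendstoD[OF z(2) d(1)]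
  proof eventually_elim
   case (elim n)
   have "a n * (f (y n) - f (z n)) - D (a n *\<^sub>R (y n - z n)) = a n * (f (y n) - f (z n) - D (y n - z n))"
    using linear_scale[OF bounded_linear.linear[OF D]] by (simp add: right_diff_distrib)
   also have "norm \<dots> \<le> \<bar>a n\<bar> * (e * norm (y n - z n))"
    unfolding norm_mult real_norm_def[of "a n"] using elim y(1) z(1) by (intro mult_left_mono d(2)) (auto simp: dist_commute)
   also have "\<dots> = e * norm (a n *\<^sub>R (y n - z n))" by simp
   also have "\<dots> < e * (norm v + 1)" using elim e by (intro mult_strict_left_mono) auto
   finally show ?case using e by (simp add: dist_real_def)
  qed
 qed
 from tendsto_add[OF this bounded_linear.tendsto[OF D a]] show ?thesis by simp
qed

text \<open>The compact set \<open>I\<close> seen through finitely many overlapping closed cubes;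
  \<open>G m x w\<close> is the gradient in chart coordinates. The last two assumptions control the
  overlaps: open cubes have relatively open images, and the boundary of one cube is a null set in
  the coordinates of every chart.\<close>

locale gaussian_charts = gaussian_field M H X I
 for M :: "'w measure" and H and X :: "'t::{metric_space, second_countable_topology} \<Rightarrow> 'w \<Rightarrow> real" and I +
 fixes m0 :: nat and \<psi> :: "nat \<Rightarrow> real ^ 'd::finite \<Rightarrow> 't" and G :: "nat \<Rightarrow> real ^ 'd \<Rightarrow> 'w \<Rightarrow> real ^ 'd"
 assumes \<psi>_cont: "m < m0 \<Longrightarrow> continuous_on (cbox 0 1) (\<psi> m)"
  and \<psi>_inj: "m < m0 \<Longrightarrow> inj_on (\<psi> m) (cbox 0 1)"
  and \<psi>_cover: "I = (\<Union>m<m0. \<psi> m ` cbox 0 1)"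
  and G_H: "m < m0 \<Longrightarrow> x \<in> cbox 0 1 \<Longrightarrow> (\<lambda>w. G m x w \<bullet> v) \<in> H"
  and G_strict: "m < m0 \<Longrightarrow> x \<in> cbox 0 1 \<Longrightarrow> w \<in> space M \<Longrightarrow> strict_diff (cbox 0 1) (\<lambda>y. X (\<psi> m y) w) (\<lambda>v. G m x w \<bullet> v) x"
  and G_nondeg: "m < m0 \<Longrightarrow> x \<in> cbox 0 1 \<Longrightarrow> v \<noteq> 0 \<Longrightarrow> 0 < cov (\<lambda>w. G m x w \<bullet> v) (\<lambda>w. G m x w \<bullet> v)"
  and \<psi>_open: "m < m0 \<Longrightarrow> openin (top_of_set I) (\<psi> m ` box 0 1)"
  and \<psi>_null: "m < m0 \<Longrightarrow> l < m0 \<Longrightarrow> negligible (cbox 0 1 \<inter> \<psi> m -` (\<psi> l ` (cbox 0 1 - box 0 1)))"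
begin

definition quad :: "nat \<Rightarrow> real ^ 'd \<Rightarrow> real ^ 'd \<Rightarrow> real" where
 "quad m x v = cov (\<lambda>w. G m x w \<bullet> v) (\<lambda>w. G m x w \<bullet> v)"

lemma \<psi>_I: "m < m0 \<Longrightarrow> x \<in> cbox 0 1 \<Longrightarrow> \<psi> m x \<in> I"
 using \<psi>_cover by blast

lemma X_\<psi>_H: "m < m0 \<Longrightarrow> x \<in> cbox 0 1 \<Longrightarrow> X (\<psi> m x) \<in> H"
 by (intro X_H \<psi>_I)

lemma X_\<psi>_lim:
 assumes "m < m0" "w \<in> space M" "\<And>n. y n \<in> cbox 0 1" "x \<in> cbox 0 1" "y \<longlonglongrightarrow> x"
 shows "(\<lambda>n. X (\<psi> m (y n)) w) \<longlonglongrightarrow> X (\<psi> m x) w"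
proof -
 have "continuous_on (cbox 0 1) (\<lambda>x. X (\<psi> m x) w)" using assms by (intro continuous_on_compose2[OF X_cont \<psi>_cont]) (auto intro: \<psi>_I)
 thus ?thesis using assms unfolding continuous_on_sequentially comp_def by blast
qed

lemma increment_lim:
 assumes m: "m < m0" and x: "x \<in> cbox 0 1" and w: "w \<in> space M"
  and y: "\<And>n. y n \<in> cbox 0 1" "y \<longlonglongrightarrow> x" and z: "\<And>n. z n \<in> cbox 0 1" "z \<longlonglongrightarrow> x"
  and a: "(\<lambda>n. a n *\<^sub>R (y n - z n)) \<longlonglongrightarrow> v"
 shows "(\<lambda>n. a n * (X (\<psi> m (y n)) w - X (\<psi> m (z n)) w)) \<longlonglongrightarrow> G m x w \<bullet> v"
 by (rule strict_diff_increment[OF G_strict[OF m x w] y z a])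

text \<open>Pointwise limits of Gaussian variables carry the variances along. The second-order
  expansion of the covariance is thus read off from the paths instead of differentiating the
  covariance function.\<close>

lemma variogram_lim:
 assumes m: "m < m0" and x: "x \<in> cbox 0 1"
  and y: "\<And>n. y n \<in> cbox 0 1" "y \<longlonglongrightarrow> x" and z: "\<And>n. z n \<in> cbox 0 1" "z \<longlonglongrightarrow> x"
  and a: "(\<lambda>n. a n *\<^sub>R (y n - z n)) \<longlonglongrightarrow> v"
 shows "(\<lambda>n. (a n)\<^sup>2 * (1 - r (\<psi> m (y n)) (\<psi> m (z n)))) \<longlonglongrightarrow> quad m x v / 2"
proof -
 let ?Y = "\<lambda>n w. a n * (X (\<psi> m (y n)) w - X (\<psi> m (z n)) w)"
 have D: "(\<lambda>w. X (\<psi> m (y n)) w - X (\<psi> m (z n)) w) \<in> H" for n using m y z by (intro H_diff X_\<psi>_H)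
 have "(\<lambda>n. cov (?Y n) (?Y n)) \<longlonglongrightarrow> quad m x v" unfolding quad_def
 proof (rule cov_limit)
  show "?Y n \<in> H" for n using D by (rule H_scale)
  show "(\<lambda>w. G m x w \<bullet> v) \<in> H" using m x by (rule G_H)
  show "(\<lambda>n. ?Y n w) \<longlonglongrightarrow> G m x w \<bullet> v" if "w \<in> space M" for w using increment_lim[OF m x that y z a] .
 qed
 moreover have "cov (?Y n) (?Y n) = (a n)\<^sup>2 * (2 * (1 - r (\<psi> m (y n)) (\<psi> m (z n))))" for n
 proof -
  have "cov (?Y n) (?Y n) = a n * (a n * cov (\<lambda>w. X (\<psi> m (y n)) w - X (\<psi> m (z n)) w) (\<lambda>w. X (\<psi> m (y n)) w - X (\<psi> m (z n)) w))"
   unfolding cov_scale by (subst cov_commute) (simp add: cov_scale)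
  also have "\<dots> = (a n)\<^sup>2 * (2 * (1 - r (\<psi> m (y n)) (\<psi> m (z n))))"
   using m y z by (simp add: cov_diff_self X_\<psi>_H X_var \<psi>_I power2_eq_square)
  finally show ?thesis .
 qed
 ultimately have "(\<lambda>n. (a n)\<^sup>2 * (2 * (1 - r (\<psi> m (y n)) (\<psi> m (z n))))) \<longlonglongrightarrow> quad m x v" by simp
 from tendsto_divide[OF this tendsto_const[of 2]] show ?thesis by (simp add: right_diff_distrib diff_divide_distrib)
qed

text \<open>With unit variances the covariance is determined by the variance of the difference, to
  which \<open>cov_limit\<close> applies.\<close>

lemma r_lim:
 assumes "\<And>n::nat. s n \<in> I" "\<And>n. t n \<in> I" "s \<longlonglongrightarrow> a" "t \<longlonglongrightarrow> b" "a \<in> I" "b \<in> I"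
 shows "(\<lambda>n. r (s n) (t n)) \<longlonglongrightarrow> r a b"
proof -
 have path: "(\<lambda>n. X (s n) w) \<longlonglongrightarrow> X a w" if "\<And>n::nat. s n \<in> I" "s \<longlonglongrightarrow> a" "a \<in> I" "w \<in> space M" for s a w
  using X_cont[OF that(4)] that unfolding continuous_on_sequentially comp_def by blast
 have "(\<lambda>n. cov (\<lambda>w. X (s n) w - X (t n) w) (\<lambda>w. X (s n) w - X (t n) w)) \<longlonglongrightarrow> cov (\<lambda>w. X a w - X b w) (\<lambda>w. X a w - X b w)"
  using assms by (intro cov_limit H_diff X_H tendsto_diff path) auto
 hence lim: "(\<lambda>n. 2 - 2 * r (s n) (t n)) \<longlonglongrightarrow> 2 - 2 * r a b" using assms by (simp add: cov_diff_self X_H X_var)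
 have "(\<lambda>n. (2 - (2 - 2 * r (s n) (t n))) / 2) \<longlonglongrightarrow> (2 - (2 - 2 * r a b)) / 2"
  by (rule tendsto_divide[OF tendsto_diff[OF tendsto_const lim] tendsto_const]) simp
 moreover have "(2 - (2 - 2 * x)) / 2 = x" for x :: real by simp
 ultimately show ?thesis by (simp only:)
qed

text \<open>Pairs of points together with the directions joining them range over a compact set.
  Along a subsequence either the two limits differ, where \<open>r < 1\<close> by injectivity of the
  chart, or they agree and the ratio tends to half the quadratic form in the limiting direction.
  Both values are positive.\<close>

lemma variogram_ratio:
 assumes m: "m < m0" and xy: "\<And>n::nat. x n \<in> cbox 0 1" "\<And>n. y n \<in> cbox 0 1" "\<And>n. x n \<noteq> y n"
 obtains f c where "strict_mono f" "0 < c" "(\<lambda>n. (1 - r (\<psi> m (x (f n))) (\<psi> m (y (f n)))) / (norm (x (f n) - y (f n)))\<^sup>2) \<longlonglongrightarrow> c"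
proof -
 define d where "d n = (1 / norm (x n - y n)) *\<^sub>R (x n - y n)" for n
 have "seq_compact (cbox 0 1 \<times> cbox 0 1 \<times> sphere 0 1 :: ((real ^ 'd) \<times> (real ^ 'd) \<times> (real ^ 'd)) set)" by (intro compact_imp_seq_compact compact_Times) auto
 moreover have "\<forall>n. (x n, y n, d n) \<in> cbox 0 1 \<times> cbox 0 1 \<times> sphere 0 1" using xy by (simp add: d_def)
 ultimately obtain L f where L: "L \<in> cbox 0 1 \<times> cbox 0 1 \<times> sphere 0 1" and f: "strict_mono f" and lim: "((\<lambda>n. (x n, y n, d n)) \<circ> f) \<longlonglongrightarrow> L"
  by (rule seq_compactE)
 obtain a b v where Leq: "L = (a, b, v)" by (cases L)
 have ab: "a \<in> cbox 0 1" "b \<in> cbox 0 1" "v \<noteq> 0" using L Leq by auto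
 have xl: "(\<lambda>n. x (f n)) \<longlonglongrightarrow> a" using tendsto_fst[OF lim] by (simp add: Leq comp_def)
 have yl: "(\<lambda>n. y (f n)) \<longlonglongrightarrow> b" using tendsto_fst[OF tendsto_snd[OF lim]] by (simp add: Leq comp_def)
 have dl: "(\<lambda>n. (1 / norm (x (f n) - y (f n))) *\<^sub>R (x (f n) - y (f n))) \<longlonglongrightarrow> v"
  using tendsto_snd[OF tendsto_snd[OF lim]] by (simp add: Leq comp_def d_def)
 show ?thesis
 proof (cases "a = b")
  case False
  have *: "(\<lambda>n. \<psi> m (z n)) \<longlonglongrightarrow> \<psi> m l" if "\<And>n. z n \<in> cbox 0 1" "l \<in> cbox 0 1" "z \<longlonglongrightarrow> l" for z l
   using \<psi>_cont[OF m] that unfolding continuous_on_sequentially comp_def by blast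
  have "(\<lambda>n. (1 - r (\<psi> m (x (f n))) (\<psi> m (y (f n)))) / (norm (x (f n) - y (f n)))\<^sup>2) \<longlonglongrightarrow> (1 - r (\<psi> m a) (\<psi> m b)) / (norm (a - b))\<^sup>2"
   using m xy ab False by (intro tendsto_intros r_lim * xl yl \<psi>_I) auto
  moreover have "\<psi> m a \<noteq> \<psi> m b" using False \<psi>_inj[OF m] ab by (auto dest: inj_onD)
  hence "0 < (1 - r (\<psi> m a) (\<psi> m b)) / (norm (a - b))\<^sup>2"
   using X_cov[of "\<psi> m a" "\<psi> m b"] m ab \<psi>_I False by (intro divide_pos_pos) auto
  ultimately show ?thesis using f by (intro that)
 next
  case True
  have "(\<lambda>n. (1 / norm (x (f n) - y (f n)))\<^sup>2 * (1 - r (\<psi> m (x (f n))) (\<psi> m (y (f n))))) \<longlonglongrightarrow> quad m a v / 2"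
   using xy yl by (intro variogram_lim[OF m ab(1) _ xl _ _ dl]) (auto simp: True)
  moreover have "0 < quad m a v / 2" using G_nondeg[OF m ab(1,3)] by (simp add: quad_def)
  ultimately show ?thesis using f by (intro that[of f "quad m a v / 2"]) (simp_all add: power_divide)
 qed
qed

text \<open>If no such constants existed, there would be pairs whose ratio leaves the interval from
  \<open>1 / (n + 1)\<close> to \<open>n + 1\<close> for each \<open>n\<close>, contradicting the
  subsequence with a positive finite limit.\<close>

lemma variogram_bounds:
 assumes m: "m < m0"
 obtains c C where "0 < c" "0 < C" "\<And>x y. x \<in> cbox 0 1 \<Longrightarrow> y \<in> cbox 0 1 \<Longrightarrow>
  c * (norm (x - y))\<^sup>2 \<le> 1 - r (\<psi> m x) (\<psi> m y) \<and> 1 - r (\<psi> m x) (\<psi> m y) \<le> C * (norm (x - y))\<^sup>2"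
proof -
 let ?q = "\<lambda>x y. (1 - r (\<psi> m x) (\<psi> m y)) / (norm (x - y))\<^sup>2"
 have "\<exists>n::nat. \<forall>x\<in>cbox 0 1. \<forall>y\<in>cbox 0 1. x \<noteq> y \<longrightarrow> 1 / (real n + 1) \<le> ?q x y \<and> ?q x y \<le> real n + 1"
 proof (rule ccontr)
  assume "\<not> ?thesis"
  then obtain x y where xy: "\<And>n. x n \<in> cbox 0 1" "\<And>n. y n \<in> cbox 0 1" "\<And>n. x n \<noteq> y n"
   and neg: "\<And>n. \<not> (1 / (real n + 1) \<le> ?q (x n) (y n) \<and> ?q (x n) (y n) \<le> real n + 1)" by metis
  obtain f c where f: "strict_mono f" and c: "0 < c" "(\<lambda>n. ?q (x (f n)) (y (f n))) \<longlonglongrightarrow> c"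
   by (rule variogram_ratio[OF m xy])
  have "eventually (\<lambda>n. c / 2 < ?q (x (f n)) (y (f n))) sequentially" "eventually (\<lambda>n. ?q (x (f n)) (y (f n)) < c + 1) sequentially"
   using c(1) by (intro order_tendstoD[OF c(2)]; simp)+
  moreover have "eventually (\<lambda>n. 1 / (real (f n) + 1) < c / 2) sequentially" "eventually (\<lambda>n. c + 1 < real (f n) + 1) sequentially"
   using c(1) by (auto intro!: eventually_compose_filterlim[OF _ filterlim_subseq[OF f]]) (real_asymp | simp)+
  ultimately have "eventually (\<lambda>n. False) sequentially" by eventually_elim (meson neg less_imp_le less_trans)
  thus False by simp
 qed
 then obtain n :: nat where n: "\<And>x y. x \<in> cbox 0 1 \<Longrightarrow> y \<in> cbox 0 1 \<Longrightarrow> x \<noteq> y \<Longrightarrow> 1 / (real n + 1) \<le> ?q x y \<and> ?q x y \<le> real n + 1" by blast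
 show ?thesis
 proof (rule that[of "1 / (real n + 1)" "real n + 1"])
  fix x y :: "real ^ 'd" assume xy: "x \<in> cbox 0 1" "y \<in> cbox 0 1"
  show "1 / (real n + 1) * (norm (x - y))\<^sup>2 \<le> 1 - r (\<psi> m x) (\<psi> m y) \<and> 1 - r (\<psi> m x) (\<psi> m y) \<le> (real n + 1) * (norm (x - y))\<^sup>2"
  proof (cases "x = y")
   case True thus ?thesis using X_var[OF \<psi>_I[OF m xy(2)]] by simp
  next
   case False
   hence "0 < (norm (x - y))\<^sup>2" by simp
   thus ?thesis using n[OF xy False] by (simp only: pos_le_divide_eq pos_divide_le_eq)
  qed
 qed auto
qed

lemma variogram_disjoint:
 assumes AB: "compact A" "compact B" "A \<subseteq> I" "B \<subseteq> I" "A \<inter> B = {}"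
 obtains c where "0 < c" "\<And>s t. s \<in> A \<Longrightarrow> t \<in> B \<Longrightarrow> c \<le> 1 - r s t"
proof (cases "A = {} \<or> B = {}")
 case True thus ?thesis using that[of 1] by auto
next
 case False
 have "continuous_on (A \<times> B) (\<lambda>p. 1 - r (fst p) (snd p))"
 proof (rule continuous_on_sequentiallyI)
  fix u a assume u: "\<forall>n. u n \<in> A \<times> B" and a: "a \<in> A \<times> B" and l: "u \<longlonglongrightarrow> a"
  show "(\<lambda>n. 1 - r (fst (u n)) (snd (u n))) \<longlonglongrightarrow> 1 - r (fst a) (snd a)"
  proof (intro tendsto_diff tendsto_const r_lim tendsto_fst tendsto_snd l)
   show "fst (u n) \<in> I" "snd (u n) \<in> I" for n using u[rule_format, of n] AB by (auto simp: mem_Times_iff)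
   show "fst a \<in> I" "snd a \<in> I" using a AB by (auto simp: mem_Times_iff)
  qed
 qed
 moreover have "compact (A \<times> B)" using AB by (intro compact_Times)
 moreover have "A \<times> B \<noteq> {}" using False by simp
 ultimately have "\<exists>p\<in>A \<times> B. \<forall>q\<in>A \<times> B. 1 - r (fst p) (snd p) \<le> 1 - r (fst q) (snd q)"
  by (intro continuous_attains_inf)
 then obtain p where p: "p \<in> A \<times> B" "\<forall>q\<in>A \<times> B. 1 - r (fst p) (snd p) \<le> 1 - r (fst q) (snd q)" by blast
 have "r (fst p) (snd p) < 1"
 proof (rule X_cov)
  have "fst p \<in> A" "snd p \<in> B" using p(1) by (auto simp: mem_Times_iff)
  thus "fst p \<in> I" "snd p \<in> I" "fst p \<noteq> snd p" using AB(3-5) by auto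
 qed
 moreover have "1 - r (fst p) (snd p) \<le> 1 - r s t" if "s \<in> A" "t \<in> B" for s t using p(2)[rule_format, of "(s, t)"] that by simp
 ultimately show ?thesis by (intro that[of "1 - r (fst p) (snd p)"]) auto
qed

end

section \<open>Maxima over a lattice\<close>

lemma tendsto_zero_of_mult_at_top:
 fixes u h :: "nat \<Rightarrow> real"
 assumes u: "filterlim u at_top sequentially" and "(\<lambda>n. u n * h n) \<longlonglongrightarrow> c"
 shows "h \<longlonglongrightarrow> 0"
proof -
 have "(\<lambda>n. (u n * h n) * inverse (u n)) \<longlonglongrightarrow> c * 0" by (intro tendsto_mult assms tendsto_inverse_0_at_top)
 moreover have "eventually (\<lambda>n. 0 < u n) sequentially" using u by (simp add: filterlim_at_top_dense)
 hence "eventually (\<lambda>n. (u n * h n) * inverse (u n) = h n) sequentially" by eventually_elim simp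
 ultimately show ?thesis by (simp add: tendsto_cong)
qed

context gaussian_field
begin

text \<open>The residual variance is at most \<open>2 * (1 - r t s)\<close>, so violating the
  threshold costs a Gaussian factor in \<open>u\<close> times the distance; this discards the
  competitors far from a candidate maximizer.\<close>

lemma residual_tail:
 assumes st: "s \<in> I" "t \<in> I" and u: "0 \<le> u"
 shows "prob {w\<in>space M. u * (1 - r t s) < X t w - r t s * X s w} \<le> exp (- (u\<^sup>2 * (1 - r t s) / 4))"
proof (cases "r t s = 1")
 case False
 hence r1: "0 < 1 - r t s" using r_le_1[OF st(2,1)] by simp
 have "prob {w\<in>space M. u * (1 - r t s) < X t w - r t s * X s w} \<le> exp (- (u * (1 - r t s))\<^sup>2 / (2 * (2 * (1 - r t s))))"
  using st u r1 by (intro cgauss_tail[OF H_cgauss[OF Z_H] cov_Z_Z_le]) auto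
 also have "- (u * (1 - r t s))\<^sup>2 / (2 * (2 * (1 - r t s))) = - (u\<^sup>2 * (1 - r t s) / 4)" using r1 by (simp add: power2_eq_square divide_simps)
 finally show ?thesis .
qed auto

end

context gaussian_charts
begin

text \<open>The maximizer conditions at the lattice neighbours in \<open>F\<close>, multiplied by
  \<open>u\<close>, in the limit: the rescaled increment tends to
  \<open>\<delta> * (G m y w \<bullet> ivec k)\<close>, and \<open>u\<^sup>2 * (1 - r)\<close> to
  half of \<open>quad m y (\<delta> *\<^sub>R ivec k)\<close>.\<close>

definition lim_event :: "nat \<Rightarrow> real ^ 'd \<Rightarrow> real \<Rightarrow> (int ^ 'd) set \<Rightarrow> real" where
 "lim_event m y \<delta> F = prob {w\<in>space M. \<forall>k\<in>F. \<delta> * (G m y w \<bullet> ivec k) \<le> \<delta>\<^sup>2 * quad m y (ivec k) / 2}"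

text \<open>Limit of the probability that a lattice point is the maximizer among all lattice points:
 the gradient has to lie in a multiple of the Voronoi cell of the lattice for the metric \<open>quad m y\<close>.\<close>

abbreviation cell_prob :: "nat \<Rightarrow> real ^ 'd \<Rightarrow> real \<Rightarrow> real" where
 "cell_prob m y \<delta> \<equiv> lim_event m y \<delta> UNIV"

lemma G_measurable: "m < m0 \<Longrightarrow> x \<in> cbox 0 1 \<Longrightarrow> (\<lambda>w. G m x w \<bullet> v) \<in> borel_measurable M"
 by (rule H_measurable[OF G_H])

lemma lim_event_measurable:
 "m < m0 \<Longrightarrow> y \<in> cbox 0 1 \<Longrightarrow> {w\<in>space M. \<forall>k\<in>F. \<delta> * (G m y w \<bullet> ivec k) \<le> \<delta>\<^sup>2 * quad m y (ivec k) / 2} \<in> sets M"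
proof -
 assume "m < m0" "y \<in> cbox 0 1"
 note [measurable] = G_measurable[OF this]
 have "countable F" by (rule countableI_type)
 thus ?thesis by measurable
qed

lemma quad_scale: "quad m y (a *\<^sub>R v) = a\<^sup>2 * quad m y v"
proof -
 have "quad m y (a *\<^sub>R v) = cov (\<lambda>w. a * (G m y w \<bullet> v)) (\<lambda>w. a * (G m y w \<bullet> v))" by (simp add: quad_def)
 also have "\<dots> = a * (a * quad m y v)" unfolding cov_scale quad_def by (subst cov_commute) (simp add: cov_scale)
 finally show ?thesis by (simp add: power2_eq_square)
qed

text \<open>The condition at \<open>k = 0\<close> is trivially true, but both of its sides vanish
  identically, so its boundary is not a null event. It is left out of the finite sets for the sake
  of \<open>prob_limit\<close>.\<close>

lemma lim_event_approx:
 assumes my: "m < m0" "y \<in> cbox 0 1" and F0: "finite F0" and e: "0 < e"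
 obtains F where "finite F" "0 \<notin> F" "F0 - {0} \<subseteq> F" "lim_event m y \<delta> F < cell_prob m y \<delta> + e"
proof -
 let ?F = "\<lambda>n::nat. F0 \<union> from_nat ` {..n} - {0}"
 let ?E = "\<lambda>F. {w\<in>space M. \<forall>k\<in>F. \<delta> * (G m y w \<bullet> ivec k) \<le> \<delta>\<^sup>2 * quad m y (ivec k) / 2}"
 have "(\<lambda>n. prob (?E (?F n))) \<longlonglongrightarrow> prob (\<Inter>n. ?E (?F n))"
 proof (rule finite_Lim_measure_decseq)
  show "range (\<lambda>n. ?E (?F n)) \<subseteq> sets M" using lim_event_measurable[OF my] by blast
  have "?F i \<subseteq> ?F j" if "i \<le> j" for i j using that by fastforce
  thus "decseq (\<lambda>n. ?E (?F n))" unfolding decseq_def by blast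
 qed
 also have "(\<Inter>n. ?E (?F n)) = ?E UNIV"
 proof -
  have "w \<in> ?E UNIV" if w: "w \<in> (\<Inter>n. ?E (?F n))" for w
  proof -
   have "\<delta> * (G m y w \<bullet> ivec k) \<le> \<delta>\<^sup>2 * quad m y (ivec k) / 2" for k
   proof (cases "k = 0")
    case True
    moreover have "quad m y 0 = 0" "ivec 0 = (0 :: real ^ 'd)" by (simp_all add: quad_def cov_def flip: zero_vec_def)
    ultimately show ?thesis by simp
   next
    case False
    hence "k \<in> ?F (to_nat k)" by (auto intro: image_eqI[of _ _ "to_nat k"])
    thus ?thesis using w by blast
   qed
   thus ?thesis using w by blast
  qed
  thus ?thesis by blast
 qed
 finally have "(\<lambda>n. lim_event m y \<delta> (?F n)) \<longlonglongrightarrow> cell_prob m y \<delta>" by (simp only: lim_event_def)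
 from order_tendstoD(2)[OF this, of "cell_prob m y \<delta> + e"] e
 obtain n where "lim_event m y \<delta> (?F n) < cell_prob m y \<delta> + e" by (auto simp: eventually_sequentially)
 thus ?thesis using F0 by (intro that[of "?F n"]) auto
qed

context
 fixes m :: nat and y :: "real ^ 'd" and x :: "nat \<Rightarrow> real ^ 'd" and u h :: "nat \<Rightarrow> real" and \<delta> :: real
 assumes m: "m < m0" and y: "y \<in> cbox 0 1" and x: "\<And>n. x n \<in> cbox 0 1" "x \<longlonglongrightarrow> y"
  and u: "filterlim u at_top sequentially" and h: "\<And>n. 0 < h n" and uh: "(\<lambda>n. u n * h n) \<longlonglongrightarrow> \<delta>" and \<delta>: "0 < \<delta>"
begin

definition pt :: "int ^ 'd \<Rightarrow> nat \<Rightarrow> real ^ 'd" where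
 "pt k n = x n + h n *\<^sub>R ivec k"

definition local_event :: "(int ^ 'd) set \<Rightarrow> nat \<Rightarrow> 'w set" where
 "local_event F n = {w\<in>space M. \<forall>k\<in>F. X (\<psi> m (pt k n)) w - r (\<psi> m (pt k n)) (\<psi> m (x n)) * X (\<psi> m (x n)) w
    \<le> u n * (1 - r (\<psi> m (pt k n)) (\<psi> m (x n)))}"

lemma u_pos: "eventually (\<lambda>n. 0 < u n) sequentially"
 using u by (simp add: filterlim_at_top_dense)

lemma h_lim: "h \<longlonglongrightarrow> 0"
 using u uh by (rule tendsto_zero_of_mult_at_top)

lemma pt_lim: "pt k \<longlonglongrightarrow> y"
proof -
 have "(\<lambda>n. x n + h n *\<^sub>R ivec k) \<longlonglongrightarrow> y + 0 *\<^sub>R ivec k" by (intro tendsto_intros x h_lim)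
 thus ?thesis by (simp add: pt_def[abs_def])
qed

lemma local_event_limit:
 assumes F: "finite F" "0 \<notin> F" and Q: "\<And>k. k \<in> F \<Longrightarrow> eventually (\<lambda>n. pt k n \<in> cbox 0 1) sequentially"
 shows "(\<lambda>n. prob (local_event F n)) \<longlonglongrightarrow> lim_event m y \<delta> F"
proof -
 \<comment> \<open>The limit lemmas ask for points of the cube at every index; the finitely many
   exceptions are replaced by \<open>x n\<close>.\<close>
 define p where "p k n = (if pt k n \<in> cbox 0 1 then pt k n else x n)" for k n
 have pQ: "p k n \<in> cbox 0 1" for k n using x by (simp add: p_def)
 have peq: "eventually (\<lambda>n. p k n = pt k n) sequentially" if "k \<in> F" for k using Q[OF that] by eventually_elim (simp add: p_def)
 have plim: "p k \<longlonglongrightarrow> y" if "k \<in> F" for k using pt_lim[of k] peq[OF that] by (simp add: tendsto_cong)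
 have dir: "(\<lambda>n. u n *\<^sub>R (p k n - x n)) \<longlonglongrightarrow> \<delta> *\<^sub>R ivec k" if "k \<in> F" for k
 proof (rule Lim_transform_eventually)
  show "(\<lambda>n. (u n * h n) *\<^sub>R ivec k) \<longlonglongrightarrow> \<delta> *\<^sub>R (ivec k :: real ^ 'd)" by (intro tendsto_intros uh)
  show "eventually (\<lambda>n. (u n * h n) *\<^sub>R ivec k = u n *\<^sub>R (p k n - x n)) sequentially"
   using peq[OF that] by eventually_elim (simp add: pt_def)
 qed
 define R where "R k n = r (\<psi> m (p k n)) (\<psi> m (x n))" for k n
 let ?Z = "\<lambda>k n w. X (\<psi> m (p k n)) w - R k n * X (\<psi> m (x n)) w"
 have vlim: "(\<lambda>n. (u n)\<^sup>2 * (1 - R k n)) \<longlonglongrightarrow> \<delta>\<^sup>2 * quad m y (ivec k) / 2" if "k \<in> F" for k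
  using variogram_lim[OF m y pQ plim[OF that] x dir[OF that]] by (simp add: R_def quad_scale)
 have ulim: "(\<lambda>n. u n * (1 - R k n)) \<longlonglongrightarrow> 0" if "k \<in> F" for k
  using vlim[OF that] by (intro tendsto_zero_of_mult_at_top[OF u]) (simp add: power2_eq_square mult.assoc)
 have "(\<lambda>n. prob {w\<in>space M. \<forall>k\<in>F. u n * ?Z k n w \<le> (u n)\<^sup>2 * (1 - R k n)})
   \<longlonglongrightarrow> lim_event m y \<delta> F"
  unfolding lim_event_def
 proof (rule prob_limit[OF F(1)])
  fix k assume k: "k \<in> F"
  have "X (\<psi> m (p k n)) \<in> borel_measurable M" "X (\<psi> m (x n)) \<in> borel_measurable M" for n
   using m pQ x by (auto intro!: X_measurable \<psi>_I)
  note [measurable] = this G_measurable[OF m y]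
  show "(\<lambda>w. u n * ?Z k n w) \<in> borel_measurable M" for n by measurable
  show "(\<lambda>w. \<delta> * (G m y w \<bullet> ivec k)) \<in> borel_measurable M" by measurable
  show "(\<lambda>n. (u n)\<^sup>2 * (1 - R k n)) \<longlonglongrightarrow> \<delta>\<^sup>2 * quad m y (ivec k) / 2" using k by (rule vlim)
  have "0 < quad m y (\<delta> *\<^sub>R ivec k)" unfolding quad_def using k F \<delta> by (intro G_nondeg m y) (auto simp: ivec_eq_0)
  hence "prob {w\<in>space M. G m y w \<bullet> (\<delta> *\<^sub>R ivec k) = \<delta>\<^sup>2 * quad m y (ivec k) / 2} = 0"
   unfolding quad_def by (rule cgauss_eq_prob[OF H_cgauss[OF G_H[OF m y]]])
  thus "prob {w\<in>space M. \<delta> * (G m y w \<bullet> ivec k) = \<delta>\<^sup>2 * quad m y (ivec k) / 2} = 0" by simp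
 next
  fix k w assume k: "k \<in> F" and w: "w \<in> space M"
  \<comment> \<open>The rescaled residual is the rescaled increment plus
    \<open>u * (1 - R k n)\<close> times the field at \<open>x n\<close>; the second summand
    vanishes because \<open>u\<^sup>2 * (1 - R k n)\<close> stays bounded.\<close>
  have "(\<lambda>n. u n * (X (\<psi> m (p k n)) w - X (\<psi> m (x n)) w) + u n * (1 - R k n) * X (\<psi> m (x n)) w)
    \<longlonglongrightarrow> G m y w \<bullet> (\<delta> *\<^sub>R ivec k) + 0 * X (\<psi> m y) w"
   by (intro tendsto_add tendsto_mult[OF ulim[OF k]] increment_lim[OF m y w pQ plim[OF k] x dir[OF k]] X_\<psi>_lim[OF m w x(1) y x(2)])
  thus "(\<lambda>n. u n * ?Z k n w) \<longlonglongrightarrow> \<delta> * (G m y w \<bullet> ivec k)" by (simp add: algebra_simps)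
 qed
 moreover have "eventually (\<lambda>n. prob {w\<in>space M. \<forall>k\<in>F. u n * ?Z k n w \<le> (u n)\<^sup>2 * (1 - R k n)}
   = prob (local_event F n)) sequentially"
 proof -
  have "eventually (\<lambda>n. \<forall>k\<in>F. p k n = pt k n) sequentially" using F peq by (intro eventually_ball_finite) auto
  thus ?thesis using u_pos
  proof eventually_elim
   case (elim n)
   have "(u n * ?Z k n w \<le> (u n)\<^sup>2 * (1 - R k n)) \<longleftrightarrow>
     X (\<psi> m (pt k n)) w - r (\<psi> m (pt k n)) (\<psi> m (x n)) * X (\<psi> m (x n)) w \<le> u n * (1 - r (\<psi> m (pt k n)) (\<psi> m (x n)))"
    if "k \<in> F" for k w
    using elim that by (simp add: R_def power2_eq_square mult.assoc)
   thus ?case unfolding local_event_def by (intro arg_cong[where f=prob] Collect_cong conj_cong ball_cong refl)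
  qed
 qed
 ultimately show ?thesis by (simp add: tendsto_cong)
qed

text \<open>\<open>K n\<close> indexes the lattice points in the same chart, \<open>R n\<close>
  contains the net points of the other charts. Keeping only the finitely many conditions in
  \<open>F\<close> gives the upper bound. The other lattice points together cost at most a tail of a
  convergent Gaussian lattice sum. The points of \<open>R n\<close> are polynomially many in
  \<open>u\<close>, with correlations bounded away from 1, so their total cost vanishes.\<close>

lemma local_limit:
 assumes T: "\<And>n. finite (T n)" "\<And>n. T n \<subseteq> I" "\<And>n. T n \<subseteq> \<psi> m ` (\<lambda>k. pt k n) ` K n \<union> R n"
  and K: "\<And>n. finite (K n)" "\<And>n k. k \<in> K n \<Longrightarrow> pt k n \<in> cbox 0 1"
  and R: "\<And>n. finite (R n)" "\<And>n. R n \<subseteq> I" "\<And>n t. t \<in> R n \<Longrightarrow> c' \<le> 1 - r t (\<psi> m (x n))" "0 < c'"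
   "eventually (\<lambda>n. real (card (R n)) \<le> B * u n ^ D) sequentially"
  and near: "\<And>k. eventually (\<lambda>n. pt k n \<in> cbox 0 1 \<and> \<psi> m (pt k n) \<in> T n) sequentially"
 shows "(\<lambda>n. argmax_prob (T n) (\<psi> m (x n)) (u n)) \<longlonglongrightarrow> cell_prob m y \<delta>"
proof -
 obtain c where c: "0 < c" "\<And>x y. x \<in> cbox 0 1 \<Longrightarrow> y \<in> cbox 0 1 \<Longrightarrow> c * (norm (x - y))\<^sup>2 \<le> 1 - r (\<psi> m x) (\<psi> m y)"
  using variogram_bounds[OF m] by metis
 \<comment> \<open>\<open>residual_tail\<close> and the lower variogram bound give the exponent
   \<open>c * (u * h)\<^sup>2 / 4\<close> times the squared norm of \<open>k\<close>; eventually
   \<open>(u * h)\<^sup>2\<close> exceeds half its limit, hence the 8.\<close>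
 define a where "a = c * \<delta>\<^sup>2 / 8"
 have a: "a > 0" using c \<delta> by (simp add: a_def)
 define w where "w k = exp (- a * (norm (ivec k :: real ^ 'd))\<^sup>2)" for k :: "int ^ 'd"
 have wsum: "w summable_on UNIV" unfolding w_def[abs_def] using a by (rule gaussian_lattice_summable)
 have w0: "0 \<le> w k" for k by (simp add: w_def)
 have xI: "\<psi> m (x n) \<in> I" for n using m x \<psi>_I by auto
 define bad where "bad t n = {\<omega>\<in>space M. u n * (1 - r t (\<psi> m (x n))) < X t \<omega> - r t (\<psi> m (x n)) * X (\<psi> m (x n)) \<omega>}" for t n
 have bad_meas: "bad t n \<in> sets M" if "t \<in> I" for t n
 proof -
  note [measurable] = X_measurable[OF that] X_measurable[OF xI]
  show ?thesis unfolding bad_def by measurable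
 qed
 have bad_prob: "prob (bad t n) \<le> exp (- ((u n)\<^sup>2 * (1 - r t (\<psi> m (x n))) / 4))" if "t \<in> I" "0 < u n" for t n
  unfolding bad_def using that xI by (intro residual_tail) auto
 have "(\<lambda>n. (u n * h n)\<^sup>2) \<longlonglongrightarrow> \<delta>\<^sup>2" by (intro tendsto_intros uh)
 hence uh2: "eventually (\<lambda>n. \<delta>\<^sup>2 / 2 < (u n * h n)\<^sup>2) sequentially" using \<delta> by (intro order_tendstoD) auto
 show ?thesis
 proof (rule LIMSEQ_I)
  fix \<epsilon> :: real assume "0 < \<epsilon>"
  define e where "e = \<epsilon> / 4"
  have e: "e > 0" using \<open>0 < \<epsilon>\<close> by (simp add: e_def)
  obtain F0 where F0: "finite F0" "\<And>A. finite A \<Longrightarrow> A \<inter> F0 = {} \<Longrightarrow> sum w A \<le> e"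
   using summable_on_small_tail[OF wsum w0 e] by metis
  obtain F where F: "finite F" "0 \<notin> F" "F0 - {0} \<subseteq> F" and limF: "lim_event m y \<delta> F < cell_prob m y \<delta> + e"
   by (rule lim_event_approx[OF m y F0(1) e])
  have "(\<lambda>n. prob (local_event F n)) \<longlonglongrightarrow> lim_event m y \<delta> F"
   by (intro local_event_limit F(1,2) eventually_mono[OF near]) auto
  hence ev1: "eventually (\<lambda>n. \<bar>prob (local_event F n) - lim_event m y \<delta> F\<bar> < e) sequentially"
   using e by (auto simp: tendsto_iff dist_real_def)
  have ev2: "eventually (\<lambda>n. \<forall>k\<in>F. pt k n \<in> cbox 0 1 \<and> \<psi> m (pt k n) \<in> T n) sequentially"
   using F near by (intro eventually_ball_finite) auto
  have "((\<lambda>v. B * v ^ D * exp (- (v\<^sup>2 * c' / 4))) \<longlongrightarrow> 0) at_top" using R(4) by real_asymp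
  hence "((\<lambda>n. B * u n ^ D * exp (- ((u n)\<^sup>2 * c' / 4))) \<longlonglongrightarrow> 0)" by (rule filterlim_compose[OF _ u])
  hence ev3: "eventually (\<lambda>n. B * u n ^ D * exp (- ((u n)\<^sup>2 * c' / 4)) < e) sequentially" using e by (rule order_tendstoD)
  have limF': "cell_prob m y \<delta> \<le> lim_event m y \<delta> F"
   unfolding lim_event_def using lim_event_measurable[OF m y] by (intro finite_measure_mono) auto
  have "eventually (\<lambda>n. norm (argmax_prob (T n) (\<psi> m (x n)) (u n) - cell_prob m y \<delta>) < \<epsilon>) sequentially"
   using ev1 ev2 ev3 u_pos uh2 R(5)
  proof eventually_elim
   case (elim n)
   have lm: "local_event F n \<in> sets M"
   proof -
    have [measurable]: "k \<in> F \<Longrightarrow> X (\<psi> m (pt k n)) \<in> borel_measurable M" "X (\<psi> m (x n)) \<in> borel_measurable M" for k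
     using elim m x by (auto intro!: X_measurable \<psi>_I)
    show ?thesis unfolding local_event_def using F by measurable
   qed
   let ?A = "{\<omega>\<in>space M. \<forall>j\<in>T n. X j \<omega> - r j (\<psi> m (x n)) * X (\<psi> m (x n)) \<omega> \<le> u n * (1 - r j (\<psi> m (x n)))}"
   let ?B = "?A \<union> (\<Union>t\<in>R n. bad t n)"
   have am: "?A \<in> sets M" using T xI by (intro argmax_event_measurable) auto
   have up: "argmax_prob (T n) (\<psi> m (x n)) (u n) \<le> prob (local_event F n)"
    unfolding argmax_prob_def using elim(2) lm by (intro finite_measure_mono) (auto simp: local_event_def)
   define K' where "K' = K n - insert 0 F"
   have K': "finite K'" "K' \<inter> F0 = {}" "\<And>k. k \<in> K' \<Longrightarrow> k \<in> K n" using K F(3) by (auto simp: K'_def)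
   have KI: "\<psi> m (pt k n) \<in> I" if "k \<in> K n" for k using K(2)[OF that] m by (intro \<psi>_I)
   have "prob (local_event F n) \<le> prob ?B + sum w K'"
   proof (rule prob_union_bound[where C="\<lambda>k. bad (\<psi> m (pt k n)) n"])
    show "?B \<in> sets M" using am R by (intro sets.Un sets.finite_UN bad_meas) auto
    show "local_event F n \<subseteq> ?B \<union> (\<Union>k\<in>K'. bad (\<psi> m (pt k n)) n)"
    proof (rule subsetI, rule ccontr)
     fix \<omega> assume wl: "\<omega> \<in> local_event F n" and neg: "\<omega> \<notin> ?B \<union> (\<Union>k\<in>K'. bad (\<psi> m (pt k n)) n)"
     have ws: "\<omega> \<in> space M" using wl by (simp add: local_event_def)
     obtain j where j: "j \<in> T n" "\<omega> \<in> bad j n" using neg ws by (auto simp: bad_def not_le)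
     then obtain k where k: "k \<in> K n" "j = \<psi> m (pt k n)" using T(3) neg by blast
     have "pt 0 n = x n" by (simp add: pt_def vec_eq_iff)
     hence "k \<noteq> 0" using k j X_var[OF xI] by (auto simp: bad_def)
     moreover have "k \<notin> F" using k j wl by (force simp: bad_def local_event_def)
     ultimately show False using k j neg by (auto simp: K'_def)
    qed
    fix k assume "k \<in> K'"
    hence k: "k \<in> K n" by (rule K'(3))
    show "bad (\<psi> m (pt k n)) n \<in> sets M" using KI[OF k] by (rule bad_meas)
    have "a \<le> c * (u n * h n)\<^sup>2 / 4" using elim(5) c(1) by (simp add: a_def)
    hence "a * (norm (ivec k :: real ^ 'd))\<^sup>2 \<le> c * (u n * h n)\<^sup>2 / 4 * (norm (ivec k :: real ^ 'd))\<^sup>2" by (rule mult_right_mono) simp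
    also have "\<dots> = (u n)\<^sup>2 * (c * (norm (pt k n - x n))\<^sup>2) / 4" using h[of n] by (simp add: pt_def power_mult_distrib)
    also have "\<dots> \<le> (u n)\<^sup>2 * (1 - r (\<psi> m (pt k n)) (\<psi> m (x n))) / 4"
     using k K x by (intro divide_right_mono mult_left_mono c) auto
    finally have "exp (- ((u n)\<^sup>2 * (1 - r (\<psi> m (pt k n)) (\<psi> m (x n))) / 4)) \<le> w k" by (simp add: w_def)
    thus "prob (bad (\<psi> m (pt k n)) n) \<le> w k" using bad_prob[OF KI[OF k] elim(4)] by linarith
   qed (use K' in auto)
   also have "sum w K' \<le> e" using K' by (intro F0(2))
   also have "prob ?B \<le> prob ?A + (\<Sum>t\<in>R n. exp (- ((u n)\<^sup>2 * c' / 4)))"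
   proof (rule prob_union_bound[where C="\<lambda>t. bad t n"])
    fix t assume t: "t \<in> R n"
    show "bad t n \<in> sets M" using t R(2) by (intro bad_meas) auto
    have "(u n)\<^sup>2 * c' \<le> (u n)\<^sup>2 * (1 - r t (\<psi> m (x n)))" using R(3)[OF t] by (intro mult_left_mono) auto
    thus "prob (bad t n) \<le> exp (- ((u n)\<^sup>2 * c' / 4))"
     using bad_prob[of t n] t R(2) elim(4) by (smt (verit) divide_right_mono exp_le_cancel_iff subsetD)
   qed (use R am in auto)
   also have "(\<Sum>t\<in>R n. exp (- ((u n)\<^sup>2 * c' / 4))) \<le> B * u n ^ D * exp (- ((u n)\<^sup>2 * c' / 4))"
    using elim(6) by (simp add: mult_right_mono)
   finally have "prob (local_event F n) \<le> argmax_prob (T n) (\<psi> m (x n)) (u n) + (e + e)" using elim(3) by (simp add: argmax_prob_def)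
   hence "\<bar>argmax_prob (T n) (\<psi> m (x n)) (u n) - cell_prob m y \<delta>\<bar> < 4 * e" using up limF limF' elim(1) by linarith
   thus ?case by (simp add: e_def)
  qed
  thus "\<exists>no. \<forall>n\<ge>no. norm (argmax_prob (T n) (\<psi> m (x n)) (u n) - cell_prob m y \<delta>) < \<epsilon>"
   by (simp add: eventually_sequentially)
 qed
qed

end

end

section \<open>Voronoi cells\<close>

text \<open>The library proves this for index types of class \<open>wellorder\<close> only.\<close>

lemma linear_image_lmeasure:
 fixes f :: "real ^ 'n \<Rightarrow> real ^ 'n"
 assumes "linear f" "S \<in> lmeasurable"
 shows "f ` S \<in> lmeasurable \<and> measure lebesgue (f ` S) = \<bar>det (matrix f)\<bar> * measure lebesgue S"
proof -
 let ?P = "\<lambda>f. \<forall>S\<in>lmeasurable. f ` S \<in> lmeasurable \<and> measure lebesgue (f ` S) = \<bar>det (matrix f)\<bar> * measure lebesgue S"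
 have "?P f"
 proof (rule induct_linear_elementary[OF assms(1)]; intro ballI)
  fix f g :: "real ^ 'n \<Rightarrow> real ^ 'n" and S :: "(real ^ 'n) set"
  assume fg: "linear f" "linear g" "?P f" "?P g" and S: "S \<in> lmeasurable"
  hence "g ` S \<in> lmeasurable" by blast
  moreover have "(f \<circ> g) ` S = f ` (g ` S)" by (simp add: image_comp)
  moreover have "matrix (f \<circ> g) = matrix f ** matrix g" using fg by (intro matrix_compose)
  ultimately show "(f \<circ> g) ` S \<in> lmeasurable \<and> measure lebesgue ((f \<circ> g) ` S) = \<bar>det (matrix (f \<circ> g))\<bar> * measure lebesgue S"
   using fg S by (simp only: abs_mult det_mul mult.assoc)
 next
  fix f :: "real ^ 'n \<Rightarrow> real ^ 'n" and i and S :: "(real ^ 'n) set"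
  assume f: "linear f" "\<And>x. f x $ i = 0"
  hence "\<not> inj f" by (metis linear_injective_imp_surjective one_neq_zero surjE vec_component)
  moreover from this f have "negligible (f ` S)" by (intro negligible_linear_singular_image)
  ultimately show "f ` S \<in> lmeasurable \<and> measure lebesgue (f ` S) = \<bar>det (matrix f)\<bar> * measure lebesgue S"
   using f det_nz_iff_inj[of f] by (auto simp: negligible_iff_measure)
 next
  fix c and S :: "(real ^ 'n) set" assume "S \<in> lmeasurable"
  thus "(\<lambda>x. \<chi> i. c i * x $ i) ` S \<in> lmeasurable \<and> measure lebesgue ((\<lambda>x. \<chi> i. c i * x $ i) ` S) = \<bar>det (matrix (\<lambda>x. \<chi> i. c i * x $ i))\<bar> * measure lebesgue S"
   by (simp add: measurable_stretch measure_stretch axis_def matrix_def det_diagonal)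
 next
 fix m n :: 'n and S :: "(real ^ 'n) set" assume mn: "m \<noteq> n" and S: "S \<in> lmeasurable"
 let ?h = "\<lambda>x :: real ^ 'n. \<chi> i. x $ Transposition.transpose m n i"
 have lin: "linear ?h" by (rule linearI) (simp_all add: vec_eq_iff)
 have hh: "?h (?h x) = x" for x by (simp add: vec_eq_iff)
 have im: "?h ` cbox a b = cbox (?h a) (?h b)" for a b
 proof
  show "?h ` cbox a b \<subseteq> cbox (?h a) (?h b)" by (auto simp: mem_box_cart)
  show "cbox (?h a) (?h b) \<subseteq> ?h ` cbox a b"
  proof
   fix x assume "x \<in> cbox (?h a) (?h b)"
   hence "?h x \<in> cbox a b" by (auto simp: mem_box_cart) (metis transpose_involutory)+
   thus "x \<in> ?h ` cbox a b" by (intro image_eqI[of _ _ "?h x"]) (auto simp: hh)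
  qed
 qed
 have meq: "measure lebesgue (?h ` cbox a b) = 1 * measure lebesgue (cbox a b)" for a b
 proof (cases "cbox a b = {}")
  case False
  hence "?h ` cbox a b \<noteq> {}" by blast
  thus ?thesis using False prod.permute[OF permutes_swap_id, of m UNIV n "\<lambda>i. (b - a) $ i", symmetric] by (simp add: im content_cbox_cart)
 qed simp
 have "matrix ?h = (\<chi> i. mat 1 $ Transposition.transpose m n i)" by (auto simp: vec_eq_iff matrix_def mat_def axis_def)
 hence "\<bar>det (matrix ?h)\<bar> = 1" using mn by (simp add: det_permute_rows permutes_swap_id sign_swap_id)
 thus "?h ` S \<in> lmeasurable \<and> measure lebesgue (?h ` S) = \<bar>det (matrix ?h)\<bar> * measure lebesgue S"
  using measure_linear_sufficient[OF lin S meq] by simp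
 next
 fix m n :: 'n and S :: "(real ^ 'n) set" assume mn: "m \<noteq> n" and S: "S \<in> lmeasurable"
 let ?h = "\<lambda>x :: real ^ 'n. \<chi> i. if i = m then x $ m + x $ n else x $ i"
 have lin: "linear ?h" by (rule linearI) (auto simp: algebra_simps vec_eq_iff)
 have meq: "measure lebesgue (?h ` cbox a b) = 1 * measure lebesgue (cbox a b)" for a b
 proof (cases "cbox a b = {}")
  case False
  define v where "v = (\<chi> i. if i = n then - a $ n else 0)"
  have ne: "cbox (v + a) (v + b) \<noteq> {}" using False by (simp add: cbox_translation)
  have "?h ` cbox a b = (+) (- ?h v) ` ?h ` (+) v ` cbox a b" using linear_add[OF lin] by (auto simp: image_comp o_def)
  hence "measure lebesgue (?h ` cbox a b) = measure lebesgue ((+) (- ?h v) ` ?h ` (+) v ` cbox a b)" by (rule arg_cong)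
  also have "\<dots> = measure lebesgue (?h ` (+) v ` cbox a b)" by (rule measure_translation)
  also have "(+) v ` cbox a b = cbox (v + a) (v + b)" by (simp only: cbox_translation)
  also have "measure lebesgue (?h ` cbox (v + a) (v + b)) = measure lebesgue (cbox (v + a) (v + b))"
   using mn ne by (intro measure_shear_interval) (auto simp: v_def)
  also have "\<dots> = measure lebesgue (cbox a b)" using measure_translation[of v "cbox a b"] by (simp add: cbox_translation)
  finally show ?thesis by simp
 qed simp
 have "matrix ?h = (\<chi> k. if k = m then row m (mat 1) + 1 *s row n (mat 1) else row k (mat 1))"
  by (auto simp: vec_eq_iff matrix_def mat_def axis_def row_def)
 hence "det (matrix ?h) = 1" using det_row_operation[OF mn, of "mat 1" 1] by simp
 thus "?h ` S \<in> lmeasurable \<and> measure lebesgue (?h ` S) = \<bar>det (matrix ?h)\<bar> * measure lebesgue S"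
  using measure_linear_sufficient[OF lin S meq] by simp
 qed
 thus ?thesis using assms(2) by blast
qed

lemma null_hyperplane:
 fixes a :: "'a::euclidean_space"
 assumes "a \<noteq> 0" shows "{x. a \<bullet> x = b} \<in> null_sets lborel"
proof -
 have "negligible {x. a \<bullet> x = b}" using assms by (intro negligible_hyperplane) auto
 moreover have "{x. a \<bullet> x = b} \<in> sets lborel" by simp
 ultimately show ?thesis by (simp add: negligible_iff_null_sets null_sets_completion_iff)
qed

lemma inner_one_Basis: "b \<in> Basis \<Longrightarrow> 1 \<bullet> b = (1 :: real)" for b :: "real ^ 'a::finite"
 by (auto simp: Basis_vec_def inner_axis)

lemma box_halfopen_measure:
 fixes a :: "real ^ 'd::finite"
 assumes h: "0 < h"
 shows "{x. \<forall>i. a $ i \<le> x $ i \<and> x $ i < a $ i + h} \<in> sets lborel"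
  and "emeasure lborel {x. \<forall>i. a $ i \<le> x $ i \<and> x $ i < a $ i + h} = ennreal (h ^ CARD('d))"
proof -
 let ?S = "{x. \<forall>i. a $ i \<le> x $ i \<and> x $ i < a $ i + h}" and ?b = "a + h *\<^sub>R 1"
 show m: "?S \<in> sets lborel" by measurable
 have le: "emeasure lborel (box a ?b) \<le> emeasure lborel ?S" "emeasure lborel ?S \<le> emeasure lborel (cbox a ?b)"
  using m by (intro emeasure_mono; auto simp: mem_box_cart less_imp_le)+
 have "emeasure lborel (box a ?b) = ennreal (h ^ CARD('d))" "emeasure lborel (cbox a ?b) = ennreal (h ^ CARD('d))"
  using h by (simp_all add: emeasure_lborel_box_eq emeasure_lborel_cbox_eq inner_add_left inner_one_Basis)
 with le show "emeasure lborel ?S = ennreal (h ^ CARD('d))" by simp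
qed

lemma ivec_add: "ivec (k + l) = ivec k + ivec l" and ivec_diff: "ivec (k - l) = ivec k - ivec l"
 by (simp_all add: vec_eq_iff)

lemma finite_ivec_bounded: "finite {k :: int ^ 'd::finite. norm (ivec k :: real ^ 'd) \<le> B}"
proof (rule finite_subset)
 show "{k :: int ^ 'd. norm (ivec k :: real ^ 'd) \<le> B} \<subseteq> vec_lambda ` (UNIV \<rightarrow>\<^sub>E {- \<lceil>B\<rceil>..\<lceil>B\<rceil>})"
 proof
  fix k :: "int ^ 'd" assume "k \<in> {k. norm (ivec k :: real ^ 'd) \<le> B}"
  hence B: "\<bar>of_int (k $ i)\<bar> \<le> B" for i using component_le_norm_cart[of "ivec k :: real ^ 'd" i] by (simp add: order_trans)
  have "k $ i \<in> {- \<lceil>B\<rceil>..\<lceil>B\<rceil>}" for i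
  proof -
   have "real_of_int (k $ i) \<le> of_int \<lceil>B\<rceil>" "real_of_int (- (k $ i)) \<le> of_int \<lceil>B\<rceil>"
    using B[of i] le_of_int_ceiling[of B] by (simp_all, linarith+)
   thus ?thesis by (simp only: of_int_le_iff atLeastAtMost_iff) simp
  qed
  hence "($) k \<in> UNIV \<rightarrow>\<^sub>E {- \<lceil>B\<rceil>..\<lceil>B\<rceil>}" by auto
  thus "k \<in> vec_lambda ` (UNIV \<rightarrow>\<^sub>E {- \<lceil>B\<rceil>..\<lceil>B\<rceil>})" by (intro image_eqI[where x="($) k"]) simp_all
 qed
 show "finite (vec_lambda ` (UNIV \<rightarrow>\<^sub>E {- \<lceil>B\<rceil>..\<lceil>B\<rceil>}) :: (int ^ 'd) set)" by (intro finite_imageI finite_PiE) auto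
qed

text \<open>The points having 0 among their nearest integer points for the norm of
  \<open>A *v w\<close>. The linear inequalities are the squared form of this comparison, and have
  the same shape as the conditions in \<open>lim_event\<close>.\<close>

definition voronoi :: "real ^ 'd ^ 'd \<Rightarrow> (real ^ 'd::finite) set" where
 "voronoi A = {w. \<forall>k. (A *v w) \<bullet> (A *v ivec k) \<le> (norm (A *v ivec k))\<^sup>2 / 2}"

lemma mem_voronoi: "w \<in> voronoi A \<longleftrightarrow> (\<forall>k. norm (A *v w) \<le> norm (A *v (w - ivec k)))"
proof -
 have "(A *v w) \<bullet> (A *v ivec k) \<le> (norm (A *v ivec k))\<^sup>2 / 2 \<longleftrightarrow> norm (A *v w) \<le> norm (A *v (w - ivec k))" for k
 proof -
  have "(norm (A *v (w - ivec k)))\<^sup>2 = (norm (A *v w))\<^sup>2 - 2 * ((A *v w) \<bullet> (A *v ivec k)) + (norm (A *v ivec k))\<^sup>2"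
   by (simp add: matrix_vector_mult_diff_distrib power2_norm_eq_inner inner_diff_left inner_diff_right inner_commute)
  moreover have "norm (A *v w) \<le> norm (A *v (w - ivec k)) \<longleftrightarrow> (norm (A *v w))\<^sup>2 \<le> (norm (A *v (w - ivec k)))\<^sup>2"
   by (simp add: abs_le_square_iff[symmetric])
  ultimately show ?thesis by auto
 qed
 thus ?thesis by (auto simp: voronoi_def)
qed

lemma closed_voronoi: "closed (voronoi (A :: real ^ 'd ^ 'd::finite))"
proof -
 have "voronoi A = (\<Inter>k. {w. (A *v w) \<bullet> (A *v ivec k) \<le> (norm (A *v ivec k))\<^sup>2 / 2})" by (auto simp: voronoi_def)
 also have "closed \<dots>"
  by (intro closed_INT ballI closed_Collect_le continuous_intros linear_continuous_on linear_linear[THEN iffD2] matrix_vector_mul_linear)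
 finally show ?thesis .
qed

text \<open>The cell and the half-open unit cube are both fundamental domains for integer
  translations: almost every point lies in exactly one translate of each. Inserting the translates
  of the cell into the measure of \<open>U\<close>, translating, and resumming the translates of
  \<open>U\<close> exchanges the two.\<close>

lemma voronoi_measure:
 fixes A :: "real ^ 'd ^ 'd::finite"
 assumes A: "invertible A"
 shows "emeasure lborel (voronoi A) = 1"
proof -
 let ?D = "voronoi A"
 have Dm[measurable]: "?D \<in> sets borel" using closed_voronoi by (rule borel_closed)
 have inj: "inj ((*v) A)" using A by (rule inj_matrix_vector_mult)
 obtain c where c: "c > 0" "\<And>x. c * norm x \<le> norm (A *v x)"
  using linear_inj_bounded_below_pos[OF matrix_vector_mul_linear inj] by (metis mult.commute)
 have ex: "\<exists>k. w - ivec k \<in> ?D" for w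
 proof -
  define S where "S = {k. norm (A *v (w - ivec k)) \<le> norm (A *v w)}"
  have "S \<subseteq> {k. norm (ivec k :: real ^ 'd) \<le> norm w + norm (A *v w) / c}"
  proof
   fix k assume "k \<in> S"
   hence "c * norm (w - ivec k) \<le> norm (A *v w)" using c(2)[of "w - ivec k"] by (simp add: S_def)
   hence "norm (w - ivec k) \<le> norm (A *v w) / c" using c by (simp add: field_simps)
   moreover have "norm (ivec k :: real ^ 'd) \<le> norm w + norm (w - ivec k)" using norm_triangle_ineq4[of w "w - ivec k"] by simp
   ultimately show "k \<in> {k. norm (ivec k :: real ^ 'd) \<le> norm w + norm (A *v w) / c}" by simp
  qed
  hence fS: "finite S" using finite_ivec_bounded by (rule finite_subset)
  have "0 \<in> S" by (simp add: S_def flip: zero_vec_def)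
  then obtain k where k: "k \<in> S" "\<And>l. l \<in> S \<Longrightarrow> norm (A *v (w - ivec k)) \<le> norm (A *v (w - ivec l))"
   using ex_min_if_finite[of "(\<lambda>k. norm (A *v (w - ivec k))) ` S"] fS by (force simp: not_less)
  have "norm (A *v (w - ivec k)) \<le> norm (A *v (w - ivec l))" for l
  proof (cases "l \<in> S")
   case False thus ?thesis using k(1) by (simp add: S_def)
  qed (rule k)
  hence "norm (A *v (w - ivec k)) \<le> norm (A *v (w - ivec k - ivec l))" for l by (metis diff_diff_add ivec_add)
  thus ?thesis by (auto simp: mem_voronoi)
 qed
 \<comment> \<open>A point in two translates is equally far from two lattice points, so it lies on a
   hyperplane, and there are countably many of those.\<close>
 have "AE w in lborel. \<forall>k. \<forall>l. k \<noteq> l \<longrightarrow> \<not> (w - ivec k \<in> ?D \<and> w - ivec l \<in> ?D)"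
 proof (intro AE_all_countable[THEN iffD2] allI AE_impI)
  fix k l :: "int ^ 'd" assume kl: "k \<noteq> l"
  define a where "a = transpose A *v (A *v (ivec l - ivec k))"
  define b where "b = ((norm (A *v ivec l))\<^sup>2 - (norm (A *v ivec k))\<^sup>2) / 2"
  have "A *v (ivec l - ivec k) \<noteq> 0"
  proof
   assume "A *v (ivec l - ivec k) = 0"
   hence "c * norm (ivec l - ivec k :: real ^ 'd) \<le> 0" using c(2)[of "ivec l - ivec k"] by simp
   hence "ivec l - ivec k = (0 :: real ^ 'd)" using c(1) by (simp add: mult_le_0_iff)
   thus False using kl by (simp add: vec_eq_iff)
  qed
  moreover have "inj ((*v) (transpose A))" using A by (intro inj_matrix_vector_mult) (simp add: invertible_det_nz det_transpose)
  ultimately have "a \<noteq> 0" unfolding a_def by (metis injD matrix_vector_mult_0_right)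
  hence "{x. a \<bullet> x = b} \<in> null_sets lborel" by (rule null_hyperplane)
  hence "AE w in lborel. w \<notin> {x. a \<bullet> x = b}" by (rule AE_not_in)
  thus "AE w in lborel. \<not> (w - ivec k \<in> ?D \<and> w - ivec l \<in> ?D)"
  proof eventually_elim
   case (elim w)
   show ?case
   proof
    assume h: "w - ivec k \<in> ?D \<and> w - ivec l \<in> ?D"
    have e1: "w - ivec l = w - ivec k - ivec (l - k)" "w - ivec k = w - ivec l - ivec (k - l)" by (simp_all only: ivec_diff) auto
    have "norm (A *v (w - ivec k)) = norm (A *v (w - ivec l))" using h[unfolded mem_voronoi] e1 by (metis order_antisym)
    hence "(norm (A *v (w - ivec k)))\<^sup>2 = (norm (A *v (w - ivec l)))\<^sup>2" by simp
    hence "(A *v w) \<bullet> (A *v (ivec l - ivec k)) = b"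
     by (simp add: b_def matrix_vector_mult_diff_distrib power2_norm_eq_inner inner_diff_left inner_diff_right inner_commute)
    moreover have "a \<bullet> w = (A *v (ivec l - ivec k)) \<bullet> (A *v w)" unfolding a_def transpose_matrix_vector by (rule dot_lmul_matrix)
    ultimately have "a \<bullet> w = b" by (simp add: inner_commute)
    with elim show False by simp
   qed
  qed
 qed
 hence one: "AE w in lborel. (\<integral>\<^sup>+k. indicator ?D (w - ivec k) \<partial>count_space UNIV) = (1 :: ennreal)"
 proof eventually_elim
  case (elim w)
  obtain k where k: "w - ivec k \<in> ?D" using ex by blast
  have "(\<integral>\<^sup>+l. indicator ?D (w - ivec l) \<partial>count_space UNIV) = (\<integral>\<^sup>+l. indicator {k} l \<partial>count_space UNIV :: ennreal)"
   using elim k by (intro nn_integral_cong) (auto simp: indicator_def)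
  thus ?case by simp
 qed
 define U where "U = {w :: real ^ 'd. \<forall>i. 0 \<le> w $ i \<and> w $ i < 1}"
 have Um[measurable]: "U \<in> sets borel" unfolding U_def by measurable
 have U1: "emeasure lborel U = 1" using box_halfopen_measure(2)[of 1 "0 :: real ^ 'd"] by (simp add: U_def)
 have oneU: "(\<integral>\<^sup>+k. indicator U (w + ivec k) \<partial>count_space UNIV) = (1 :: ennreal)" for w
 proof -
  define k0 where "k0 = (\<chi> i. - \<lfloor>w $ i\<rfloor>)"
  have "w + ivec k \<in> U \<longleftrightarrow> k = k0" for k
  proof
   assume "w + ivec k \<in> U"
   hence "0 \<le> w $ i + of_int (k $ i) \<and> w $ i + of_int (k $ i) < 1" for i by (simp add: U_def)
   hence "\<lfloor>w $ i\<rfloor> = - (k $ i)" for i by (simp add: floor_eq_iff) (smt (verit))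
   thus "k = k0" by (simp add: k0_def vec_eq_iff)
  qed (auto simp: k0_def U_def, linarith)
  hence "(\<integral>\<^sup>+k. indicator U (w + ivec k) \<partial>count_space UNIV) = (\<integral>\<^sup>+k. indicator {k0} k \<partial>count_space UNIV :: ennreal)"
   by (intro nn_integral_cong) (auto simp: indicator_def)
  thus ?thesis by simp
 qed
 have "1 = (\<integral>\<^sup>+w. indicator U w \<partial>lborel)" by (simp add: U1)
 also have "\<dots> = (\<integral>\<^sup>+w. indicator U w * (\<integral>\<^sup>+k. indicator ?D (w - ivec k) \<partial>count_space UNIV) \<partial>lborel)"
  using one by (intro nn_integral_cong_AE) auto
 also have "\<dots> = (\<integral>\<^sup>+w. (\<integral>\<^sup>+k. indicator U w * indicator ?D (w - ivec k) \<partial>count_space UNIV) \<partial>lborel)"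
  by (simp add: nn_integral_cmult)
 also have "\<dots> = (\<integral>\<^sup>+k. (\<integral>\<^sup>+w. indicator U w * indicator ?D (w - ivec k) \<partial>lborel) \<partial>count_space UNIV)"
  by (rule nn_integral_count_space_nn_integral) (auto intro: countableI_type)
 also have "\<dots> = (\<integral>\<^sup>+k. (\<integral>\<^sup>+w. indicator U (w + ivec k) * indicator ?D w \<partial>lborel) \<partial>count_space UNIV)"
 proof (rule nn_integral_cong)
  fix k :: "int ^ 'd"
  have "(\<integral>\<^sup>+w. indicator U w * indicator ?D (w - ivec k) \<partial>lborel) = (\<integral>\<^sup>+w. indicator U w * indicator ?D (w - ivec k) \<partial>distr lborel borel ((+) (ivec k)))"
   by (simp add: lborel_distr_plus)
  also have "\<dots> = (\<integral>\<^sup>+w. indicator U (ivec k + w) * indicator ?D (ivec k + w - ivec k) \<partial>lborel)"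
   by (subst nn_integral_distr) auto
  finally show "(\<integral>\<^sup>+w. indicator U w * indicator ?D (w - ivec k) \<partial>lborel) = (\<integral>\<^sup>+w. indicator U (w + ivec k) * indicator ?D w \<partial>(lborel :: (real ^ 'd) measure) :: ennreal)"
   by (simp add: add.commute)
 qed
 also have "\<dots> = (\<integral>\<^sup>+w. (\<integral>\<^sup>+k. indicator U (w + ivec k) * indicator ?D w \<partial>count_space UNIV) \<partial>lborel)"
  by (rule nn_integral_count_space_nn_integral[symmetric]) (auto intro: countableI_type)
 also have "\<dots> = (\<integral>\<^sup>+w. (\<integral>\<^sup>+k. indicator U (w + ivec k) \<partial>count_space UNIV) * indicator ?D w \<partial>lborel)"
  by (simp add: nn_integral_multc)
 also have "\<dots> = emeasure lborel ?D" by (simp add: oneU)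
 finally show ?thesis by simp
qed

text \<open>A point of the cell is no farther from 0 than from the lattice point obtained by
  rounding down, and that distance is uniformly bounded.\<close>

lemma voronoi_bounded:
 fixes A :: "real ^ 'd ^ 'd::finite"
 obtains R where "\<And>w. w \<in> voronoi A \<Longrightarrow> norm (A *v w) \<le> R"
proof -
 obtain B where B: "\<And>x. norm (A *v x) \<le> B * norm x"
  using linear_bounded[OF matrix_vector_mul_linear, of A] by (metis mult.commute)
 show ?thesis
 proof (rule that[of "\<bar>B\<bar> * real CARD('d)"])
  fix w assume w: "w \<in> voronoi A"
  define k where "k = (\<chi> i. \<lfloor>w $ i\<rfloor>)"
  have "norm (w - ivec k) \<le> (\<Sum>i\<in>UNIV. \<bar>(w - ivec k) $ i\<bar>)" by (rule norm_le_l1_cart)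
  also have "\<dots> \<le> (\<Sum>i\<in>(UNIV :: 'd set). 1)" by (intro sum_mono) (simp add: k_def, linarith)
  finally have n: "norm (w - ivec k) \<le> real CARD('d)" by simp
  have "norm (A *v w) \<le> norm (A *v (w - ivec k))" using w by (simp add: mem_voronoi)
  also have "\<dots> \<le> \<bar>B\<bar> * norm (w - ivec k)" using B[of "w - ivec k"] by (smt (verit) mult_right_mono norm_ge_zero)
  also have "\<dots> \<le> \<bar>B\<bar> * real CARD('d)" using n by (intro mult_left_mono) auto
  finally show "norm (A *v w) \<le> \<bar>B\<bar> * real CARD('d)" .
 qed
qed

text \<open>Gram-Schmidt for the inner product given by \<open>L\<close>: any vector outside the
  span found so far is made orthogonal to it and normalized. The rows satisfy
  \<open>P ** L ** transpose P = mat 1\<close>, so \<open>P\<close> whitens a vector with covariance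
  \<open>L\<close>.\<close>

lemma posdef_orthonormalize:
 fixes L :: "real ^ 'd ^ 'd::finite"
 assumes sym: "transpose L = L" and pos: "\<And>v. v \<noteq> 0 \<Longrightarrow> 0 < v \<bullet> (L *v v)"
 shows "\<exists>P :: real ^ 'd ^ 'd. \<forall>i j. P $ i \<bullet> (L *v P $ j) = (if i = j then 1 else 0)"
proof -
 have bsym: "v \<bullet> (L *v w) = w \<bullet> (L *v v)" for v w by (metis sym dot_lmul_matrix inner_commute vector_transpose_matrix)
 have "\<exists>v :: nat \<Rightarrow> real ^ 'd. \<forall>i<n. \<forall>j<n. v i \<bullet> (L *v v j) = (if i = j then 1 else 0)" if "n \<le> CARD('d)" for n
  using that
 proof (induction n)
  case (Suc n)
  then obtain v :: "nat \<Rightarrow> real ^ 'd" where v: "\<And>i j. i < n \<Longrightarrow> j < n \<Longrightarrow> v i \<bullet> (L *v v j) = (if i = j then 1 else 0)" by auto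
  have "dim (span (v ` {..<n})) \<le> card (v ` {..<n})" by (simp add: dim_le_card')
  also have "\<dots> \<le> n" using card_image_le[of "{..<n}" v] by simp
  also have "\<dots> < DIM(real ^ 'd)" using Suc.prems by simp
  finally have "span (v ` {..<n}) \<noteq> UNIV" by (metis dim_UNIV less_irrefl)
  then obtain x where x: "x \<notin> span (v ` {..<n})" by auto
  define w where "w = x - (\<Sum>i<n. (x \<bullet> (L *v v i)) *\<^sub>R v i)"
  have "w \<noteq> 0"
  proof
   assume "w = 0"
   hence "x = (\<Sum>i<n. (x \<bullet> (L *v v i)) *\<^sub>R v i)" by (simp add: w_def)
   also have "\<dots> \<in> span (v ` {..<n})" by (intro span_sum span_scale span_base) auto
   finally show False using x by simp
  qed
  hence ww: "0 < w \<bullet> (L *v w)" by (rule pos)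
  have wv: "w \<bullet> (L *v v j) = 0" if "j < n" for j
  proof -
   have "w \<bullet> (L *v v j) = x \<bullet> (L *v v j) - (\<Sum>i<n. (x \<bullet> (L *v v i)) * (v i \<bullet> (L *v v j)))"
    by (simp add: w_def inner_diff_left inner_sum_left)
   also have "(\<Sum>i<n. (x \<bullet> (L *v v i)) * (v i \<bullet> (L *v v j))) = (\<Sum>i<n. if i = j then x \<bullet> (L *v v j) else 0)"
    using that by (intro sum.cong) (auto simp: v)
   finally show ?thesis using that by simp
  qed
  define e where "e = (1 / sqrt (w \<bullet> (L *v w))) *\<^sub>R w"
  have ee: "e \<bullet> (L *v e) = 1" using ww by (simp add: e_def matrix_vector_mult_scaleR)
  have ev: "e \<bullet> (L *v v j) = 0" "v j \<bullet> (L *v e) = 0" if "j < n" for j using wv[OF that] bsym[of "v j" e] by (auto simp: e_def)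
  show ?case by (rule exI[of _ "v(n := e)"]) (use v ee ev in \<open>auto simp: less_Suc_eq\<close>)
 qed simp
 from this[OF order_refl] obtain v :: "nat \<Rightarrow> real ^ 'd"
  where v: "\<And>i j. i < CARD('d) \<Longrightarrow> j < CARD('d) \<Longrightarrow> v i \<bullet> (L *v v j) = (if i = j then 1 else 0)" by auto
 obtain f :: "'d \<Rightarrow> nat" where f: "bij_betw f UNIV {0..<CARD('d)}"
  using ex_bij_betw_finite_nat[of "UNIV :: 'd set"] by auto
 have "f i < CARD('d)" "f i = f j \<longleftrightarrow> i = j" for i j using f by (auto simp: bij_betw_def inj_on_def dest: equalityD1)
 thus ?thesis using v by (intro exI[of _ "\<chi> i. v (f i)"]) simp
qed

lemma gram_matrix_mult:
 fixes P L :: "real ^ 'd ^ 'd::finite"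
 shows "(P ** L ** transpose P) $ i $ j = P $ i \<bullet> (L *v P $ j)"
proof -
 have "(P ** L ** transpose P) $ i $ j = (P ** (L ** transpose P)) $ i $ j" by (simp add: matrix_mul_assoc)
 also have "\<dots> = P $ i \<bullet> (L *v P $ j)" by (simp add: matrix_matrix_mult_def matrix_vector_mult_def inner_vec_def transpose_def)
 finally show ?thesis .
qed

text \<open>Uncorrelated coordinates are split off one by one with
  \<open>uncorrelated_fubini\<close>, so orthants get product probabilities; orthants generate the
  Borel sets and are stable under intersection.\<close>

lemma (in gaussian_space) iid_normal_density:
 fixes N :: "'d::finite \<Rightarrow> 'w \<Rightarrow> real"
 assumes N: "\<And>i. N i \<in> H" and c: "\<And>i j. cov (N i) (N j) = (if i = j then 1 else 0)"
 shows "distr M borel (\<lambda>w. \<chi> i. N i w) = density lborel (\<lambda>z. \<Prod>i\<in>UNIV. ennreal (phi (z $ i)))"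
proof (rule measure_eqI_generator_eq)
 let ?D = "distr M borel (\<lambda>w. \<chi> i. N i w)" and ?R = "density lborel (\<lambda>z :: real ^ 'd. \<Prod>i\<in>UNIV. ennreal (phi (z $ i)))"
 note [measurable] = H_measurable[OF N]
 have NN[measurable]: "(\<lambda>w. \<chi> i. N i w) \<in> borel_measurable M"
  by (subst borel_measurable_euclidean_space) (auto simp: Basis_vec_def inner_axis)
 let ?E = "range (\<lambda>a. {..a} :: (real ^ 'd) set)"
 have "{..a} \<inter> {..b} = {..inf a b}" for a b :: "real ^ 'd" by auto
 thus "Int_stable ?E" by (auto simp: Int_stable_def)
 show "?E \<subseteq> Pow UNIV" "sets ?D = sigma_sets UNIV ?E"
  "sets ?R = sigma_sets UNIV ?E"
  by (simp_all add: borel_eq_atMost)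
 let ?A = "\<lambda>n::nat. {..(\<chi> i. real n)} :: (real ^ 'd) set"
 show "range ?A \<subseteq> ?E" by auto
 show "(\<Union>i. ?A i) = UNIV"
 proof (intro equalityI subsetI UNIV_I)
  fix x :: "real ^ 'd"
  obtain n :: nat where "norm x \<le> real n" using real_arch_simple by blast
  hence "x $ i \<le> real n" for i using component_le_norm_cart[of x i] by linarith
  thus "x \<in> (\<Union>i. ?A i)" by (auto simp: less_eq_vec_def)
 qed
 show "emeasure ?D (?A i) \<noteq> \<infinity>" for i by (simp add: emeasure_distr)
 have indep: "prob {w\<in>space M. \<forall>i\<in>J. N i w \<le> a i} = (\<Prod>i\<in>J. prob {w\<in>space M. N i w \<in> {..a i}})" for J and a :: "'d \<Rightarrow> real"
  using finite[of J]
 proof (induction J rule: finite_induct)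
  case empty thus ?case by (simp add: prob_space)
 next
  case (insert i J)
  have "prob {w\<in>space M. \<forall>i\<in>insert i J. N i w \<le> a i} = prob {w\<in>space M. N i w \<in> {..a i} \<and> (\<forall>j\<in>J. N j w \<le> a j + 0 * N i w)}"
   by simp
  also have "\<dots> = (\<integral>x. indicator {..a i} x * prob {w\<in>space M. \<forall>j\<in>J. N j w \<le> a j + 0 * x} \<partial>distr M borel (N i))"
   using insert.hyps c N by (intro uncorrelated_fubini(1)) auto
  also have "\<dots> = measure (distr M borel (N i)) {..a i} * prob {w\<in>space M. \<forall>j\<in>J. N j w \<le> a j}" by simp
  also have "measure (distr M borel (N i)) {..a i} = prob {w\<in>space M. N i w \<in> {..a i}}"
   by (subst measure_distr) (auto simp: vimage_def Int_def conj_commute)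
  finally show ?case using insert by simp
 qed
 have Nd: "distr M borel (N i) = std_normal_distribution" for i using H_cgauss[OF N, of i] by (intro cgauss_std) (simp add: c)
 fix X :: "(real ^ 'd) set" assume "X \<in> ?E"
 then obtain a where X: "X = {..a}" by auto
 have Xm[measurable]: "X \<in> sets borel" by (simp add: X)
 have B: "Basis = range (\<lambda>i. axis i (1::real) :: real ^ 'd)" by (auto simp: Basis_vec_def)
 have inj: "inj (\<lambda>i. axis i (1::real) :: real ^ 'd)" by (auto simp: inj_on_def axis_eq_axis)
 have pB: "(\<Prod>b\<in>Basis. g b) = (\<Prod>i\<in>UNIV. g (axis i 1 :: real ^ 'd))" for g :: "real ^ 'd \<Rightarrow> ennreal"
  unfolding B by (subst prod.reindex[OF inj]) simp
 have "emeasure ?D X = emeasure M {w\<in>space M. \<forall>i\<in>UNIV. N i w \<le> a$i}"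
  by (subst emeasure_distr) (auto simp: X less_eq_vec_def intro!: arg_cong[where f="emeasure M"])
 also have "\<dots> = ennreal (\<Prod>i\<in>UNIV. prob {w\<in>space M. N i w \<in> {..a$i}})" unfolding emeasure_eq_measure indep ..
 also have "\<dots> = (\<Prod>i\<in>UNIV. emeasure (distr M borel (N i)) {..a$i})"
  by (subst prod_ennreal[symmetric]) (auto simp: emeasure_distr emeasure_eq_measure intro!: prod.cong arg_cong[where f=prob])
 also have "\<dots> = (\<Prod>i\<in>UNIV. \<integral>\<^sup>+x. ennreal (phi x) * indicator {..a$i} x \<partial>lborel)"
  unfolding Nd by (intro prod.cong refl) (simp add: emeasure_density)
 also have "\<dots> = (\<integral>\<^sup>+x. (\<Prod>b'\<in>Basis. (ennreal (phi (x \<bullet> b')) * indicator {..a\<bullet>b'} (x \<bullet> b'))) \<partial>(lborel :: (real ^ 'd) measure))"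
  by (subst nn_integral_lborel_prod) (auto simp: pB inner_axis)
 also have "\<dots> = (\<integral>\<^sup>+x. (\<Prod>i\<in>UNIV. ennreal (phi (x $ i))) * indicator X x \<partial>lborel)"
 proof (rule nn_integral_cong)
  fix x :: "real ^ 'd"
  show "(\<Prod>b'\<in>Basis. (ennreal (phi (x \<bullet> b')) * indicator {..a\<bullet>b'} (x \<bullet> b'))) = (\<Prod>i\<in>UNIV. ennreal (phi (x $ i))) * indicator X x"
  proof (cases "x \<in> X")
   case True
   thus ?thesis by (simp add: pB inner_axis X less_eq_vec_def)
  next
   case False
   then obtain i where "x $ i \<notin> {..a$i}" by (auto simp: X less_eq_vec_def)
   thus ?thesis using False by (auto simp: pB inner_axis indicator_def intro!: prod_zero exI[of _ i])
  qed
 qed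
 also have "\<dots> = emeasure ?R X" by (subst emeasure_density) auto
 finally show "emeasure ?D X = emeasure ?R X" .
qed

lemma (in gaussian_space) cov_lincomb:
 fixes Y :: "'a::finite \<Rightarrow> 'w \<Rightarrow> real"
 assumes Y: "\<And>k. Y k \<in> H"
 shows "cov (\<lambda>w. \<Sum>k\<in>UNIV. b k * Y k w) (\<lambda>w. \<Sum>k\<in>UNIV. c k * Y k w) = (\<Sum>l\<in>UNIV. \<Sum>k\<in>UNIV. b k * cov (Y k) (Y l) * c l)"
proof -
 have "cov (\<lambda>w. \<Sum>k\<in>UNIV. b k * Y k w) Z = (\<Sum>k\<in>UNIV. b k * cov (Y k) Z)" if "Z \<in> H" for b Z
  using Y that by (subst cov_sum) (auto intro: H_scale simp: cov_scale)
 note 1 = this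
 have "cov (Y k) (\<lambda>w. \<Sum>k\<in>UNIV. c k * Y k w) = (\<Sum>l\<in>UNIV. c l * cov (Y k) (Y l))" for k
  by (subst cov_commute, subst 1[OF Y]) (simp add: cov_commute)
 moreover have "(\<lambda>w. \<Sum>k\<in>UNIV. c k * Y k w) \<in> H" by (intro H_sum H_scale Y) simp
 ultimately have "cov (\<lambda>w. \<Sum>k\<in>UNIV. b k * Y k w) (\<lambda>w. \<Sum>k\<in>UNIV. c k * Y k w) = (\<Sum>k\<in>UNIV. \<Sum>l\<in>UNIV. b k * cov (Y k) (Y l) * c l)"
  by (simp add: 1 sum_distrib_left mult_ac)
 also have "\<dots> = (\<Sum>l\<in>UNIV. \<Sum>k\<in>UNIV. b k * cov (Y k) (Y l) * c l)" by (rule sum.swap)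
 finally show ?thesis .
qed

section \<open>Small cells: probability against volume\<close>

context gaussian_charts
begin

definition Lam :: "nat \<Rightarrow> real ^ 'd \<Rightarrow> real ^ 'd ^ 'd" where
 "Lam m y = (\<chi> i j. cov (\<lambda>w. G m y w $ i) (\<lambda>w. G m y w $ j))"

lemma G_component_H: "m < m0 \<Longrightarrow> y \<in> cbox 0 1 \<Longrightarrow> (\<lambda>w. G m y w $ i) \<in> H"
 using G_H[of m y "axis i 1"] by (simp add: inner_axis)

lemma cov_G:
 assumes "m < m0" "y \<in> cbox 0 1"
 shows "cov (\<lambda>\<omega>. G m y \<omega> \<bullet> v) (\<lambda>\<omega>. G m y \<omega> \<bullet> w) = v \<bullet> (Lam m y *v w)"
proof -
 note Gi = G_component_H[OF assms]
 have e: "(\<lambda>\<omega>. G m y \<omega> \<bullet> v) = (\<lambda>\<omega>. \<Sum>i\<in>UNIV. v $ i * G m y \<omega> $ i)" for v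
  by (auto simp: inner_vec_def mult.commute)
 have "cov (\<lambda>\<omega>. G m y \<omega> \<bullet> v) (\<lambda>\<omega>. G m y \<omega> \<bullet> w) = (\<Sum>l\<in>UNIV. \<Sum>k\<in>UNIV. v $ k * Lam m y $ k $ l * w $ l)"
  unfolding e by (subst cov_lincomb[OF Gi]) (simp add: Lam_def)
 also have "\<dots> = (\<Sum>k\<in>UNIV. \<Sum>l\<in>UNIV. v $ k * Lam m y $ k $ l * w $ l)" by (rule sum.swap)
 also have "\<dots> = v \<bullet> (Lam m y *v w)" by (simp add: inner_vec_def matrix_vector_mult_def sum_distrib_left mult.assoc)
 finally show ?thesis .
qed

lemma quad_Lam: "m < m0 \<Longrightarrow> y \<in> cbox 0 1 \<Longrightarrow> quad m y v = v \<bullet> (Lam m y *v v)"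
 unfolding quad_def by (rule cov_G)

text \<open>The standard normal density on the coordinate space, evaluated at the origin.\<close>

definition vol_const :: real where
 "vol_const = (1 / sqrt (2 * pi)) ^ CARD('d)"

lemma vol_const_pos: "0 < vol_const"
 by (simp add: vol_const_def)

lemma prod_phi: "(\<Prod>i\<in>UNIV. phi (z $ i)) = vol_const * exp (- (norm z)\<^sup>2 / 2)" for z :: "real ^ 'd"
proof -
 have "(\<Prod>i\<in>UNIV. phi (z $ i)) = vol_const * (\<Prod>i\<in>UNIV. exp (- (z $ i)\<^sup>2 / 2))"
  by (simp add: std_normal_density_def prod.distrib vol_const_def prod_dividef power_divide)
 also have "(\<Prod>i\<in>UNIV. exp (- (z $ i)\<^sup>2 / 2)) = exp (\<Sum>i\<in>UNIV. - (z $ i)\<^sup>2 / 2)" by (simp add: exp_sum)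
 also have "(\<Sum>i\<in>UNIV. - (z $ i)\<^sup>2 / 2) = - (norm z)\<^sup>2 / 2" by (simp add: norm_vec_def L2_set_def sum_nonneg sum_negf sum_divide_distrib)
 finally show ?thesis .
qed

text \<open>Writing the covariance as \<open>transpose A ** A\<close>, the gradient is
  \<open>transpose A\<close> applied to a standard normal vector \<open>Nv\<close>, and the event
  says that \<open>Nv\<close> lies in \<open>\<delta>\<close> times the image of the Voronoi cell
  under \<open>A\<close>. That image has volume \<open>\<bar>det A\<bar> = sqrt (det L)\<close> and
  lies in a ball of radius \<open>R\<close>, so the normal density on the scaled set is between
  \<open>vol_const * exp (- (\<delta> * R)\<^sup>2 / 2)\<close> and
  \<open>vol_const\<close>.\<close>

lemma cell_prob_bounds:
 assumes m: "m < m0" and y: "y \<in> cbox 0 1"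
 shows "0 < det (Lam m y)"
  and "\<exists>R. \<forall>\<delta>>0. cell_prob m y \<delta> \<le> vol_const * sqrt (det (Lam m y)) * \<delta> ^ CARD('d) \<and>
    vol_const * sqrt (det (Lam m y)) * exp (- (\<delta> * R)\<^sup>2 / 2) * \<delta> ^ CARD('d) \<le> cell_prob m y \<delta>"
proof -
 define L where "L = Lam m y"
 have sym: "transpose L = L" by (simp add: L_def Lam_def transpose_def vec_eq_iff cov_commute)
 have pos: "0 < v \<bullet> (L *v v)" if "v \<noteq> 0" for v using G_nondeg[OF m y that] cov_G[OF m y] by (simp add: L_def)
 obtain P :: "real ^ 'd ^ 'd" where P: "\<And>i j. P $ i \<bullet> (L *v P $ j) = (if i = j then 1 else 0)"
  using posdef_orthonormalize[OF sym pos] by blast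
 have PLP: "P ** L ** transpose P = mat 1" by (simp add: vec_eq_iff gram_matrix_mult P mat_def)
 have "det P * det L * det P = 1" using arg_cong[OF PLP, of det] by (simp add: det_mul)
 hence dL: "det L * (det P)\<^sup>2 = 1" by (simp add: power2_eq_square mult_ac)
 hence dP0: "det P \<noteq> 0" by auto
 hence dP: "det P \<noteq> 0" "det L = 1 / (det P)\<^sup>2" using dL by (auto simp: eq_divide_eq)
 show "0 < det (Lam m y)" using dP by (simp add: L_def[symmetric])
 obtain C where C: "P ** C = mat 1" "C ** P = mat 1"
  using dP by (auto simp: invertible_det_nz[symmetric] invertible_def)
 \<comment> \<open>\<open>C\<close> is the inverse of the whitening matrix, so
   \<open>L = C ** transpose C\<close>, and the transpose of \<open>C\<close> is a square root in
   the required order.\<close>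
 define A where "A = transpose C"
 have dC: "det P * det C = 1" using arg_cong[OF C(1), of det] by (simp add: det_mul)
 have dA: "\<bar>det A\<bar> = sqrt (det L)"
 proof -
  have "det C = 1 / det P" using dC dP by (simp add: field_simps)
  hence "(det A)\<^sup>2 = det L" by (simp add: A_def det_transpose dP power_divide)
  thus ?thesis by (metis real_sqrt_abs)
 qed
 have "L = C ** transpose C"
 proof -
  have "C ** (P ** L ** transpose P) ** transpose C = (C ** P) ** L ** transpose (C ** P)" by (simp add: matrix_mul_assoc matrix_transpose_mul)
  thus ?thesis by (simp add: PLP C transpose_mat)
 qed
 hence LA: "L = transpose A ** A" by (simp add: A_def)
 have inner_t: "(transpose A *v v) \<bullet> w = v \<bullet> (A *v w)" for v w by (simp add: transpose_matrix_vector dot_lmul_matrix)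
 have quadA: "quad m y v = (norm (A *v v))\<^sup>2" for v unfolding quad_Lam[OF m y] L_def[symmetric] LA
  by (simp add: matrix_vector_mul_assoc[symmetric] power2_norm_eq_inner inner_commute[of v] dot_lmul_matrix)
 define N where "N i \<omega> = G m y \<omega> \<bullet> P $ i" for i \<omega>
 have NH: "N i \<in> H" for i unfolding N_def[abs_def] by (rule G_H[OF m y])
 have Nc: "cov (N i) (N j) = (if i = j then 1 else 0)" for i j unfolding N_def[abs_def] cov_G[OF m y] L_def[symmetric] by (rule P)
 define Nv where "Nv \<omega> = (\<chi> i. N i \<omega>)" for \<omega>
 have dist: "distr M borel Nv = density lborel (\<lambda>z. \<Prod>i\<in>UNIV. ennreal (phi (z $ i)))"
  unfolding Nv_def[abs_def] by (rule iid_normal_density[OF NH Nc])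
 note [measurable] = H_measurable[OF NH]
 have Nvm[measurable]: "Nv \<in> borel_measurable M" unfolding Nv_def[abs_def]
  by (subst borel_measurable_euclidean_space) (auto simp: Basis_vec_def inner_axis)
 have NP: "Nv \<omega> = P *v G m y \<omega>" for \<omega> by (simp add: Nv_def N_def vec_eq_iff matrix_vector_mult_def inner_vec_def mult.commute)
 have GN: "G m y \<omega> = transpose A *v Nv \<omega>" for \<omega> by (simp add: NP A_def matrix_vector_mul_assoc C)
 have GNk: "G m y \<omega> \<bullet> v = Nv \<omega> \<bullet> (A *v v)" for \<omega> v by (simp add: GN dot_lmul_matrix)
 have Ainv: "invertible A" using dC by (auto simp: invertible_det_nz A_def det_transpose)
 then obtain B where B: "A ** B = mat 1" "B ** A = mat 1" by (auto simp: invertible_def)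
 define V where "V = (*v) A ` voronoi A"
 have V_iff: "z \<in> V \<longleftrightarrow> (\<forall>k. z \<bullet> (A *v ivec k) \<le> (norm (A *v ivec k))\<^sup>2 / 2)" for z
 proof
  assume "z \<in> V" thus "\<forall>k. z \<bullet> (A *v ivec k) \<le> (norm (A *v ivec k))\<^sup>2 / 2" by (auto simp: V_def voronoi_def)
 next
  assume h: "\<forall>k. z \<bullet> (A *v ivec k) \<le> (norm (A *v ivec k))\<^sup>2 / 2"
  have "A *v (B *v z) = z" by (simp add: matrix_vector_mul_assoc B)
  with h show "z \<in> V" unfolding V_def voronoi_def by (intro image_eqI[of _ _ "B *v z"]) auto
 qed
 have "voronoi A \<in> lmeasurable" "measure lebesgue (voronoi A) = 1"
 proof -
  have "voronoi A \<in> sets borel" using closed_voronoi by (rule borel_closed)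
  thus "voronoi A \<in> lmeasurable" "measure lebesgue (voronoi A) = 1" using voronoi_measure[OF Ainv] by (auto simp: fmeasurable_def measure_def)
 qed
 hence Vm: "V \<in> lmeasurable" "measure lebesgue V = \<bar>det A\<bar>"
  using linear_image_lmeasure[OF matrix_vector_mul_linear, of "voronoi A" A] by (auto simp: V_def matrix_of_matrix_vector_mul)
 obtain R where R: "\<And>w. w \<in> voronoi A \<Longrightarrow> norm (A *v w) \<le> R" using voronoi_bounded by metis
 hence VR: "norm z \<le> R" if "z \<in> V" for z using that by (auto simp: V_def)
 have cell: "cell_prob m y \<delta> \<le> vol_const * sqrt (det L) * \<delta> ^ CARD('d) \<and>
    vol_const * sqrt (det L) * exp (- (\<delta> * R)\<^sup>2 / 2) * \<delta> ^ CARD('d) \<le> cell_prob m y \<delta>" if \<delta>: "\<delta> > 0" for \<delta>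
 proof -
  define S where "S = (\<lambda>z. \<delta> *\<^sub>R z) ` V"
  have "S = {z. \<forall>k. z \<bullet> (A *v ivec k) \<le> \<delta> * (norm (A *v ivec k))\<^sup>2 / 2}"
  proof safe
   fix z k assume "z \<in> S" thus "z \<bullet> (A *v ivec k) \<le> \<delta> * (norm (A *v ivec k))\<^sup>2 / 2"
    using \<delta> by (auto simp: S_def V_iff)
  next
   fix z assume "\<forall>k. z \<bullet> (A *v ivec k) \<le> \<delta> * (norm (A *v ivec k))\<^sup>2 / 2"
   hence "(1 / \<delta>) *\<^sub>R z \<in> V" using \<delta> by (auto simp: V_iff field_simps)
   thus "z \<in> S" unfolding S_def using \<delta> by (intro image_eqI[of _ _ "(1 / \<delta>) *\<^sub>R z"]) auto
  qed
  hence S_iff: "z \<in> S \<longleftrightarrow> (\<forall>k. z \<bullet> (A *v ivec k) \<le> \<delta> * (norm (A *v ivec k))\<^sup>2 / 2)" for z by blast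
  have "closed S"
  proof -
   have "S = (\<Inter>k. {z. z \<bullet> (A *v ivec k) \<le> \<delta> * (norm (A *v ivec k))\<^sup>2 / 2})" using S_iff by auto
   also have "closed \<dots>" by (intro closed_INT ballI closed_Collect_le continuous_intros)
   finally show ?thesis .
  qed
  hence Sm[measurable]: "S \<in> sets borel" by (rule borel_closed)
  have eS: "emeasure lborel S = ennreal (\<delta> ^ CARD('d) * sqrt (det L))"
  proof -
   have "emeasure lborel S = emeasure lebesgue S" using Sm by simp
   thus ?thesis using emeasure_lebesgue_affine[of \<delta> 0 V] emeasure_eq_measure2[OF Vm(1)] \<delta> by (simp add: S_def Vm dA flip: ennreal_mult')
  qed
  have ev: "{\<omega>\<in>space M. \<forall>k\<in>UNIV. \<delta> * (G m y \<omega> \<bullet> ivec k) \<le> \<delta>\<^sup>2 * quad m y (ivec k) / 2} = Nv -` S \<inter> space M"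
   using \<delta> by (auto simp: S_iff GNk quadA power2_eq_square)
  have "ennreal (cell_prob m y \<delta>) = emeasure (distr M borel Nv) S" unfolding lim_event_def ev by (simp add: emeasure_distr emeasure_eq_measure)
  also have "\<dots> = (\<integral>\<^sup>+z. ennreal (vol_const * exp (- (norm z)\<^sup>2 / 2)) * indicator S z \<partial>lborel)"
   unfolding dist by (subst emeasure_density) (auto simp: prod_ennreal prod_phi)
  finally have cp: "ennreal (cell_prob m y \<delta>) = (\<integral>\<^sup>+z. ennreal (vol_const * exp (- (norm z)\<^sup>2 / 2)) * indicator S z \<partial>lborel)" .
  have dL0: "det L > 0" using dP by simp
  have cint: "(\<integral>\<^sup>+z. ennreal c * indicator S z \<partial>lborel) = ennreal (c * (\<delta> ^ CARD('d) * sqrt (det L)))" if "c \<ge> 0" for c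
   using that dL0 \<delta> by (subst nn_integral_cmult) (auto simp: eS ennreal_mult)
  have "ennreal (cell_prob m y \<delta>) \<le> (\<integral>\<^sup>+z. ennreal vol_const * indicator S z \<partial>lborel)"
   unfolding cp using vol_const_pos by (intro nn_integral_mono) (auto split: split_indicator intro!: ennreal_leI mult_left_le)
  also have "\<dots> = ennreal (vol_const * sqrt (det L) * \<delta> ^ CARD('d))" using vol_const_pos by (subst cint) (auto simp: mult_ac)
  finally have up: "cell_prob m y \<delta> \<le> vol_const * sqrt (det L) * \<delta> ^ CARD('d)"
   using vol_const_pos \<delta> dP by (subst (asm) ennreal_le_iff) auto
  have "ennreal (vol_const * sqrt (det L) * exp (- (\<delta> * R)\<^sup>2 / 2) * \<delta> ^ CARD('d)) = (\<integral>\<^sup>+z. ennreal (vol_const * exp (- (\<delta> * R)\<^sup>2 / 2)) * indicator S z \<partial>lborel)"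
   using vol_const_pos by (subst cint) (auto simp: mult_ac)
  also have "\<dots> \<le> ennreal (cell_prob m y \<delta>)" unfolding cp
  proof (rule nn_integral_mono)
   fix z
   have "exp (- (\<delta> * R)\<^sup>2 / 2) \<le> exp (- (norm z)\<^sup>2 / 2)" if z: "z \<in> S"
   proof -
    obtain z' where "z' \<in> V" "z = \<delta> *\<^sub>R z'" using z by (auto simp: S_def)
    hence "norm z \<le> \<delta> * R" using VR \<delta> by (simp add: mult_left_mono)
    hence "(norm z)\<^sup>2 \<le> (\<delta> * R)\<^sup>2" by (intro power_mono) auto
    thus ?thesis by simp
   qed
   thus "ennreal (vol_const * exp (- (\<delta> * R)\<^sup>2 / 2)) * indicator S z \<le> ennreal (vol_const * exp (- (norm z)\<^sup>2 / 2)) * indicator S z"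
    using vol_const_pos by (auto split: split_indicator intro!: ennreal_leI mult_left_mono)
  qed
  finally have "vol_const * sqrt (det L) * exp (- (\<delta> * R)\<^sup>2 / 2) * \<delta> ^ CARD('d) \<le> cell_prob m y \<delta>"
   by (subst (asm) ennreal_le_iff) (auto simp: lim_event_def)
  with up show ?thesis by blast
 qed
 show "\<exists>R. \<forall>\<delta>>0. cell_prob m y \<delta> \<le> vol_const * sqrt (det (Lam m y)) * \<delta> ^ CARD('d) \<and>
    vol_const * sqrt (det (Lam m y)) * exp (- (\<delta> * R)\<^sup>2 / 2) * \<delta> ^ CARD('d) \<le> cell_prob m y \<delta>"
  using cell unfolding L_def by blast
qed

lemma cell_prob_limit:
 assumes m: "m < m0" and y: "y \<in> cbox 0 1" and d: "\<And>p::nat. 0 < d p" "d \<longlonglongrightarrow> 0"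
 shows "(\<lambda>p. cell_prob m y (d p) / d p ^ CARD('d)) \<longlonglongrightarrow> vol_const * sqrt (det (Lam m y))"
proof -
 obtain R where R: "\<And>\<delta>. \<delta> > 0 \<Longrightarrow> cell_prob m y \<delta> \<le> vol_const * sqrt (det (Lam m y)) * \<delta> ^ CARD('d) \<and>
    vol_const * sqrt (det (Lam m y)) * exp (- (\<delta> * R)\<^sup>2 / 2) * \<delta> ^ CARD('d) \<le> cell_prob m y \<delta>"
  using cell_prob_bounds(2)[OF m y] by blast
 show ?thesis
 proof (rule tendsto_sandwich)
  show "eventually (\<lambda>p. vol_const * sqrt (det (Lam m y)) * exp (- (d p * R)\<^sup>2 / 2) \<le> cell_prob m y (d p) / d p ^ CARD('d)) sequentially"
   using R[OF d(1)] d(1) by (intro always_eventually allI) (simp add: pos_le_divide_eq)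
  show "eventually (\<lambda>p. cell_prob m y (d p) / d p ^ CARD('d) \<le> vol_const * sqrt (det (Lam m y))) sequentially"
   using R[OF d(1)] d(1) by (intro always_eventually allI) (simp add: pos_divide_le_eq)
  have "(\<lambda>p. vol_const * sqrt (det (Lam m y)) * exp (- (d p * R)\<^sup>2 / 2)) \<longlonglongrightarrow> vol_const * sqrt (det (Lam m y)) * exp (- (0 * R)\<^sup>2 / 2)"
   by (intro tendsto_intros d) auto
  thus "(\<lambda>p. vol_const * sqrt (det (Lam m y)) * exp (- (d p * R)\<^sup>2 / 2)) \<longlonglongrightarrow> vol_const * sqrt (det (Lam m y))" by simp
 qed simp
qed

end

section \<open>Decomposition of the manifold\<close>

text \<open>Provides partial derivatives also at boundary points of the cube: the sign
  \<open>c\<close> points towards the farther of the two faces, and steps of length at most 1/2 then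
  stay inside.\<close>

lemma cube_axis_approach:
 assumes "y \<in> (cbox 0 1 :: (real ^ 'd::finite) set)"
 obtains z :: "nat \<Rightarrow> real ^ 'd" and a :: "nat \<Rightarrow> real"
 where "\<And>k. z k \<in> cbox 0 1" "z \<longlonglongrightarrow> y" "\<And>k. a k *\<^sub>R (z k - y) = axis i 1"
proof -
 define c :: real where "c = (if y $ i \<le> 1/2 then 1 else - 1)"
 define t :: "nat \<Rightarrow> real" where "t n = 1 / (2 * real (Suc n))" for n
 define z where "z n = y + (c * t n) *\<^sub>R axis i 1" for n
 have t: "0 < t n" "t n \<le> 1/2" for n by (auto simp: t_def field_simps)
 have y01: "0 \<le> y $ j" "y $ j \<le> 1" for j using assms by (auto simp: mem_box_cart)
 have "0 \<le> z n $ j \<and> z n $ j \<le> 1" for n j using y01[of j] y01[of i] t[of n] by (cases "j = i") (auto simp: z_def c_def axis_def)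
 hence 1: "z n \<in> cbox 0 1" for n by (simp add: mem_box_cart)
 have t0: "t \<longlonglongrightarrow> 0" unfolding t_def by real_asymp
 have "z \<longlonglongrightarrow> y + (c * 0) *\<^sub>R axis i 1" unfolding z_def by (intro tendsto_intros t0)
 moreover have "(c / t n) *\<^sub>R (z n - y) = axis i 1" for n using t(1)[of n] by (simp add: z_def c_def)
 ultimately show ?thesis using 1 by (intro that) auto
qed

text \<open>Strict differentiability at \<open>l\<close> already controls difference quotients based
  at points near \<open>l\<close>, hence the derivatives there. So a strict derivative existing
  everywhere is continuous.\<close>

lemma strict_diff_axis_cont:
 fixes f :: "real ^ 'd::finite \<Rightarrow> real"
 assumes s: "\<And>y. y \<in> cbox 0 1 \<Longrightarrow> strict_diff (cbox 0 1) f (D y) y"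
  and x: "\<And>n::nat. x n \<in> cbox 0 1" "l \<in> cbox 0 1" "x \<longlonglongrightarrow> l"
 shows "(\<lambda>n. D (x n) (axis i 1)) \<longlonglongrightarrow> D l (axis i 1)"
proof (rule tendstoI)
 fix \<epsilon> :: real assume \<epsilon>: "0 < \<epsilon>"
 obtain d where d: "0 < d" "\<And>y z. y \<in> cbox 0 1 \<inter> ball l d \<Longrightarrow> z \<in> cbox 0 1 \<inter> ball l d \<Longrightarrow> norm (f y - f z - D l (y - z)) \<le> \<epsilon> / 2 * norm (y - z)"
  by (rule strict_diffD[OF s[OF x(2)] half_gt_zero[OF \<epsilon>]]) blast
 show "eventually (\<lambda>n. dist (D (x n) (axis i 1)) (D l (axis i 1)) < \<epsilon>) sequentially" using tendstoD[OF x(3) d(1)]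
 proof eventually_elim
  case (elim n)
  obtain z a where z: "\<And>k. z k \<in> cbox 0 1" "z \<longlonglongrightarrow> x n" and a: "\<And>k. a k *\<^sub>R (z k - x n) = axis i 1"
   by (rule cube_axis_approach[OF x(1)[of n], of i]) blast
  have "(\<lambda>k. a k * (f (z k) - f (x n))) \<longlonglongrightarrow> D (x n) (axis i 1)" using a x(1) by (intro strict_diff_increment[OF s z]) auto
  hence "(\<lambda>k. norm (a k * (f (z k) - f (x n)) - D l (axis i 1))) \<longlonglongrightarrow> norm (D (x n) (axis i 1) - D l (axis i 1))"
   by (intro tendsto_intros)
  moreover have "eventually (\<lambda>k. z k \<in> ball l d) sequentially"
   using topological_tendstoD[OF z(2) open_ball, of l d] elim by (simp add: dist_commute)
  hence "eventually (\<lambda>k. norm (a k * (f (z k) - f (x n)) - D l (axis i 1)) \<le> \<epsilon> / 2) sequentially"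
  proof eventually_elim
   case zk: (elim k)
   have "a k * (f (z k) - f (x n)) - D l (axis i 1) = a k * (f (z k) - f (x n) - D l (z k - x n))"
    using linear_scale[OF bounded_linear.linear[OF strict_diff_bounded_linear[OF s[OF x(2)]]], of "a k" "z k - x n"] a by (simp add: right_diff_distrib)
   also have "norm \<dots> \<le> \<bar>a k\<bar> * (\<epsilon> / 2 * norm (z k - x n))"
    unfolding norm_mult real_norm_def[of "a k"] using zk elim z(1) x(1) by (intro mult_left_mono d(2)) (auto simp: dist_commute)
   also have "\<dots> = \<epsilon> / 2 * norm (a k *\<^sub>R (z k - x n))" by simp
   finally show ?case using a by simp
  qed
  ultimately have "norm (D (x n) (axis i 1) - D l (axis i 1)) \<le> \<epsilon> / 2" by (intro tendsto_upperbound[where F=sequentially]) auto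
  thus ?case using \<epsilon> by (simp add: dist_norm)
 qed
qed

context gaussian_charts
begin

lemma G_component_cont:
 assumes "m < m0" "w \<in> space M" "\<And>n::nat. x n \<in> cbox 0 1" "l \<in> cbox 0 1" "x \<longlonglongrightarrow> l"
 shows "(\<lambda>n. G m (x n) w $ i) \<longlonglongrightarrow> G m l w $ i"
 using strict_diff_axis_cont[where i=i, OF G_strict assms(3-5)] assms(1,2) by (simp add: inner_axis)

lemma Lam_cont:
 assumes m: "m < m0" shows "continuous_on (cbox 0 1) (\<lambda>y. Lam m y $ i $ j)"
proof (rule continuous_on_sequentiallyI)
 fix x :: "nat \<Rightarrow> real ^ 'd" and l assume x: "\<forall>n. x n \<in> cbox 0 1" and l: "l \<in> cbox 0 1" and lim: "x \<longlonglongrightarrow> l"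
 \<comment> \<open>\<open>cov_limit\<close> concerns variances; polarization transfers it to
   covariances.\<close>
 have pol: "cov Y Z = (cov (\<lambda>w. Y w + Z w) (\<lambda>w. Y w + Z w) - cov (\<lambda>w. Y w - Z w) (\<lambda>w. Y w - Z w)) / 4"
  if "Y \<in> H" "Z \<in> H" for Y Z using that by (simp add: cov_add_self cov_diff_self)
 note GH = G_component_H[OF m]
 have xn: "x n \<in> cbox 0 1" for n using x by simp
 have "(\<lambda>n. (cov (\<lambda>w. G m (x n) w $ i + G m (x n) w $ j) (\<lambda>w. G m (x n) w $ i + G m (x n) w $ j)
    - cov (\<lambda>w. G m (x n) w $ i - G m (x n) w $ j) (\<lambda>w. G m (x n) w $ i - G m (x n) w $ j)) / 4)
   \<longlonglongrightarrow> (cov (\<lambda>w. G m l w $ i + G m l w $ j) (\<lambda>w. G m l w $ i + G m l w $ j)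
    - cov (\<lambda>w. G m l w $ i - G m l w $ j) (\<lambda>w. G m l w $ i - G m l w $ j)) / 4"
  by (intro tendsto_divide tendsto_const tendsto_diff cov_limit H_add H_diff GH xn l tendsto_add G_component_cont m lim) auto
 thus "(\<lambda>n. Lam m (x n) $ i $ j) \<longlonglongrightarrow> Lam m l $ i $ j"
  by (simp only: Lam_def vec_lambda_beta pol[OF GH[OF xn] GH[OF xn]] pol[OF GH[OF l] GH[OF l]])
qed

definition dens :: "nat \<Rightarrow> real ^ 'd \<Rightarrow> real" where
 "dens m y = vol_const * sqrt (det (Lam m y))"

lemma dens_cont: "m < m0 \<Longrightarrow> continuous_on (cbox 0 1) (dens m)"
 unfolding dens_def[abs_def] det_def by (intro continuous_intros Lam_cont) auto

lemma dens_pos: "m < m0 \<Longrightarrow> y \<in> cbox 0 1 \<Longrightarrow> 0 < dens m y"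
 using cell_prob_bounds(1) vol_const_pos by (simp add: dens_def)

lemma dens_bounded:
 obtains D where "0 < D" "\<And>m y. m < m0 \<Longrightarrow> y \<in> cbox 0 1 \<Longrightarrow> dens m y \<le> D"
proof -
 have "\<exists>D. \<forall>y\<in>cbox 0 1. dens m y \<le> D" if "m < m0" for m
 proof -
  have "bounded (dens m ` cbox 0 1)" using compact_continuous_image[OF dens_cont[OF that] compact_cbox] by (rule compact_imp_bounded)
  then obtain a where "\<forall>y\<in>cbox 0 1. norm (dens m y) \<le> a" by (auto simp: bounded_iff)
  thus ?thesis by (intro exI[of _ a]) auto
 qed
 then obtain D where D: "\<And>m y. m < m0 \<Longrightarrow> y \<in> cbox 0 1 \<Longrightarrow> dens m y \<le> D m" by metis
 show ?thesis
 proof (rule that[of "1 + (\<Sum>m<m0. \<bar>D m\<bar>)"])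
  show "0 < 1 + (\<Sum>m<m0. \<bar>D m\<bar>)" by (simp add: add_pos_nonneg sum_nonneg)
  fix m y assume my: "m < m0" "y \<in> (cbox 0 1 :: (real ^ 'd) set)"
  have "dens m y \<le> \<bar>D m\<bar>" using D[OF my] by simp
  also have "\<dots> \<le> (\<Sum>m<m0. \<bar>D m\<bar>)" using my by (intro member_le_sum) auto
  finally show "dens m y \<le> 1 + (\<Sum>m<m0. \<bar>D m\<bar>)" by simp
 qed
qed

end

section \<open>Subdivision of the cube and step functions\<close>

definition subcube :: "nat \<Rightarrow> ('d \<Rightarrow> nat) \<Rightarrow> (real ^ 'd) set" where
 "subcube n j = cbox (gridpt 0 (1 / real n) j) (gridpt 0 (1 / real n) j + (1 / real n) *\<^sub>R 1)"

definition subcells :: "nat \<Rightarrow> ('d \<Rightarrow> nat) set" where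
 "subcells n = UNIV \<rightarrow>\<^sub>E {..<n}"

lemma finite_subcells: "finite (subcells n :: ('d::finite \<Rightarrow> nat) set)"
 and card_subcells: "card (subcells n :: ('d::finite \<Rightarrow> nat) set) = n ^ CARD('d)"
 unfolding subcells_def by (auto intro!: finite_PiE simp: card_PiE)

lemma mem_subcube: "x \<in> subcube n j \<longleftrightarrow> (\<forall>i. real (j i) / real n \<le> x $ i \<and> x $ i \<le> (real (j i) + 1) / real n)"
 by (auto simp: subcube_def gridpt_def mem_box_cart add_divide_distrib)

lemma subcube_subset: "0 < n \<Longrightarrow> j \<in> subcells n \<Longrightarrow> subcube n j \<subseteq> cbox 0 1"
proof
 fix x assume n: "0 < n" and j: "j \<in> subcells n" and x: "x \<in> subcube n j"
 have "0 \<le> x $ i \<and> x $ i \<le> 1" for i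
 proof -
  have "j i < n" using j by (auto simp: subcells_def)
  hence "(real (j i) + 1) / real n \<le> 1" using n by (simp add: divide_le_eq)
  moreover have "0 \<le> real (j i) / real n" by simp
  ultimately show ?thesis using x unfolding mem_subcube by (meson order_trans)
 qed
 thus "x \<in> cbox 0 1" by (simp add: mem_box_cart)
qed

lemma subcube_cover: "0 < n \<Longrightarrow> x \<in> cbox 0 1 \<Longrightarrow> \<exists>j\<in>subcells n. x \<in> subcube n j"
proof -
 assume n: "0 < n" and x: "x \<in> cbox 0 1"
 have x01: "0 \<le> x $ i" "x $ i \<le> 1" for i using x by (auto simp: mem_box_cart)
 define j where "j i = (if x $ i = 1 then n - 1 else nat \<lfloor>x $ i * real n\<rfloor>)" for i
 have "j i < n \<and> real (j i) / real n \<le> x $ i \<and> x $ i \<le> (real (j i) + 1) / real n" for i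
 proof (cases "x $ i = 1")
  case True thus ?thesis using n by (simp add: j_def of_nat_diff field_simps)
 next
  case False
  hence "x $ i < 1" using x01[of i] by simp
  hence lt: "x $ i * real n < real n" using n by simp
  have nn: "0 \<le> x $ i * real n" using x01 by simp
  have r: "real (j i) = of_int \<lfloor>x $ i * real n\<rfloor>" using False nn by (simp add: j_def)
  have "real (j i) \<le> x $ i * real n" "x $ i * real n \<le> real (j i) + 1" unfolding r by linarith+
  moreover from this lt have "j i < n" by linarith
  ultimately show ?thesis using n by (simp add: divide_le_eq le_divide_eq)
 qed
 thus ?thesis by (intro bexI[of _ j]) (auto simp: mem_subcube subcells_def)
qed

lemma subcube_diam:
 assumes "x \<in> subcube n j" "y \<in> (subcube n j :: (real ^ 'd::finite) set)"
 shows "norm (x - y) \<le> real CARD('d) / real n"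
proof -
 have "norm (x - y) \<le> (\<Sum>i\<in>UNIV. \<bar>(x - y) $ i\<bar>)" by (rule norm_le_l1_cart)
 also have "\<dots> \<le> (\<Sum>i\<in>(UNIV :: 'd set). 1 / real n)"
 proof (rule sum_mono)
  fix i
  have "real (j i) / real n \<le> x $ i" "x $ i \<le> real (j i) / real n + 1 / real n"
   "real (j i) / real n \<le> y $ i" "y $ i \<le> real (j i) / real n + 1 / real n"
   using assms by (auto simp: mem_subcube add_divide_distrib)
  thus "\<bar>(x - y) $ i\<bar> \<le> 1 / real n" by (auto simp: abs_le_iff)
 qed
 finally show ?thesis by simp
qed

definition fl :: "real \<Rightarrow> real ^ 'd \<Rightarrow> real ^ 'd" where
 "fl h y = (\<chi> i. h * of_int \<lfloor>y $ i / h\<rfloor>)"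

lemma fl_ivec: "fl h y = h *\<^sub>R ivec (\<chi> i. \<lfloor>y $ i / h\<rfloor>)"
 by (simp add: fl_def vec_eq_iff)

lemma fl_bounds: "0 < h \<Longrightarrow> fl h y $ i \<le> y $ i \<and> y $ i < fl h y $ i + h"
proof -
 assume h: "0 < h"
 have "of_int \<lfloor>y $ i / h\<rfloor> \<le> y $ i / h" "y $ i / h < of_int \<lfloor>y $ i / h\<rfloor> + 1" by linarith+
 hence "h * of_int \<lfloor>y $ i / h\<rfloor> \<le> y $ i" "y $ i < h * (of_int \<lfloor>y $ i / h\<rfloor> + 1)"
  using h by (simp_all only: pos_le_divide_eq pos_divide_less_eq mult.commute)
 thus ?thesis by (simp add: fl_def distrib_left)
qed

lemma fl_unique:
 assumes h: "0 < h" and z: "z = h *\<^sub>R ivec k" and y: "\<And>i. z $ i \<le> y $ i \<and> y $ i < z $ i + h"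
 shows "z = fl h y"
proof -
 have "\<lfloor>y $ i / h\<rfloor> = k $ i" for i
 proof (rule floor_unique)
  show "of_int (k $ i) \<le> y $ i / h" "y $ i / h < of_int (k $ i) + 1" using y[of i] h by (auto simp: z field_simps)
 qed
 thus ?thesis by (simp add: fl_def z vec_eq_iff)
qed

lemma fl_lim:
 assumes "\<And>n::nat. 0 < h n" "h \<longlonglongrightarrow> 0" shows "(\<lambda>n. fl (h n) y) \<longlonglongrightarrow> y"
proof (rule vec_tendstoI)
 fix i
 show "(\<lambda>n. fl (h n) y $ i) \<longlonglongrightarrow> y $ i"
 proof (rule tendsto_sandwich[of "\<lambda>n. y $ i - h n" _ _ "\<lambda>_. y $ i"])
  have "(\<lambda>n. y $ i - h n) \<longlonglongrightarrow> y $ i - 0" by (intro tendsto_intros assms)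
  thus "(\<lambda>n. y $ i - h n) \<longlonglongrightarrow> y $ i" by simp
  show "eventually (\<lambda>n. y $ i - h n \<le> fl (h n) y $ i) sequentially" "eventually (\<lambda>n. fl (h n) y $ i \<le> y $ i) sequentially"
   using fl_bounds[OF assms(1), of _ y i] by (auto intro!: always_eventually simp: algebra_simps less_imp_le)
 qed auto
qed

text \<open>Spreads the value at a lattice point over the half-open mesh cube above it, turning a
  lattice sum into an integral to which dominated convergence applies. Half-open cubes make the
  corner \<open>fl h y\<close> belonging to \<open>y\<close> unique.\<close>

definition step_fun :: "real \<Rightarrow> (real ^ 'd) set \<Rightarrow> (real ^ 'd \<Rightarrow> real) \<Rightarrow> real ^ 'd \<Rightarrow> real" where
 "step_fun h Z f y = (\<Sum>z\<in>Z. f z * indicator {y. \<forall>i. z $ i \<le> y $ i \<and> y $ i < z $ i + h} y)"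

lemma step_fun_value:
 assumes "finite Z" "0 < h" "\<And>z. z \<in> Z \<Longrightarrow> \<exists>k. z = h *\<^sub>R ivec k"
 shows "step_fun h Z f y = (if fl h y \<in> Z then f (fl h y) else 0)"
proof -
 have "f z * indicator {y. \<forall>i. z $ i \<le> y $ i \<and> y $ i < z $ i + h} y = (if z = fl h y then f z else 0)" if zZ: "z \<in> Z" for z
 proof (cases "z = fl h y")
  case True
  thus ?thesis using fl_bounds[OF assms(2)] by (auto simp: indicator_def)
 next
  case False
  obtain k where "z = h *\<^sub>R ivec k" using assms(3)[OF zZ] by blast
  hence "\<not> (\<forall>i. z $ i \<le> y $ i \<and> y $ i < z $ i + h)" using fl_unique[OF assms(2)] False by blast
  thus ?thesis using False by (auto simp: indicator_def)
 qed
 hence "step_fun h Z f y = (\<Sum>z\<in>Z. if z = fl h y then f z else 0)" unfolding step_fun_def by (intro sum.cong) auto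
 thus ?thesis using assms(1) by simp
qed

lemma step_fun_integral:
 assumes "finite Z" "0 < h"
 shows "integrable lborel (step_fun h Z f)" "(\<integral>y. step_fun h Z f y \<partial>lborel) = h ^ CARD('d) * (\<Sum>z\<in>Z. f (z :: real ^ 'd::finite))"
proof -
 let ?C = "\<lambda>z :: real ^ 'd. {y. \<forall>i. z $ i \<le> y $ i \<and> y $ i < z $ i + h}"
 note C = box_halfopen_measure[OF assms(2)]
 have i: "integrable lborel (indicator (?C z) :: _ \<Rightarrow> real)" for z by (intro integrable_real_indicator C) (simp add: C)
 thus "integrable lborel (step_fun h Z f)" unfolding step_fun_def[abs_def] by auto
 have "(\<integral>y. step_fun h Z f y \<partial>lborel) = (\<Sum>z\<in>Z. f z * (\<integral>y. indicator (?C z) y \<partial>lborel))"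
  unfolding step_fun_def using i by (subst Bochner_Integration.integral_sum) auto
 also have "\<dots> = (\<Sum>z\<in>Z. f z * h ^ CARD('d))" using assms(2) by (intro sum.cong) (auto simp: measure_def C)
 finally show "(\<integral>y. step_fun h Z f y \<partial>lborel) = h ^ CARD('d) * (\<Sum>z\<in>Z. f z)"
  by (simp add: sum_distrib_left mult.commute[of _ "h ^ CARD('d)"])
qed

lemma measure_nbhd_null:
 fixes B :: "'a::euclidean_space set"
 assumes B: "compact B" "B \<noteq> {}" "B \<in> null_sets lborel" and c: "0 < c"
 shows "(\<lambda>n. measure lborel {x. infdist x B \<le> c / real (Suc n)}) \<longlonglongrightarrow> 0"
proof -
 define N where "N n = {x. infdist x B \<le> c / real (Suc n)}" for n
 have cN: "compact (N n)" for n unfolding N_def using B c by (intro compact_infdist_le) auto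
 have "(\<lambda>n. measure lborel (N n)) \<longlonglongrightarrow> measure lborel (\<Inter>n. N n)"
 proof (rule Lim_measure_decseq)
  show "range N \<subseteq> sets lborel" using cN by (auto intro: borel_compact)
  show "decseq N"
  proof (rule decseq_SucI)
   fix n
   have "c / real (Suc (Suc n)) \<le> c / real (Suc n)" using c by (intro divide_left_mono) auto
   thus "N (Suc n) \<subseteq> N n" unfolding N_def using order_trans by blast
  qed
  show "emeasure lborel (N i) \<noteq> \<infinity>" for i using emeasure_compact_finite[OF cN[of i]] by simp
 qed
 also have "(\<Inter>n. N n) = B"
 proof
  show "B \<subseteq> (\<Inter>n. N n)" using c by (auto simp: N_def)
  show "(\<Inter>n. N n) \<subseteq> B"
  proof
   fix x assume "x \<in> (\<Inter>n. N n)"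
   hence x: "infdist x B \<le> c / real (Suc n)" for n by (auto simp: N_def)
   have "(\<lambda>n. c / real (Suc n)) \<longlonglongrightarrow> 0" by real_asymp
   hence "infdist x B \<le> 0" by (rule LIMSEQ_le_const) (use x in auto)
   hence "infdist x B = 0" using infdist_nonneg[of x B] by linarith
   thus "x \<in> B" using in_closed_iff_infdist_zero[OF compact_imp_closed[OF B(1)] B(2)] by simp
  qed
 qed
 also have "measure lborel B = 0" using B by (simp add: measure_eq_0_null_sets)
 finally show ?thesis by (simp add: N_def)
qed

section \<open>Disjoint parts of the charts, their cores and seams\<close>

context gaussian_charts
begin

text \<open>Removing what earlier charts already cover makes the images a partition of
  \<open>I\<close>, with each point assigned to the first chart that reaches it.\<close>

definition part :: "nat \<Rightarrow> (real ^ 'd) set" where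
 "part m = {x\<in>cbox 0 1. \<psi> m x \<notin> (\<Union>l<m. \<psi> l ` cbox 0 1)}"

definition good :: "nat \<Rightarrow> nat \<Rightarrow> ('d \<Rightarrow> nat) set" where
 "good n m = {j\<in>subcells n. subcube n j \<subseteq> part m}"

definition bad :: "nat \<Rightarrow> nat \<Rightarrow> ('d \<Rightarrow> nat) set" where
 "bad n m = {j\<in>subcells n. subcube n j \<inter> part m \<noteq> {} \<and> \<not> subcube n j \<subseteq> part m}"

text \<open>A finite union of closed cubes, hence compact. Compactness puts the images of different
  cores at positive distance, which disjointness of the parts alone does not give.\<close>

definition core :: "nat \<Rightarrow> nat \<Rightarrow> (real ^ 'd) set" where
 "core n m = (\<Union>j\<in>good n m. subcube n j)"

lemma part_cover: "I = (\<Union>m<m0. \<psi> m ` part m)"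
proof
 show "(\<Union>m<m0. \<psi> m ` part m) \<subseteq> I" using \<psi>_I by (auto simp: part_def)
 show "I \<subseteq> (\<Union>m<m0. \<psi> m ` part m)"
 proof
  fix t assume "t \<in> I"
  hence ex: "\<exists>m. m < m0 \<and> t \<in> \<psi> m ` cbox 0 1" using \<psi>_cover by auto
  define m where "m = (LEAST m. m < m0 \<and> t \<in> \<psi> m ` cbox 0 1)"
  have m: "m < m0" "t \<in> \<psi> m ` cbox 0 1" using LeastI_ex[OF ex] by (auto simp: m_def)
  have "t \<notin> \<psi> l ` cbox 0 1" if "l < m" for l
   using not_less_Least[of l "\<lambda>m. m < m0 \<and> t \<in> \<psi> m ` cbox 0 1"] that m by (auto simp: m_def)
  thus "t \<in> (\<Union>m<m0. \<psi> m ` part m)" using m by (auto simp: part_def)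
 qed
qed

lemma part_disjoint:
 assumes "l \<noteq> m" shows "\<psi> l ` part l \<inter> \<psi> m ` part m = {}"
proof -
 have *: "\<psi> l ` part l \<inter> \<psi> m ` part m = {}" if "l < m" for l m
 proof (rule ccontr)
  assume "\<psi> l ` part l \<inter> \<psi> m ` part m \<noteq> {}"
  then obtain t where "t \<in> \<psi> l ` part l" "t \<in> \<psi> m ` part m" by blast
  then obtain x y where xy: "x \<in> part l" "y \<in> part m" "\<psi> m y = \<psi> l x" by (metis imageE)
  hence "\<psi> m y \<in> (\<Union>l<m. \<psi> l ` cbox 0 1)" using that by (auto simp: part_def)
  with xy(2) show False by (simp add: part_def)
 qed
 show ?thesis
 proof (cases "l < m")
  case False
  hence "m < l" using assms by simp
  thus ?thesis using *[of m l] by blast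
 qed (rule *)
qed

lemma part_subset: "part m \<subseteq> cbox 0 1"
 by (auto simp: part_def)

lemma closed_chart_image: "m < m0 \<Longrightarrow> compact (\<psi> m ` cbox 0 1)"
 by (intro compact_continuous_image \<psi>_cont compact_cbox)

lemma closed_complement_part:
 assumes m: "m < m0" shows "closed (cbox 0 1 - part m)"
proof -
 have "compact (\<Union>l<m. \<psi> l ` cbox 0 1)" using m by (intro compact_UN closed_chart_image) auto
 hence "closed (cbox 0 1 \<inter> \<psi> m -` (\<Union>l<m. \<psi> l ` cbox 0 1))"
  using m by (intro continuous_closed_preimage \<psi>_cont compact_imp_closed) auto
 also have "cbox 0 1 \<inter> \<psi> m -` (\<Union>l<m. \<psi> l ` cbox 0 1) = cbox 0 1 - part m" by (auto simp: part_def)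
 finally show ?thesis .
qed

lemma part_measurable: "m < m0 \<Longrightarrow> part m \<in> sets borel"
proof -
 assume "m < m0"
 hence "cbox 0 1 - part m \<in> sets borel" by (intro borel_closed closed_complement_part)
 hence "cbox 0 1 - (cbox 0 1 - part m) \<in> sets borel" by auto
 also have "cbox 0 1 - (cbox 0 1 - part m) = part m" using part_subset by auto
 finally show ?thesis .
qed

text \<open>Where \<open>part m\<close> can border on what earlier charts cover: a covered point
  outside the seam lies in the relatively open image of an open cube, so nearby points are covered
  as well.\<close>

definition seam :: "nat \<Rightarrow> (real ^ 'd) set" where
 "seam m = (\<Union>l<m. cbox 0 1 \<inter> \<psi> m -` (\<psi> l ` (cbox 0 1 - box 0 1)))"

lemma seam_compact:
 assumes m: "m < m0" shows "compact (seam m)"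
proof -
 have "compact (cbox 0 1 \<inter> \<psi> m -` (\<psi> l ` (cbox 0 1 - box 0 1)))" if "l < m" for l
 proof -
  have "compact (cbox 0 1 - box 0 1 :: (real ^ 'd) set)" by (intro compact_diff compact_cbox open_box)
  hence "compact (\<psi> l ` (cbox 0 1 - box 0 1))" using that m by (intro compact_continuous_image continuous_on_subset[OF \<psi>_cont[of l]]) auto
  hence "closed (cbox 0 1 \<inter> \<psi> m -` (\<psi> l ` (cbox 0 1 - box 0 1)))"
   using m by (intro continuous_closed_preimage \<psi>_cont compact_imp_closed) auto
  thus ?thesis using compact_Int_closed[OF compact_cbox, of _ 0 1] by (metis inf.left_idem)
 qed
 thus ?thesis unfolding seam_def by (intro compact_UN) auto
qed

lemma seam_null: assumes m: "m < m0" shows "seam m \<in> null_sets lborel"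
proof -
 have "negligible (seam m)" unfolding seam_def using m by (intro negligible_Union) (auto intro!: \<psi>_null)
 moreover have "seam m \<in> sets lborel" using seam_compact[OF m] by (auto intro: borel_compact)
 ultimately show ?thesis by (simp add: negligible_iff_null_sets null_sets_completion_iff)
qed

text \<open>On a subcube avoiding the seam the complement of \<open>part m\<close> is relatively
  closed, and also relatively open as the preimage of images of open cubes. Connectedness leaves all
  or nothing, so the subcube is not bad.\<close>

lemma bad_meets_seam:
 assumes m: "m < m0" and n: "0 < n" and j: "j \<in> bad n m"
 shows "subcube n j \<inter> seam m \<noteq> {}"
proof
 assume no: "subcube n j \<inter> seam m = {}"
 let ?C = "subcube n j"
 have CQ: "?C \<subseteq> cbox 0 1" using j n by (intro subcube_subset) (auto simp: bad_def)
 have "connected ?C" unfolding subcube_def by (intro convex_connected convex_box)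
 have cont: "continuous_on ?C (\<psi> m)" using \<psi>_cont[OF m] CQ by (rule continuous_on_subset)
 have im: "\<psi> m \<in> ?C \<rightarrow> I" using CQ m \<psi>_I by auto
 have "openin (top_of_set ?C) (?C \<inter> \<psi> m -` (\<Union>l<m. \<psi> l ` box 0 1))"
 proof (rule continuous_openin_preimage[OF cont im])
  show "openin (top_of_set I) (\<Union>l<m. \<psi> l ` box 0 1)" using m by (intro openin_clauses(3)) (auto intro!: \<psi>_open)
 qed
 also have "?C \<inter> \<psi> m -` (\<Union>l<m. \<psi> l ` box 0 1) = ?C - part m"
 proof
  show "?C \<inter> \<psi> m -` (\<Union>l<m. \<psi> l ` box 0 1) \<subseteq> ?C - part m"
   using box_subset_cbox[of 0 "1 :: real ^ 'd"] by (auto simp: part_def)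
  show "?C - part m \<subseteq> ?C \<inter> \<psi> m -` (\<Union>l<m. \<psi> l ` box 0 1)"
  proof
   fix x assume x: "x \<in> ?C - part m"
   then obtain l y where l: "l < m" "y \<in> cbox 0 1" "\<psi> m x = \<psi> l y" using CQ by (auto simp: part_def)
   have "y \<in> box 0 1"
   proof (rule ccontr)
    assume "y \<notin> box 0 1"
    hence "x \<in> seam m" using l x CQ by (auto simp: seam_def)
    with no x show False by auto
   qed
   thus "x \<in> ?C \<inter> \<psi> m -` (\<Union>l<m. \<psi> l ` box 0 1)" using l x by auto
  qed
 qed
 finally have op: "openin (top_of_set ?C) (?C - part m)" .
 have "closedin (top_of_set ?C) (?C \<inter> (cbox 0 1 - part m))" using closed_complement_part[OF m] by (intro closedin_closed_Int)
 also have "?C \<inter> (cbox 0 1 - part m) = ?C - part m" using CQ by auto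
 finally have cl: "closedin (top_of_set ?C) (?C - part m)" .
 from \<open>connected ?C\<close> op cl have "?C - part m = {} \<or> ?C - part m = ?C" unfolding connected_clopen by blast
 with j show False by (auto simp: bad_def)
qed

text \<open>Bad subcubes meet the seam, so they lie within one diameter of it. Their total volume is
  at most that of a shrinking neighbourhood of a compact null set. Half-open copies of the subcubes
  make the volume count exact.\<close>

lemma bad_fraction:
 assumes m: "m < m0"
 shows "(\<lambda>n. real (card (bad (Suc n) m)) / real (Suc n) ^ CARD('d)) \<longlonglongrightarrow> 0"
proof (cases "seam m = {}")
 case True
 hence "bad (Suc n) m = {}" for n using bad_meets_seam[OF m, of "Suc n"] by blast
 thus ?thesis by simp
next
 case False
 define N where "N n = {x. infdist x (seam m) \<le> real CARD('d) / real (Suc n)}" for n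
 have lim: "(\<lambda>n. measure lborel (N n)) \<longlonglongrightarrow> 0"
  unfolding N_def by (rule measure_nbhd_null[OF seam_compact[OF m] False seam_null[OF m]]) simp
 have bnd: "real (card (bad (Suc n) m)) / real (Suc n) ^ CARD('d) \<le> measure lborel (N n)" for n
 proof -
  let ?h = "1 / real (Suc n)"
  let ?Z = "gridpt 0 ?h ` bad (Suc n) m"
  have cN: "compact (N n)" unfolding N_def using False seam_compact[OF m] by (intro compact_infdist_le) auto
  have fb: "finite (bad (Suc n) m)" by (auto simp: bad_def intro: finite_subset[OF _ finite_subcells[of "Suc n"]])
  have h: "0 < ?h" by simp
  have "inj_on (gridpt 0 ?h) (bad (Suc n) m)" by (auto simp: inj_on_def gridpt_def vec_eq_iff fun_eq_iff simp del: of_nat_Suc)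
  hence "real (card (bad (Suc n) m)) / real (Suc n) ^ CARD('d) = (\<integral>y. step_fun ?h ?Z (\<lambda>_. 1) y \<partial>lborel)"
   using fb by (subst step_fun_integral(2)) (auto simp: card_image power_one_over simp del: of_nat_Suc)
  also have "\<dots> \<le> (\<integral>y. indicator (N n) y \<partial>lborel)"
  proof (rule integral_mono)
   show "integrable lborel (step_fun ?h ?Z (\<lambda>_. 1))" using fb h by (intro step_fun_integral(1)) auto
   show "integrable lborel (indicator (N n) :: _ \<Rightarrow> real)"
    using cN emeasure_compact_finite[OF cN] by (intro integrable_real_indicator) (auto intro: borel_compact)
   fix y :: "real ^ 'd"
   have "y \<in> N n" if "fl ?h y \<in> ?Z"
   proof -
    obtain j where j: "j \<in> bad (Suc n) m" "fl ?h y = gridpt 0 ?h j" using \<open>fl ?h y \<in> ?Z\<close> by blast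
    obtain b where b: "b \<in> subcube (Suc n) j" "b \<in> seam m" using bad_meets_seam[OF m _ j(1)] by auto
    have "fl ?h y $ i = real (j i) / real (Suc n)" for i unfolding j(2) by (simp add: gridpt_def)
    hence "y \<in> subcube (Suc n) j" using fl_bounds[OF h, of y] unfolding mem_subcube by (simp add: add_divide_distrib less_imp_le del: of_nat_Suc)
    hence "dist y b \<le> real CARD('d) / real (Suc n)" using b unfolding dist_norm by (intro subcube_diam)
    thus ?thesis using infdist_le[OF b(2), of y] by (simp add: N_def del: of_nat_Suc)
   qed
   moreover have "\<exists>k. z = ?h *\<^sub>R ivec k" if "z \<in> ?Z" for z
   proof -
    obtain j where "z = gridpt 0 ?h j" using \<open>z \<in> ?Z\<close> by blast
    thus ?thesis by (intro exI[of _ "\<chi> i. int (j i)"]) (simp add: gridpt_def vec_eq_iff)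
   qed
   ultimately show "step_fun ?h ?Z (\<lambda>_. 1) y \<le> indicator (N n) y" using fb h by (subst step_fun_value) auto
  qed
  finally show ?thesis by simp
 qed
 show ?thesis by (rule tendsto_sandwich[OF _ _ tendsto_const lim]) (use bnd in \<open>auto simp del: of_nat_Suc\<close>)
qed

lemma part_covered:
 assumes n: "0 < n" shows "part m \<subseteq> core n m \<union> (\<Union>j\<in>bad n m. subcube n j)"
proof
 fix x assume x: "x \<in> part m"
 then obtain j where "j \<in> subcells n" "x \<in> subcube n j" using subcube_cover[OF n] part_subset by blast
 thus "x \<in> core n m \<union> (\<Union>j\<in>bad n m. subcube n j)"
  using x by (cases "subcube n j \<subseteq> part m") (auto simp: core_def good_def bad_def)
qed

lemma core_subset: "core n m \<subseteq> part m"
 by (auto simp: core_def good_def)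

lemma finite_good: "finite (good n m)" and finite_bad: "finite (bad n m)"
 by (auto simp: good_def bad_def intro: finite_subset[OF _ finite_subcells[of n]])

lemma compact_core: "compact (core n m)"
 unfolding core_def subcube_def using finite_good by (intro compact_UN) auto

lemma core_frontier_null: "frontier (core n m) \<in> null_sets lborel"
proof -
 have "frontier (\<Union>(subcube n ` good n m)) \<subseteq> (\<Union>t\<in>subcube n ` good n m. frontier t)"
  using finite_good by (intro frontier_Union_subset finite_imageI)
 hence sub: "frontier (core n m) \<subseteq> (\<Union>j\<in>good n m. frontier (subcube n j))" by (simp add: core_def)
 have "negligible (frontier (subcube n j))" for j :: "'d \<Rightarrow> nat" unfolding subcube_def by (intro negligible_convex_frontier convex_box)
 hence "negligible (\<Union>j\<in>good n m. frontier (subcube n j))" using finite_good by (intro negligible_Union) auto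
 hence "negligible (frontier (core n m))" using sub by (rule negligible_subset)
 moreover have "frontier (core n m) \<in> sets lborel" by (simp add: borel_closed)
 ultimately show ?thesis by (simp add: negligible_iff_null_sets null_sets_completion_iff)
qed

end

section \<open>Nets\<close>

text \<open>Number of divisions of the edge of a subcube of side \<open>1/N\<close>, so that the
  resulting cells have side close to \<open>1/u\<close> and still fit the subcubes; the product
  \<open>N * nsub N u\<close> lies between \<open>u\<close> and \<open>u + 2 * N\<close>. The added
  1 keeps it positive for every \<open>u\<close>.\<close>

definition nsub :: "nat \<Rightarrow> real \<Rightarrow> nat" where
 "nsub N u = nat \<lceil>u / real N\<rceil> + 1"

text \<open>Each cell of side about \<open>1/u\<close> is halved \<open>p\<close> times, so that
  every such cell carries a full dyadic grid of the chaining argument. Multiplied by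
  \<open>u\<close> the mesh tends to \<open>\<delta> = 1 / 2 ^ p\<close>.\<close>

definition mesh :: "nat \<Rightarrow> nat \<Rightarrow> real \<Rightarrow> real" where
 "mesh N p u = 1 / (real N * real (nsub N u) * 2 ^ p)"

definition lat :: "nat \<Rightarrow> nat \<Rightarrow> real \<Rightarrow> (real ^ 'd) set" where
 "lat N p u = grid 0 (mesh N p u) (N * nsub N u * 2 ^ p)"

lemma nsub_pos: "0 < nsub N u"
 by (simp add: nsub_def)

lemma nsub_bounds:
 assumes "0 < N" "0 \<le> u" shows "u \<le> real N * real (nsub N u)" "real N * real (nsub N u) \<le> u + 2 * real N"
proof -
 have "real (nat \<lceil>u / real N\<rceil>) = of_int \<lceil>u / real N\<rceil>" using assms by simp
 hence "u / real N \<le> real (nsub N u)" "real (nsub N u) \<le> u / real N + 2" unfolding nsub_def by (simp_all, linarith+)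
 thus "u \<le> real N * real (nsub N u)" "real N * real (nsub N u) \<le> u + 2 * real N" using assms by (auto simp: field_simps)
qed

lemma mesh_pos: "0 < N \<Longrightarrow> 0 < mesh N p u"
 using nsub_pos[of N u] by (simp add: mesh_def)

lemma mesh_le_1: "0 < N \<Longrightarrow> mesh N p u \<le> 1"
proof -
 assume "0 < N"
 hence "1 \<le> real N * real (nsub N u) * 2 ^ p" using nsub_pos[of N u] by (intro mult_ge1_I) auto
 thus ?thesis by (simp add: mesh_def)
qed

lemma mesh_mult: "0 < N \<Longrightarrow> mesh N p u * real (N * nsub N u * 2 ^ p) = 1"
 using nsub_pos[of N u] by (simp add: mesh_def)

lemma lat_iff:
 assumes N: "0 < N"
 shows "x \<in> lat N p u \<longleftrightarrow> x \<in> cbox 0 1 \<and> (\<exists>k. x = mesh N p u *\<^sub>R ivec k)"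
proof
 assume x: "x \<in> lat N p u"
 then obtain k where k: "x = gridpt 0 (mesh N p u) k" by (auto simp: lat_def grid_def)
 have "x \<in> cbox 0 (0 + (mesh N p u * real (N * nsub N u * 2 ^ p)) *\<^sub>R 1)"
  using x grid_subset_box[of "mesh N p u" 0 "N * nsub N u * 2 ^ p"] mesh_pos[OF N] unfolding lat_def by (meson less_imp_le subsetD)
 hence "x \<in> cbox 0 1" using mesh_mult[OF N] by simp
 moreover have "x = mesh N p u *\<^sub>R ivec (\<chi> i. int (k i))" by (simp add: k gridpt_def vec_eq_iff)
 ultimately show "x \<in> cbox 0 1 \<and> (\<exists>k. x = mesh N p u *\<^sub>R ivec k)" by blast
next
 assume "x \<in> cbox 0 1 \<and> (\<exists>k. x = mesh N p u *\<^sub>R ivec k)"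
 then obtain k where x: "x \<in> cbox 0 1" "x = mesh N p u *\<^sub>R ivec k" by blast
 have h: "mesh N p u > 0" using N by (rule mesh_pos)
 have b: "0 \<le> mesh N p u * of_int (k $ i)" "mesh N p u * of_int (k $ i) \<le> 1" for i using x by (auto simp: mem_box_cart)
 have k0: "0 \<le> k $ i" for i using b(1)[of i] h by (simp add: zero_le_mult_iff)
 have "k $ i \<le> int (N * nsub N u * 2 ^ p)" for i
 proof -
  have "mesh N p u * of_int (k $ i) \<le> mesh N p u * real (N * nsub N u * 2 ^ p)" using b(2) mesh_mult[OF N] by simp
  hence "real_of_int (k $ i) \<le> of_int (int (N * nsub N u * 2 ^ p))" using h by (simp add: mult_le_cancel_left_pos del: of_nat_mult)
  thus ?thesis by (simp only: of_int_le_iff)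
 qed
 hence "(\<lambda>i. nat (k $ i)) \<in> UNIV \<rightarrow>\<^sub>E {..N * nsub N u * 2 ^ p}" by (auto simp: nat_le_iff)
 moreover have "x = gridpt 0 (mesh N p u) (\<lambda>i. nat (k $ i))" using k0 by (simp add: x(2) gridpt_def vec_eq_iff)
 ultimately show "x \<in> lat N p u" by (auto simp: lat_def grid_def)
qed

lemma lat_memI: "0 < N \<Longrightarrow> x \<in> cbox 0 1 \<Longrightarrow> x = mesh N p u *\<^sub>R ivec k \<Longrightarrow> x \<in> lat N p u"
 using lat_iff by blast

lemma finite_lat: "finite (lat N p u :: (real ^ 'd::finite) set)"
 by (simp add: lat_def finite_grid)

lemma mesh_lim:
 assumes N: "0 < N" and u: "filterlim u at_top sequentially"
 shows "(\<lambda>n. u n * mesh N p (u n)) \<longlonglongrightarrow> 1 / 2 ^ p"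
proof -
 have ev: "eventually (\<lambda>n. 0 < u n) sequentially" using u by (simp add: filterlim_at_top_dense)
 have "(\<lambda>n. u n / (real N * real (nsub N (u n)))) \<longlonglongrightarrow> 1"
 proof (rule tendsto_sandwich)
  show "eventually (\<lambda>n. u n / (u n + 2 * real N) \<le> u n / (real N * real (nsub N (u n)))) sequentially" using ev
  proof eventually_elim
   case (elim n)
   have "0 < real N * real (nsub N (u n))" using N nsub_pos by simp
   thus ?case using elim nsub_bounds[OF N, of "u n"] by (intro divide_left_mono) auto
  qed
  show "eventually (\<lambda>n. u n / (real N * real (nsub N (u n))) \<le> 1) sequentially" using ev
  proof eventually_elim
   case (elim n)
   have "0 < real N * real (nsub N (u n))" using N nsub_pos by simp
   thus ?case using elim nsub_bounds[OF N, of "u n"] by (simp add: pos_divide_le_eq)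
  qed
  have "((\<lambda>v. v / (v + 2 * real N)) \<longlongrightarrow> 1) at_top" by real_asymp
  thus "(\<lambda>n. u n / (u n + 2 * real N)) \<longlonglongrightarrow> 1" by (rule filterlim_compose[OF _ u])
 qed simp
 hence "(\<lambda>n. u n / (real N * real (nsub N (u n))) * (1 / 2 ^ p)) \<longlonglongrightarrow> 1 * (1 / 2 ^ p)" by (intro tendsto_intros)
 thus ?thesis by (simp add: mesh_def field_simps)
qed

lemma mesh_null:
 assumes "0 < N" "filterlim u at_top sequentially" shows "(\<lambda>n. mesh N p (u n)) \<longlonglongrightarrow> 0"
 using assms(2) mesh_lim[OF assms] by (rule tendsto_zero_of_mult_at_top)

context gaussian_charts
begin

definition net :: "nat \<Rightarrow> nat \<Rightarrow> real \<Rightarrow> 't set" where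
 "net N p u = (\<Union>m<m0. \<psi> m ` (lat N p u \<inter> core N m))"

lemma core_Q: "core N m \<subseteq> cbox 0 1"
 using core_subset part_subset by blast

lemma finite_lat_core: "finite (lat N p u \<inter> core N m)"
 using finite_lat by (rule finite_Int[OF disjI1])

lemma finite_net: "finite (net N p u)"
 unfolding net_def by (intro finite_UN_I finite_imageI finite_lat_core) simp

lemma net_subset: "net N p u \<subseteq> (\<Union>m<m0. \<psi> m ` core N m)"
 by (auto simp: net_def)

lemma core_image_I: "(\<Union>m<m0. \<psi> m ` core N m) \<subseteq> I"
 using core_Q \<psi>_I by blast

lemma net_I: "net N p u \<subseteq> I"
 using net_subset core_image_I by blast

lemma gT_net:
 "gT (net N p u) v = (\<Sum>m<m0. \<Sum>z\<in>lat N p u \<inter> core N m. argmax_prob (net N p u) (\<psi> m z) v)"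
proof -
 have disj: "\<psi> l ` (lat N p u \<inter> core N l) \<inter> \<psi> m ` (lat N p u \<inter> core N m) = {}" if "l \<noteq> m" for l m
  using part_disjoint[OF that] core_subset[of N l] core_subset[of N m] by blast
 have "gT (net N p u) v = (\<Sum>m<m0. \<Sum>t\<in>\<psi> m ` (lat N p u \<inter> core N m). argmax_prob (net N p u) t v)"
  unfolding gT_def by (subst (1) net_def, rule sum.UNION_disjoint) (use finite_lat_core disj in auto)
 also have "\<dots> = (\<Sum>m<m0. \<Sum>z\<in>lat N p u \<inter> core N m. argmax_prob (net N p u) (\<psi> m z) v)"
 proof (rule sum.cong[OF refl])
  fix m assume "m \<in> {..<m0}"
  hence "inj_on (\<psi> m) (lat N p u \<inter> core N m)" using core_Q by (intro inj_on_subset[OF \<psi>_inj]) auto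
  thus "(\<Sum>t\<in>\<psi> m ` (lat N p u \<inter> core N m). argmax_prob (net N p u) t v) = (\<Sum>z\<in>lat N p u \<inter> core N m. argmax_prob (net N p u) (\<psi> m z) v)"
   by (subst sum.reindex) auto
 qed
 finally show ?thesis .
qed

lemma core_separation:
 assumes m: "m < m0"
 obtains c where "0 < c" "\<And>l s x. l < m0 \<Longrightarrow> l \<noteq> m \<Longrightarrow> s \<in> \<psi> l ` core N l \<Longrightarrow> x \<in> core N m \<Longrightarrow> c \<le> 1 - r s (\<psi> m x)"
proof -
 define S where "S = (\<Union>l\<in>{..<m0} - {m}. \<psi> l ` core N l)"
 have comp: "compact (\<psi> l ` core N l)" if "l < m0" for l
  using that core_Q by (intro compact_continuous_image compact_core continuous_on_subset[OF \<psi>_cont]) auto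
 have "S \<inter> \<psi> m ` core N m = {}"
 proof -
  have "\<psi> l ` core N l \<inter> \<psi> m ` core N m = {}" if "l \<noteq> m" for l
   using part_disjoint[OF that] core_subset[of N l] core_subset[of N m] by blast
  thus ?thesis unfolding S_def by blast
 qed
 moreover have "S \<subseteq> I" "\<psi> m ` core N m \<subseteq> I" using core_image_I[of N] m unfolding S_def by blast+
 moreover have "compact S" unfolding S_def using comp by (intro compact_UN) auto
 ultimately obtain c where c: "0 < c" "\<And>s t. s \<in> S \<Longrightarrow> t \<in> \<psi> m ` core N m \<Longrightarrow> c \<le> 1 - r s t"
  using variogram_disjoint[OF _ comp[OF m], of S] by metis
 show ?thesis
 proof (rule that[OF c(1)])
  fix l s x assume h: "l < m0" "l \<noteq> m" "s \<in> \<psi> l ` core N l" "x \<in> core N m"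
  have "s \<in> S" unfolding S_def using h by blast
  thus "c \<le> 1 - r s (\<psi> m x)" using h by (intro c(2)) auto
 qed
qed

text \<open>Near an interior point of the core the net looks like the full lattice, so
  \<open>local_limit\<close> applies with base points obtained by rounding \<open>y\<close> down.
  Net points of other charts stay apart by \<open>core_separation\<close>.\<close>

lemma net_term_limit:
 assumes N: "0 < N" and m: "m < m0" and u: "filterlim u at_top sequentially" and y: "y \<in> interior (core N m)"
 shows "(\<lambda>n. step_fun (mesh N p (u n)) (lat N p (u n) \<inter> core N m) (\<lambda>z. argmax_prob (net N p (u n)) (\<psi> m z) (u n)) y)
   \<longlonglongrightarrow> cell_prob m y (1 / 2 ^ p)" (is "?s \<longlonglongrightarrow> _")
proof -
 define h where "h n = mesh N p (u n)" for n
 have h: "0 < h n" for n unfolding h_def using N by (rule mesh_pos)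
 have uh: "(\<lambda>n. u n * h n) \<longlonglongrightarrow> 1 / 2 ^ p" unfolding h_def using N u by (rule mesh_lim)
 have u0: "eventually (\<lambda>n. 1 \<le> u n) sequentially" using u by (simp add: filterlim_at_top)
 have h0: "h \<longlonglongrightarrow> 0" unfolding h_def using N u by (rule mesh_null)
 have flim: "(\<lambda>n. fl (h n) y) \<longlonglongrightarrow> y" using h h0 by (rule fl_lim)
 have yc: "y \<in> core N m" using y interior_subset by blast
 hence yQ: "y \<in> cbox 0 1" using core_Q by blast
 define ok where "ok n \<longleftrightarrow> fl (h n) y \<in> core N m" for n
 have near_core: "eventually (\<lambda>n. fl (h n) y + h n *\<^sub>R ivec k \<in> core N m) sequentially" for k
 proof -
  have "(\<lambda>n. fl (h n) y + h n *\<^sub>R ivec k) \<longlonglongrightarrow> y + 0 *\<^sub>R ivec k" by (intro tendsto_intros flim h0)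
  hence "eventually (\<lambda>n. fl (h n) y + h n *\<^sub>R ivec k \<in> interior (core N m)) sequentially" using y by (intro topological_tendstoD) auto
  thus ?thesis by eventually_elim (use interior_subset in blast)
 qed
 have ok_ev: "eventually ok sequentially" using near_core[of 0] by (simp add: ok_def[abs_def] flip: zero_vec_def)
 \<comment> \<open>While the rounded point is still outside the core, \<open>x n\<close> defaults to
   \<open>y\<close>, and \<open>T n\<close> and \<open>K n\<close> to the empty set; the hypotheses
   of \<open>local_limit\<close> then hold for every \<open>n\<close>.\<close>
 define x where "x n = (if ok n then fl (h n) y else y)" for n
 have xQ: "x n \<in> cbox 0 1" for n using yQ core_Q by (auto simp: x_def ok_def)
 have xcore: "x n \<in> core N m" for n using yc by (auto simp: x_def ok_def)
 have "eventually (\<lambda>n. x n = fl (h n) y) sequentially" using ok_ev by eventually_elim (simp add: x_def)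
 hence xlim: "x \<longlonglongrightarrow> y" using flim by (simp add: tendsto_cong)
 define T where "T n = (if ok n then net N p (u n) else {})" for n
 define R where "R n = (\<Union>l\<in>{..<m0} - {m}. \<psi> l ` (lat N p (u n) \<inter> core N l))" for n
 define K where "K n = {k. ok n \<and> x n + h n *\<^sub>R ivec k \<in> lat N p (u n)}" for n
 have fK: "finite (K n)" for n
 proof -
  have "inj_on (\<lambda>k. x n + h n *\<^sub>R ivec k) (K n)" using h[of n] by (auto simp: inj_on_def vec_eq_iff)
  moreover have "finite ((\<lambda>k. x n + h n *\<^sub>R ivec k) ` K n)" by (rule finite_subset[OF _ finite_lat[of N p "u n"]]) (auto simp: K_def)
  ultimately show ?thesis by (rule finite_imageD[rotated])
 qed
 obtain c' where c': "0 < c'" "\<And>l s x. l < m0 \<Longrightarrow> l \<noteq> m \<Longrightarrow> s \<in> \<psi> l ` core N l \<Longrightarrow> x \<in> core N m \<Longrightarrow> c' \<le> 1 - r s (\<psi> m x)"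
  using core_separation[OF m] by metis
 \<comment> \<open>For \<open>u \<ge> 1\<close> the number of lattice steps along an edge is at most
   \<open>3 * N * u * 2 ^ p\<close>; a further \<open>N * u * 2 ^ p\<close> absorbs the additional
   endpoint of the grid.\<close>
 define B where "B = real m0 * (real (4 * N * 2 ^ p)) ^ CARD('d)"
 have cardR: "eventually (\<lambda>n. real (card (R n)) \<le> B * u n ^ CARD('d)) sequentially" using u0
 proof eventually_elim
  case (elim n)
  have "card (R n) \<le> (\<Sum>l\<in>{..<m0} - {m}. card (\<psi> l ` (lat N p (u n) \<inter> core N l)))" unfolding R_def by (rule card_UN_le) simp
  also have "\<dots> \<le> (\<Sum>l\<in>{..<m0} - {m}. card (lat N p (u n) :: (real ^ 'd) set))"
   by (intro sum_mono order_trans[OF card_image_le] card_mono finite_lat) (auto simp: finite_lat)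
  also have "\<dots> \<le> m0 * card (lat N p (u n) :: (real ^ 'd) set)"
  proof -
   have "card ({..<m0} - {m}) \<le> m0" using card_mono[of "{..<m0}" "{..<m0} - {m}"] by auto
   thus ?thesis by simp
  qed
  also have "\<dots> \<le> m0 * (N * nsub N (u n) * 2 ^ p + 1) ^ CARD('d)" unfolding lat_def by (intro mult_left_mono card_grid) auto
  finally have "real (card (R n)) \<le> real m0 * (real (N * nsub N (u n) * 2 ^ p + 1)) ^ CARD('d)" by (metis of_nat_le_iff of_nat_mult of_nat_power)
  also have "\<dots> \<le> real m0 * (real (4 * N * 2 ^ p) * u n) ^ CARD('d)"
  proof (intro mult_left_mono power_mono)
   have "real N * real (nsub N (u n)) \<le> u n + 2 * real N" using nsub_bounds[OF N] elim by auto
   also have "\<dots> \<le> 3 * real N * u n"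
   proof -
    have "1 * u n \<le> real N * u n" using N elim by (intro mult_right_mono) auto
    moreover have "real N * 1 \<le> real N * u n" using N elim by (intro mult_left_mono) auto
    ultimately show ?thesis by linarith
   qed
   finally have a: "real N * real (nsub N (u n)) * 2 ^ p \<le> 3 * real N * u n * 2 ^ p" by (intro mult_right_mono) auto
   have "1 \<le> real N * u n * 2 ^ p" using N elim by (intro mult_ge1_I) auto
   with a have "real N * real (nsub N (u n)) * 2 ^ p + 1 \<le> 3 * real N * u n * 2 ^ p + real N * u n * 2 ^ p" by linarith
   thus "real (N * nsub N (u n) * 2 ^ p + 1) \<le> real (4 * N * 2 ^ p) * u n" by (simp add: algebra_simps)
  qed auto
  also have "\<dots> = B * u n ^ CARD('d)" by (simp add: B_def power_mult_distrib)
  finally show ?case .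
 qed
 have "(\<lambda>n. argmax_prob (T n) (\<psi> m (x n)) (u n)) \<longlonglongrightarrow> cell_prob m y (1 / 2 ^ p)"
 proof (rule local_limit[OF m yQ xQ xlim u h uh])
  show d0: "0 < 1 / (2 ^ p :: real)" by simp
  note pt = pt_def[OF m yQ xQ xlim u h uh d0]
  show "finite (T n)" "T n \<subseteq> I" for n using finite_net net_I by (auto simp: T_def)
  show "finite (K n)" for n by (rule fK)
  show "finite (R n)" for n unfolding R_def by (intro finite_UN_I finite_imageI finite_lat_core) simp
  show "R n \<subseteq> I" for n unfolding R_def using core_image_I[of N] by blast
  show "0 < c'" by (rule c')
  show "eventually (\<lambda>n. real (card (R n)) \<le> B * u n ^ CARD('d)) sequentially" by (rule cardR)
  show "pt x h k n \<in> cbox 0 1" if "k \<in> K n" for n k using that N unfolding K_def pt by (simp add: lat_iff)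
  show "c' \<le> 1 - r t (\<psi> m (x n))" if "t \<in> R n" for n t
  proof -
   from that obtain l where "l < m0" "l \<noteq> m" "t \<in> \<psi> l ` core N l" by (auto simp: R_def)
   thus ?thesis using xcore by (intro c'(2))
  qed
  show "T n \<subseteq> \<psi> m ` (\<lambda>k. pt x h k n) ` K n \<union> R n" for n
  proof
   fix t assume t: "t \<in> T n"
   hence ok: "ok n" by (auto simp: T_def split: if_splits)
   then obtain l z where l: "l < m0" "z \<in> lat N p (u n)" "z \<in> core N l" "t = \<psi> l z" using t by (auto simp: T_def net_def)
   show "t \<in> \<psi> m ` (\<lambda>k. pt x h k n) ` K n \<union> R n"
   proof (cases "l = m")
    case False thus ?thesis using l by (auto simp: R_def)
   next
    case True
    obtain k where k: "z = h n *\<^sub>R ivec k" using l(2) N by (auto simp: lat_iff h_def)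
    define k0 where "k0 = (\<chi> i. \<lfloor>y $ i / h n\<rfloor>)"
    have "x n = h n *\<^sub>R ivec k0" using ok by (simp add: x_def fl_ivec k0_def)
    hence "z = x n + h n *\<^sub>R ivec (k - k0)" by (simp add: k vec_eq_iff right_diff_distrib)
    moreover from this have "k - k0 \<in> K n" using ok l by (auto simp: K_def)
    ultimately show ?thesis using l True unfolding pt by blast
   qed
  qed
  show "eventually (\<lambda>n. pt x h k n \<in> cbox 0 1 \<and> \<psi> m (pt x h k n) \<in> T n) sequentially" for k using ok_ev near_core[of k]
  proof eventually_elim
   case (elim n)
   define k0 where "k0 = (\<chi> i. \<lfloor>y $ i / h n\<rfloor>)"
   have xn: "x n = fl (h n) y" using elim by (simp add: x_def)
   have "x n + h n *\<^sub>R ivec k = h n *\<^sub>R ivec (k0 + k)" by (simp add: xn fl_ivec k0_def vec_eq_iff distrib_left)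
   moreover have "x n + h n *\<^sub>R ivec k \<in> core N m" using elim xn by simp
   ultimately have "x n + h n *\<^sub>R ivec k \<in> lat N p (u n) \<inter> core N m" using N core_Q unfolding h_def by (metis IntI lat_iff subsetD)
   thus ?case using elim m core_Q unfolding pt T_def net_def by auto
  qed
 qed
 moreover have "eventually (\<lambda>n. argmax_prob (T n) (\<psi> m (x n)) (u n) = ?s n) sequentially" using ok_ev
 proof eventually_elim
  case (elim n)
  have "fl (h n) y \<in> lat N p (u n) \<inter> core N m"
   using elim N subsetD[OF core_Q] unfolding ok_def h_def by (intro IntI lat_memI[OF _ _ fl_ivec]) simp_all
  moreover have "\<exists>k. z = mesh N p (u n) *\<^sub>R ivec k" if "z \<in> lat N p (u n) \<inter> core N m" for z :: "real ^ 'd"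
   using that N by (auto simp: lat_iff)
  ultimately show ?case using elim N finite_lat_core by (subst step_fun_value) (auto simp: T_def x_def h_def mesh_pos)
 qed
 ultimately show ?thesis by (simp add: tendsto_cong)
qed

lemma net_term_outside:
 assumes N: "0 < N" and m: "m < m0" and u: "filterlim u at_top sequentially" and y: "y \<notin> core N m"
 shows "(\<lambda>n. step_fun (mesh N p (u n)) (lat N p (u n) \<inter> core N m) (f n) y) \<longlonglongrightarrow> 0"
proof -
 have "(\<lambda>n. fl (mesh N p (u n)) y) \<longlonglongrightarrow> y" using N u by (intro fl_lim mesh_pos mesh_null)
 moreover have "open (- core N m)" using compact_core by (auto intro: compact_imp_closed)
 ultimately have "eventually (\<lambda>n. fl (mesh N p (u n)) y \<in> - core N m) sequentially" using y by (intro topological_tendstoD) auto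
 hence "eventually (\<lambda>n. step_fun (mesh N p (u n)) (lat N p (u n) \<inter> core N m) (f n) y = 0) sequentially"
 proof eventually_elim
  case (elim n)
  have "\<exists>k. z = mesh N p (u n) *\<^sub>R ivec k" if "z \<in> lat N p (u n) \<inter> core N m" for z :: "real ^ 'd"
   using that N by (auto simp: lat_iff)
  thus ?case using elim N finite_lat_core by (subst step_fun_value) (auto simp: mesh_pos)
 qed
 thus ?thesis by (rule tendsto_eventually)
qed

definition cell_mass :: "nat \<Rightarrow> nat \<Rightarrow> real \<Rightarrow> real" where
 "cell_mass N m \<delta> = (\<integral>y. indicator (interior (core N m)) y * cell_prob m y \<delta> \<partial>lborel)"

text \<open>The scaled sum is the integral of a step function, which converges off the null frontier
  of the core. The same pointwise limit proves that \<open>cell_prob\<close> restricted to the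
  interior of the core is measurable in \<open>y\<close>.\<close>

lemma net_integral_limit:
 assumes N: "0 < N" and m: "m < m0" and u: "filterlim u at_top sequentially"
 shows "(\<lambda>n. mesh N p (u n) ^ CARD('d) * (\<Sum>z\<in>lat N p (u n) \<inter> core N m. argmax_prob (net N p (u n)) (\<psi> m z) (u n)))
   \<longlonglongrightarrow> cell_mass N m (1 / 2 ^ p)" (is "?S \<longlonglongrightarrow> _")
  and "(\<lambda>y. indicator (interior (core N m)) y * cell_prob m y (1 / 2 ^ p)) \<in> borel_measurable lborel"
proof -
 define s where "s n = step_fun (mesh N p (u n)) (lat N p (u n) \<inter> core N m) (\<lambda>z. argmax_prob (net N p (u n)) (\<psi> m z) (u n))" for n
 define F where "F y = indicator (interior (core N m)) y * cell_prob m y (1 / 2 ^ p)" for y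
 have fin: "finite (lat N p (u n) \<inter> core N m)" for n by (rule finite_lat_core)
 have sm[measurable]: "s n \<in> borel_measurable lborel" for n
  unfolding s_def by (rule borel_measurable_integrable[OF step_fun_integral(1)[OF fin mesh_pos[OF N]]])
 have sint: "(\<integral>y. s n y \<partial>lborel) = ?S n" for n unfolding s_def by (rule step_fun_integral(2)[OF fin mesh_pos[OF N]])
 have slim: "(\<lambda>n. s n y) \<longlonglongrightarrow> F y" if "y \<notin> frontier (core N m)" for y
 proof (cases "y \<in> interior (core N m)")
  case True thus ?thesis unfolding s_def F_def using net_term_limit[OF N m u True] by simp
 next
  case False
  hence "y \<notin> core N m" using that compact_imp_closed[OF compact_core] by (simp add: frontier_def)
  thus ?thesis unfolding s_def F_def using False net_term_outside[OF N m u] by simp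
 qed
 have fr[measurable]: "- frontier (core N m) \<in> sets lborel" by (auto intro: borel_closed)
 have "(\<lambda>y. indicator (- frontier (core N m)) y * F y) \<in> borel_measurable lborel"
 proof (rule borel_measurable_LIMSEQ_real)
  show "(\<lambda>y. indicator (- frontier (core N m)) y * s n y) \<in> borel_measurable lborel" for n by measurable
  show "(\<lambda>n. indicator (- frontier (core N m)) y * s n y) \<longlonglongrightarrow> indicator (- frontier (core N m)) y * F y" for y
   using slim[of y] by (auto simp: indicator_def)
 qed
 moreover have "(\<lambda>y. indicator (- frontier (core N m)) y * F y) = F" by (auto simp: F_def frontier_def indicator_def)
 ultimately have Fm[measurable]: "F \<in> borel_measurable lborel" by simp
 thus "(\<lambda>y. indicator (interior (core N m)) y * cell_prob m y (1 / 2 ^ p)) \<in> borel_measurable lborel" by (simp add: F_def[abs_def])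
 \<comment> \<open>The values are probabilities, and a mesh cube of side at most 1 with its corner
   in the unit cube stays inside \<open>cbox 0 2\<close>.\<close>
 have sb: "norm (s n y) \<le> indicator (cbox 0 2) y" for n y
 proof -
  have k: "\<exists>k. z = mesh N p (u n) *\<^sub>R ivec k" if "z \<in> lat N p (u n) \<inter> core N m" for z :: "real ^ 'd"
   using that N by (auto simp: lat_iff)
  show ?thesis
  proof (cases "fl (mesh N p (u n)) y \<in> lat N p (u n) \<inter> core N m")
   case True
   hence q: "fl (mesh N p (u n)) y \<in> cbox 0 1" using core_Q by blast
   have "0 \<le> y $ i \<and> y $ i \<le> 2" for i
   proof -
    have "0 \<le> fl (mesh N p (u n)) y $ i" "fl (mesh N p (u n)) y $ i \<le> 1" using q by (auto simp: mem_box_cart)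
    thus ?thesis using fl_bounds[OF mesh_pos[OF N], of p "u n" y i] mesh_le_1[OF N, of p "u n"] by linarith
   qed
   hence "y \<in> cbox 0 2" by (simp add: mem_box_cart)
   thus ?thesis unfolding s_def by (subst step_fun_value[OF fin mesh_pos[OF N] k]) (auto simp: argmax_prob_range)
  next
   case False
   thus ?thesis unfolding s_def by (subst step_fun_value[OF fin mesh_pos[OF N] k]) auto
  qed
 qed
 have "(\<lambda>n. \<integral>y. s n y \<partial>lborel) \<longlonglongrightarrow> (\<integral>y. F y \<partial>lborel)"
 proof (rule integral_dominated_convergence[where w="indicator (cbox 0 2)"])
  show "integrable lborel (indicator (cbox 0 2 :: (real ^ 'd) set) :: _ \<Rightarrow> real)"
   by (intro integrable_real_indicator) (auto simp: emeasure_lborel_cbox_eq)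
  have "AE y in lborel. y \<notin> frontier (core N m)" using core_frontier_null by (rule AE_not_in)
  thus "AE y in lborel. (\<lambda>n. s n y) \<longlonglongrightarrow> F y" by eventually_elim (rule slim)
 qed (use sb in auto)
 thus "?S \<longlonglongrightarrow> cell_mass N m (1 / 2 ^ p)" unfolding sint by (simp add: cell_mass_def F_def)
qed

text \<open>Dividing by the power of \<open>u * mesh\<close>, which tends to
  \<open>1 / 2 ^ p\<close>, cancels the mesh and leaves the normalization by
  \<open>u ^ d\<close>.\<close>

lemma gT_net_limit:
 assumes N: "0 < N" and u: "filterlim u at_top sequentially"
 shows "(\<lambda>n. gT (net N p (u n)) (u n) / u n ^ CARD('d)) \<longlonglongrightarrow> (\<Sum>m<m0. cell_mass N m (1 / 2 ^ p)) / (1 / 2 ^ p) ^ CARD('d)"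
proof -
 have "(\<lambda>n. (\<Sum>m<m0. mesh N p (u n) ^ CARD('d) * (\<Sum>z\<in>lat N p (u n) \<inter> core N m. argmax_prob (net N p (u n)) (\<psi> m z) (u n)))
    / (u n * mesh N p (u n)) ^ CARD('d)) \<longlonglongrightarrow> (\<Sum>m<m0. cell_mass N m (1 / 2 ^ p)) / (1 / 2 ^ p) ^ CARD('d)"
  by (intro tendsto_divide tendsto_sum net_integral_limit N u tendsto_power mesh_lim) auto
 moreover have "(\<Sum>m<m0. mesh N p (u n) ^ CARD('d) * (\<Sum>z\<in>lat N p (u n) \<inter> core N m. argmax_prob (net N p (u n)) (\<psi> m z) (u n)))
    / (u n * mesh N p (u n)) ^ CARD('d) = gT (net N p (u n)) (u n) / u n ^ CARD('d)" for n
  using mesh_pos[OF N, of p "u n"] by (simp add: gT_net sum_distrib_left[symmetric] power_mult_distrib)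
 ultimately show ?thesis by simp
qed

end

section \<open>Asymptotics of the derivative\<close>

lemma phi_pos [simp]: "0 < phi x" and phi_neq_0 [simp]: "phi x \<noteq> 0"
 by (simp_all add: std_normal_density_def)

context gaussian_field
begin

text \<open>The convexity of \<open>FK K\<close> as a function of \<open>Phi\<close>, with the third point sent to infinity.\<close>

lemma FK_increment:
 assumes K: "K \<subseteq> I" and uv: "0 \<le> u" "u < v" and B: "1 - FK K v \<le> B * (1 - Phi v)"
 shows "FK K v - FK K u \<le> B * (phi u * (v - u))"
proof -
 have "(FK K v - FK K u) * (Phi w - Phi v) \<le> (1 - FK K v) * (Phi v - Phi u)" if "v < w" for w
 proof -
  have "FK K w \<le> 1" by (simp add: FK_def)
  hence "(FK K w - FK K v) * (Phi v - Phi u) \<le> (1 - FK K v) * (Phi v - Phi u)" using Phi_mono[of u v] uv by (intro mult_right_mono) auto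
  thus ?thesis using FK_Phi_convex[OF K uv(2) that] by linarith
 qed
 moreover have "((\<lambda>w. (FK K v - FK K u) * (Phi w - Phi v)) \<longlongrightarrow> (FK K v - FK K u) * (1 - Phi v)) at_top"
 proof -
  have "((\<lambda>w. phi w / w) \<longlongrightarrow> 0) at_top" unfolding std_normal_density_def by real_asymp
  hence "((\<lambda>w. 1 - phi w / w) \<longlongrightarrow> 1 - 0) at_top" by (intro tendsto_intros)
  hence "(Phi \<longlongrightarrow> 1) at_top" by (intro tendsto_sandwich[of "\<lambda>w. 1 - phi w / w" Phi at_top "\<lambda>_. 1"])
    (use Psi_upper Phi_le_1 in \<open>auto intro!: eventually_at_top_linorderI[of 1] simp: algebra_simps\<close>)
  thus ?thesis by (intro tendsto_intros)
 qed
 ultimately have "(FK K v - FK K u) * (1 - Phi v) \<le> (1 - FK K v) * (Phi v - Phi u)"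
  by (intro tendsto_upperbound[where F=at_top]) (auto intro: eventually_mono[OF eventually_gt_at_top[of v]])
 also have "\<dots> \<le> (B * (1 - Phi v)) * (Phi v - Phi u)" using Phi_mono[of u v] uv B by (intro mult_right_mono) auto
 finally have "(FK K v - FK K u) * (1 - Phi v) \<le> (B * (Phi v - Phi u)) * (1 - Phi v)" by (simp add: mult_ac)
 hence "FK K v - FK K u \<le> B * (Phi v - Phi u)" using Phi_lt_1[of v] by simp
 also have "\<dots> \<le> B * (phi u * (v - u))"
 proof (rule mult_left_mono)
  show "Phi v - Phi u \<le> phi u * (v - u)" using uv by (intro Phi_step) auto
  have "0 \<le> B * (1 - Phi v)" using B by (smt (verit) FK_def prob_le_1)
  thus "0 \<le> B" using Phi_lt_1[of v] by (simp add: zero_le_mult_iff)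
 qed
 finally show ?thesis .
qed

end

context gaussian_charts
begin

text \<open>The estimates for one cell, with \<open>phi u / u\<close> in place of
  \<open>1 - Phi u\<close>. The stronger condition on \<open>(u + 4 / u) * h\<close> leaves room to
  use the crude bound also at levels up to \<open>u + 4 / u\<close>.\<close>

definition cell_bounds :: "nat \<Rightarrow> (nat \<Rightarrow> real) \<Rightarrow> real \<Rightarrow> nat \<Rightarrow> bool" where
 "cell_bounds m e B p0 \<longleftrightarrow> e \<longlonglongrightarrow> 0 \<and> 0 < B \<and>
  (\<forall>u h x0. 2 \<le> u \<and> 0 < h \<and> u * h \<le> 2 \<and> cbox x0 (x0 + h *\<^sub>R 1) \<subseteq> cbox 0 1 \<longrightarrow>
    prob (exceed (\<psi> m ` cbox x0 (x0 + h *\<^sub>R 1)) u) \<le> B * (phi u / u)) \<and>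
  (\<forall>p u h x0. p0 \<le> p \<and> 2 \<le> u \<and> 0 < h \<and> (u + 4 / u) * h \<le> 2 \<and> cbox x0 (x0 + h *\<^sub>R 1) \<subseteq> cbox 0 1 \<longrightarrow>
    prob (exceed (\<psi> m ` cbox x0 (x0 + h *\<^sub>R 1)) u - exceed (\<psi> m ` grid x0 (h / 2 ^ p) (2 ^ p)) u) \<le> e p * (phi u / u))"

text \<open>Chaining compares the grid at level \<open>u\<close> with the cube at the higher level
  \<open>v = u + \<theta> p / u\<close>. The cube having its supremum between \<open>u\<close> and
  \<open>v\<close> remains, and \<open>FK_increment\<close> bounds this by
  \<open>B * \<theta> p * (phi u / u)\<close>; here convexity replaces any estimate of a density.
  Both errors vanish with growing \<open>p\<close>.\<close>

lemma chart_cell_bounds: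
 assumes m: "m < m0" shows "\<exists>e B p0. cell_bounds m e B p0"
proof -
 obtain C where C: "0 < C" "\<And>x y. x \<in> cbox 0 1 \<Longrightarrow> y \<in> cbox 0 1 \<Longrightarrow> 1 - r (\<psi> m x) (\<psi> m y) \<le> C * (norm (x - y))\<^sup>2"
  by (rule variogram_bounds[OF m]) blast
 have I: "\<psi> m ` cbox 0 1 \<subseteq> I" using \<psi>_I[OF m] by blast
 note prem = \<psi>_cont[OF m] I C
 obtain B where B: "0 < B"
  "\<And>u h x0. u \<ge> 2 \<Longrightarrow> 0 < h \<Longrightarrow> u * h \<le> 2 \<Longrightarrow> cbox x0 (x0 + h *\<^sub>R 1) \<subseteq> cbox 0 1 \<Longrightarrow>
    prob (exceed (\<psi> m ` cbox x0 (x0 + h *\<^sub>R 1)) u) \<le> B * (1 - Phi u)"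
  by (rule crude_cell_bound[OF prem], assumption, assumption, rule that)
 obtain e where e: "e \<longlonglongrightarrow> 0"
  "\<And>p u h x0. u \<ge> 1 \<Longrightarrow> 0 < h \<Longrightarrow> u * h \<le> 2 \<Longrightarrow> cbox x0 (x0 + h *\<^sub>R 1) \<subseteq> cbox 0 1 \<Longrightarrow> chain_rate TYPE('d) C * 3 ^ p \<ge> 1 \<Longrightarrow>
   prob (exceed (\<psi> m ` cbox x0 (x0 + h *\<^sub>R 1)) (u + 4 * (3/4) ^ p / u) - exceed (\<psi> m ` grid x0 (h / 2 ^ p) (2 ^ p)) u) \<le> e p * (1 - Phi u)"
  "eventually (\<lambda>p. chain_rate TYPE('d) C * 3 ^ p \<ge> 1) sequentially"
  by (rule chaining[OF prem], assumption, assumption, rule that)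
 obtain p0 where p0: "\<And>p. p0 \<le> p \<Longrightarrow> chain_rate TYPE('d) C * 3 ^ p \<ge> 1"
  using e(3) by (auto simp: eventually_sequentially)
 have sub_I: "\<psi> m ` S \<subseteq> I" if "S \<subseteq> cbox 0 1" for S using that I by blast
 define \<theta> where "\<theta> p = 4 * (3/4 :: real) ^ p" for p :: nat
 have \<theta>: "0 < \<theta> p" "\<theta> p \<le> 4" for p by (auto simp: \<theta>_def intro: power_le_one)
 have "cell_bounds m (\<lambda>p. \<bar>e p\<bar> + B * \<theta> p) B p0" unfolding cell_bounds_def
 proof (intro conjI allI impI; (elim conjE)?)
  have "\<theta> \<longlonglongrightarrow> 0" unfolding \<theta>_def by real_asymp
  hence "(\<lambda>p. \<bar>e p\<bar> + B * \<theta> p) \<longlonglongrightarrow> \<bar>0\<bar> + B * 0" by (intro tendsto_intros e)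
  thus "(\<lambda>p. \<bar>e p\<bar> + B * \<theta> p) \<longlonglongrightarrow> 0" by simp
  show "0 < B" by (rule B)
  fix u h :: real and x0 :: "real ^ 'd"
  let ?C = "cbox x0 (x0 + h *\<^sub>R 1)"
  assume u: "2 \<le> u" and h: "0 < h" and C01: "?C \<subseteq> cbox 0 1"
  note CI = sub_I[OF C01]
  {
   assume "u * h \<le> 2"
   hence "prob (exceed (\<psi> m ` ?C) u) \<le> B * (1 - Phi u)" using u h C01 by (intro B)
   also have "\<dots> \<le> B * (phi u / u)" using u B(1) by (intro mult_left_mono Psi_upper) auto
   finally show "prob (exceed (\<psi> m ` ?C) u) \<le> B * (phi u / u)" .
  }
  fix p assume p: "p0 \<le> p" and uh: "(u + 4 / u) * h \<le> 2"
  let ?G = "grid x0 (h / 2 ^ p) (2 ^ p)"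
 let ?E = "\<lambda>u. exceed (\<psi> m ` ?C) u" and ?F = "exceed (\<psi> m ` ?G) u"
  have "?G \<subseteq> cbox x0 (x0 + (h / 2 ^ p * real (2 ^ p)) *\<^sub>R 1)" using h by (intro grid_subset_box) auto
  hence GI: "\<psi> m ` ?G \<subseteq> I" using CI by auto
  define v where "v = u + \<theta> p / u"
  have uv: "u < v" using \<theta> u by (simp add: v_def)
  have vh: "v * h \<le> 2"
  proof -
   have "\<theta> p / u \<le> 4 / u" using \<theta> u by (intro divide_right_mono) auto
   thus ?thesis using uh h by (smt (verit) v_def mult_right_mono)
  qed
  hence uh': "u * h \<le> 2" using uv h by (smt (verit) mult_right_mono)
  note meas = exceed_measurable[OF CI] exceed_measurable[OF GI]
  have "prob (?E u - ?F)
    \<le> prob ((?E v - ?F) \<union> (?E u - ?E v))"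
   using meas by (intro finite_measure_mono) auto
  also have "\<dots> \<le> prob (?E v - ?F) + prob (?E u - ?E v)" using meas by (intro measure_Un_le) auto
  also have "prob (?E v - ?F) \<le> \<bar>e p\<bar> * (phi u / u)"
  proof -
   have "prob (?E v - ?F) \<le> e p * (1 - Phi u)" unfolding v_def \<theta>_def using u h uh' C01 p0[OF p] by (intro e(2)) auto
   also have "\<dots> \<le> \<bar>e p\<bar> * (phi u / u)" using Psi_upper[of u] Phi_le_1[of u] u by (intro mult_mono) auto
   finally show ?thesis .
  qed
  also have "prob (?E u - ?E v) \<le> B * \<theta> p * (phi u / u)"
  proof -
   have "?E v \<subseteq> ?E u" using uv by (intro exceed_antimono) simp
   hence "prob (?E u - ?E v) = FK (\<psi> m ` ?C) v - FK (\<psi> m ` ?C) u"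
    using meas exceed_measurable[OF CI] by (simp add: finite_measure_Diff prob_exceed[OF CI])
   also have "\<dots> \<le> B * (phi u * (v - u))" using u uv h vh C01 by (intro FK_increment CI) (auto simp: B(2) simp flip: prob_exceed[OF CI])
   finally show ?thesis by (simp add: v_def mult_ac)
  qed
  finally show "prob (?E u - ?F) \<le> (\<bar>e p\<bar> + B * \<theta> p) * (phi u / u)" by (simp add: algebra_simps)
 qed
 thus ?thesis by blast
qed

section \<open>The defect of the net, summed over cells\<close>

definition children :: "nat \<Rightarrow> ('d \<Rightarrow> nat) \<Rightarrow> ('d \<Rightarrow> nat) set" where
 "children n j = (\<Pi>\<^sub>E i\<in>UNIV. {n * j i..<n * j i + n})"

lemma card_children: "card (children n j) = n ^ CARD('d)" and finite_children: "finite (children n j)"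
 unfolding children_def by (auto simp: card_PiE intro!: finite_PiE)

lemma children_subcube:
 assumes N: "0 < N" and n: "0 < n" and k: "k \<in> children n j"
 shows "subcube (N * n) k \<subseteq> subcube N j"
proof
 fix z assume z: "z \<in> subcube (N * n) k"
 have "real (j i) / real N \<le> z $ i \<and> z $ i \<le> (real (j i) + 1) / real N" for i
 proof -
  have ki: "n * j i \<le> k i" "k i + 1 \<le> n * (j i + 1)" using k[unfolded children_def, THEN PiE_mem, of i] by auto
  have "real (k i) \<le> real (N * n) * z $ i" "real (N * n) * z $ i \<le> real (k i) + 1"
   using z N n by (auto simp: mem_subcube pos_divide_le_eq pos_le_divide_eq mult.commute simp del: of_nat_mult)
  moreover have "real n * real (j i) \<le> real (k i)" "real (k i) + 1 \<le> real n * (real (j i) + 1)"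
   using ki[THEN of_nat_mono[where 'a=real]] by (simp_all add: distrib_left)
  ultimately have "real n * real (j i) \<le> real n * (real N * z $ i)" "real n * (real N * z $ i) \<le> real n * (real (j i) + 1)" by (simp_all add: mult_ac)
  hence "real (j i) \<le> real N * z $ i" "real N * z $ i \<le> real (j i) + 1" using n by (simp_all only: mult_le_cancel_left_pos of_nat_0_less_iff)
  thus ?thesis using N by (simp add: pos_le_divide_eq pos_divide_le_eq mult.commute)
 qed
 thus "z \<in> subcube N j" by (simp add: mem_subcube)
qed

lemma subcube_refine:
 assumes x: "x \<in> subcube N j" and N: "0 < N" and n: "0 < n"
 shows "\<exists>k\<in>children n j. x \<in> subcube (N * n) k"
proof -
 define y where "y = (\<chi> i. real N * x $ i - real (j i))"
 have "0 \<le> y $ i \<and> y $ i \<le> 1" for i using x[unfolded mem_subcube, rule_format, of i] N by (simp add: y_def field_simps)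
 hence "y \<in> cbox 0 1" by (simp add: mem_box_cart)
 then obtain l where l: "l \<in> subcells n" "y \<in> subcube n l" using subcube_cover[OF n] by blast
 have "(\<lambda>i. n * j i + l i) \<in> children n j" using l(1) by (auto simp: subcells_def children_def)
 moreover have "x \<in> subcube (N * n) (\<lambda>i. n * j i + l i)" using l(2) N n by (auto simp: mem_subcube y_def field_simps)
 ultimately show ?thesis by blast
qed

lemma cell_grid_lat:
 assumes N: "0 < N" and c: "c = N * nsub N x" and sub: "subcube c k \<subseteq> core N m"
 shows "grid (gridpt 0 (1 / real c) k) (1 / real c / 2 ^ p) (2 ^ p) \<subseteq> lat N p x \<inter> core N m"
proof -
 have c0: "0 < c" using N nsub_pos by (simp add: c)
 have mesh: "mesh N p x = 1 / real c / 2 ^ p" by (simp add: mesh_def c)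
 have 1: "grid (gridpt 0 (1 / real c) k) (1 / real c / 2 ^ p) (2 ^ p) \<subseteq> core N m"
  using grid_subset_box[of "1 / real c / 2 ^ p" "gridpt 0 (1 / real c) k" "2 ^ p"] sub by (simp add: subcube_def)
 moreover have "y \<in> lat N p x" if y: "y \<in> grid (gridpt 0 (1 / real c) k) (1 / real c / 2 ^ p) (2 ^ p)" for y
 proof -
  obtain l where "y = gridpt (gridpt 0 (1 / real c) k) (1 / real c / 2 ^ p) l" using y by (auto simp: grid_def)
  hence "y = mesh N p x *\<^sub>R ivec (\<chi> i. int (2 ^ p * k i + l i))" using c0 by (simp add: gridpt_def vec_eq_iff mesh field_simps)
  thus ?thesis using subsetD[OF core_Q subsetD[OF 1 y]] N by (intro lat_memI)
 qed
 ultimately show ?thesis by blast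
qed

definition bad_ratio :: "nat \<Rightarrow> real" where
 "bad_ratio N = (\<Sum>m<m0. real (card (bad N m)) / real N ^ CARD('d))"

text \<open>The defect is the probability that \<open>I\<close> exceeds \<open>v\<close> while no
  net point does. A cell in a good subcube contains its own grid of net points and is charged the
  chaining error; a cell in a bad subcube is charged the crude bound. There are at most
  \<open>(N * nsub N x) ^ d\<close> cells of the first kind, and the share of the second kind is at
  most \<open>bad_ratio N\<close> after summation over charts. The net is built for a level
  \<open>x\<close> but compared at a neighbouring \<open>v\<close>, hence two parameters.\<close>

lemma net_defect:
 obtains e :: "nat \<Rightarrow> real" and B :: real and p0 :: nat where "e \<longlonglongrightarrow> 0" "0 < B"
  "\<And>N p x v. 0 < N \<Longrightarrow> p0 \<le> p \<Longrightarrow> 2 \<le> v \<Longrightarrow> v + 4 / v \<le> 2 * real (N * nsub N x) \<Longrightarrow>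
    FK (net N p x) v - FK I v \<le> real (N * nsub N x) ^ CARD('d) * (e p + B * bad_ratio N) * (phi v / v)"
proof -
 obtain e B p0 where P: "\<And>m. m < m0 \<Longrightarrow> cell_bounds m (e m) (B m) (p0 m)" using chart_cell_bounds by metis
 have P1: "e m \<longlonglongrightarrow> 0" "0 < B m" if "m < m0" for m using P[OF that] by (auto simp: cell_bounds_def)
 define B' where "B' = 1 + (\<Sum>m<m0. B m)"
 have BB: "B m \<le> B'" if "m < m0" for m using member_le_sum[of m "{..<m0}" B] that P1(2) by (auto simp: B'_def less_imp_le)
 have B'0: "0 < B'" unfolding B'_def using P1(2) by (intro add_pos_nonneg sum_nonneg) (auto intro: less_imp_le)
 show ?thesis
 proof (rule that[of "\<lambda>p. \<Sum>m<m0. \<bar>e m p\<bar>" B' "Max (p0 ` {..<m0} \<union> {0})"])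
  have "(\<lambda>p. \<Sum>m<m0. \<bar>e m p\<bar>) \<longlonglongrightarrow> (\<Sum>m<m0. \<bar>0\<bar>)" by (intro tendsto_intros P1) auto
  thus "(\<lambda>p. \<Sum>m<m0. \<bar>e m p\<bar>) \<longlonglongrightarrow> 0" by simp
  show "0 < B'" by (rule B'0)
  fix N p :: nat and x v :: real
  assume N: "0 < N" and p: "Max (p0 ` {..<m0} \<union> {0}) \<le> p" and v: "2 \<le> v" and vc: "v + 4 / v \<le> 2 * real (N * nsub N x)"
  define n where "n = nsub N x"
  define c where "c = N * n"
  have n0: "0 < n" and c0: "0 < c" using N nsub_pos by (auto simp: n_def c_def)
  have vh: "(v + 4 / v) * (1 / real c) \<le> 2" "v * (1 / real c) \<le> 2"
  proof -
   have "v + 4 / v \<le> 2 * real c" using vc by (simp add: c_def n_def)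
   moreover have "0 \<le> 4 / v" using v by simp
   ultimately have "v + 4 / v \<le> 2 * real c" "v \<le> 2 * real c" by linarith+
   thus "(v + 4 / v) * (1 / real c) \<le> 2" "v * (1 / real c) \<le> 2" using c0 by (simp_all add: pos_divide_le_eq)
  qed
  have pm: "p0 m \<le> p" if "m < m0" for m using p that by (auto simp: Max_le_iff)
  let ?w = "\<lambda>k. gridpt 0 (1 / real c) k :: real ^ 'd"
  let ?T = "net N p x" and ?G = "\<lambda>k. grid (?w k) (1 / real c / 2 ^ p) (2 ^ p) :: (real ^ 'd) set"
  have sc: "subcube c k = cbox (?w k) (?w k + (1 / real c) *\<^sub>R 1)" for k by (simp add: subcube_def)
  have ch: "subcube c k \<subseteq> subcube N j" if "k \<in> children n j" for k j unfolding c_def using N n0 that by (rule children_subcube)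
  have jc: "subcube N j \<subseteq> cbox 0 1" if "j \<in> good N m \<union> bad N m" for j m
   using that N by (intro subcube_subset) (auto simp: good_def bad_def)
  let ?f = "phi v / v" and ?K = "SIGMA m:{..<m0}. SIGMA j:good N m \<union> bad N m. children n j"
  let ?C = "\<lambda>m k. exceed (\<psi> m ` subcube c k) v - exceed ?T v"
  define b where "b m j = (if j \<in> good N m then \<bar>e m p\<bar> else B') * ?f" for m j
  have f0: "0 \<le> ?f" using v by simp
  note mT = exceed_measurable[OF net_I]
  have each: "?C m k \<in> sets M \<and> prob (?C m k) \<le> b m j"
   if m: "m < m0" and j: "j \<in> good N m \<union> bad N m" and k: "k \<in> children n j" for m j k
  proof -
   have sub: "subcube c k \<subseteq> cbox 0 1" using ch[OF k] jc[OF j] by blast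
   have "\<psi> m ` subcube c k \<subseteq> I" using sub \<psi>_I[OF m] by blast
   note mC = exceed_measurable[OF this]
   note bounds = P[OF m, unfolded cell_bounds_def, THEN conjunct2, THEN conjunct2]
   have "prob (?C m k) \<le> b m j"
   proof (cases "j \<in> good N m")
    case True
    hence "subcube c k \<subseteq> core N m" using ch[OF k] by (auto simp: core_def)
    hence "?G k \<subseteq> lat N p x \<inter> core N m" using N by (intro cell_grid_lat) (auto simp: c_def n_def)
    hence G: "\<psi> m ` ?G k \<subseteq> ?T" using m by (auto simp: net_def)
    hence "?C m k \<subseteq> exceed (\<psi> m ` subcube c k) v - exceed (\<psi> m ` ?G k) v" unfolding exceed_def by blast
    hence "prob (?C m k) \<le> prob (exceed (\<psi> m ` subcube c k) v - exceed (\<psi> m ` ?G k) v)"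
     using mC exceed_measurable[OF order_trans[OF G net_I]] by (intro finite_measure_mono) auto
    also have "\<dots> \<le> e m p * ?f"
     unfolding sc by (rule bounds[THEN conjunct2, rule_format]) (use c0 v vh pm[OF m] sub in \<open>auto simp: sc\<close>)
    also have "\<dots> \<le> \<bar>e m p\<bar> * ?f" using f0 by (intro mult_right_mono) auto
    finally show ?thesis using True by (simp add: b_def)
   next
    case False
    have "prob (?C m k) \<le> prob (exceed (\<psi> m ` subcube c k) v)" using mC by (intro finite_measure_mono) auto
    also have "\<dots> \<le> B m * ?f" unfolding sc by (rule bounds[THEN conjunct1, rule_format]) (use c0 v vh sub in \<open>auto simp: sc\<close>)
    also have "\<dots> \<le> B' * ?f" using f0 BB[OF m] by (intro mult_right_mono) auto
    finally show ?thesis using False by (simp add: b_def)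
   qed
   thus ?thesis using mC mT by auto
  qed
  have cov: "exceed I v - exceed ?T v \<subseteq> {} \<union> (\<Union>i\<in>?K. ?C (fst i) (snd (snd i)))"
  proof
   fix \<omega> assume w: "\<omega> \<in> exceed I v - exceed ?T v"
   then obtain t where t: "t \<in> I" "v < X t \<omega>" and ws: "\<omega> \<in> space M" by (auto simp: exceed_def)
   obtain m y where m: "m < m0" and y: "y \<in> part m" "t = \<psi> m y" using t(1) part_cover by auto
   obtain j where j: "j \<in> good N m \<union> bad N m" "y \<in> subcube N j"
    using part_covered[OF N, of m] y(1) unfolding core_def by blast
   obtain k where k: "k \<in> children n j" "y \<in> subcube c k" using subcube_refine[OF j(2) N n0] by (auto simp: c_def)
   have "\<omega> \<in> ?C m k" using w ws t y k by (auto simp: exceed_def)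
   moreover have "(m, j, k) \<in> ?K" using m j k by simp
   ultimately show "\<omega> \<in> {} \<union> (\<Union>i\<in>?K. ?C (fst i) (snd (snd i)))" by force
  qed
  have "FK ?T v - FK I v = prob (exceed I v) - prob (exceed ?T v)" by (simp add: prob_exceed net_I)
  also have "\<dots> = prob (exceed I v - exceed ?T v)"
  proof -
   have "exceed ?T v \<subseteq> exceed I v" unfolding exceed_def using net_I by blast
   thus ?thesis using exceed_measurable[of I] mT by (simp add: finite_measure_Diff)
  qed
  also have "\<dots> \<le> prob {} + (\<Sum>i\<in>?K. b (fst i) (fst (snd i)))"
  proof (rule prob_union_bound[OF _ _ _ cov])
   fix i assume "i \<in> ?K"
   hence "fst i < m0" "fst (snd i) \<in> good N (fst i) \<union> bad N (fst i)" "snd (snd i) \<in> children n (fst (snd i))" by auto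
   from each[OF this] show "?C (fst i) (snd (snd i)) \<in> sets M" "prob (?C (fst i) (snd (snd i))) \<le> b (fst i) (fst (snd i))" by auto
  qed (auto simp: finite_good finite_bad finite_children)
  also have "\<dots> = (\<Sum>m<m0. \<Sum>j\<in>good N m \<union> bad N m. \<Sum>k\<in>children n j. b m j)"
  proof -
   have "(\<Sum>i\<in>?K. b (fst i) (fst (snd i))) = (\<Sum>m<m0. \<Sum>p\<in>Sigma (good N m \<union> bad N m) (children n). b m (fst p))"
    by (subst sum.Sigma) (auto simp: split_def finite_good finite_bad finite_children)
   also have "\<dots> = (\<Sum>m<m0. \<Sum>j\<in>good N m \<union> bad N m. \<Sum>k\<in>children n j. b m j)"
    by (intro sum.cong refl, subst sum.Sigma) (auto simp: split_def finite_good finite_bad finite_children)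
   finally show ?thesis by simp
  qed
  also have "\<dots> \<le> (\<Sum>m<m0. real c ^ CARD('d) * (\<bar>e m p\<bar> + B' * (card (bad N m) / real N ^ CARD('d))) * ?f)"
  proof (rule sum_mono)
   fix m
   have disj: "good N m \<inter> bad N m = {}" by (auto simp: good_def bad_def)
   have "b m j = \<bar>e m p\<bar> * ?f" if "j \<in> good N m" for j using that by (simp add: b_def)
   moreover have "b m j = B' * ?f" if "j \<in> bad N m" for j using that disj by (auto simp: b_def)
   ultimately have "(\<Sum>j\<in>good N m \<union> bad N m. \<Sum>k\<in>children n j. b m j)
     = (\<Sum>j\<in>good N m. real n ^ CARD('d) * (\<bar>e m p\<bar> * ?f)) + (\<Sum>j\<in>bad N m. real n ^ CARD('d) * (B' * ?f))"
    using disj by (subst sum.union_disjoint) (simp_all add: finite_good finite_bad card_children)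
   also have "\<dots> = real (card (good N m)) * (real n ^ CARD('d) * (\<bar>e m p\<bar> * ?f)) + real (card (bad N m)) * (real n ^ CARD('d) * (B' * ?f))"
    by simp
   also have "\<dots> \<le> real N ^ CARD('d) * (real n ^ CARD('d) * (\<bar>e m p\<bar> * ?f)) + real (card (bad N m)) * (real n ^ CARD('d) * (B' * ?f))"
   proof (intro add_right_mono mult_right_mono)
    have "card (good N m) \<le> N ^ CARD('d)" using card_mono[OF finite_subcells, of "good N m" N] by (auto simp: card_subcells good_def)
    thus "real (card (good N m)) \<le> real N ^ CARD('d)" by (metis of_nat_le_iff of_nat_power)
   qed (intro mult_nonneg_nonneg abs_ge_zero f0, simp)
   also have "\<dots> = real c ^ CARD('d) * (\<bar>e m p\<bar> + B' * (card (bad N m) / real N ^ CARD('d))) * ?f"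
   proof -
    have *: "g * (k * (a * f)) + l * (k * (b * f)) = (g * k) * (a + b * (l / g)) * f" if "g \<noteq> 0" for g k a f l b :: real
     using that by (simp add: field_simps)
    show ?thesis unfolding c_def of_nat_mult power_mult_distrib by (rule *) (use N in simp)
   qed
   finally show "(\<Sum>j\<in>good N m \<union> bad N m. \<Sum>k\<in>children n j. b m j)
     \<le> real c ^ CARD('d) * (\<bar>e m p\<bar> + B' * (card (bad N m) / real N ^ CARD('d))) * ?f" .
  qed
  also have "\<dots> = real c ^ CARD('d) * ((\<Sum>m<m0. \<bar>e m p\<bar>) + B' * bad_ratio N) * ?f"
   by (simp add: bad_ratio_def sum_distrib_left sum_distrib_right distrib_left distrib_right mult_ac sum.distrib)
  finally show "FK ?T v - FK I v \<le> real (N * nsub N x) ^ CARD('d) * ((\<Sum>m<m0. \<bar>e m p\<bar>) + B' * bad_ratio N) * ?f" by (simp add: c_def n_def)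
 qed
qed

lemma bad_ratio_lim: "(\<lambda>n. bad_ratio (Suc n)) \<longlonglongrightarrow> 0"
proof -
 have "(\<lambda>n. bad_ratio (Suc n)) \<longlonglongrightarrow> (\<Sum>m<m0. 0)" unfolding bad_ratio_def by (intro tendsto_sum bad_fraction) auto
 thus ?thesis by simp
qed

section \<open>Masses of cells, cores and parts\<close>

lemma dens_integrable:
 assumes m: "m < m0" and A: "A \<in> sets borel" "A \<subseteq> cbox 0 1"
 shows "integrable lborel (\<lambda>y. indicator A y * dens m y)"
proof -
 obtain D where D: "0 < D" "\<And>m y. m < m0 \<Longrightarrow> y \<in> cbox 0 1 \<Longrightarrow> dens m y \<le> D" by (rule dens_bounded) blast
 have meas: "(\<lambda>y. indicator A y *\<^sub>R dens m y) \<in> borel_measurable borel"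
  using A by (intro borel_measurable_continuous_on_indicator continuous_on_subset[OF dens_cont[OF m]]) auto
 show ?thesis
 proof (rule Bochner_Integration.integrable_bound)
  show "integrable lborel (\<lambda>y. D * indicator (cbox 0 1 :: (real ^ 'd) set) y)"
   by (intro integrable_mult_right integrable_real_indicator) (auto simp: emeasure_lborel_cbox_eq)
  show "(\<lambda>y. indicator A y * dens m y) \<in> borel_measurable lborel" using meas by simp
  have "norm (indicator A y * dens m y) \<le> norm (D * indicator (cbox 0 1) y)" for y
   using A(2) D(1) D(2)[OF m, of y] dens_pos[OF m, of y] by (auto simp: indicator_def)
  thus "AE y in lborel. norm (indicator A y * dens m y) \<le> norm (D * indicator (cbox 0 1) y)" by simp
 qed
qed

definition core_mass :: "nat \<Rightarrow> nat \<Rightarrow> real" where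
 "core_mass N m = (\<integral>y. indicator (interior (core N m)) y * dens m y \<partial>lborel)"

definition total_mass :: real where
 "total_mass = (\<Sum>m<m0. \<integral>y. indicator (part m) y * dens m y \<partial>lborel)"

text \<open>The quotient of cell probability and \<open>\<delta> ^ d\<close> converges at each point
  and never exceeds the bounded density \<open>dens\<close>, so convergence is dominated.\<close>

lemma cell_mass_limit:
 assumes N: "0 < N" and m: "m < m0"
 shows "(\<lambda>p. cell_mass N m (1 / 2 ^ p) / (1 / 2 ^ p) ^ CARD('d)) \<longlonglongrightarrow> core_mass N m"
proof -
 let ?\<delta> = "\<lambda>p :: nat. 1 / 2 ^ p :: real" and ?J = "interior (core N m)"
 obtain D where D: "0 < D" "\<And>m y. m < m0 \<Longrightarrow> y \<in> cbox 0 1 \<Longrightarrow> dens m y \<le> D" by (rule dens_bounded) blast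
 have JQ: "?J \<subseteq> cbox 0 1" using core_Q interior_subset by blast
 have meas[measurable]: "(\<lambda>y. indicator ?J y * cell_prob m y (?\<delta> p)) \<in> borel_measurable lborel" for p
  using N m filterlim_real_sequentially by (rule net_integral_limit(2))
 have "(\<lambda>p. \<integral>y. indicator ?J y * cell_prob m y (?\<delta> p) / ?\<delta> p ^ CARD('d) \<partial>lborel) \<longlonglongrightarrow> core_mass N m"
  unfolding core_mass_def
 proof (rule integral_dominated_convergence[where w="\<lambda>y. D * indicator (cbox 0 1) y"])
  show "(\<lambda>y. indicator ?J y * dens m y) \<in> borel_measurable lborel" using dens_integrable[OF m _ JQ] by auto
  show "(\<lambda>y. indicator ?J y * cell_prob m y (?\<delta> p) / ?\<delta> p ^ CARD('d)) \<in> borel_measurable lborel" for p by measurable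
  show "integrable lborel (\<lambda>y. D * indicator (cbox 0 1 :: (real ^ 'd) set) y)"
   by (intro integrable_mult_right integrable_real_indicator) (auto simp: emeasure_lborel_cbox_eq)
  have "(\<lambda>p. indicator ?J y * cell_prob m y (?\<delta> p) / ?\<delta> p ^ CARD('d)) \<longlonglongrightarrow> indicator ?J y * dens m y" for y
  proof (cases "y \<in> ?J")
   case True
   hence "y \<in> cbox 0 1" using JQ by blast
   moreover have "?\<delta> \<longlonglongrightarrow> 0" by real_asymp
   ultimately have "(\<lambda>p. cell_prob m y (?\<delta> p) / ?\<delta> p ^ CARD('d)) \<longlonglongrightarrow> dens m y"
    unfolding dens_def by (intro cell_prob_limit[OF m]) auto
   thus ?thesis using True by simp
  qed simp
  thus "AE y in lborel. (\<lambda>p. indicator ?J y * cell_prob m y (?\<delta> p) / ?\<delta> p ^ CARD('d)) \<longlonglongrightarrow> indicator ?J y * dens m y" by simp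
  fix p
  have "norm (indicator ?J y * cell_prob m y (?\<delta> p) / ?\<delta> p ^ CARD('d)) \<le> D * indicator (cbox 0 1) y" for y
  proof (cases "y \<in> ?J")
   case True
   hence y: "y \<in> cbox 0 1" using JQ by blast
   have "cell_prob m y (?\<delta> p) \<le> dens m y * ?\<delta> p ^ CARD('d)"
    using cell_prob_bounds(2)[OF m y] unfolding dens_def by (metis zero_less_divide_1_iff zero_less_numeral zero_less_power)
   hence "cell_prob m y (?\<delta> p) / ?\<delta> p ^ CARD('d) \<le> dens m y" by (simp add: pos_divide_le_eq)
   moreover have "0 \<le> cell_prob m y (?\<delta> p)" by (simp add: lim_event_def)
   ultimately show ?thesis using True y D(2)[OF m y] by simp
  qed (use D in auto)
  thus "AE y in lborel. norm (indicator ?J y * cell_prob m y (?\<delta> p) / ?\<delta> p ^ CARD('d)) \<le> D * indicator (cbox 0 1) y" by simp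
 qed
 thus ?thesis by (simp add: cell_mass_def)
qed

text \<open>What a part has beyond the interior of its core lies in the bad subcubes or in the null
  frontier of the core; with \<open>dens\<close> bounded, the loss is controlled by
  \<open>bad_ratio\<close>.\<close>

lemma core_mass_limit: "(\<lambda>n. \<Sum>m<m0. core_mass (Suc n) m) \<longlonglongrightarrow> total_mass"
proof -
 let ?I = "\<lambda>m. \<integral>y. indicator (part m) y * dens m y \<partial>lborel" and ?S = "\<lambda>N m y. \<Sum>j\<in>bad N m. indicator (subcube N j) y :: real"
 obtain D where D: "0 < D" "\<And>m y. m < m0 \<Longrightarrow> y \<in> cbox 0 1 \<Longrightarrow> dens m y \<le> D" by (rule dens_bounded) blast
 have bound: "\<bar>core_mass N m - ?I m\<bar> \<le> D * (real (card (bad N m)) / real N ^ CARD('d))"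
  if N: "0 < N" and m: "m < m0" for N m
 proof -
  let ?J = "interior (core N m)" and ?F = "frontier (core N m)"
  have JP: "?J \<subseteq> part m" using interior_subset core_subset by blast
  note i1 = dens_integrable[OF m part_measurable[OF m] part_subset]
  note i2 = dens_integrable[OF m _ order_trans[OF JP part_subset]]
  have F0: "?F \<in> null_sets lborel" by (rule core_frontier_null)
  hence Fm: "?F \<in> sets lborel" "emeasure lborel ?F = 0" by auto
  have sub: "indicator (part m) y * dens m y - indicator ?J y * dens m y
    \<le> D * (indicator ?F y + ?S N m y)" for y
  proof (cases "y \<in> part m \<and> y \<notin> ?J")
   case True
   hence yQ: "y \<in> cbox 0 1" using part_subset by blast
   have "1 \<le> indicator ?F y + ?S N m y"
   proof (cases "y \<in> core N m")
    case True': True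
    hence "y \<in> ?F" using True closure_subset by (auto simp: frontier_def)
    thus ?thesis by (simp add: sum_nonneg)
   next
    case False
    then obtain j where j: "j \<in> bad N m" "y \<in> subcube N j" using True part_covered[OF N] by blast
    hence "1 \<le> ?S N m y" using member_le_sum[of j "bad N m" "\<lambda>j. indicator (subcube N j) y :: real"] finite_bad by simp
    moreover have "0 \<le> (indicator ?F y :: real)" by simp
    ultimately show ?thesis by linarith
   qed
   hence "dens m y * 1 \<le> D * (indicator ?F y + ?S N m y)" using D dens_pos[OF m yQ] D(2)[OF m yQ] by (intro mult_mono) auto
   thus ?thesis using True by simp
  next
   case False
   have "0 \<le> D * (indicator ?F y + ?S N m y)" using D(1) by (intro mult_nonneg_nonneg add_nonneg_nonneg sum_nonneg) auto
   thus ?thesis using False JP by (auto simp: indicator_def split: if_splits)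
  qed
  have ms: "subcube N j \<in> sets lborel" "emeasure lborel (subcube N j) = ennreal ((1 / real N) ^ CARD('d))" for j :: "'d \<Rightarrow> nat"
   using N by (simp_all add: subcube_def emeasure_lborel_cbox_eq inner_add_left inner_one_Basis)
  have ii: "integrable lborel (indicator (subcube N j) :: _ \<Rightarrow> real)" for j :: "'d \<Rightarrow> nat"
   by (intro integrable_real_indicator) (use ms in auto)
  have iF: "integrable lborel (indicator ?F :: _ \<Rightarrow> real)" using Fm by (intro integrable_real_indicator) simp_all
  have "?I m - core_mass N m
    = (\<integral>y. indicator (part m) y * dens m y - indicator ?J y * dens m y \<partial>lborel)"
   unfolding core_mass_def using i1 i2 by (subst Bochner_Integration.integral_diff) auto
  also have "\<dots> \<le> (\<integral>y. D * (indicator ?F y + ?S N m y) \<partial>lborel)" using i1 i2 ii iF by (intro integral_mono sub) auto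
  also have "\<dots> = D * (real (card (bad N m)) / real N ^ CARD('d))"
   using ii iF Fm ms N by (simp add: Bochner_Integration.integral_sum measure_def power_divide)
  finally have up: "?I m - core_mass N m \<le> D * (real (card (bad N m)) / real N ^ CARD('d))" .
  have "core_mass N m \<le> ?I m" unfolding core_mass_def
  proof (rule integral_mono)
   show "indicator ?J y * dens m y \<le> indicator (part m) y * dens m y" for y
    using JP part_subset dens_pos[OF m, of y] by (auto simp: indicator_def intro: less_imp_le)
  qed (use i1 i2 in auto)
  with up show ?thesis by linarith
 qed
 have "(\<lambda>n. (\<Sum>m<m0. core_mass (Suc n) m) - total_mass) \<longlonglongrightarrow> 0"
 proof (rule Lim_null_comparison)
  have "norm ((\<Sum>m<m0. core_mass (Suc n) m) - total_mass) \<le> D * bad_ratio (Suc n)" for n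
  proof -
   have "(\<Sum>m<m0. core_mass (Suc n) m) - total_mass = (\<Sum>m<m0. core_mass (Suc n) m - ?I m)" by (simp add: total_mass_def sum_subtractf)
   also have "norm \<dots> \<le> (\<Sum>m<m0. D * (real (card (bad (Suc n) m)) / real (Suc n) ^ CARD('d)))"
    by (rule sum_norm_le) (use bound[of "Suc n"] in auto)
   finally show ?thesis by (simp add: bad_ratio_def sum_distrib_left)
  qed
  thus "eventually (\<lambda>n. norm ((\<Sum>m<m0. core_mass (Suc n) m) - total_mass) \<le> D * bad_ratio (Suc n)) sequentially" by simp
  show "(\<lambda>n. D * bad_ratio (Suc n)) \<longlonglongrightarrow> 0" using tendsto_mult[OF tendsto_const bad_ratio_lim, of D] by simp
 qed
 thus ?thesis by (simp add: LIM_zero_iff)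
qed

text \<open>The supporting line at \<open>w\<close> compares \<open>k w\<close> with the increment
  of \<open>FK I\<close> between \<open>w\<close> and \<open>x\<close>. Replacing \<open>I\<close>
  by the net has the favourable sign at \<open>x\<close>, because \<open>FK\<close> is larger on the
  subset; so only the defect at \<open>w\<close> enters. The increment for the net is
  \<open>gT\<close> at \<open>x\<close> times that of \<open>Phi\<close> up to the right inequality,
  and the latter is at least of order \<open>phi w / w\<close>, the scale of the defect.\<close>

lemma deriv_bounds:
 obtains e :: "nat \<Rightarrow> real" and B v0 :: real and p0 :: nat and k :: "real \<Rightarrow> real" where "e \<longlonglongrightarrow> 0" "0 < B"
  "\<And>w. v0 \<le> w \<Longrightarrow> deriv (FK I) w = k w * phi w"
  "\<And>N p w x. 0 < N \<Longrightarrow> p0 \<le> p \<Longrightarrow> v0 \<le> w \<Longrightarrow> x = w + 1 / w \<Longrightarrow>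
    k w \<le> gT (net N p x) x + exp 2 * real (N * nsub N x) ^ CARD('d) * (e p + B * bad_ratio N)"
  "\<And>N p w x. 0 < N \<Longrightarrow> p0 \<le> p \<Longrightarrow> v0 \<le> w \<Longrightarrow> x = w - 1 / w \<Longrightarrow>
    gT (net N p x) x - exp 2 * real (N * nsub N x) ^ CARD('d) * (e p + B * bad_ratio N) \<le> k w"
proof -
 obtain e :: "nat \<Rightarrow> real" and B :: real and p0 :: nat where e: "e \<longlonglongrightarrow> 0" "0 < B" and defect:
  "\<And>N p x v. 0 < N \<Longrightarrow> p0 \<le> p \<Longrightarrow> 2 \<le> v \<Longrightarrow> v + 4 / v \<le> 2 * real (N * nsub N x) \<Longrightarrow>
    FK (net N p x) v - FK I v \<le> real (N * nsub N x) ^ CARD('d) * (e p + B * bad_ratio N) * (phi v / v)"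
  by (rule net_defect) (rule that)
 obtain u0 where u0: "0 < FK I u0" using FK_pos by blast
 define k where "k w = deriv (FK I) w / phi w" for w
 have k: "FK I w + k w * (Phi y - Phi w) \<le> FK I y" if w: "u0 < w" for w y
 proof -
  obtain a where a: "(FK I has_real_derivative a * phi w) (at w)" "\<And>y. FK I w + a * (Phi y - Phi w) \<le> FK I y"
   using FK_deriv[OF subset_refl u0 w] by blast
  have "a = k w" using DERIV_imp_deriv[OF a(1)] by (simp add: k_def std_normal_density_def)
  thus ?thesis using a(2) by blast
 qed
 \<comment> \<open>From 5 on, \<open>w + 4 / w \<le> 2 * (w - 1 / w)\<close>, which makes
   \<open>net_defect\<close> applicable to nets built for \<open>x \<ge> w - 1 / w\<close>; beyond
   \<open>u0\<close> the derivative exists.\<close>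
 define v0 where "v0 = max 5 (u0 + 1)"
 have diff: "0 \<le> FK (net N p x) y - FK I y" for N p x y using FK_antimono[OF net_I subset_refl] by simp
 \<comment> \<open>The step up to \<open>w + 1 / w\<close> decreases the density by the factor
   \<open>exp (1 + (1 / w)\<^sup>2 / 2)\<close>, at most \<open>exp 2\<close>. The second, weaker
   bound carries the same constant so that both sides of the squeeze look alike.\<close>
 have defect': "FK (net N p x) w - FK I w \<le> exp 2 * real (N * nsub N x) ^ CARD('d) * (e p + B * bad_ratio N) * (phi (w + 1 / w) / w)"
  "FK (net N p x) w - FK I w \<le> exp 2 * real (N * nsub N x) ^ CARD('d) * (e p + B * bad_ratio N) * (phi w / w)"
  if N: "0 < N" and p: "p0 \<le> p" and w: "v0 \<le> w" and x: "w - 1 / w \<le> x" for N p w x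
 proof -
  have w5: "5 \<le> w" using w by (simp add: v0_def)
  have w1: "1 / w \<le> 1 / 5" using w5 by (intro divide_left_mono) auto
  have "w + 4 / w = w + 4 * (1 / w)" by simp
  also have "\<dots> \<le> 2 * (w - 1 / w)" using w1 w5 by argo
  also have "\<dots> \<le> 2 * x" using x by simp
  also have "x \<le> real (N * nsub N x)" using nsub_bounds(1)[OF N, of x] x w1 w5 by simp
  finally have vc: "w + 4 / w \<le> 2 * real (N * nsub N x)" by simp
  define Q where "Q = real (N * nsub N x) ^ CARD('d) * (e p + B * bad_ratio N)"
  have le: "FK (net N p x) w - FK I w \<le> Q * (phi w / w)" unfolding Q_def using N p w5 vc by (intro defect) auto
  have ph: "0 < phi w / w" using w5 by simp
  have Q0: "0 \<le> Q" using le diff[of N p x w] ph by (smt (verit) mult_neg_pos)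
  have "phi w = exp (1 + (1 / w)\<^sup>2 / 2) * phi (w + 1 / w)" using w5 by (subst phi_shift) (simp add: mult.commute[of _ "phi w"] flip: exp_add)
  also have "\<dots> \<le> exp 2 * phi (w + 1 / w)"
  proof -
   have "(1 / w)\<^sup>2 \<le> (1 / 5)\<^sup>2" using w1 w5 by (intro power_mono) auto
   thus ?thesis by (intro mult_right_mono) (auto simp: power2_eq_square)
  qed
  finally have "phi w / w \<le> exp 2 * phi (w + 1 / w) / w" using w5 by (intro divide_right_mono) auto
  hence "Q * (phi w / w) \<le> Q * (exp 2 * phi (w + 1 / w) / w)" using Q0 by (intro mult_left_mono)
  with le show "FK (net N p x) w - FK I w \<le> exp 2 * real (N * nsub N x) ^ CARD('d) * (e p + B * bad_ratio N) * (phi (w + 1 / w) / w)"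
   by (simp add: Q_def mult_ac)
  have "1 \<le> exp (2 :: real)" by simp
  hence "1 * (Q * (phi w / w)) \<le> exp 2 * (Q * (phi w / w))" using mult_nonneg_nonneg[OF Q0 less_imp_le[OF ph]] by (intro mult_right_mono)
  with le show "FK (net N p x) w - FK I w \<le> exp 2 * real (N * nsub N x) ^ CARD('d) * (e p + B * bad_ratio N) * (phi w / w)" by (simp add: Q_def mult_ac)
 qed
 show ?thesis
 proof (rule that[of e B v0 k p0])
  show "e \<longlonglongrightarrow> 0" "0 < B" by (rule e)+
  show "deriv (FK I) w = k w * phi w" for w by (simp add: k_def)
  fix N p :: nat and w x :: real
  assume N: "0 < N" and p: "p0 \<le> p" and w: "v0 \<le> w"
  have w5: "5 \<le> w" and wu: "u0 < w" using w by (auto simp: v0_def)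
  let ?T = "net N p x" and ?Q = "exp 2 * real (N * nsub N x) ^ CARD('d) * (e p + B * bad_ratio N)"
  note T = finite_net[of N p x] net_I[of N p x]
  {
   assume x: "x = w + 1 / w"
   have wx: "w < x" using w5 by (simp add: x)
   have step: "phi x / w \<le> Phi x - Phi w" using Phi_step(1)[of w x] w5 wx by (simp add: x)
   have pos: "0 < Phi x - Phi w" using Phi_strict_mono[OF wx] by simp
   have d: "FK ?T w - FK I w \<le> ?Q * (phi x / w)" using defect'(1)[OF N p w, of x] w5 by (simp add: x)
   have "0 < phi x / w" using w5 by simp
   hence Q0: "0 \<le> ?Q" using d diff[of N p x w] by (smt (verit) mult_neg_pos)
   have "k w * (Phi x - Phi w) \<le> (FK ?T x - FK ?T w) + (FK ?T w - FK I w)" using k[OF wu, of x] diff[of N p x x] by linarith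
   also have "\<dots> \<le> gT ?T x * (Phi x - Phi w) + ?Q * (Phi x - Phi w)"
   proof (rule add_mono)
    show "FK ?T x - FK ?T w \<le> gT ?T x * (Phi x - Phi w)" using wx by (intro FK_finite_bounds T) auto
    show "FK ?T w - FK I w \<le> ?Q * (Phi x - Phi w)" using d mult_left_mono[OF step Q0] by linarith
   qed
   finally have "k w * (Phi x - Phi w) \<le> (gT ?T x + ?Q) * (Phi x - Phi w)" by (simp only: distrib_right)
   thus "k w \<le> gT ?T x + ?Q" using pos by (simp only: mult_le_cancel_right_pos)
  }
  assume x: "x = w - 1 / w"
  have "1 / w \<le> 1 / 5" using w5 by (intro divide_left_mono) auto
  moreover have "0 < 1 / w" using w5 by simp
  ultimately have wx: "x < w" "0 \<le> x" using w5 unfolding x by linarith+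
  have step: "phi w / w \<le> Phi w - Phi x" using Phi_step(1)[of x w] wx by (simp add: x)
  have pos: "0 < Phi w - Phi x" using Phi_strict_mono[OF wx(1)] by simp
  have d: "FK ?T w - FK I w \<le> ?Q * (phi w / w)" using defect'(2)[OF N p w, of x] by (simp add: x)
  have "0 < phi w / w" using w5 by simp
  hence Q0: "0 \<le> ?Q" using d diff[of N p x w] by (smt (verit) mult_neg_pos)
  have "gT ?T x * (Phi w - Phi x) \<le> FK ?T w - FK ?T x" using wx by (intro FK_finite_bounds T) auto
  also have "\<dots> \<le> (FK I w - FK I x) + (FK ?T w - FK I w)" using diff[of N p x x] by linarith
  also have "\<dots> \<le> k w * (Phi w - Phi x) + ?Q * (Phi w - Phi x)"
  proof (rule add_mono)
   have "k w * (Phi x - Phi w) = - (k w * (Phi w - Phi x))" by (simp add: algebra_simps)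
   thus "FK I w - FK I x \<le> k w * (Phi w - Phi x)" using k[OF wu, of x] by linarith
   show "FK ?T w - FK I w \<le> ?Q * (Phi w - Phi x)" using d mult_left_mono[OF step Q0] by linarith
  qed
  finally have "gT ?T x * (Phi w - Phi x) \<le> (k w + ?Q) * (Phi w - Phi x)" by (simp only: distrib_right)
  hence "gT ?T x \<le> k w + ?Q" using pos by (simp only: mult_le_cancel_right_pos)
  thus "gT ?T x - ?Q \<le> k w" by linarith
 qed
qed

text \<open>The nets belong to the levels \<open>u + 1 / u\<close> and \<open>u - 1 / u\<close>,
  while the normalization is by \<open>u\<close>. The ratio of the levels tends to 1, so the limit
  is unchanged.\<close>

lemma gT_net_limit_shifted:
 assumes N: "0 < N" and u: "filterlim u at_top sequentially" and a: "\<bar>a\<bar> \<le> 1"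
 shows "(\<lambda>n. gT (net N p (u n + a / u n)) (u n + a / u n) / u n ^ CARD('d))
  \<longlonglongrightarrow> (\<Sum>m<m0. cell_mass N m (1 / 2 ^ p)) / (1 / 2 ^ p) ^ CARD('d)"
  and "eventually (\<lambda>n. real (N * nsub N (u n + a / u n)) ^ CARD('d) \<le> 2 ^ CARD('d) * u n ^ CARD('d)) sequentially"
proof -
 define x where "x n = u n + a / u n" for n
 have "filterlim (\<lambda>w. w + a / w) at_top at_top" by real_asymp
 hence xlim: "filterlim x at_top sequentially" unfolding x_def using u by (rule filterlim_compose)
 have "((\<lambda>w. (w + a / w) / w) \<longlongrightarrow> 1) at_top" by real_asymp
 hence ratio: "(\<lambda>n. x n / u n) \<longlonglongrightarrow> 1" unfolding x_def using u by (rule filterlim_compose)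
 have "(\<lambda>n. gT (net N p (x n)) (x n) / x n ^ CARD('d) * (x n / u n) ^ CARD('d))
   \<longlonglongrightarrow> (\<Sum>m<m0. cell_mass N m (1 / 2 ^ p)) / (1 / 2 ^ p) ^ CARD('d) * 1 ^ CARD('d)"
  by (intro tendsto_mult gT_net_limit N xlim tendsto_power ratio)
 moreover have "eventually (\<lambda>n. gT (net N p (x n)) (x n) / x n ^ CARD('d) * (x n / u n) ^ CARD('d)
   = gT (net N p (x n)) (x n) / u n ^ CARD('d)) sequentially"
  using xlim[unfolded filterlim_at_top_dense, rule_format, of 0] by eventually_elim (simp add: power_divide)
 ultimately show "(\<lambda>n. gT (net N p (u n + a / u n)) (u n + a / u n) / u n ^ CARD('d))
  \<longlonglongrightarrow> (\<Sum>m<m0. cell_mass N m (1 / 2 ^ p)) / (1 / 2 ^ p) ^ CARD('d)"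
  by (simp add: tendsto_cong x_def)
 have "eventually (\<lambda>n. 2 * real N + 1 < u n) sequentially" using u by (simp add: filterlim_at_top_dense)
 moreover have "eventually (\<lambda>n. 0 < x n) sequentially" using xlim by (simp add: filterlim_at_top_dense)
 ultimately show "eventually (\<lambda>n. real (N * nsub N (u n + a / u n)) ^ CARD('d) \<le> 2 ^ CARD('d) * u n ^ CARD('d)) sequentially"
 proof eventually_elim
  case (elim n)
  have "real N * real (nsub N (x n)) \<le> x n + 2 * real N" using elim by (intro nsub_bounds N) auto
  also have "x n + 2 * real N \<le> 2 * u n"
  proof -
   have "a / u n \<le> 1" using a elim by (simp add: divide_le_eq)
   moreover have "x n = u n + a / u n" by (simp add: x_def)
   ultimately show ?thesis using elim by linarith
  qed
  finally have "real (N * nsub N (x n)) \<le> 2 * u n" by simp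
  hence "real (N * nsub N (x n)) ^ CARD('d) \<le> (2 * u n) ^ CARD('d)" by (intro power_mono) auto
  thus ?case by (simp add: power_mult_distrib x_def)
 qed
qed

theorem deriv_FK_asymptotics: "((\<lambda>u. deriv (FK I) u / (u ^ CARD('d) * phi u)) \<longlongrightarrow> total_mass) at_top"
proof (rule tendsto_at_topI_sequentially)
 fix u :: "nat \<Rightarrow> real" assume u: "filterlim u at_top sequentially"
 obtain e :: "nat \<Rightarrow> real" and B v0 :: real and p0 :: nat and k :: "real \<Rightarrow> real" where e: "e \<longlonglongrightarrow> 0" "0 < B"
  and k: "\<And>w. v0 \<le> w \<Longrightarrow> deriv (FK I) w = k w * phi w"
  and upper: "\<And>N p w x. 0 < N \<Longrightarrow> p0 \<le> p \<Longrightarrow> v0 \<le> w \<Longrightarrow> x = w + 1 / w \<Longrightarrow>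
    k w \<le> gT (net N p x) x + exp 2 * real (N * nsub N x) ^ CARD('d) * (e p + B * bad_ratio N)"
  and lower: "\<And>N p w x. 0 < N \<Longrightarrow> p0 \<le> p \<Longrightarrow> v0 \<le> w \<Longrightarrow> x = w - 1 / w \<Longrightarrow>
    gT (net N p x) x - exp 2 * real (N * nsub N x) ^ CARD('d) * (e p + B * bad_ratio N) \<le> k w"
  by (rule deriv_bounds) (rule that)
 \<comment> \<open>\<open>exp 2\<close> is the constant of \<open>deriv_bounds\<close>, and
   \<open>2 ^ CARD('d)\<close> comes from \<open>N * nsub N x \<le> 2 * u\<close> for large
   \<open>u\<close>.\<close>
 define A :: real where "A = exp 2 * 2 ^ CARD('d)"
 have A: "0 < A" by (simp add: A_def)
 have "(\<lambda>n. k (u n) / u n ^ CARD('d)) \<longlonglongrightarrow> total_mass"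
 proof (rule LIMSEQ_I)
  fix \<epsilon>' :: real assume "0 < \<epsilon>'"
  \<comment> \<open>Five contributions: one from the convergence of \<open>gT\<close>, two from the
    defect through \<open>\<kappa>\<close>, one from the choice of \<open>p\<close>, one from the
    choice of \<open>N\<close>.\<close>
  define \<epsilon> where "\<epsilon> = \<epsilon>' / 5"
  have \<epsilon>: "0 < \<epsilon>" using \<open>0 < \<epsilon>'\<close> by (simp add: \<epsilon>_def)
  have "(\<lambda>n. A * (B * bad_ratio (Suc n))) \<longlonglongrightarrow> A * (B * 0)" by (intro tendsto_intros bad_ratio_lim)
  hence "eventually (\<lambda>n. \<bar>A * (B * bad_ratio (Suc n))\<bar> < \<epsilon>) sequentially"
   using \<epsilon> by (auto dest!: tendstoD simp: dist_real_def)
  moreover have "eventually (\<lambda>n. \<bar>(\<Sum>m<m0. core_mass (Suc n) m) - total_mass\<bar> < \<epsilon>) sequentially"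
   using tendstoD[OF core_mass_limit \<epsilon>] by (simp add: dist_real_def)
  ultimately have "eventually (\<lambda>n. \<bar>A * (B * bad_ratio (Suc n))\<bar> < \<epsilon> \<and> \<bar>(\<Sum>m<m0. core_mass (Suc n) m) - total_mass\<bar> < \<epsilon>) sequentially"
   by eventually_elim simp
  then obtain N where N: "0 < N" "\<bar>A * (B * bad_ratio N)\<bar> < \<epsilon>" "\<bar>(\<Sum>m<m0. core_mass N m) - total_mass\<bar> < \<epsilon>"
   unfolding eventually_sequentially by (metis order_refl zero_less_Suc)
  define L where "L p = (\<Sum>m<m0. cell_mass N m (1 / 2 ^ p)) / (1 / 2 ^ p) ^ CARD('d)" for p :: nat
  have "L \<longlonglongrightarrow> (\<Sum>m<m0. core_mass N m)" unfolding L_def sum_divide_distrib by (intro tendsto_sum cell_mass_limit N) auto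
  hence "eventually (\<lambda>p. \<bar>L p - (\<Sum>m<m0. core_mass N m)\<bar> < \<epsilon>) sequentially"
   using \<epsilon> by (auto dest!: tendstoD simp: dist_real_def)
  moreover have "(\<lambda>p. A * e p) \<longlonglongrightarrow> A * 0" by (intro tendsto_intros e)
  hence "eventually (\<lambda>p. \<bar>A * e p\<bar> < \<epsilon>) sequentially" using \<epsilon> by (auto dest!: tendstoD simp: dist_real_def)
  ultimately have "eventually (\<lambda>p. p0 \<le> p \<and> \<bar>L p - (\<Sum>m<m0. core_mass N m)\<bar> < \<epsilon> \<and> \<bar>A * e p\<bar> < \<epsilon>) sequentially"
   using eventually_ge_at_top[of p0] by eventually_elim simp
  then obtain p where p: "p0 \<le> p" "\<bar>L p - (\<Sum>m<m0. core_mass N m)\<bar> < \<epsilon>" "\<bar>A * e p\<bar> < \<epsilon>"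
   unfolding eventually_sequentially by blast
  define \<kappa> where "\<kappa> = e p + B * bad_ratio N"
  have kap: "A * \<bar>\<kappa>\<bar> < 2 * \<epsilon>"
  proof -
   have "A * \<bar>\<kappa>\<bar> = \<bar>A * e p + A * (B * bad_ratio N)\<bar>" using A by (simp add: \<kappa>_def abs_mult flip: distrib_left)
   thus ?thesis using N(2) p(3) by linarith
  qed
  have main: "eventually (\<lambda>n. \<bar>gT (net N p (u n + a / u n)) (u n + a / u n) / u n ^ CARD('d) - L p\<bar> < \<epsilon> \<and>
    exp 2 * real (N * nsub N (u n + a / u n)) ^ CARD('d) * \<bar>\<kappa>\<bar> / u n ^ CARD('d) < 2 * \<epsilon>) sequentially"
   if a: "\<bar>a\<bar> \<le> 1" for a
  proof -
   have "eventually (\<lambda>n. \<bar>gT (net N p (u n + a / u n)) (u n + a / u n) / u n ^ CARD('d) - L p\<bar> < \<epsilon>) sequentially"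
    using tendstoD[OF gT_net_limit_shifted(1)[OF N(1) u a] \<epsilon>] by (simp add: dist_real_def L_def)
   moreover have "eventually (\<lambda>n. 0 < u n) sequentially" using u by (simp add: filterlim_at_top_dense)
   ultimately show ?thesis using gT_net_limit_shifted(2)[OF N(1) u a]
   proof eventually_elim
    case (elim n)
    have "exp 2 * real (N * nsub N (u n + a / u n)) ^ CARD('d) * \<bar>\<kappa>\<bar> \<le> exp 2 * (2 ^ CARD('d) * u n ^ CARD('d)) * \<bar>\<kappa>\<bar>"
     using elim by (intro mult_right_mono mult_left_mono) auto
    also have "\<dots> = A * \<bar>\<kappa>\<bar> * u n ^ CARD('d)" by (simp add: A_def)
    finally have "exp 2 * real (N * nsub N (u n + a / u n)) ^ CARD('d) * \<bar>\<kappa>\<bar> / u n ^ CARD('d) \<le> A * \<bar>\<kappa>\<bar>"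
     using elim by (simp only: pos_divide_le_eq zero_less_power)
    thus ?case using elim kap by linarith
   qed
  qed
  have "eventually (\<lambda>n. \<bar>k (u n) / u n ^ CARD('d) - total_mass\<bar> < \<epsilon>') sequentially"
   using main[of 1, simplified] main[of "- 1", simplified]
    u[unfolded filterlim_at_top, rule_format, of v0] u[unfolded filterlim_at_top_dense, rule_format, of 0]
  proof eventually_elim
   case (elim n)
   let ?U = "u n ^ CARD('d)"
   have U: "0 < ?U" using elim by simp
   have up: "k (u n) / ?U < L p + 3 * \<epsilon>"
   proof -
    let ?x = "u n + 1 / u n"
    have "k (u n) \<le> gT (net N p ?x) ?x + exp 2 * real (N * nsub N ?x) ^ CARD('d) * \<kappa>" unfolding \<kappa>_def using N p elim by (intro upper) auto
    also have "\<dots> \<le> gT (net N p ?x) ?x + exp 2 * real (N * nsub N ?x) ^ CARD('d) * \<bar>\<kappa>\<bar>"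
     by (intro add_left_mono mult_left_mono) auto
    finally have "k (u n) / ?U \<le> (gT (net N p ?x) ?x + exp 2 * real (N * nsub N ?x) ^ CARD('d) * \<bar>\<kappa>\<bar>) / ?U"
     using U by (intro divide_right_mono) auto
    thus ?thesis using conjunct1[OF elim(1)] conjunct2[OF elim(1)] unfolding add_divide_distrib abs_less_iff of_nat_mult by linarith
   qed
   have lo: "L p - 3 * \<epsilon> < k (u n) / ?U"
   proof -
    let ?x = "u n - 1 / u n"
    have "gT (net N p ?x) ?x - exp 2 * real (N * nsub N ?x) ^ CARD('d) * \<kappa> \<le> k (u n)" unfolding \<kappa>_def using N p elim by (intro lower) auto
    moreover have "exp 2 * real (N * nsub N ?x) ^ CARD('d) * \<kappa> \<le> exp 2 * real (N * nsub N ?x) ^ CARD('d) * \<bar>\<kappa>\<bar>"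
     by (intro mult_left_mono) auto
    ultimately have "gT (net N p ?x) ?x - exp 2 * real (N * nsub N ?x) ^ CARD('d) * \<bar>\<kappa>\<bar> \<le> k (u n)" by linarith
    hence "(gT (net N p ?x) ?x - exp 2 * real (N * nsub N ?x) ^ CARD('d) * \<bar>\<kappa>\<bar>) / ?U \<le> k (u n) / ?U"
     using U by (intro divide_right_mono) auto
    thus ?thesis using conjunct1[OF elim(2)] conjunct2[OF elim(2)] unfolding diff_divide_distrib abs_less_iff of_nat_mult by linarith
   qed
   have "5 * \<epsilon> = \<epsilon>'" by (simp add: \<epsilon>_def)
   thus ?case using up lo p(2) N(3) by linarith
  qed
  thus "\<exists>no. \<forall>n\<ge>no. norm (k (u n) / u n ^ CARD('d) - total_mass) < \<epsilon>'" by (simp add: eventually_sequentially)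
 qed
 moreover have "eventually (\<lambda>n. deriv (FK I) (u n) / (u n ^ CARD('d) * phi (u n)) = k (u n) / u n ^ CARD('d)) sequentially"
  using u[unfolded filterlim_at_top, rule_format, of v0]
 proof eventually_elim
  case (elim n)
  have "phi (u n) \<noteq> 0" by (simp add: std_normal_density_def)
  thus ?case using k[OF elim] by simp
 qed
 ultimately show "(\<lambda>n. deriv (FK I) (u n) / (u n ^ CARD('d) * phi (u n))) \<longlonglongrightarrow> total_mass" by (simp add: tendsto_cong)
qed

end

section \<open>Strict differentiability\<close>

lemma strict_diff_has_derivative:
 assumes s: "strict_diff S f D x" and x: "x \<in> S" shows "(f has_derivative D) (at x within S)"
 unfolding has_derivative_within_alt
proof (intro conjI allI impI)
 show "bounded_linear D" using s by (rule strict_diff_bounded_linear)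
 fix e :: real assume "0 < e"
 then obtain d where d: "0 < d" "\<And>y z. y \<in> S \<inter> ball x d \<Longrightarrow> z \<in> S \<inter> ball x d \<Longrightarrow> norm (f y - f z - D (y - z)) \<le> e * norm (y - z)"
  by (rule strict_diffD[OF s]) blast
 show "\<exists>d>0. \<forall>y\<in>S. norm (y - x) < d \<longrightarrow> norm (f y - f x - D (y - x)) \<le> e * norm (y - x)"
  using d x by (intro exI[of _ d]) (auto simp: dist_norm norm_minus_commute)
qed

lemma strict_diff_compose:
 assumes f: "strict_diff S f D x" and g: "strict_diff T g E (f x)" and ST: "f ` S \<subseteq> T" and x: "x \<in> S"
 shows "strict_diff S (\<lambda>y. g (f y)) (\<lambda>v. E (D v)) x"
 unfolding strict_diff_def
proof (intro conjI allI impI)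
 note D = strict_diff_bounded_linear[OF f] and E = strict_diff_bounded_linear[OF g]
 show "bounded_linear (\<lambda>v. E (D v))" using E D by (rule bounded_linear_compose)
 fix e :: real assume e: "0 < e"
 obtain K where K: "0 < K" "\<And>v. norm (D v) \<le> norm v * K" using bounded_linear.pos_bounded[OF D] by blast
 obtain L where L: "0 < L" "\<And>v. norm (E v) \<le> norm v * L" using bounded_linear.pos_bounded[OF E] by blast
 \<comment> \<open>\<open>e1 \<le> 1\<close> makes \<open>f\<close> Lipschitz near \<open>x\<close>
   with constant \<open>K + 1\<close>; then \<open>e1 * L\<close> and \<open>e2 * (K + 1)\<close>
   each account for half of \<open>e\<close>.\<close>
 define e1 where "e1 = min 1 (e / (2 * L))"
 define e2 where "e2 = e / (2 * (K + 1))"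
 have e1: "0 < e1" "e1 \<le> 1" "e1 * L \<le> e / 2" and e2: "0 < e2" "e2 * (K + 1) = e / 2" using e K L by (auto simp: e1_def e2_def min_def field_simps)
 obtain d1 where d1: "0 < d1" "\<And>y z. y \<in> S \<inter> ball x d1 \<Longrightarrow> z \<in> S \<inter> ball x d1 \<Longrightarrow> norm (f y - f z - D (y - z)) \<le> e1 * norm (y - z)"
  by (rule strict_diffD[OF f e1(1)]) blast
 obtain d2 where d2: "0 < d2" "\<And>y z. y \<in> T \<inter> ball (f x) d2 \<Longrightarrow> z \<in> T \<inter> ball (f x) d2 \<Longrightarrow> norm (g y - g z - E (y - z)) \<le> e2 * norm (y - z)"
  by (rule strict_diffD[OF g e2(1)]) blast
 define d where "d = min d1 (d2 / (K + 1))"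
 have lip: "norm (f y - f z) \<le> (K + 1) * norm (y - z)" if "y \<in> S \<inter> ball x d" "z \<in> S \<inter> ball x d" for y z
 proof -
  have "norm (f y - f z) \<le> norm (f y - f z - D (y - z)) + norm (D (y - z))" by (metis norm_triangle_sub add.commute)
  also have "\<dots> \<le> 1 * norm (y - z) + norm (y - z) * K"
   using that d1(2)[of y z] e1 by (intro add_mono K(2) order_trans[OF d1(2)] mult_right_mono) (auto simp: d_def)
  finally show ?thesis by (simp add: algebra_simps)
 qed
 have d: "0 < d" using d1 d2 K by (simp add: d_def)
 have near: "f y \<in> T \<inter> ball (f x) d2" if y: "y \<in> S \<inter> ball x d" for y
 proof -
  have "norm (f y - f x) \<le> (K + 1) * norm (y - x)" using y x d by (intro lip) auto
  also have "\<dots> < (K + 1) * (d2 / (K + 1))" using y K by (intro mult_strict_left_mono) (auto simp: d_def dist_norm norm_minus_commute)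
  finally show ?thesis using ST y K by (auto simp: dist_norm norm_minus_commute)
 qed
 show "\<exists>d>0. \<forall>y\<in>S \<inter> ball x d. \<forall>z\<in>S \<inter> ball x d. norm (g (f y) - g (f z) - E (D (y - z))) \<le> e * norm (y - z)"
 proof (intro exI conjI ballI)
  show "0 < d" by (rule d)
  fix y z assume yz: "y \<in> S \<inter> ball x d" "z \<in> S \<inter> ball x d"
  have "g (f y) - g (f z) - E (D (y - z)) = (g (f y) - g (f z) - E (f y - f z)) + E (f y - f z - D (y - z))"
   using bounded_linear.linear[OF E] by (simp add: linear_diff)
  also have "norm \<dots> \<le> e2 * norm (f y - f z) + norm (f y - f z - D (y - z)) * L" using near yz by (intro norm_triangle_mono d2(2) L(2))
  also have "\<dots> \<le> e2 * ((K + 1) * norm (y - z)) + (e1 * norm (y - z)) * L"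
   using yz e2 L by (intro add_mono mult_left_mono mult_right_mono lip d1(2)) (auto simp: d_def)
  also have "\<dots> = e2 * (K + 1) * norm (y - z) + e1 * L * norm (y - z)" by (simp add: algebra_simps)
  also have "\<dots> \<le> e / 2 * norm (y - z) + e / 2 * norm (y - z)" using e1 e2 by (intro add_mono mult_right_mono) auto
  finally show "norm (g (f y) - g (f z) - E (D (y - z))) \<le> e * norm (y - z)" by (simp add: field_simps)
 qed
qed

lemma strict_diff_local:
 assumes s: "strict_diff U g D x" and U: "open U" "x \<in> U" and eq: "\<And>y. y \<in> S \<inter> U \<Longrightarrow> g y = f y"
 shows "strict_diff S f D x"
 unfolding strict_diff_def
proof (intro conjI allI impI)
 show "bounded_linear D" using s by (rule strict_diff_bounded_linear)
 fix e :: real assume "0 < e"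
 then obtain d where d: "0 < d" "\<And>y z. y \<in> U \<inter> ball x d \<Longrightarrow> z \<in> U \<inter> ball x d \<Longrightarrow> norm (g y - g z - D (y - z)) \<le> e * norm (y - z)"
  by (rule strict_diffD[OF s]) blast
 obtain c where c: "0 < c" "ball x c \<subseteq> U" using U by (rule openE)
 have "norm (f y - f z - D (y - z)) \<le> e * norm (y - z)" if "y \<in> S \<inter> ball x (min c d)" "z \<in> S \<inter> ball x (min c d)" for y z
 proof -
  have "y \<in> U" "z \<in> U" using that c(2) by auto
  thus ?thesis using that d(2)[of y z] eq[of y] eq[of z] by auto
 qed
 thus "\<exists>d>0. \<forall>y\<in>S \<inter> ball x d. \<forall>z\<in>S \<inter> ball x d. norm (f y - f z - D (y - z)) \<le> e * norm (y - z)"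
  using c d by (intro exI[of _ "min c d"]) auto
qed

lemma C1_deriv_cont:
 assumes U: "open U" "x \<in> U" and g: "higher_differentiable_on U g 1"
 shows "isCont (\<lambda>x. frechet_derivative g (at x) v) x"
proof -
 have "continuous_on U (\<lambda>x. frechet_derivative g (at x) v)" using g by simp
 thus ?thesis using continuous_on_eq_continuous_at[OF U(1)] U(2) by blast
qed

text \<open>The mean value inequality on a ball where the derivative differs little from the one at
  \<open>x\<close>. Continuity is available for each direction separately, and the sum over the
  basis bounds the operator norm.\<close>

lemma C1_strict_diff:
 fixes g :: "'a::euclidean_space \<Rightarrow> 'b::real_normed_vector"
 assumes U: "open U" "x \<in> U" and g: "higher_differentiable_on U g 1"
 shows "strict_diff U g (frechet_derivative g (at x)) x"
 unfolding strict_diff_def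
proof (intro conjI allI impI)
 let ?D = "\<lambda>x. frechet_derivative g (at x)"
 have d: "(g has_derivative ?D y) (at y)" if "y \<in> U" for y using g that by (simp add: frechet_derivative_works)
 have bl: "bounded_linear (?D y)" if "y \<in> U" for y using d[OF that] by (rule has_derivative_bounded_linear)
 show "bounded_linear (?D x)" using U by (intro bl)
 fix e :: real assume e: "0 < e"
 have "(\<lambda>y. \<Sum>b\<in>Basis. norm (?D y b - ?D x b)) \<midarrow>x\<rightarrow> (\<Sum>b\<in>(Basis :: 'a set). norm (?D x b - ?D x b))"
  by (intro tendsto_intros C1_deriv_cont[OF U g, unfolded isCont_def])
 hence "eventually (\<lambda>y. (\<Sum>b\<in>Basis. norm (?D y b - ?D x b)) < e) (at x)" using e by (intro order_tendstoD) auto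
 then obtain c where c: "0 < c" "\<And>y. y \<noteq> x \<Longrightarrow> dist y x < c \<Longrightarrow> (\<Sum>b\<in>Basis. norm (?D y b - ?D x b)) < e"
  unfolding eventually_at by blast
 obtain c' where c': "0 < c'" "ball x c' \<subseteq> U" using U by (rule openE)
 let ?B = "ball x (min c c')"
 have BU: "?B \<subseteq> U" using c' by auto
 have "norm (g y - g z - ?D x (y - z)) \<le> norm (y - z) * e" if yz: "y \<in> ?B" "z \<in> ?B" for y z
 proof (rule differentiable_bound_linearization[where S="?B" and f'="?D"])
  show "z + t *\<^sub>R (y - z) \<in> ?B" if "t \<in> {0..1}" for t
  proof -
   have "(1 - t) *\<^sub>R z + t *\<^sub>R y \<in> ?B" using that yz by (intro convexD[OF convex_ball]) auto
   thus ?thesis by (simp add: algebra_simps)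
  qed
  fix w assume w: "w \<in> ?B"
  show "(g has_derivative ?D w) (at w within ?B)" using subsetD[OF BU w] by (rule has_derivative_at_withinI[OF d])
  have "onorm (?D w - ?D x) \<le> (\<Sum>b\<in>Basis. norm ((?D w - ?D x) b))"
  proof (rule onorm_componentwise)
   have "w \<in> U" using w BU by blast
   thus "bounded_linear (?D w - ?D x)" unfolding fun_diff_def using U(2) by (intro bounded_linear_sub bl)
  qed
  also have "\<dots> \<le> e" using c(2)[of w] w e by (cases "w = x") (auto simp: dist_commute)
  finally show "onorm (?D w - ?D x) \<le> e" .
 qed (use c c' in auto)
 thus "\<exists>d>0. \<forall>y\<in>U \<inter> ball x d. \<forall>z\<in>U \<inter> ball x d. norm (g y - g z - ?D x (y - z)) \<le> e * norm (y - z)"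
  using c c' by (intro exI[of _ "min c c'"]) (auto simp: mult.commute)
qed

lemma Ck_on_C1:
 assumes "Ck_on k S f" "1 \<le> k" "x \<in> S"
 obtains U g where "open U" "x \<in> U" "higher_differentiable_on U g 1" "\<And>y. y \<in> S \<inter> U \<Longrightarrow> g y = f y"
 using assms unfolding Ck_on_def one_enat_def by metis

lemma Ck_on_strict_diff:
 assumes "Ck_on k S f" "1 \<le> k" "x \<in> S" shows "\<exists>D. strict_diff S f D x"
proof -
 obtain U g where "open U" "x \<in> U" "higher_differentiable_on U g 1" "\<And>y. y \<in> S \<inter> U \<Longrightarrow> g y = f y"
  by (rule Ck_on_C1[OF assms]) blast
 thus ?thesis using strict_diff_local[OF C1_strict_diff] by metis
qed

section \<open>Half-space domains and coordinate patches\<close>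

definition half_domain :: "(real ^ 'd) set \<Rightarrow> bool" where
 "half_domain W \<longleftrightarrow> open W \<or> (\<exists>k. openin (top_of_set {x. 0 \<le> x $ k}) W)"

lemma half_domain_ball:
 assumes W: "half_domain W" and x: "x \<in> W"
 obtains \<epsilon> where "0 < \<epsilon>" "ball x \<epsilon> \<subseteq> W \<or> (\<exists>k. x $ k = 0 \<and> ball x \<epsilon> \<inter> {y. 0 \<le> y $ k} \<subseteq> W \<and> W \<subseteq> {y. 0 \<le> y $ k})"
proof -
 consider "open W" | k where "openin (top_of_set {x. 0 \<le> x $ k}) W" using W unfolding half_domain_def by blast
 thus ?thesis
 proof cases
  case 1 thus ?thesis using x that by (metis openE)
 next
  case 2
  then obtain \<epsilon> where \<epsilon>: "0 < \<epsilon>" "ball x \<epsilon> \<inter> {y. 0 \<le> y $ k} \<subseteq> W" and sub: "W \<subseteq> {y. 0 \<le> y $ k}"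
   using x unfolding openin_contains_ball by blast
  show ?thesis
  proof (cases "x $ k = 0")
   case True thus ?thesis using \<epsilon> sub that by blast
  next
   case False
   hence pos: "0 < x $ k" using sub x by force
   have "ball x (min \<epsilon> (x $ k)) \<subseteq> W"
   proof
    fix y assume y: "y \<in> ball x (min \<epsilon> (x $ k))"
    have "\<bar>(x - y) $ k\<bar> \<le> norm (x - y)" by (rule component_le_norm_cart)
    hence "0 \<le> y $ k" using y by (auto simp: dist_norm)
    thus "y \<in> W" using \<epsilon>(2) y by auto
   qed
   thus ?thesis using \<epsilon>(1) pos that[of "min \<epsilon> (x $ k)"] by auto
  qed
 qed
qed

text \<open>From each point of a half-space, boundary points included, small steps in the positive
  coordinate directions stay inside, and these directions span.\<close>

lemma half_domain_unique_derivative: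
 fixes f :: "real ^ 'd::finite \<Rightarrow> 'b::real_normed_vector"
 assumes W: "half_domain W" "x \<in> W" and D: "(f has_derivative D) (at x within W)" "(f has_derivative E) (at x within W)"
 shows "D = E"
proof (rule frechet_derivative_unique_within[OF D])
 fix i :: "real ^ 'd" and e :: real assume i: "i \<in> Basis" and e: "0 < e"
 obtain j where j: "i = axis j 1" using i by (auto simp: Basis_vec_def)
 obtain \<epsilon> where \<epsilon>: "0 < \<epsilon>" "ball x \<epsilon> \<subseteq> W \<or> (\<exists>k. x $ k = 0 \<and> ball x \<epsilon> \<inter> {y. 0 \<le> y $ k} \<subseteq> W \<and> W \<subseteq> {y. 0 \<le> y $ k})"
  using W by (rule half_domain_ball)
 define d where "d = min e \<epsilon> / 2"
 have d: "0 < d" "d < e" "d < \<epsilon>" using e \<epsilon>(1) by (auto simp: d_def)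
 have "x + d *\<^sub>R i \<in> ball x \<epsilon>" using d i by (simp add: dist_norm)
 moreover have "0 \<le> (x + d *\<^sub>R i) $ k" if "x $ k = 0" for k using that d by (simp add: j axis_def)
 ultimately have "x + d *\<^sub>R i \<in> W" using \<epsilon>(2) by blast
 thus "\<exists>d. 0 < \<bar>d\<bar> \<and> \<bar>d\<bar> < e \<and> x + d *\<^sub>R i \<in> W" using d by (intro exI[of _ d]) auto
qed

text \<open>At a boundary point the cube is shifted along the normal axis until one face lies on the
  boundary hyperplane. It then stays inside the domain and still contains a relative neighbourhood
  of the point.\<close>

lemma half_domain_cube:
 assumes W: "half_domain W" "x \<in> (W :: (real ^ 'd::finite) set)"
 obtains a s U where "0 < s" "cbox a (a + s *\<^sub>R 1) \<subseteq> W" "openin (top_of_set W) U" "x \<in> U" "U \<subseteq> cbox a (a + s *\<^sub>R 1)"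
proof -
 obtain \<epsilon> where \<epsilon>: "0 < \<epsilon>" "ball x \<epsilon> \<subseteq> W \<or> (\<exists>k. x $ k = 0 \<and> ball x \<epsilon> \<inter> {y. 0 \<le> y $ k} \<subseteq> W \<and> W \<subseteq> {y. 0 \<le> y $ k})"
  using W by (rule half_domain_ball)
 \<comment> \<open>All points of the cube differ from \<open>x\<close> by at most
   \<open>2 * s\<close> in each coordinate, so by less than \<open>\<epsilon>\<close> in the sum
   norm.\<close>
 define s where "s = \<epsilon> / (3 * CARD('d))"
 have s: "0 < s" using \<epsilon>(1) by (simp add: s_def)
 define U where "U = W \<inter> box (x - s *\<^sub>R 1) (x + s *\<^sub>R 1)"
 have U: "openin (top_of_set W) U" unfolding U_def by (intro openin_open_Int open_box)
 have xU: "x \<in> U" using W(2) s by (simp add: U_def mem_box_cart)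
 have near: "y \<in> ball x \<epsilon>" if "\<And>i. \<bar>y $ i - x $ i\<bar> \<le> 2 * s" for y
 proof -
  have "norm (y - x) \<le> (\<Sum>i\<in>UNIV. \<bar>(y - x) $ i\<bar>)" by (rule norm_le_l1_cart)
  also have "\<dots> \<le> (\<Sum>i\<in>(UNIV :: 'd set). 2 * s)" using that by (intro sum_mono) simp
  also have "\<dots> < \<epsilon>" using \<epsilon>(1) by (simp add: s_def)
  finally show ?thesis by (simp add: dist_norm norm_minus_commute)
 qed
 have small: "y \<in> ball x \<epsilon>" if "y \<in> cbox a (a + (2 * s) *\<^sub>R 1)" "\<And>i. x $ i - s \<le> a $ i \<and> a $ i \<le> x $ i" for y a
 proof (rule near)
  fix i show "\<bar>y $ i - x $ i\<bar> \<le> 2 * s"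
   using that(1) that(2)[of i] s by (auto simp: mem_box_cart abs_le_iff) (smt (verit))+
 qed
 from \<epsilon>(2) show ?thesis
 proof (elim disjE exE conjE)
  assume B: "ball x \<epsilon> \<subseteq> W"
  let ?a = "x - s *\<^sub>R 1"
  have "cbox ?a (?a + (2 * s) *\<^sub>R 1) \<subseteq> W" using small[of _ ?a] s B by auto
  moreover have "U \<subseteq> cbox ?a (?a + (2 * s) *\<^sub>R 1)" by (auto simp: U_def mem_box_cart less_imp_le add.commute)
  ultimately show ?thesis using that[of "2 * s" ?a U] s U xU by simp
 next
  fix k assume k: "x $ k = 0" and B: "ball x \<epsilon> \<inter> {y. 0 \<le> y $ k} \<subseteq> W" and Wk: "W \<subseteq> {y. 0 \<le> y $ k}"
  let ?a = "x - s *\<^sub>R 1 + s *\<^sub>R axis k 1"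
  have ak: "?a $ i = (if i = k then 0 else x $ i - s)" for i using k by (simp add: axis_def)
  have 1: "y \<in> W" if y: "y \<in> cbox ?a (?a + (2 * s) *\<^sub>R 1)" for y
  proof -
   have "y \<in> ball x \<epsilon>" using y k s ak by (intro small[of _ ?a]) auto
   moreover have "0 \<le> y $ k" using y ak[of k] unfolding mem_box_cart by metis
   ultimately show ?thesis using B by blast
  qed
  have 2: "y \<in> cbox ?a (?a + (2 * s) *\<^sub>R 1)" if y: "y \<in> U" for y unfolding mem_box_cart
  proof
   fix i
   have "x $ i - s < y $ i" "y $ i < x $ i + s" "0 \<le> y $ k" using y Wk by (auto simp: U_def mem_box_cart)
   moreover have "(?a + (2 * s) *\<^sub>R 1) $ i = ?a $ i + 2 * s" by simp
   ultimately show "?a $ i \<le> y $ i \<and> y $ i \<le> (?a + (2 * s) *\<^sub>R 1) $ i" using ak[of i] k s by (auto split: if_splits)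
  qed
  have s2: "0 < 2 * s" using s by simp
  show ?thesis by (rule that[OF s2 subsetI[OF 1] U xU subsetI[OF 2]])
 qed
qed

lemma smooth_patchD:
 assumes "smooth_patch \<alpha> W I"
 shows "half_domain W" "openin (top_of_set I) (\<alpha> ` W)" "\<exists>\<beta>. homeomorphism W (\<alpha> ` W) \<alpha> \<beta>" "Ck_on \<infinity> W \<alpha>"
  "x \<in> W \<Longrightarrow> inj (frechet_derivative \<alpha> (at x within W))"
 using assms by (auto simp: smooth_patch_def half_domain_def)

lemma frechet_derivative_half_domain:
 assumes W: "half_domain W" "x \<in> W" and s: "strict_diff W f D x"
 shows "frechet_derivative f (at x within W) = D"
proof -
 have d: "(f has_derivative D) (at x within W)" using s W(2) by (rule strict_diff_has_derivative)
 hence "(f has_derivative frechet_derivative f (at x within W)) (at x within W)" by (metis differentiableI frechet_derivative_works)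
 thus ?thesis using half_domain_unique_derivative[OF W _ d] by blast
qed

lemma patch_strict_diff:
 assumes p: "smooth_patch \<alpha> W I" and x: "x \<in> W"
 shows "strict_diff W \<alpha> (frechet_derivative \<alpha> (at x within W)) x"
proof -
 obtain D where D: "strict_diff W \<alpha> D x" using Ck_on_strict_diff[OF smooth_patchD(4)[OF p] _ x] by auto
 show ?thesis using D unfolding frechet_derivative_half_domain[OF smooth_patchD(1)[OF p] x D] .
qed

text \<open>Near each point the derivative within \<open>W\<close> is, by uniqueness, the derivative
  of a smooth extension to an open set, and the latter is continuous.\<close>

lemma patch_derivative_cont:
 assumes p: "smooth_patch \<alpha> W I"
 shows "continuous_on W (\<lambda>x. frechet_derivative \<alpha> (at x within W) v)"
 unfolding continuous_on_def
proof
 fix x assume x: "x \<in> W"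
 obtain U g where U: "open U" "x \<in> U" and g: "higher_differentiable_on U g 1" and eq: "\<And>y. y \<in> W \<inter> U \<Longrightarrow> g y = \<alpha> y"
  by (rule Ck_on_C1[OF smooth_patchD(4)[OF p] _ x]) auto
 have same: "frechet_derivative \<alpha> (at y within W) v = frechet_derivative g (at y) v" if y: "y \<in> W" "y \<in> U" for y
  using frechet_derivative_half_domain[OF smooth_patchD(1)[OF p] y(1) strict_diff_local[OF C1_strict_diff[OF U(1) y(2) g] U(1) y(2) eq]] by simp
 have "((\<lambda>y. frechet_derivative g (at y) v) \<longlongrightarrow> frechet_derivative g (at x) v) (at x within W)"
  using C1_deriv_cont[OF U g] subset_UNIV unfolding isCont_def by (rule tendsto_within_subset)
 moreover have "eventually (\<lambda>y. frechet_derivative g (at y) v = frechet_derivative \<alpha> (at y within W) v) (at x within W)"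
  unfolding eventually_at_topological using U same by (intro exI[of _ U]) auto
 ultimately show "((\<lambda>x. frechet_derivative \<alpha> (at x within W) v) \<longlongrightarrow> frechet_derivative \<alpha> (at x within W) v) (at x within W)"
  using same[OF x U(2)] by (simp add: tendsto_cong)
qed

section \<open>The Gaussian process on the manifold\<close>

lemma (in prob_space) nondegenerate_AE: "nondegenerate M Y \<Longrightarrow> a \<noteq> 0 \<Longrightarrow> \<not> (AE w in M. a \<bullet> Y w = 0)"
 by (simp add: nondegenerate_def)

locale manifold_process = prob_space M for M :: "'w measure" +
 fixes I :: "(real ^ 'n) set" and \<sigma> :: "(real ^ 'n) measure"
  and e :: "real ^ 'n \<Rightarrow> 'd::finite \<Rightarrow> real ^ 'n" and X :: "real ^ 'n \<Rightarrow> 'w \<Rightarrow> real"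
 assumes compact_I: "compact I" and I_nonempty: "I \<noteq> {}"
  and manifold: "embedded_manifold TYPE('d) I"
  and volume: "riemannian_volume TYPE('d) I \<sigma>"
  and basis: "t \<in> I \<Longrightarrow> orthonormal_tangent_basis I t (e t)"
  and gaussian: "gaussian_process M I X"
  and smooth: "w \<in> space M \<Longrightarrow> Ck_on 2 I (\<lambda>t. X t w)"
  and nondeg: "s \<in> I \<Longrightarrow> t \<in> I \<Longrightarrow> s \<noteq> t \<Longrightarrow>
      nondegenerate M (\<lambda>w. (X s w, X t w, manifold_deriv I (e t) (\<lambda>r. X r w) t))"
  and mean_0: "t \<in> I \<Longrightarrow> expectation (X t) = 0"
  and var_1: "t \<in> I \<Longrightarrow> variance (X t) = 1"
begin

definition lin :: "('w \<Rightarrow> real) set" where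
 "lin = {Y. \<exists>J c. finite J \<and> J \<subseteq> I \<and> Y = (\<lambda>w. \<Sum>t\<in>J. c t * X t w)}"

text \<open>Gradients of the paths are pointwise limits of difference quotients, so they belong to
  this space; \<open>cgauss_limit\<close> keeps all its members Gaussian.\<close>

definition H :: "('w \<Rightarrow> real) set" where
 "H = {Y. \<exists>Z. (\<forall>n::nat. Z n \<in> lin) \<and> (\<forall>w\<in>space M. (\<lambda>n. Z n w) \<longlonglongrightarrow> Y w)}"

lemma HI: "(\<And>n. Z n \<in> lin) \<Longrightarrow> (\<And>w. w \<in> space M \<Longrightarrow> (\<lambda>n::nat. Z n w) \<longlonglongrightarrow> Y w) \<Longrightarrow> Y \<in> H"
 unfolding H_def by blast

lemma lin_X: "t \<in> I \<Longrightarrow> X t \<in> lin"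
 unfolding lin_def by (rule CollectI, rule exI[of _ "{t}"], rule exI[of _ "\<lambda>_. 1"]) simp

lemma lin_scale: "Y \<in> lin \<Longrightarrow> (\<lambda>w. a * Y w) \<in> lin"
proof -
 assume "Y \<in> lin"
 then obtain J c where "finite J" "J \<subseteq> I" "Y = (\<lambda>w. \<Sum>t\<in>J. c t * X t w)" by (auto simp: lin_def)
 thus ?thesis unfolding lin_def by (intro CollectI exI[of _ J] exI[of _ "\<lambda>t. a * c t"]) (simp add: sum_distrib_left mult.assoc)
qed

lemma lin_add: "Y \<in> lin \<Longrightarrow> Z \<in> lin \<Longrightarrow> (\<lambda>w. Y w + Z w) \<in> lin"
proof -
 assume "Y \<in> lin" "Z \<in> lin"
 then obtain J c K b where J: "finite J" "J \<subseteq> I" "Y = (\<lambda>w. \<Sum>t\<in>J. c t * X t w)"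
  and K: "finite K" "K \<subseteq> I" "Z = (\<lambda>w. \<Sum>t\<in>K. b t * X t w)" unfolding lin_def by blast
 define c' b' where "c' t = (if t \<in> J then c t else 0)" and "b' t = (if t \<in> K then b t else 0)" for t
 have "(\<Sum>t\<in>J. c t * X t w) = (\<Sum>t\<in>J \<union> K. c' t * X t w)" "(\<Sum>t\<in>K. b t * X t w) = (\<Sum>t\<in>J \<union> K. b' t * X t w)" for w
  using J(1) K(1) by (auto intro!: sum.mono_neutral_cong_left simp: c'_def b'_def)
 hence "(\<lambda>w. Y w + Z w) = (\<lambda>w. \<Sum>t\<in>J \<union> K. (c' t + b' t) * X t w)" by (simp add: J(3) K(3) distrib_right sum.distrib)
 thus ?thesis unfolding lin_def using J K by (intro CollectI exI[of _ "J \<union> K"] exI[of _ "\<lambda>t. c' t + b' t"]) auto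
qed

lemma X_cgauss: "t \<in> I \<Longrightarrow> \<exists>v. cgauss M (X t) v"
proof (rule gaussian_rv_cgauss)
 assume t: "t \<in> I"
 have "gaussian_rv M (\<lambda>w. \<Sum>s\<in>{t}. 1 * X s w)" using gaussian[unfolded gaussian_process_def, rule_format, of "{t}" "\<lambda>_. 1"] t by auto
 thus "gaussian_rv M (X t)" by simp
 show "expectation (X t) = 0" using t by (rule mean_0)
qed (rule prob_space_axioms)

lemma lin_cgauss: "Y \<in> lin \<Longrightarrow> \<exists>v. cgauss M Y v"
proof -
 assume "Y \<in> lin"
 then obtain J c where J: "finite J" "J \<subseteq> I" "Y = (\<lambda>w. \<Sum>t\<in>J. c t * X t w)" by (auto simp: lin_def)
 have "integrable M (X t)" if "t \<in> J" for t using X_cgauss J(2) that cgauss_square(3) by blast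
 hence "expectation Y = (\<Sum>t\<in>J. c t * expectation (X t))" unfolding J(3) by (subst Bochner_Integration.integral_sum) auto
 also have "\<dots> = 0" using J(2) mean_0 by (intro sum.neutral) auto
 finally have "expectation Y = 0" .
 moreover have "gaussian_rv M Y" using gaussian J unfolding gaussian_process_def by blast
 ultimately show ?thesis by (intro gaussian_rv_cgauss prob_space_axioms)
qed

sublocale gaussian_space M H
proof
 fix Y Z c
 show "\<exists>v. cgauss M Y v" if "Y \<in> H"
 proof -
  obtain Yn where Yn: "\<And>n::nat. Yn n \<in> lin" "\<And>w. w \<in> space M \<Longrightarrow> (\<lambda>n. Yn n w) \<longlonglongrightarrow> Y w"
   using \<open>Y \<in> H\<close> unfolding H_def by blast
  obtain v where "\<And>n. cgauss M (Yn n) (v n)" using lin_cgauss[OF Yn(1)] by metis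
  thus ?thesis using cgauss_limit[of M Yn v Y] Yn(2) prob_space_axioms by blast
 qed
 show "(\<lambda>_. 0) \<in> H"
 proof -
  obtain t where t: "t \<in> I" using I_nonempty by blast
  have "(\<lambda>w. 0 * X t w) \<in> lin" by (intro lin_scale lin_X t)
  thus ?thesis by (intro HI[of "\<lambda>_ _. 0"]) auto
 qed
 show "(\<lambda>w. Y w + Z w) \<in> H" if YZ: "Y \<in> H" "Z \<in> H"
 proof -
  obtain Yn Zn where "\<And>n::nat. Yn n \<in> lin" "\<And>w. w \<in> space M \<Longrightarrow> (\<lambda>n. Yn n w) \<longlonglongrightarrow> Y w"
   "\<And>n::nat. Zn n \<in> lin" "\<And>w. w \<in> space M \<Longrightarrow> (\<lambda>n. Zn n w) \<longlonglongrightarrow> Z w" using YZ unfolding H_def by blast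
  thus ?thesis by (intro HI[of "\<lambda>n w. Yn n w + Zn n w"] lin_add tendsto_add)
 qed
 show "(\<lambda>w. c * Y w) \<in> H" if Y: "Y \<in> H"
 proof -
  obtain Yn where "\<And>n::nat. Yn n \<in> lin" "\<And>w. w \<in> space M \<Longrightarrow> (\<lambda>n. Yn n w) \<longlonglongrightarrow> Y w" using Y unfolding H_def by blast
  thus ?thesis by (intro HI[of "\<lambda>n w. c * Yn n w"] lin_scale tendsto_mult tendsto_const)
 qed
qed

lemma lin_H: "Y \<in> lin \<Longrightarrow> Y \<in> H"
 by (rule HI[of "\<lambda>_. Y"]) auto

lemma H_var_pos:
 assumes Y: "Y \<in> H" and ne: "\<not> (AE w in M. Y w = 0)" shows "0 < cov Y Y"
proof -
 have "cov Y Y \<noteq> 0" using H_cgauss[OF Y] cgauss_zero_AE ne by metis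
 thus ?thesis using cov_nonneg[of Y] by linarith
qed

sublocale gaussian_field M H X I
proof
 show "compact I" by (rule compact_I)
 show XH: "X t \<in> H" if "t \<in> I" for t using that by (intro lin_H lin_X)
 show X1: "cov (X t) (X t) = 1" if "t \<in> I" for t using var_1[OF that] mean_0[OF that] by (simp add: cov_def power2_eq_square)
 show "cov (X s) (X t) < 1" if st: "s \<in> I" "t \<in> I" "s \<noteq> t" for s t
 proof -
  have "\<not> (AE w in M. (1, - 1, 0) \<bullet> (X s w, X t w, manifold_deriv I (e t) (\<lambda>r. X r w) t) = 0)"
   by (rule nondegenerate_AE[OF nondeg[OF st]]) (simp add: zero_prod_def)
  hence "\<not> (AE w in M. X s w - X t w = 0)" by simp
  hence "0 < cov (\<lambda>w. X s w - X t w) (\<lambda>w. X s w - X t w)" using st by (intro H_var_pos H_diff XH)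
  thus ?thesis using st by (simp add: cov_diff_self XH X1)
 qed
 show "continuous_on I (\<lambda>t. X t w)" if w: "w \<in> space M" for w unfolding continuous_on_eq_continuous_within
 proof
  fix t assume t: "t \<in> I"
  obtain D where "strict_diff I (\<lambda>t. X t w) D t" using Ck_on_strict_diff[OF smooth[OF w] _ t] by (auto simp: one_enat_def numeral_eq_enat)
  thus "continuous (at t within I) (\<lambda>t. X t w)" using t by (intro has_derivative_continuous strict_diff_has_derivative)
 qed
qed

definition grad :: "real ^ 'n \<Rightarrow> 'w \<Rightarrow> real ^ 'd" where
 "grad p w = manifold_deriv I (e p) (\<lambda>r. X r w) p"

lemma orthonormal_expand:
 assumes p: "p \<in> I" and v: "v \<in> tangent_space TYPE('d) I p"
 shows "v = (\<Sum>i\<in>UNIV. (v \<bullet> e p i) *\<^sub>R e p i)"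
proof -
 have on: "e p i \<bullet> e p j = (if i = j then 1 else 0)" and sp: "span (range (e p)) = tangent_space TYPE('d) I p" for i j
  using basis[OF p] by (auto simp: orthonormal_tangent_basis_def)
 have "v \<in> span (range (e p))" using v sp by simp
 thus ?thesis
 proof (rule span_induct)
  show "subspace {v. v = (\<Sum>i\<in>UNIV. (v \<bullet> e p i) *\<^sub>R e p i)}"
   by (auto simp: subspace_def inner_add_left scaleR_add_left sum.distrib simp flip: scaleR_scaleR scaleR_sum_right)
  show "v = (\<Sum>i\<in>UNIV. (v \<bullet> e p i) *\<^sub>R e p i)" if "v \<in> range (e p)" for v
   using that by (auto simp: on if_distrib[of "\<lambda>c. c *\<^sub>R _"] cong: if_cong)
 qed
qed

lemma X_strict_diff:
 assumes p: "p \<in> I" and w: "w \<in> space M" shows "\<exists>D. strict_diff I (\<lambda>t. X t w) D p"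
 using Ck_on_strict_diff[OF smooth[OF w] _ p] by (auto simp: one_enat_def numeral_eq_enat)

lemma X_has_derivative:
 assumes p: "p \<in> I" and w: "w \<in> space M"
 shows "((\<lambda>t. X t w) has_derivative frechet_derivative (\<lambda>t. X t w) (at p within I)) (at p within I)"
 using X_strict_diff[OF p w] strict_diff_has_derivative[OF _ p] by (metis differentiableI frechet_derivative_works)

lemma grad_tangent:
 assumes p: "p \<in> I" and w: "w \<in> space M" and v: "v \<in> tangent_space TYPE('d) I p"
 shows "frechet_derivative (\<lambda>t. X t w) (at p within I) v = grad p w \<bullet> (\<chi> i. v \<bullet> e p i)"
proof -
 let ?A = "frechet_derivative (\<lambda>t. X t w) (at p within I)"
 have lin: "linear ?A" using X_has_derivative[OF p w] by (intro bounded_linear.linear has_derivative_bounded_linear)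
 have "?A v = (\<Sum>i\<in>UNIV. (v \<bullet> e p i) * ?A (e p i))" by (subst orthonormal_expand[OF p v]) (simp add: linear_sum[OF lin] linear_scale[OF lin])
 thus ?thesis by (simp add: inner_vec_def grad_def manifold_deriv_def mult.commute)
qed

section \<open>The process in a coordinate patch\<close>

definition chart :: "(real ^ 'd \<Rightarrow> real ^ 'n) \<Rightarrow> (real ^ 'd) set \<Rightarrow> real ^ 'd \<Rightarrow> real \<Rightarrow> bool" where
 "chart \<alpha> W a s \<longleftrightarrow> smooth_patch \<alpha> W I \<and> 0 < s \<and> cbox a (a + s *\<^sub>R 1) \<subseteq> W"

text \<open>The derivative of the patch read in the orthonormal tangent basis. It is a square matrix
  even though the ambient space may have a larger dimension.\<close>

definition frame :: "(real ^ 'd \<Rightarrow> real ^ 'n) \<Rightarrow> (real ^ 'd) set \<Rightarrow> real ^ 'd \<Rightarrow> real ^ 'd ^ 'd" where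
 "frame \<alpha> W x = matrix (\<lambda>v. \<chi> i. frechet_derivative \<alpha> (at x within W) v \<bullet> e (\<alpha> x) i)"

context
 fixes \<alpha> :: "real ^ 'd \<Rightarrow> real ^ 'n" and W assumes patch: "smooth_patch \<alpha> W I"
begin

lemma patch_image: "x \<in> W \<Longrightarrow> \<alpha> x \<in> I"
 using openin_subset[OF smooth_patchD(2)[OF patch]] by auto

lemma patch_tangent: "x \<in> W \<Longrightarrow> frechet_derivative \<alpha> (at x within W) v \<in> tangent_space TYPE('d) I (\<alpha> x)"
 unfolding tangent_space_def using patch by blast

lemma patch_linear: "x \<in> W \<Longrightarrow> linear (frechet_derivative \<alpha> (at x within W))"
 using patch_strict_diff[OF patch] strict_diff_bounded_linear bounded_linear.linear by blast

lemma frame_apply: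
 assumes x: "x \<in> W" shows "frame \<alpha> W x *v v = (\<chi> i. frechet_derivative \<alpha> (at x within W) v \<bullet> e (\<alpha> x) i)"
proof -
 have "linear (\<lambda>v. \<chi> i. frechet_derivative \<alpha> (at x within W) v \<bullet> e (\<alpha> x) i)"
  using patch_linear[OF x] by (intro linearI) (simp_all add: vec_eq_iff linear_add linear_scale inner_add_left)
 thus ?thesis unfolding frame_def by (intro matrix_works) (simp add: linear_matrix_vector_mul_eq)
qed

lemma frame_injective:
 assumes x: "x \<in> W" and v: "frame \<alpha> W x *v v = 0" shows "v = 0"
proof -
 have "frechet_derivative \<alpha> (at x within W) v \<bullet> e (\<alpha> x) i = 0" for i using v unfolding frame_apply[OF x] by (simp add: vec_eq_iff)
 hence "frechet_derivative \<alpha> (at x within W) v = 0" by (subst orthonormal_expand[OF patch_image[OF x] patch_tangent[OF x]]) simp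
 thus "v = 0" using linear_injective_0[OF patch_linear[OF x]] smooth_patchD(5)[OF patch x] by blast
qed

lemma det_frame: assumes x: "x \<in> W" shows "det (frame \<alpha> W x) \<noteq> 0"
 using frame_injective[OF x] by (metis invertible_det_nz invertible_left_inverse matrix_left_invertible_ker)

text \<open>In an orthonormal basis the Gram matrix of the partial derivatives is
  \<open>transpose F ** F\<close> with \<open>F\<close> the frame, so the root of its determinant is
  \<open>\<bar>det F\<bar>\<close>.\<close>

lemma patch_jacobian_frame:
 assumes x: "x \<in> W" shows "patch_jacobian \<alpha> W x = \<bar>det (frame \<alpha> W x)\<bar>"
proof -
 let ?D = "frechet_derivative \<alpha> (at x within W)" and ?F = "frame \<alpha> W x"
 have F: "?F $ k $ i = ?D (axis i 1) \<bullet> e (\<alpha> x) k" for k i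
  using frame_apply[OF x, of "axis i 1"] by (simp add: vec_eq_iff matrix_vector_mul_component inner_axis)
 have "(\<chi> i j. ?D (axis i 1) \<bullet> ?D (axis j 1)) = transpose ?F ** ?F"
 proof -
  have "?D (axis i 1) \<bullet> ?D (axis j 1) = (\<Sum>k\<in>UNIV. ?F $ k $ i * ?F $ k $ j)" for i j
   by (subst orthonormal_expand[OF patch_image[OF x] patch_tangent[OF x, of "axis i 1"]])
    (simp add: inner_sum_left F inner_commute[of "e (\<alpha> x) _"])
  thus ?thesis by (simp add: vec_eq_iff matrix_matrix_mult_def transpose_def)
 qed
 thus ?thesis by (simp add: patch_jacobian_def Let_def det_mul det_transpose)
qed

lemma patch_jacobian_pos: "x \<in> W \<Longrightarrow> 0 < patch_jacobian \<alpha> W x"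
 using det_frame by (simp add: patch_jacobian_frame)

lemma patch_jacobian_cont: "continuous_on W (patch_jacobian \<alpha> W)"
 unfolding patch_jacobian_def[abs_def] Let_def det_def
 by (intro continuous_on_real_sqrt continuous_intros) (auto intro!: continuous_intros patch_derivative_cont[OF patch])

text \<open>The strict derivative along \<open>I\<close> and the chosen Frechet derivative may
  differ on the ambient space. Composed with the patch both are derivatives on a half-space domain,
  where derivatives are unique, and tangent vectors express the result through
  \<open>grad\<close>.\<close>

lemma X_patch_strict_diff:
 assumes x: "x \<in> W" and w: "w \<in> space M"
 shows "strict_diff W (\<lambda>y. X (\<alpha> y) w) (\<lambda>v. grad (\<alpha> x) w \<bullet> (frame \<alpha> W x *v v)) x"
proof -
 let ?D = "frechet_derivative \<alpha> (at x within W)" and ?A = "frechet_derivative (\<lambda>t. X t w) (at (\<alpha> x) within I)"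
 note p = patch_image[OF x]
 have sub: "\<alpha> ` W \<subseteq> I" using patch_image by blast
 obtain E where E: "strict_diff I (\<lambda>t. X t w) E (\<alpha> x)" using X_strict_diff[OF p w] by blast
 note s = strict_diff_compose[OF patch_strict_diff[OF patch x] E sub x]
 have "((\<lambda>y. X (\<alpha> y) w) has_derivative (\<lambda>v. ?A (?D v))) (at x within W)"
  by (rule has_derivative_in_compose[OF strict_diff_has_derivative[OF patch_strict_diff[OF patch x] x]
     has_derivative_subset[OF X_has_derivative[OF p w] sub]])
 hence "(\<lambda>v. E (?D v)) = (\<lambda>v. ?A (?D v))"
  using half_domain_unique_derivative[OF smooth_patchD(1)[OF patch] x strict_diff_has_derivative[OF s x]] by blast
 also have "\<dots> = (\<lambda>v. grad (\<alpha> x) w \<bullet> (frame \<alpha> W x *v v))"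
  by (simp add: grad_tangent[OF p w patch_tangent[OF x]] frame_apply[OF x])
 finally show ?thesis using s by simp
qed

end

end

lemma strict_diff_affine: "strict_diff S (\<lambda>y. a + s *\<^sub>R y) (\<lambda>v. s *\<^sub>R v) x"
 unfolding strict_diff_def by (auto intro!: exI[of _ "1 :: real"] bounded_linear_scaleR_right simp: scaleR_diff_right)

lemma nn_integral_lborel_affine:
 fixes f :: "real ^ 'd::finite \<Rightarrow> ennreal"
 assumes f: "f \<in> borel_measurable borel" and s: "0 < s"
 shows "(\<integral>\<^sup>+x. f x \<partial>lborel) = (\<integral>\<^sup>+y. ennreal (s ^ CARD('d)) * f (a + s *\<^sub>R y) \<partial>lborel)"
proof -
 have [measurable]: "f \<in> borel_measurable borel" by fact
 have "(\<integral>\<^sup>+x. f x \<partial>lborel) = (\<integral>\<^sup>+x. f x \<partial>density (distr lborel borel (\<lambda>x. a + s *\<^sub>R x)) (\<lambda>_. ennreal (\<bar>s\<bar> ^ DIM(real ^ 'd))))"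
  using s by (subst lborel_affine[of s a]) auto
 also have "\<dots> = (\<integral>\<^sup>+y. ennreal (s ^ CARD('d)) * f (a + s *\<^sub>R y) \<partial>lborel)"
  using s by (simp add: nn_integral_density nn_integral_distr)
 finally show ?thesis .
qed

section \<open>Cubes inside patches as charts of a Gaussian field\<close>

context manifold_process
begin

definition psi :: "(real ^ 'd \<Rightarrow> real ^ 'n) \<Rightarrow> real ^ 'd \<Rightarrow> real \<Rightarrow> real ^ 'd \<Rightarrow> real ^ 'n" where
 "psi \<alpha> a s y = \<alpha> (a + s *\<^sub>R y)"

text \<open>The frame composed with the affine map of the unit cube onto the patch cube, that is,
  \<open>s\<close> times the frame; the row-wise form suits the determinant rule for scaled
  rows.\<close>

definition K :: "(real ^ 'd \<Rightarrow> real ^ 'n) \<Rightarrow> (real ^ 'd) set \<Rightarrow> real ^ 'd \<Rightarrow> real \<Rightarrow> real ^ 'd \<Rightarrow> real ^ 'd ^ 'd" where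
 "K \<alpha> W a s y = (\<chi> i. s *s frame \<alpha> W (a + s *\<^sub>R y) $ i)"

definition G :: "(real ^ 'd \<Rightarrow> real ^ 'n) \<Rightarrow> (real ^ 'd) set \<Rightarrow> real ^ 'd \<Rightarrow> real \<Rightarrow> real ^ 'd \<Rightarrow> 'w \<Rightarrow> real ^ 'd" where
 "G \<alpha> W a s y w = grad (psi \<alpha> a s y) w v* K \<alpha> W a s y"

context
 fixes \<alpha> :: "real ^ 'd \<Rightarrow> real ^ 'n" and W a s assumes ch: "chart \<alpha> W a s"
begin

lemma chart_patch: "smooth_patch \<alpha> W I" and chart_pos: "0 < s"
 using ch by (auto simp: chart_def)

lemma chart_cube: "y \<in> cbox 0 1 \<Longrightarrow> a + s *\<^sub>R y \<in> cbox a (a + s *\<^sub>R 1)"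
 using chart_pos by (simp add: mem_box_cart mult_left_le)

lemma chart_W: "y \<in> cbox 0 1 \<Longrightarrow> a + s *\<^sub>R y \<in> W"
 using chart_cube ch by (auto simp: chart_def)

lemma psi_I: "psi \<alpha> a s ` cbox 0 1 \<subseteq> I"
 using patch_image[OF chart_patch] chart_W by (auto simp: psi_def)

lemma patch_homeo: obtains \<beta> where "homeomorphism W (\<alpha> ` W) \<alpha> \<beta>"
 using smooth_patchD(3)[OF chart_patch] by blast

lemma psi_cont: "continuous_on (cbox 0 1) (psi \<alpha> a s)"
proof -
 obtain \<beta> where "homeomorphism W (\<alpha> ` W) \<alpha> \<beta>" by (rule patch_homeo)
 hence "continuous_on W \<alpha>" by (simp add: homeomorphism_def)
 thus ?thesis unfolding psi_def[abs_def] by (rule continuous_on_compose2) (use chart_W in \<open>auto intro!: continuous_intros\<close>)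
qed

lemma psi_inj: "inj_on (psi \<alpha> a s) (cbox 0 1)"
proof
 obtain \<beta> where \<beta>: "homeomorphism W (\<alpha> ` W) \<alpha> \<beta>" by (rule patch_homeo)
 fix y z assume yz: "y \<in> cbox 0 1" "z \<in> cbox 0 1" "psi \<alpha> a s y = psi \<alpha> a s z"
 have "a + s *\<^sub>R y = a + s *\<^sub>R z" using yz chart_W homeomorphism_apply1[OF \<beta>] unfolding psi_def by metis
 thus "y = z" using chart_pos by simp
qed

lemma image_affine: "(\<lambda>y. a + s *\<^sub>R y) ` B = (\<lambda>x. (1 / s) *\<^sub>R (x - a)) -` B"
proof (intro equalityI subsetI)
 fix x assume "x \<in> (\<lambda>x. (1 / s) *\<^sub>R (x - a)) -` B"
 thus "x \<in> (\<lambda>y. a + s *\<^sub>R y) ` B" using chart_pos by (intro image_eqI[of _ _ "(1 / s) *\<^sub>R (x - a)"]) auto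
qed (use chart_pos in auto)

lemma psi_open: "openin (top_of_set I) (psi \<alpha> a s ` box 0 1)"
proof -
 obtain \<beta> where \<beta>: "homeomorphism W (\<alpha> ` W) \<alpha> \<beta>" by (rule patch_homeo)
 have "open ((\<lambda>y. a + s *\<^sub>R y) ` box 0 1)" unfolding image_affine by (intro open_vimage continuous_intros open_box)
 moreover have "(\<lambda>y. a + s *\<^sub>R y) ` box 0 1 \<subseteq> W" using chart_W box_subset_cbox by blast
 ultimately have "openin (top_of_set W) ((\<lambda>y. a + s *\<^sub>R y) ` box 0 1)" by (rule open_subset[rotated])
 hence "openin (top_of_set (\<alpha> ` W)) (\<alpha> ` (\<lambda>y. a + s *\<^sub>R y) ` box 0 1)" by (rule homeomorphism_imp_open_map[OF \<beta>])
 thus ?thesis using smooth_patchD(2)[OF chart_patch] by (simp add: psi_def[abs_def] image_image openin_trans)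
qed

lemma K_apply: "K \<alpha> W a s y *v v = frame \<alpha> W (a + s *\<^sub>R y) *v (s *\<^sub>R v)"
 by (simp add: K_def vec_eq_iff matrix_vector_mult_def sum_distrib_left mult_ac)

lemma X_psi_strict_diff:
 assumes y: "y \<in> cbox 0 1" and w: "w \<in> space M"
 shows "strict_diff (cbox 0 1) (\<lambda>y. X (psi \<alpha> a s y) w) (\<lambda>v. G \<alpha> W a s y w \<bullet> v) y"
proof -
 have "strict_diff (cbox 0 1) (\<lambda>y. X (\<alpha> (a + s *\<^sub>R y)) w) (\<lambda>v. grad (\<alpha> (a + s *\<^sub>R y)) w \<bullet> (frame \<alpha> W (a + s *\<^sub>R y) *v (s *\<^sub>R v))) y"
  by (rule strict_diff_compose[OF strict_diff_affine X_patch_strict_diff[OF chart_patch chart_W[OF y] w] _ y]) (use chart_W in auto)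
 thus ?thesis by (simp add: psi_def G_def dot_lmul_matrix K_apply)
qed

text \<open>A component of the gradient is the limit of difference quotients of the field along its
  axis. These are combinations of two values of the field, taken towards the inside of the
  cube.\<close>

lemma G_component_lim:
 assumes y: "y \<in> cbox 0 1" shows "(\<lambda>w. G \<alpha> W a s y w $ i) \<in> H"
proof -
 obtain z b where z: "\<And>k. z k \<in> cbox 0 1" "z \<longlonglongrightarrow> y" and b: "\<And>k. b k *\<^sub>R (z k - y) = axis i 1"
  by (rule cube_axis_approach[OF y, of i]) blast
 show ?thesis
 proof (rule HI)
  have "(\<lambda>w. b n * (X (psi \<alpha> a s (z n)) w + (- 1) * X (psi \<alpha> a s y) w)) \<in> lin" for n
   using z y psi_I by (intro lin_scale lin_add lin_X) auto
  thus "(\<lambda>w. b n * (X (psi \<alpha> a s (z n)) w - X (psi \<alpha> a s y) w)) \<in> lin" for n by simp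
  fix w assume w: "w \<in> space M"
  show "(\<lambda>n. b n * (X (psi \<alpha> a s (z n)) w - X (psi \<alpha> a s y) w)) \<longlonglongrightarrow> G \<alpha> W a s y w $ i"
   using strict_diff_increment[OF X_psi_strict_diff[OF y w] z, of "\<lambda>_. y" b "axis i 1"] y b by (simp add: inner_axis)
 qed
qed

lemma G_in_H: "y \<in> cbox 0 1 \<Longrightarrow> (\<lambda>w. G \<alpha> W a s y w \<bullet> v) \<in> H"
 by (auto simp: inner_vec_def mult.commute[of _ "v $ _"] intro!: H_sum H_scale G_component_lim)

lemma K_injective: "y \<in> cbox 0 1 \<Longrightarrow> K \<alpha> W a s y *v v = 0 \<Longrightarrow> v = 0"
 using frame_injective[OF chart_patch chart_W, of y "s *\<^sub>R v"] chart_pos by (simp add: K_apply)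

text \<open>\<open>K\<close> is invertible, so each component of the intrinsic gradient is a
  combination of chart gradients.\<close>

lemma grad_in_H:
 assumes y: "y \<in> cbox 0 1" shows "(\<lambda>\<omega>. grad (psi \<alpha> a s y) \<omega> \<bullet> w) \<in> H"
proof -
 obtain B where "B ** K \<alpha> W a s y = mat 1" using K_injective[OF y] by (metis matrix_left_invertible_ker)
 hence "K \<alpha> W a s y ** B = mat 1" by (simp add: matrix_left_right_inverse)
 hence "K \<alpha> W a s y *v (B *v w) = w" by (simp add: matrix_vector_mul_assoc)
 thus ?thesis using G_in_H[OF y, of "B *v w"] by (simp add: G_def dot_lmul_matrix)
qed

lemma G_var_pos:
 assumes y: "y \<in> cbox 0 1" and v: "v \<noteq> 0"
 shows "0 < cov (\<lambda>w. G \<alpha> W a s y w \<bullet> v) (\<lambda>w. G \<alpha> W a s y w \<bullet> v)"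
proof (rule H_var_pos[OF G_in_H[OF y]])
 \<comment> \<open>Nondegeneracy is given for triplets with two distinct points, so a second point
   of the cube is supplied; its image differs by injectivity of the chart.\<close>
 define z :: "real ^ 'd" where "z = (if y = 0 then 1 else 0)"
 have z: "z \<in> cbox 0 1" "z \<noteq> y" by (auto simp: z_def mem_box_cart vec_eq_iff)
 have ne: "psi \<alpha> a s z \<noteq> psi \<alpha> a s y" using inj_onD[OF psi_inj _ z(1) y] z(2) by blast
 let ?u = "K \<alpha> W a s y *v v"
 have "?u \<noteq> 0" using K_injective[OF y] v by blast
 hence "\<not> (AE w in M. (0, 0, ?u) \<bullet> (X (psi \<alpha> a s z) w, X (psi \<alpha> a s y) w,
   manifold_deriv I (e (psi \<alpha> a s y)) (\<lambda>r. X r w) (psi \<alpha> a s y)) = 0)"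
  using psi_I y z(1) by (intro nondegenerate_AE[OF nondeg[OF _ _ ne]]) (auto simp: zero_prod_def)
 thus "\<not> (AE w in M. G \<alpha> W a s y w \<bullet> v = 0)" by (simp add: G_def dot_lmul_matrix inner_commute[of ?u] flip: grad_def)
qed

lemma det_K: "y \<in> cbox 0 1 \<Longrightarrow> \<bar>det (K \<alpha> W a s y)\<bar> = s ^ CARD('d) * patch_jacobian \<alpha> W (a + s *\<^sub>R y)"
 using chart_pos by (simp add: K_def det_rows_mul patch_jacobian_frame[OF chart_patch chart_W] abs_mult vec_lambda_eta)

lemma det_K_pos: "y \<in> cbox 0 1 \<Longrightarrow> 0 < \<bar>det (K \<alpha> W a s y)\<bar>"
 unfolding det_K using chart_pos patch_jacobian_pos[OF chart_patch chart_W] by (intro mult_pos_pos) auto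

lemma det_K_cont: "continuous_on (cbox 0 1) (\<lambda>y. \<bar>det (K \<alpha> W a s y)\<bar>)"
proof -
 have "continuous_on (cbox 0 1) (\<lambda>y. s ^ CARD('d) * patch_jacobian \<alpha> W (a + s *\<^sub>R y))"
  by (intro continuous_intros continuous_on_compose2[OF patch_jacobian_cont[OF chart_patch]]) (use chart_W in auto)
 thus ?thesis by (subst continuous_on_cong[OF refl det_K])
qed

lemma volume_psi:
 assumes B: "B \<in> sets borel" "B \<subseteq> cbox 0 1"
 shows "emeasure \<sigma> (psi \<alpha> a s ` B) = (\<integral>\<^sup>+y\<in>B. ennreal \<bar>det (K \<alpha> W a s y)\<bar> \<partial>lborel)"
proof -
 let ?T = "\<lambda>y. a + s *\<^sub>R y" and ?C = "cbox a (a + s *\<^sub>R 1)"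
 have TB: "?T ` B \<in> sets borel" unfolding image_affine by (rule measurable_sets_borel[OF _ B(1)]) (intro borel_measurable_continuous_onI continuous_intros)
 have TC: "?T ` B \<subseteq> ?C" using B(2) chart_cube by blast
 have CW: "?C \<subseteq> W" using ch by (simp add: chart_def)
 have "emeasure \<sigma> (psi \<alpha> a s ` B) = (\<integral>\<^sup>+x\<in>?T ` B. ennreal (patch_jacobian \<alpha> W x) \<partial>lborel)"
 proof -
  have "emeasure \<sigma> (\<alpha> ` (?T ` B)) = (\<integral>\<^sup>+x\<in>?T ` B. ennreal (patch_jacobian \<alpha> W x) \<partial>lborel)"
   using volume chart_patch TB order_trans[OF TC CW] unfolding riemannian_volume_def by blast
  thus ?thesis by (simp add: psi_def[abs_def] image_image)
 qed
 \<comment> \<open>The Jacobian is continuous on \<open>W\<close>; cutting it off outside the closed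
   cube gives a Borel function on the whole space, as the affine substitution requires.\<close>
 also have "\<dots> = (\<integral>\<^sup>+x. ennreal (indicator ?C x *\<^sub>R patch_jacobian \<alpha> W x) * indicator (?T ` B) x \<partial>lborel)"
  using TC by (intro nn_integral_cong) (auto simp: indicator_def)
 also have "\<dots> = (\<integral>\<^sup>+y. ennreal (s ^ CARD('d)) * (ennreal (indicator ?C (?T y) *\<^sub>R patch_jacobian \<alpha> W (?T y)) * indicator (?T ` B) (?T y)) \<partial>lborel)"
 proof (rule nn_integral_lborel_affine[OF _ chart_pos])
  have "(\<lambda>x. indicator ?C x *\<^sub>R patch_jacobian \<alpha> W x) \<in> borel_measurable borel"
   by (intro borel_measurable_continuous_on_indicator continuous_on_subset[OF patch_jacobian_cont[OF chart_patch] CW]) auto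
  thus "(\<lambda>x. ennreal (indicator ?C x *\<^sub>R patch_jacobian \<alpha> W x) * indicator (?T ` B) x) \<in> borel_measurable borel"
   using TB by measurable
 qed
 also have "\<dots> = (\<integral>\<^sup>+y\<in>B. ennreal \<bar>det (K \<alpha> W a s y)\<bar> \<partial>lborel)"
 proof (rule nn_integral_cong)
  fix y
  have TBy: "?T y \<in> ?T ` B \<longleftrightarrow> y \<in> B" using chart_pos by auto
  show "ennreal (s ^ CARD('d)) * (ennreal (indicator ?C (?T y) *\<^sub>R patch_jacobian \<alpha> W (?T y)) * indicator (?T ` B) (?T y))
    = ennreal \<bar>det (K \<alpha> W a s y)\<bar> * indicator B y"
  proof (cases "y \<in> B")
   case True
   hence "y \<in> cbox 0 1" using B by blast
   thus ?thesis using True TBy chart_cube chart_pos patch_jacobian_pos[OF chart_patch chart_W, of y] by (simp add: det_K ennreal_mult less_imp_le)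
  qed (use TBy in simp)
 qed
 finally show ?thesis .
qed

end

lemma cube_image: "0 < s \<Longrightarrow> psi \<alpha> a s ` cbox 0 1 = \<alpha> ` cbox a (a + s *\<^sub>R 1)"
proof -
 assume s: "0 < s"
 have "(\<lambda>y. a + s *\<^sub>R y) ` cbox 0 1 = cbox a (a + s *\<^sub>R 1)"
  using image_affinity_cbox[of s a 0 1] s by (simp add: add.commute interval_eq_empty_cart)
 thus ?thesis unfolding psi_def[abs_def] by (metis image_image)
qed

lemma finite_charts:
 obtains m0 :: nat and \<alpha> W a s where "\<And>m. m < m0 \<Longrightarrow> chart (\<alpha> m) (W m) (a m) (s m)"
  "I = (\<Union>m<m0. psi (\<alpha> m) (a m) (s m) ` cbox 0 1)"
proof -
 define C where "C = {V. openin (top_of_set I) V \<and> (\<exists>\<alpha> W a s. chart \<alpha> W a s \<and> V \<subseteq> psi \<alpha> a s ` cbox 0 1)}"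
 have "p \<in> \<Union>C" if p: "p \<in> I" for p
 proof -
  obtain \<alpha> :: "real ^ 'd \<Rightarrow> real ^ 'n" and W where patch: "smooth_patch \<alpha> W I" "p \<in> \<alpha> ` W"
   using manifold p unfolding embedded_manifold_def by blast
  then obtain x where x: "x \<in> W" "p = \<alpha> x" by blast
  obtain a s U where U: "0 < s" "cbox a (a + s *\<^sub>R 1) \<subseteq> W" "openin (top_of_set W) U" "x \<in> U" "U \<subseteq> cbox a (a + s *\<^sub>R 1)"
   by (rule half_domain_cube[OF smooth_patchD(1)[OF patch(1)] x(1)])
  obtain \<beta> where \<beta>: "homeomorphism W (\<alpha> ` W) \<alpha> \<beta>" using smooth_patchD(3)[OF patch(1)] by blast
  have "openin (top_of_set I) (\<alpha> ` U)" using homeomorphism_imp_open_map[OF \<beta> U(3)] smooth_patchD(2)[OF patch(1)] by (rule openin_trans)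
  moreover have "chart \<alpha> W a s" using patch U by (simp add: chart_def)
  moreover have "\<alpha> ` U \<subseteq> psi \<alpha> a s ` cbox 0 1" using U by (auto simp: cube_image)
  ultimately have "\<alpha> ` U \<in> C" unfolding C_def by blast
  thus ?thesis using x U by blast
 qed
 moreover have "\<forall>c\<in>C. openin (top_of_set I) c" by (simp add: C_def)
 hence "\<exists>D\<subseteq>C. finite D \<and> I \<subseteq> \<Union>D"
  using calculation compact_I[unfolded compact_eq_openin_cover, rule_format, of C] by (meson subsetI)
 then obtain D where D: "D \<subseteq> C" "finite D" "I \<subseteq> \<Union>D" by metis
 obtain m0 :: nat and f where f: "D = f ` {i. i < m0}" using D(2) by (auto simp: finite_conv_nat_seg_image)
 have "\<forall>m. \<exists>\<alpha> W a s. m < m0 \<longrightarrow> chart \<alpha> W a s \<and> f m \<subseteq> psi \<alpha> a s ` cbox 0 1"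
 proof
  fix m
  have "m < m0 \<Longrightarrow> f m \<in> C" using D(1) f by blast
  thus "\<exists>\<alpha> W a s. m < m0 \<longrightarrow> chart \<alpha> W a s \<and> f m \<subseteq> psi \<alpha> a s ` cbox 0 1" unfolding C_def by blast
 qed
 then obtain \<alpha> W a s where c: "\<And>m. m < m0 \<Longrightarrow> chart (\<alpha> m) (W m) (a m) (s m) \<and> f m \<subseteq> psi (\<alpha> m) (a m) (s m) ` cbox 0 1"
  by metis
 let ?U = "\<Union>m<m0. psi (\<alpha> m) (a m) (s m) ` cbox 0 1"
 show ?thesis
 proof (rule that)
  show "chart (\<alpha> m) (W m) (a m) (s m)" if "m < m0" for m using c that by blast
  show "I = ?U"
  proof
   show "I \<subseteq> ?U"
   proof
    fix p assume "p \<in> I"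
    then obtain m where "m < m0" "p \<in> f m" using D(3) f by blast
    thus "p \<in> ?U" using c by blast
   qed
   show "?U \<subseteq> I" using c psi_I by blast
  qed
 qed
qed

lemma sets_\<sigma>: "sets \<sigma> = sets (restrict_space borel I)" and space_\<sigma>: "space \<sigma> = I"
 using volume by (auto simp: riemannian_volume_def)

lemma borel_in_\<sigma>: "E \<in> sets borel \<Longrightarrow> E \<subseteq> I \<Longrightarrow> E \<in> sets \<sigma>"
 using compact_I by (subst sets_\<sigma>) (auto simp: sets_restrict_space_iff borel_compact)

definition \<Lambda> :: "real ^ 'n \<Rightarrow> real ^ 'd ^ 'd" where
 "\<Lambda> t = covariance_matrix M (grad t)"

text \<open>The chart gradient is the intrinsic gradient multiplied by \<open>K\<close>, so
  covariances change by congruence. The root of the determinant then acquires exactly the Jacobian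
  factor of the volume density.\<close>

lemma cov_G_\<Lambda>:
 assumes c: "chart \<alpha> W a s" and y: "y \<in> cbox 0 1"
 shows "(\<chi> i j. cov (\<lambda>w. G \<alpha> W a s y w $ i) (\<lambda>w. G \<alpha> W a s y w $ j))
  = transpose (K \<alpha> W a s y) ** \<Lambda> (psi \<alpha> a s y) ** K \<alpha> W a s y"
proof -
 let ?Y = "\<lambda>k w. grad (psi \<alpha> a s y) w $ k" and ?K = "K \<alpha> W a s y"
 have Y: "?Y k \<in> H" for k using grad_in_H[OF c y, of "axis k 1"] by (simp add: inner_axis)
 have L: "\<Lambda> (psi \<alpha> a s y) $ k $ l = cov (?Y k) (?Y l)" for k l
  using H_integrable(2)[OF Y] by (simp add: \<Lambda>_def covariance_matrix_def cov_def)
 have "(\<lambda>w. G \<alpha> W a s y w $ i) = (\<lambda>w. \<Sum>k\<in>UNIV. ?K $ k $ i * ?Y k w)" for i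
  by (simp add: G_def vector_matrix_mult_def mult.commute)
 thus ?thesis by (simp add: vec_eq_iff matrix_matrix_mult_def transpose_def cov_lincomb[OF Y] L sum_distrib_right)
qed

section \<open>Volume in the charts and the limiting constant\<close>

context
 fixes m0 :: nat and \<alpha> W a s
 assumes ch: "\<And>m. m < m0 \<Longrightarrow> chart (\<alpha> m) (W m) (a m) (s m)"
  and cover: "I = (\<Union>m<m0. psi (\<alpha> m) (a m) (s m) ` cbox 0 1)"
begin

abbreviation \<psi> :: "nat \<Rightarrow> real ^ 'd \<Rightarrow> real ^ 'n" where "\<psi> m \<equiv> psi (\<alpha> m) (a m) (s m)"
abbreviation jac :: "nat \<Rightarrow> real ^ 'd \<Rightarrow> real" where "jac m y \<equiv> \<bar>det (K (\<alpha> m) (W m) (a m) (s m) y)\<bar>"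

lemma jac_measurable: "m < m0 \<Longrightarrow> A \<in> sets borel \<Longrightarrow> A \<subseteq> cbox 0 1 \<Longrightarrow> (\<lambda>y. ennreal (jac m y) * indicator A y) \<in> borel_measurable lborel"
proof -
 assume m: "m < m0" and A: "A \<in> sets borel" "A \<subseteq> cbox 0 1"
 have "(\<lambda>y. indicator A y *\<^sub>R jac m y) \<in> borel_measurable borel"
  by (intro borel_measurable_continuous_on_indicator A(1) continuous_on_subset[OF det_K_cont[OF ch[OF m]] A(2)])
 hence "(\<lambda>y. ennreal (indicator A y *\<^sub>R jac m y)) \<in> borel_measurable lborel" by measurable
 also have "(\<lambda>y. ennreal (indicator A y *\<^sub>R jac m y)) = (\<lambda>y. ennreal (jac m y) * indicator A y)" by (auto simp: indicator_def)
 finally show ?thesis .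
qed

text \<open>The measure \<open>\<sigma>\<close> mediates between the charts: the boundary of a cube
  has volume zero computed in chart \<open>l\<close>, and the positive density in chart
  \<open>m\<close> forces its preimage to be Lebesgue null. No transition map has to be
  differentiated.\<close>

lemma chart_null:
 assumes m: "m < m0" and l: "l < m0"
 shows "negligible (cbox 0 1 \<inter> \<psi> m -` (\<psi> l ` (cbox 0 1 - box 0 1)))"
proof -
 let ?Q = "cbox 0 1 - box 0 1 :: (real ^ 'd) set"
 define B where "B = cbox 0 1 \<inter> \<psi> m -` (\<psi> l ` ?Q)"
 have cS: "compact (\<psi> l ` ?Q)" by (intro compact_continuous_image continuous_on_subset[OF psi_cont[OF ch[OF l]]] compact_diff compact_cbox open_box) auto
 have S: "\<psi> l ` ?Q \<in> sets \<sigma>" using psi_I[OF ch[OF l]] cS by (intro borel_in_\<sigma> borel_compact) auto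
 have "?Q \<in> null_sets lborel"
 proof -
  have "negligible ?Q" by (rule negligible_frontier_interval)
  thus ?thesis by (simp add: negligible_iff_null_sets null_sets_completion_iff)
 qed
 hence "emeasure \<sigma> (\<psi> l ` ?Q) = 0" using volume_psi[OF ch[OF l], of ?Q] by (simp add: nn_integral_null_set)
 moreover have "\<psi> m ` B \<subseteq> \<psi> l ` ?Q" by (auto simp: B_def)
 ultimately have "emeasure \<sigma> (\<psi> m ` B) = 0" using emeasure_mono[OF _ S, of "\<psi> m ` B"] by simp
 moreover have "closed B" unfolding B_def by (intro continuous_closed_preimage psi_cont[OF ch[OF m]] compact_imp_closed[OF cS] closed_cbox)
 hence B: "B \<in> sets borel" "B \<subseteq> cbox 0 1" by (auto simp: B_def borel_closed)
 ultimately have "(\<integral>\<^sup>+y\<in>B. ennreal (jac m y) \<partial>lborel) = 0" using volume_psi[OF ch[OF m]] by simp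
 hence "AE y in lborel. ennreal (jac m y) * indicator B y = 0" using jac_measurable[OF m B] by (simp add: nn_integral_0_iff_AE)
 hence "AE y in lborel. y \<notin> B"
 proof eventually_elim
  case (elim y)
  thus ?case using det_K_pos[OF ch[OF m], of y] B(2) by (auto simp: indicator_def split: if_splits)
 qed
 hence "B \<in> null_sets lborel" using B by (simp add: AE_iff_null_sets)
 thus ?thesis unfolding B_def[symmetric] by (simp add: negligible_iff_null_sets null_sets_completionI)
qed

lemma charts_gaussian: "gaussian_charts M H X I m0 \<psi> (\<lambda>m. G (\<alpha> m) (W m) (a m) (s m))"
proof
 fix m and x :: "real ^ 'd" assume m: "m < m0" and x: "x \<in> cbox 0 1"
 show "(\<lambda>w. G (\<alpha> m) (W m) (a m) (s m) x w \<bullet> v) \<in> H" for v using G_in_H[OF ch[OF m] x] .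
 show "0 < cov (\<lambda>w. G (\<alpha> m) (W m) (a m) (s m) x w \<bullet> v) (\<lambda>w. G (\<alpha> m) (W m) (a m) (s m) x w \<bullet> v)" if "v \<noteq> 0" for v
  using G_var_pos[OF ch[OF m] x that] .
 show "strict_diff (cbox 0 1) (\<lambda>y. X (\<psi> m y) w) (\<lambda>v. G (\<alpha> m) (W m) (a m) (s m) x w \<bullet> v) x" if "w \<in> space M" for w
  using X_psi_strict_diff[OF ch[OF m] x that] .
qed (use ch psi_cont psi_inj psi_open cover chart_null in blast)+

interpretation C: gaussian_charts M H X I m0 \<psi> "\<lambda>m. G (\<alpha> m) (W m) (a m) (s m)"
 by (rule charts_gaussian)

lemma sqrt_det_Lam:
 assumes m: "m < m0" and y: "y \<in> cbox 0 1"
 shows "sqrt (det (C.Lam m y)) = jac m y * sqrt (det (\<Lambda> (\<psi> m y)))"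
proof -
 have "C.Lam m y = transpose (K (\<alpha> m) (W m) (a m) (s m) y) ** \<Lambda> (\<psi> m y) ** K (\<alpha> m) (W m) (a m) (s m) y"
  unfolding C.Lam_def by (rule cov_G_\<Lambda>[OF ch[OF m] y])
 hence "det (C.Lam m y) = (det (K (\<alpha> m) (W m) (a m) (s m) y))\<^sup>2 * det (\<Lambda> (\<psi> m y))"
  by (simp add: det_mul det_transpose power2_eq_square)
 thus ?thesis by (simp add: real_sqrt_mult)
qed

lemma sqrt_det_\<Lambda>:
 assumes m: "m < m0" and y: "y \<in> cbox 0 1"
 shows "sqrt (det (\<Lambda> (\<psi> m y))) = C.dens m y / (C.vol_const * jac m y)"
 using sqrt_det_Lam[OF m y] det_K_pos[OF ch[OF m] y] C.vol_const_pos by (simp add: C.dens_def)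

text \<open>The tangent basis may vary discontinuously, and \<open>\<Lambda>\<close> with it. In
  each chart the determinant is nevertheless the quotient of two continuous functions; the chart
  images are compact, so the inverse charts are continuous, and finitely many closed pieces can be
  glued.\<close>

lemma sqrt_det_\<Lambda>_cont: "continuous_on I (\<lambda>t. sqrt (det (\<Lambda> t)))"
proof -
 have comp: "compact (\<psi> m ` cbox 0 1)" if "m < m0" for m by (intro compact_continuous_image psi_cont[OF ch[OF that]] compact_cbox)
 have "continuous_on (\<Union>m<m0. \<psi> m ` cbox 0 1) (\<lambda>t. sqrt (det (\<Lambda> t)))"
 proof (rule continuous_on_closed_Union)
  fix m assume "m \<in> {..<m0}" hence m: "m < m0" by simp
  show "closed (\<psi> m ` cbox 0 1)" by (rule compact_imp_closed[OF comp[OF m]])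
  let ?inv = "the_inv_into (cbox 0 1) (\<psi> m)"
  note inj = psi_inj[OF ch[OF m]]
  have inv: "continuous_on (\<psi> m ` cbox 0 1) ?inv"
   by (rule continuous_on_inv[OF psi_cont[OF ch[OF m]] compact_cbox]) (use the_inv_into_f_f[OF inj] in auto)
  have "continuous_on (\<psi> m ` cbox 0 1) (\<lambda>t. C.dens m (?inv t) / (C.vol_const * jac m (?inv t)))"
  proof (rule continuous_on_compose2[OF _ inv])
   show "continuous_on (cbox 0 1) (\<lambda>y. C.dens m y / (C.vol_const * jac m y))" using det_K_pos[OF ch[OF m]] C.vol_const_pos
    by (intro continuous_intros C.dens_cont[OF m] det_K_cont[OF ch[OF m]]) force
   show "?inv ` \<psi> m ` cbox 0 1 \<subseteq> cbox 0 1" using the_inv_into_f_f[OF inj] by auto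
  qed
  thus "continuous_on (\<psi> m ` cbox 0 1) (\<lambda>t. sqrt (det (\<Lambda> t)))"
   by (rule continuous_on_eq) (auto simp: the_inv_into_f_f[OF inj] sqrt_det_\<Lambda>[OF m])
 qed simp
 thus ?thesis by (simp flip: cover)
qed

lemma part_image: "m < m0 \<Longrightarrow> \<psi> m ` C.part m \<in> sets \<sigma>"
proof -
 assume m: "m < m0"
 have cl: "closed (\<psi> l ` cbox 0 1)" if "l < m0" for l using compact_imp_closed[OF C.closed_chart_image[OF that]] .
 have "\<psi> m ` C.part m = \<psi> m ` cbox 0 1 - (\<Union>l<m. \<psi> l ` cbox 0 1)" by (auto simp: C.part_def)
 also have "\<dots> \<in> sets borel" using cl m by (intro sets.Diff borel_closed closed_UN) auto
 finally show ?thesis using psi_I[OF ch[OF m]] C.part_subset[of m] by (intro borel_in_\<sigma>) auto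
qed

text \<open>Change of variables from \<open>\<sigma>\<close> to chart coordinates: the volume
  formula identifies two measures on \<open>\<sigma>\<close>-measurable sets, and integration
  follows.\<close>

lemma nn_integral_part:
 assumes m: "m < m0" and f: "f \<in> borel_measurable \<sigma>"
 shows "(\<integral>\<^sup>+t. f t * indicator (\<psi> m ` C.part m) t \<partial>\<sigma>) = (\<integral>\<^sup>+y. ennreal (jac m y) * indicator (C.part m) y * f (\<psi> m y) \<partial>lborel)"
proof -
 let ?d = "\<lambda>y. ennreal (jac m y) * indicator (C.part m) y"
 obtain p0 where p0: "p0 \<in> I" using I_nonempty by blast
 let ?P = "C.part m"
 note Pb = C.part_measurable[OF m] and PQ = C.part_subset[of m]
 \<comment> \<open>The chart restricted to its part, extended by a fixed point of \<open>I\<close>,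
   becomes a measurable map from the whole coordinate space into \<open>\<sigma>\<close>; the
   density vanishes on the extension.\<close>
 define g where "g y = (if y \<in> ?P then indicator (cbox 0 1) y *\<^sub>R \<psi> m y else p0)" for y
 have g: "g y = \<psi> m y" if "y \<in> ?P" for y using that PQ by (auto simp: g_def)
 have gb: "g \<in> borel_measurable lborel"
 proof -
  have "(\<lambda>y. indicator (cbox 0 1) y *\<^sub>R \<psi> m y) \<in> borel_measurable borel"
   by (intro borel_measurable_continuous_on_indicator psi_cont[OF ch[OF m]]) simp
  thus ?thesis unfolding g_def[abs_def] using Pb by (intro measurable_If) auto
 qed
 have "g y \<in> I" for y using g[of y] p0 psi_I[OF ch[OF m]] PQ by (cases "y \<in> ?P") (auto simp: g_def)
 hence "g \<in> measurable lborel (restrict_space borel I)" using gb by (intro measurable_restrict_space2) auto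
 hence gm[measurable]: "g \<in> measurable lborel \<sigma>" using measurable_cong_sets[OF refl sets_\<sigma>] by blast
 have jm[measurable]: "?d \<in> borel_measurable lborel" by (rule jac_measurable[OF m Pb PQ])
 note im[measurable] = part_image[OF m] and f[measurable]
 have eq: "density \<sigma> (indicator (\<psi> m ` ?P)) = distr (density lborel ?d) \<sigma> g"
 proof (rule measure_eqI)
  fix E assume "E \<in> sets (density \<sigma> (indicator (\<psi> m ` ?P)))"
  hence E[measurable]: "E \<in> sets \<sigma>" by simp
  let ?B = "?P \<inter> g -` E"
  have "g -` E \<inter> space lborel \<in> sets lborel" by measurable
  hence gE: "g -` E \<in> sets lborel" by simp
  hence B: "?B \<in> sets borel" "?B \<subseteq> cbox 0 1" using Pb PQ by auto
  have "emeasure (density \<sigma> (indicator (\<psi> m ` ?P))) E = emeasure \<sigma> (\<psi> m ` ?P \<inter> E)"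
   by (subst emeasure_density) (auto simp: mult.commute Int_commute simp flip: indicator_inter_arith nn_integral_indicator)
  also have "\<psi> m ` ?P \<inter> E = \<psi> m ` ?B" using g by force
  also have "emeasure \<sigma> \<dots> = (\<integral>\<^sup>+y\<in>?B. ennreal (jac m y) \<partial>lborel)" by (rule volume_psi[OF ch[OF m] B])
  also have "\<dots> = (\<integral>\<^sup>+y\<in>g -` E. (ennreal (jac m y) * indicator ?P y) \<partial>lborel)"
   by (intro nn_integral_cong) (auto simp: indicator_def)
  also have "\<dots> = emeasure (distr (density lborel ?d) \<sigma> g) E" using E gE jm by (simp add: emeasure_distr emeasure_density)
  finally show "emeasure (density \<sigma> (indicator (\<psi> m ` ?P))) E = emeasure (distr (density lborel ?d) \<sigma> g) E" .
 qed simp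
 have "(\<integral>\<^sup>+t. f t * indicator (\<psi> m ` ?P) t \<partial>\<sigma>) = (\<integral>\<^sup>+t. f t \<partial>density \<sigma> (indicator (\<psi> m ` ?P)))"
  by (subst nn_integral_density) (auto simp: mult.commute)
 also have "\<dots> = (\<integral>\<^sup>+y. (ennreal (jac m y) * indicator ?P y) * f (g y) \<partial>lborel)"
  unfolding eq by (simp add: nn_integral_distr nn_integral_density)
 also have "\<dots> = (\<integral>\<^sup>+y. ennreal (jac m y) * indicator ?P y * f (\<psi> m y) \<partial>lborel)"
  by (intro nn_integral_cong) (auto simp: g indicator_def)
 finally show ?thesis .
qed

lemma part_dens:
 assumes "m < m0" shows "integrable lborel (\<lambda>y. indicator (C.part m) y * C.dens m y)" "0 \<le> indicator (C.part m) y * C.dens m y"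
 using C.dens_integrable[OF assms C.part_measurable[OF assms] C.part_subset] C.dens_pos[OF assms, of y] C.part_subset[of m]
 by (auto simp: indicator_def less_imp_le)

text \<open>The parts partition \<open>I\<close>, and on each of them the Jacobian of the volume
  cancels against the one contained in \<open>dens\<close>. Working with nonnegative integrals first
  gives finiteness together with the value.\<close>

lemma total_mass_integral: "C.vol_const * (\<integral>t. sqrt (det (\<Lambda> t)) \<partial>\<sigma>) = C.total_mass"
proof -
 let ?L = "\<lambda>t. sqrt (det (\<Lambda> t))"
 note vol = C.vol_const_pos
 have Lm: "?L \<in> borel_measurable \<sigma>"
  using borel_measurable_continuous_on_restrict[OF sqrt_det_\<Lambda>_cont] measurable_cong_sets[OF sets_\<sigma> refl] by blast
 have L0: "0 \<le> ?L t" if tI: "t \<in> I" for t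
 proof -
  obtain m y where my: "m < m0" "y \<in> cbox 0 1" "t = \<psi> m y" using tI[unfolded cover] by blast
  show ?thesis unfolding my(3) sqrt_det_\<Lambda>[OF my(1,2)]
   using C.dens_pos[OF my(1,2)] vol det_K_pos[OF ch[OF my(1)] my(2)] by (intro divide_nonneg_nonneg mult_nonneg_nonneg) auto
 qed
 let ?d = "\<lambda>m y. indicator (C.part m) y * C.dens m y"
 note d = part_dens
 have "(\<integral>\<^sup>+t. ennreal (?L t) \<partial>\<sigma>) = (\<integral>\<^sup>+t. (\<Sum>m<m0. ennreal (?L t) * indicator (\<psi> m ` C.part m) t) \<partial>\<sigma>)"
 proof (rule nn_integral_cong)
  fix t assume "t \<in> space \<sigma>"
  then obtain m where m: "m < m0" "t \<in> \<psi> m ` C.part m" using C.part_cover by (auto simp: space_\<sigma>)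
  have "ennreal (?L t) * indicator (\<psi> l ` C.part l) t = (if l = m then ennreal (?L t) else 0)" for l
   using m C.part_disjoint[of l m] by (auto simp: indicator_def)
  thus "ennreal (?L t) = (\<Sum>m<m0. ennreal (?L t) * indicator (\<psi> m ` C.part m) t)" using m(1) by simp
 qed
 also have "\<dots> = (\<Sum>m<m0. \<integral>\<^sup>+t. ennreal (?L t) * indicator (\<psi> m ` C.part m) t \<partial>\<sigma>)"
  using Lm part_image by (intro nn_integral_sum borel_measurable_times_ennreal measurable_compose[OF Lm] borel_measurable_indicator) auto
 also have "\<dots> = (\<Sum>m<m0. \<integral>\<^sup>+y. ennreal (jac m y) * indicator (C.part m) y * ennreal (?L (\<psi> m y)) \<partial>lborel)"
  using Lm by (intro sum.cong nn_integral_part) auto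
 also have "ennreal C.vol_const * \<dots> = (\<Sum>m<m0. ennreal (\<integral>y. ?d m y \<partial>lborel))" unfolding sum_distrib_left
 proof (rule sum.cong[OF refl])
  fix m assume "m \<in> {..<m0}" hence m: "m < m0" by simp
  have "ennreal (jac m y) * indicator (C.part m) y * ennreal (?L (\<psi> m y)) = ennreal (1 / C.vol_const) * ennreal (?d m y)" for y
  proof (cases "y \<in> C.part m")
   case True
   hence y: "y \<in> cbox 0 1" using C.part_subset by blast
   have "1 / C.vol_const * C.dens m y = jac m y * ?L (\<psi> m y)" unfolding sqrt_det_\<Lambda>[OF m y] using vol det_K_pos[OF ch[OF m] y] by simp
   thus ?thesis using True vol by (simp flip: ennreal_mult')
  qed simp
  hence "ennreal C.vol_const * (\<integral>\<^sup>+y. ennreal (jac m y) * indicator (C.part m) y * ennreal (?L (\<psi> m y)) \<partial>lborel)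
    = ennreal C.vol_const * (ennreal (1 / C.vol_const) * (\<integral>\<^sup>+y. ennreal (?d m y) \<partial>lborel))"
   using d(1)[OF m] by (simp add: nn_integral_cmult)
  also have "\<dots> = (\<integral>\<^sup>+y. ennreal (?d m y) \<partial>lborel)" using vol by (simp flip: mult.assoc ennreal_mult')
  also have "\<dots> = ennreal (\<integral>y. ?d m y \<partial>lborel)" using d[OF m] by (subst nn_integral_eq_integral) auto
  finally show "ennreal C.vol_const * (\<integral>\<^sup>+y. ennreal (jac m y) * indicator (C.part m) y * ennreal (?L (\<psi> m y)) \<partial>lborel) = ennreal (\<integral>y. ?d m y \<partial>lborel)" .
 qed
 also have "\<dots> = ennreal C.total_mass" unfolding C.total_mass_def using d(2) by (intro sum_ennreal Bochner_Integration.integral_nonneg) auto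
 finally have "ennreal C.vol_const * (\<integral>\<^sup>+t. ennreal (?L t) \<partial>\<sigma>) = ennreal C.total_mass" .
 from arg_cong[OF this, of enn2real]
 have "C.vol_const * enn2real (\<integral>\<^sup>+t. ennreal (?L t) \<partial>\<sigma>) = enn2real (ennreal C.total_mass)"
  unfolding enn2real_mult using vol by (simp only: enn2real_ennreal less_imp_le)
 moreover have "0 \<le> C.total_mass" unfolding C.total_mass_def using d(2) by (intro sum_nonneg Bochner_Integration.integral_nonneg) auto
 moreover have "(\<integral>t. ?L t \<partial>\<sigma>) = enn2real (\<integral>\<^sup>+t. ennreal (?L t) \<partial>\<sigma>)"
  using L0 Lm by (intro integral_eq_nn_integral AE_I2) (auto simp: space_\<sigma>)
 ultimately show ?thesis by simp
qed

text \<open>Needed to turn a limit into an equivalence. No chart precedes the first one, so its part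
  is a whole cube, on which the continuous positive density has a positive minimum.\<close>

lemma total_mass_pos: "0 < C.total_mass"
proof -
 have m: "0 < m0"
 proof (rule ccontr)
  assume "\<not> 0 < m0"
  hence "(\<Union>m<m0. \<psi> m ` cbox 0 1) = {}" by simp
  thus False using I_nonempty cover by metis
 qed
 have P0: "C.part 0 = cbox 0 1" by (simp add: C.part_def)
 let ?d = "\<lambda>m y. indicator (C.part m) y * C.dens m y"
 note d = part_dens
 have "cbox 0 (1 :: real ^ 'd) \<noteq> {}" by (simp add: interval_ne_empty_cart)
 then obtain x where x: "x \<in> cbox 0 1" "\<And>y. y \<in> cbox 0 1 \<Longrightarrow> C.dens 0 x \<le> C.dens 0 y"
  using continuous_attains_inf[OF compact_cbox _ C.dens_cont[OF m]] by blast
 have i: "integrable lborel (\<lambda>y. C.dens 0 x * indicator (cbox 0 1 :: (real ^ 'd) set) y)"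
  by (intro integrable_mult_right integrable_real_indicator) (auto simp: emeasure_lborel_cbox_eq)
 have "0 < C.dens 0 x * measure lborel (cbox 0 1 :: (real ^ 'd) set)" using C.dens_pos[OF m x(1)] by (simp add: measure_lborel_cbox_eq inner_one_Basis)
 also have "\<dots> = (\<integral>y. C.dens 0 x * indicator (cbox 0 (1 :: real ^ 'd)) y \<partial>lborel)" by simp
 also have "\<dots> \<le> (\<integral>y. ?d 0 y \<partial>lborel)" using i d(1)[OF m] x(2) by (intro integral_mono) (auto simp: P0 indicator_def)
 also have "\<dots> \<le> C.total_mass" unfolding C.total_mass_def using m d(2)
  by (intro member_le_sum[where f="\<lambda>m. \<integral>y. ?d m y \<partial>lborel"] Bochner_Integration.integral_nonneg) auto
 finally show ?thesis .
qed

end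

lemma sup_cdf_FK: "sup_cdf M I X = FK I"
proof
 fix u
 have "(SUP t\<in>I. X t w) \<le> u \<longleftrightarrow> (\<forall>t\<in>I. X t w \<le> u)" if "w \<in> space M" for w
 proof (rule cSUP_le_iff)
  have "compact ((\<lambda>t. X t w) ` I)" using X_cont[OF that] compact_I by (rule compact_continuous_image)
  thus "bdd_above ((\<lambda>t. X t w) ` I)" by (intro bounded_imp_bdd_above compact_imp_bounded)
 qed (rule I_nonempty)
 thus "sup_cdf M I X u = FK I u" unfolding sup_cdf_def FK_def by (metis (no_types, lifting) Collect_cong)
qed

lemma sup_cdf_asymptotics:
 "((\<lambda>u. deriv (sup_cdf M I X) u /
   (u ^ CARD('d) / (2 * pi) powr ((real CARD('d) + 1) / 2) * exp (- u\<^sup>2 / 2) * (\<integral>t. sqrt (det (\<Lambda> t)) \<partial>\<sigma>))) \<longlongrightarrow> 1) at_top"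
proof -
 obtain m0 :: nat and \<alpha> W a s where c: "\<And>m. m < m0 \<Longrightarrow> chart (\<alpha> m) (W m) (a m) (s m)"
  "I = (\<Union>m<m0. psi (\<alpha> m) (a m) (s m) ` cbox 0 1)"
  by (rule finite_charts) blast
 interpret C: gaussian_charts M H X I m0 "\<lambda>m. psi (\<alpha> m) (a m) (s m)" "\<lambda>m. G (\<alpha> m) (W m) (a m) (s m)"
  by (rule charts_gaussian[OF c])
 note tm = total_mass_pos[OF c] total_mass_integral[OF c]
 \<comment> \<open>The density of the gradient at the origin contributes \<open>d\<close> factors
   \<open>1 / sqrt (2 * pi)\<close> and \<open>phi u\<close> one more, whence the exponent
   \<open>(d + 1) / 2\<close>.\<close>
 have vol: "C.vol_const * phi u = exp (- u\<^sup>2 / 2) / (2 * pi) powr ((real CARD('d) + 1) / 2)" for u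
 proof -
  have "sqrt (2 * pi) ^ Suc CARD('d) = ((2 * pi) powr (1 / 2)) powr real (Suc CARD('d))" by (subst powr_realpow) (auto simp: powr_half_sqrt)
  also have "\<dots> = (2 * pi) powr ((real CARD('d) + 1) / 2)" by (simp add: powr_powr add.commute)
  finally show ?thesis by (simp add: C.vol_const_def std_normal_density_def power_one_over field_simps)
 qed
 have "((\<lambda>u. deriv (FK I) u / (u ^ CARD('d) * phi u) / C.total_mass) \<longlongrightarrow> C.total_mass / C.total_mass) at_top"
  using tm(1) by (intro tendsto_intros C.deriv_FK_asymptotics) auto
 moreover have "deriv (FK I) u / (u ^ CARD('d) * phi u) / C.total_mass = deriv (FK I) u /
   (u ^ CARD('d) / (2 * pi) powr ((real CARD('d) + 1) / 2) * exp (- u\<^sup>2 / 2) * (\<integral>t. sqrt (det (\<Lambda> t)) \<partial>\<sigma>))" for u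
 proof -
  have "u ^ CARD('d) / (2 * pi) powr ((real CARD('d) + 1) / 2) * exp (- u\<^sup>2 / 2) * (\<integral>t. sqrt (det (\<Lambda> t)) \<partial>\<sigma>)
   = u ^ CARD('d) * (C.vol_const * phi u) * (\<integral>t. sqrt (det (\<Lambda> t)) \<partial>\<sigma>)" by (simp add: vol)
  also have "\<dots> = u ^ CARD('d) * phi u * C.total_mass" by (simp flip: tm(2))
  finally show ?thesis by simp
 qed
 ultimately show ?thesis using tm(1) by (simp add: sup_cdf_FK)
qed

end

theorem corollary5p1:
 fixes I :: "(real ^ 'n) set"
  and \<sigma> :: "(real ^ 'n) measure"
  and e :: "real ^ 'n \<Rightarrow> 'd::finite \<Rightarrow> real ^ 'n"
  and M :: "'w measure"
  and X :: "real ^ 'n \<Rightarrow> 'w \<Rightarrow> real"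
 assumes "compact I" and "I \<noteq> {}"
  and "embedded_manifold TYPE('d) I" and "CARD('d) \<le> CARD('n)"
  and "riemannian_volume TYPE('d) I \<sigma>"
  and "\<And>t. t \<in> I \<Longrightarrow> orthonormal_tangent_basis I t (e t)"
  and "prob_space M"
  and "gaussian_process M I X"
  and "\<And>\<omega>. \<omega> \<in> space M \<Longrightarrow> Ck_on 2 I (\<lambda>t. X t \<omega>)"
  and "\<And>s t. s \<in> I \<Longrightarrow> t \<in> I \<Longrightarrow> s \<noteq> t \<Longrightarrow>
      nondegenerate M (\<lambda>\<omega>. (X s \<omega>, X t \<omega>, manifold_deriv I (e t) (\<lambda>r. X r \<omega>) t))"
  and "\<And>t. t \<in> I \<Longrightarrow> prob_space.expectation M (X t) = 0"
  and "\<And>t. t \<in> I \<Longrightarrow> prob_space.variance M (X t) = 1"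
 defines "\<Lambda> \<equiv> \<lambda>t. covariance_matrix M (\<lambda>\<omega>. manifold_deriv I (e t) (\<lambda>r. X r \<omega>) t)"
 shows "((\<lambda>u. deriv (sup_cdf M I X) u /
      (u ^ CARD('d) / (2 * pi) powr ((real CARD('d) + 1) / 2) * exp (- u\<^sup>2 / 2) *
       (\<integral>t. sqrt (det (\<Lambda> t)) \<partial>\<sigma>))) \<longlongrightarrow> 1) at_top"
proof -
 note \<Lambda>_cov = \<Lambda>_def
 interpret manifold_process M I \<sigma> e X
  by (intro manifold_process.intro manifold_process_axioms.intro assms)
 show ?thesis using sup_cdf_asymptotics unfolding \<Lambda>_def \<Lambda>_cov grad_def .
qed

end
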